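(* Let $N\ge 1$, $l\ge 0$, $z=(z_1,\dots,z_l)\in\mathbb C^l$ and $k\in\mathbb C$. (i) If $k\notin\mathbb Z+\tfrac12$, then $\mathcal H_{N,\deg}(1,k)$ is the algebra of all elements of $\mathbb CS_N\ltimes\mathcal D_N$ which preserve $\mathbf P$ and $|\Delta|^{2k}\,\mathrm{sign}(\Delta)\,\mathbf P$. (ii) Suppose that $z_i-z_j$ ($i\ne j$) are not integers and that $k\in\mathbb C$ is Weil generic (i.e. outside a countable set). Then the degenerate cyclotomic DAHA $\mathcal H^l_{N,\deg}(z,1,k)$ is the subalgebra of all elements of $\mathcal H_{N,\deg}(1,k)$ which preserve $(\prod_j X_j)^{z_i}\mathbf P_+$ for all $i=1,\dots,l$. (iii) Under the assumption of (ii), the algebra $\mathcal H^l_{N,\deg}(z,1,k)$ is the subalgebra of all elements of $\mathbb CS_N\ltimes\mathcal D_N$ which preserve $\mathbf P$, $|\Delta|^{2k}\,\mathrm{sign}(\Delta)\,\mathbf P$, and $(\prod_jX_j)^{z_i}\mathbf P_+$ for all $i=1,\dots,l$.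
   Context: Degenerate DAHA. For $\hbar,k\in\mathbb C$, $\mathcal H_{N,\deg}(\hbar,k)$ is the $\mathbb C$-algebra generated by the group $S_N\ltimes\mathbb Z^N$ (with $S_N$ generated by the simple transpositions $s_1,\dots,s_{N-1}$, $\mathbb Z^N$ generated by commuting invertible $X_1,\dots,X_N$, and $sX_i=X_{s(i)}s$ for $s\in S_N$) and elements $y_1,\dots,y_N$, with relations: $s_iy_i=y_{i+1}s_i+k$; $s_iy_j=y_js_i$ for $j\ne i,i+1$; $[y_i,y_j]=0$; $[y_i,X_j]=kX_js_{ij}$ for $i>j$; $[y_i,X_j]=kX_is_{ij}$ for $i<j$; $[y_i,X_i]=\hbar X_i-k\sum_{r<i}X_rs_{ir}-k\sum_{r>i}X_is_{ir}$. Here $s_{ij}$ is the transposition of $i$ and $j$. Put $\pi=X_1s_1\cdots s_{N-1}$. Degenerate cyclotomic DAHA. $\mathcal H^l_{N,\deg}(z,\hbar,k)$ is the subalgebra of $\mathcal H_{N,\deg}(\hbar,k)$ generated by $s_i$ ($1\le i\le N-1$), $y_i$ ($1\le i\le N$), $\pi$, and $\pi_-:=\pi^{-1}\prod_{i=1}^l(y_1-z_i)$. Operators. $\mathbf P=\mathbb C[X_1^{\pm1},\dots,X_N^{\pm1}]$, $\mathbf P_+=\mathbb C[X_1,\dots,X_N]$, $\Delta=\prod_{i<j}(X_i-X_j)$. $\mathcal D_N$ is the algebra of differential operators in $X_1,\dots,X_N$ with poles allowed at $X_i=0$ and $X_i=X_j$. For $\hbar=1$ the algebra $\mathcal H_{N,\deg}(1,k)$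 is regarded as a subalgebra of $\mathbb CS_N\ltimes\mathcal D_N$ via the (faithful) polynomial representation: $s_i\mapsto s_i$, $X_i\mapsto X_i$, $y_i\mapsto X_iD_i-k\sum_{j<i}s_{ij}$, where $D_i=\partial_i-\sum_{j\ne i}\frac{k}{X_i-X_j}(1-s_{ij})$. Preservation. An element $L\in\mathbb CS_N\ltimes\mathcal D_N$ preserves $\mathbf P$ if its natural action on $\mathbf P[\Delta^{-1}]$ maps $\mathbf P$ to $\mathbf P$. It preserves $(\prod_jX_j)^u\mathbf P_+$ ($u\in\mathbb C$) if $\phi_u(L)$ preserves $\mathbf P_+$, where $\phi_u$ is the automorphism fixing $X_i,s_i$ and sending $\partial_i\mapsto\partial_i+uX_i^{-1}$ (conjugation by $(\prod_iX_i)^u$). It preserves $|\Delta|^{\kappa}\mathrm{sign}(\Delta)\mathbf P$ ($\kappa\in\mathbb C$) if $\psi_\kappa(L)$ preserves $\mathbf P$, where $\psi_\kappa$ is the automorphism fixing $X_i$ and sending $s_i\mapsto -s_i$, $\partial_i\mapsto\partial_i+\sum_{j\neq i}\frac{\kappa}{X_i-X_j}$ (conjugation by $|\Delta|^\kappa\mathrm{sign}(\Delta)$ on the real locus). *)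

theory Defs
  imports
    Complex_Main
    "HOL-Library.Poly_Mapping"
    "HOL-Library.Countable_Set"
    "HOL-Computational_Algebra.Fraction_Field"
    "HOL-Combinatorics.Permutations"
    "HOL-Algebra.QuotRing"
    "HOL-Algebra.Generated_Rings"
begin

text \<open>All indices run over \<open>{1..N}\<close>; permutations are functions \<open>w :: nat \<Rightarrow> nat\<close> with
  \<open>w permutes {1..N}\<close>.  The ambient types carry variables \<open>X\<^sub>i\<close> for every natural number \<open>i\<close>;
  the carriers below cut them down to \<open>X\<^sub>1, \<dots>, X\<^sub>N\<close>.\<close>

section \<open>Polynomials, Laurent polynomials and rational functions\<close>

type_synonym mpoly = "(nat \<Rightarrow>\<^sub>0 nat) \<Rightarrow>\<^sub>0 complex"
type_synonym ratfun = "mpoly fract"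

lemma poly_mapping_eq_sum_single:
  fixes p :: "'a \<Rightarrow>\<^sub>0 'b::comm_monoid_add"
  shows "p = (\<Sum>m\<in>Poly_Mapping.keys p. Poly_Mapping.single m (Poly_Mapping.lookup p m))"
  by (rule poly_mapping_eqI) (auto simp: lookup_sum lookup_single when_def in_keys_iff)

lemma poly_mapping_additive_induct:
  fixes p :: "'a \<Rightarrow>\<^sub>0 'b::comm_monoid_add"
  assumes z: "P 0" and s: "\<And>m c. P (Poly_Mapping.single m c)"
    and a: "\<And>p q. P p \<Longrightarrow> P q \<Longrightarrow> P (p + q)"
  shows "P p"
proof -
  have "P (\<Sum>m\<in>A. Poly_Mapping.single m (Poly_Mapping.lookup p m))" if "finite A" for A
    using that by induction (auto intro: z s a)
  then show ?thesis by (subst poly_mapping_eq_sum_single) simp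
qed

text \<open>The permutation action \<open>X\<^sub>i \<mapsto> X\<^bsub>w i\<^esub>\<close>: the coefficient of \<open>w p\<close> at the exponent \<open>m\<close> is
  that of \<open>p\<close> at \<open>m \<circ> w\<close>.\<close>

definition mpoly_perm :: "(nat \<Rightarrow> nat) \<Rightarrow> mpoly \<Rightarrow> mpoly" where
  "mpoly_perm w p = Poly_Mapping.map_key (Poly_Mapping.map_key w) p"

definition mpoly_deriv :: "nat \<Rightarrow> mpoly \<Rightarrow> mpoly" where
  "mpoly_deriv i p = (\<Sum>m\<in>Poly_Mapping.keys p.
     Poly_Mapping.single (m - Poly_Mapping.single i 1)
       (of_nat (Poly_Mapping.lookup m i) * Poly_Mapping.lookup p m))"

lemma lookup_map_key: "inj f \<Longrightarrow> Poly_Mapping.lookup (Poly_Mapping.map_key f p) x = Poly_Mapping.lookup p (f x)"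
  by (simp add: Poly_Mapping.map_key.rep_eq)

lemma inj_exponent_map:
  assumes "bij w" shows "inj (Poly_Mapping.map_key w :: (nat \<Rightarrow>\<^sub>0 nat) \<Rightarrow> _)"
proof (rule injI)
  fix p q :: "nat \<Rightarrow>\<^sub>0 nat" assume "Poly_Mapping.map_key w p = Poly_Mapping.map_key w q"
  then have "Poly_Mapping.lookup p (w x) = Poly_Mapping.lookup q (w x)" for x
    using assms by (metis lookup_map_key bij_is_inj)
  then show "p = q"
    using assms by (metis poly_mapping_eqI bij_pointE)
qed

lemma exponent_map_inverse:
  assumes "bij w"
  shows "Poly_Mapping.map_key w (Poly_Mapping.map_key (inv_into UNIV w) m) = m"
  using assms
  by (intro poly_mapping_eqI) (simp add: lookup_map_key bij_is_inj bij_imp_bij_inv)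

lemma mpoly_perm_single:
  assumes "bij w"
  shows "mpoly_perm w (Poly_Mapping.single m c) = Poly_Mapping.single (Poly_Mapping.map_key (inv_into UNIV w) m) c"
  unfolding mpoly_perm_def
  by (metis map_key_single inj_exponent_map exponent_map_inverse assms)

lemma mpoly_perm_add: "bij w \<Longrightarrow> mpoly_perm w (p + q) = mpoly_perm w p + mpoly_perm w q"
  by (simp add: mpoly_perm_def map_key_plus inj_exponent_map)

lemma mpoly_perm_zero: "bij w \<Longrightarrow> mpoly_perm w 0 = 0"
  by (simp add: mpoly_perm_def map_key_zero inj_exponent_map)

lemma mpoly_perm_mult:
  assumes "bij w" shows "mpoly_perm w (p * q) = mpoly_perm w p * mpoly_perm w q"
proof (induction p rule: poly_mapping_additive_induct)
  case (2 m c)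
  show ?case
    by (induction q rule: poly_mapping_additive_induct)
      (simp_all add: assms mpoly_perm_zero mpoly_perm_add mpoly_perm_single mult_single distrib_left
        map_key_plus bij_is_inj bij_imp_bij_inv)
qed (simp_all add: assms mpoly_perm_zero mpoly_perm_add distrib_right)

lemma mpoly_perm_eq_0: "bij w \<Longrightarrow> mpoly_perm w p = 0 \<longleftrightarrow> p = 0"
proof
  assume w: "bij w" and "mpoly_perm w p = 0"
  then have "Poly_Mapping.lookup p (Poly_Mapping.map_key w m) = 0" for m
    unfolding mpoly_perm_def using inj_exponent_map lookup_map_key lookup_zero by metis
  then have "Poly_Mapping.lookup p m = 0" for m
    using exponent_map_inverse[OF w] by metis
  then show "p = 0" by (simp add: poly_mapping_eqI)
qed (simp add: mpoly_perm_zero)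

lemma mpoly_deriv_single:
  "mpoly_deriv i (Poly_Mapping.single m c) =
     Poly_Mapping.single (m - Poly_Mapping.single i 1) (of_nat (Poly_Mapping.lookup m i) * c)"
  by (simp add: mpoly_deriv_def)

lemma mpoly_deriv_zero: "mpoly_deriv i 0 = 0"
  by (simp add: mpoly_deriv_def)

lemma mpoly_deriv_add: "mpoly_deriv i (p + q) = mpoly_deriv i p + mpoly_deriv i q"
  unfolding mpoly_deriv_def
  by (rule setsum_keys_plus_distrib) (simp_all add: algebra_simps single_add)

lemma exponent_shift:
  fixes m n :: "nat \<Rightarrow>\<^sub>0 nat"
  assumes "Poly_Mapping.lookup m i \<noteq> 0"
  shows "m + n - Poly_Mapping.single i 1 = (m - Poly_Mapping.single i 1) + n"
  using assms
  by (intro poly_mapping_eqI) (auto simp: lookup_add lookup_minus lookup_single when_def)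

lemma mpoly_deriv_mult:
  "mpoly_deriv i (p * q) = mpoly_deriv i p * q + p * mpoly_deriv i q"
proof (induction p rule: poly_mapping_additive_induct)
  case (2 m c)
  show ?case
  proof (induction q rule: poly_mapping_additive_induct)
    case (2 n d)
    let ?e = "Poly_Mapping.single i (1::nat)"
    have "Poly_Mapping.single (m + n - ?e) (of_nat (Poly_Mapping.lookup m i) * c * d)
        = Poly_Mapping.single ((m - ?e) + n) (of_nat (Poly_Mapping.lookup m i) * c * d)"
      using exponent_shift[of m i n] by (cases "Poly_Mapping.lookup m i = 0") auto
    moreover have "Poly_Mapping.single (m + n - ?e) (of_nat (Poly_Mapping.lookup n i) * c * d)
        = Poly_Mapping.single (m + (n - ?e)) (of_nat (Poly_Mapping.lookup n i) * c * d)"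
      using exponent_shift[of n i m]
      by (cases "Poly_Mapping.lookup n i = 0") (auto simp: add.commute)
    ultimately show ?case
      by (simp add: mult_single mpoly_deriv_single lookup_add algebra_simps single_add)
  qed (simp_all add: mpoly_deriv_zero mpoly_deriv_add distrib_left)
qed (simp_all add: mpoly_deriv_zero mpoly_deriv_add algebra_simps)

lemma quotient_rule_well_defined:
  fixes a b c d a' b' c' d' :: "'a::idom"
  assumes "a * d = c * b" and "a' * d + a * d' = c' * b + c * b'"
  shows "(a' * b - a * b') * (d * d) = (c' * d - c * d') * (b * b)"
proof -
  have "(a' * b - a * b') * (d * d) = (a' * d) * (b * d) - (a * d) * (b' * d)"
    by (simp add: algebra_simps)
  also have "\<dots> = (c' * b + c * b' - a * d') * (b * d) - (c * b) * (b' * d)"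
    using assms by (simp add: eq_diff_eq)
  also have "\<dots> = c' * b * (b * d) - (a * d) * (d' * b)"
    by (simp add: algebra_simps)
  also have "\<dots> = (c' * d - c * d') * (b * b)"
    using assms(1) by (simp add: algebra_simps)
  finally show ?thesis .
qed

text \<open>The first branch is the meaningful one; the second only makes the function total.\<close>

lift_definition rat_perm :: "(nat \<Rightarrow> nat) \<Rightarrow> ratfun \<Rightarrow> ratfun" is
  "\<lambda>w (a, b). if bij w then (mpoly_perm w a, mpoly_perm w b) else (a, b)"
proof (clarsimp simp: split_beta mpoly_perm_eq_0)
  fix w :: "nat \<Rightarrow> nat" and a b c d :: mpoly
  assume "a * d = c * b" and w: "bij w"
  then show "mpoly_perm w a * mpoly_perm w d = mpoly_perm w c * mpoly_perm w b"
    by (metis mpoly_perm_mult)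
qed

lift_definition rat_deriv :: "nat \<Rightarrow> ratfun \<Rightarrow> ratfun" is
  "\<lambda>i (a, b). (mpoly_deriv i a * b - a * mpoly_deriv i b, b * b)"
proof clarsimp
  fix i and a b c d :: mpoly
  assume "b \<noteq> 0" "d \<noteq> 0" and e: "a * d = c * b"
  have "mpoly_deriv i a * d + a * mpoly_deriv i d = mpoly_deriv i c * b + c * mpoly_deriv i b"
    using arg_cong[OF e, of "mpoly_deriv i"] by (simp add: mpoly_deriv_mult)
  with e show "(mpoly_deriv i a * b - a * mpoly_deriv i b) * (d * d)
      = (mpoly_deriv i c * d - c * mpoly_deriv i d) * (b * b)"
    by (rule quotient_rule_well_defined)
qed

lemma rat_perm_Fract:
  "bij w \<Longrightarrow> b \<noteq> 0 \<Longrightarrow> rat_perm w (Fract a b) = Fract (mpoly_perm w a) (mpoly_perm w b)"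
  by (transfer fixing: w a b) (simp add: mpoly_perm_eq_0)

lemma rat_deriv_Fract:
  "b \<noteq> 0 \<Longrightarrow> rat_deriv i (Fract a b) = Fract (mpoly_deriv i a * b - a * mpoly_deriv i b) (b * b)"
  by (transfer fixing: i a b) simp

definition rat_const :: "complex \<Rightarrow> ratfun" where
  "rat_const c = Fract (Poly_Mapping.single 0 c) 1"

definition rat_var :: "nat \<Rightarrow> ratfun" where
  "rat_var i = Fract (Poly_Mapping.single (Poly_Mapping.single i 1) 1) 1"

text \<open>\<open>\<^bold>P\<^sub>+ = \<complex>[X\<^sub>1,\<dots>,X\<^sub>N]\<close>, \<open>\<^bold>P = \<complex>[X\<^sub>1\<^sup>\<plusminus>\<^sup>1,\<dots>,X\<^sub>N\<^sup>\<plusminus>\<^sup>1]\<close> and \<open>\<^bold>P[\<Delta>\<^sup>-\<^sup>1]\<close>, inside the field of rational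
  functions.\<close>

definition polynomials :: "nat \<Rightarrow> ratfun set" where
  "polynomials N = {Fract p 1 | p. \<forall>m\<in>Poly_Mapping.keys p. Poly_Mapping.keys m \<subseteq> {1..N}}"

definition laurent_polynomials :: "nat \<Rightarrow> ratfun set" where
  "laurent_polynomials N = {p / (\<Prod>i=1..N. rat_var i) ^ n | p n. p \<in> polynomials N}"

definition vandermonde :: "nat \<Rightarrow> ratfun" where
  "vandermonde N = (\<Prod>i=1..N. \<Prod>j=i+1..N. rat_var i - rat_var j)"

definition regular_functions :: "nat \<Rightarrow> ratfun set" where
  "regular_functions N = {f / vandermonde N ^ n | f n. f \<in> laurent_polynomials N}"


section \<open>The algebra \<open>\<complex>S\<^sub>N \<ltimes> D\<^sub>N\<close>\<close>

text \<open>An element is written uniquely as a finite sum of terms \<open>f \<partial>\<^sup>\<alpha> w\<close> with \<open>f\<close> in \<open>\<^bold>P[\<Delta>\<^sup>-\<^sup>1]\<close>,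
  a multi-index \<open>\<alpha>\<close> and a permutation \<open>w\<close>; it is represented by the finitely supported family of its
  coefficients \<open>f\<close>, indexed by \<open>(w, \<alpha>)\<close>.\<close>

type_synonym crossed = "((nat \<Rightarrow> nat) \<times> (nat \<Rightarrow>\<^sub>0 nat)) \<Rightarrow>\<^sub>0 ratfun"

definition cterm :: "ratfun \<Rightarrow> (nat \<Rightarrow>\<^sub>0 nat) \<Rightarrow> (nat \<Rightarrow> nat) \<Rightarrow> crossed" where
  "cterm f \<alpha> w = Poly_Mapping.single (w, \<alpha>) f"

definition crossed_algebra :: "nat \<Rightarrow> crossed set" where
  "crossed_algebra N = {L. \<forall>(w, \<alpha>) \<in> Poly_Mapping.keys L.
     w permutes {1..N} \<and> Poly_Mapping.keys \<alpha> \<subseteq> {1..N} \<and>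
     Poly_Mapping.lookup L (w, \<alpha>) \<in> regular_functions N}"

text \<open>\<open>T\<^sub>1\<^bsup>\<alpha>\<^sub>1\<^esup> T\<^sub>2\<^bsup>\<alpha>\<^sub>2\<^esup> \<cdots>\<close> for a family of operators \<open>T\<close>.\<close>

definition iterate :: "(nat \<Rightarrow> 'a \<Rightarrow> 'a) \<Rightarrow> (nat \<Rightarrow>\<^sub>0 nat) \<Rightarrow> 'a \<Rightarrow> 'a" where
  "iterate T \<alpha> = foldr (\<lambda>i. T i ^^ Poly_Mapping.lookup \<alpha> i) (sorted_list_of_set (Poly_Mapping.keys \<alpha>))"

text \<open>Left multiplication by a function \<open>h\<close>, by \<open>\<partial>\<^sub>i\<close> (using \<open>\<partial>\<^sub>i f = f \<partial>\<^sub>i + \<partial>\<^sub>i(f)\<close>) and by a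
  permutation \<open>v\<close> (using \<open>v f = v(f) v\<close> and \<open>v \<partial>\<^sub>i = \<partial>\<^bsub>v i\<^esub> v\<close>).\<close>

definition fun_mult :: "ratfun \<Rightarrow> crossed \<Rightarrow> crossed" where
  "fun_mult h L = (\<Sum>(w, \<alpha>)\<in>Poly_Mapping.keys L. cterm (h * Poly_Mapping.lookup L (w, \<alpha>)) \<alpha> w)"

definition partial_mult :: "nat \<Rightarrow> crossed \<Rightarrow> crossed" where
  "partial_mult i L = (\<Sum>(w, \<alpha>)\<in>Poly_Mapping.keys L.
     cterm (Poly_Mapping.lookup L (w, \<alpha>)) (\<alpha> + Poly_Mapping.single i 1) w +
     cterm (rat_deriv i (Poly_Mapping.lookup L (w, \<alpha>))) \<alpha> w)"

definition perm_mult :: "(nat \<Rightarrow> nat) \<Rightarrow> crossed \<Rightarrow> crossed" where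
  "perm_mult v L = (\<Sum>(w, \<alpha>)\<in>Poly_Mapping.keys L.
     cterm (rat_perm v (Poly_Mapping.lookup L (w, \<alpha>))) (Poly_Mapping.map_key (inv_into UNIV v) \<alpha>) (v \<circ> w))"

definition crossed_mult :: "crossed \<Rightarrow> crossed \<Rightarrow> crossed" (infixl \<open>\<star>\<close> 70) where
  "L \<star> M = (\<Sum>(w, \<alpha>)\<in>Poly_Mapping.keys L.
     fun_mult (Poly_Mapping.lookup L (w, \<alpha>)) (iterate partial_mult \<alpha> (perm_mult w M)))"

definition crossed_fun :: "ratfun \<Rightarrow> crossed" where
  "crossed_fun f = cterm f 0 id"

definition crossed_partial :: "nat \<Rightarrow> crossed" where
  "crossed_partial i = cterm 1 (Poly_Mapping.single i 1) id"

definition crossed_perm :: "(nat \<Rightarrow> nat) \<Rightarrow> crossed" where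
  "crossed_perm w = cterm 1 0 w"

definition act :: "crossed \<Rightarrow> ratfun \<Rightarrow> ratfun" where
  "act L g = (\<Sum>(w, \<alpha>)\<in>Poly_Mapping.keys L.
     Poly_Mapping.lookup L (w, \<alpha>) * iterate rat_deriv \<alpha> (rat_perm w g))"

definition preserves :: "crossed \<Rightarrow> ratfun set \<Rightarrow> bool" where
  "preserves L V \<longleftrightarrow> (\<forall>g\<in>V. act L g \<in> V)"

text \<open>The automorphism fixing functions, with \<open>\<partial>\<^sub>i \<mapsto> \<partial>\<^sub>i + a i\<close> and \<open>w \<mapsto> \<chi> w \<cdot> w\<close>.\<close>

definition twist :: "(nat \<Rightarrow> ratfun) \<Rightarrow> ((nat \<Rightarrow> nat) \<Rightarrow> ratfun) \<Rightarrow> crossed \<Rightarrow> crossed" where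
  "twist a \<chi> L = (\<Sum>(w, \<alpha>)\<in>Poly_Mapping.keys L.
     fun_mult (Poly_Mapping.lookup L (w, \<alpha>))
       (iterate (\<lambda>i M. (crossed_partial i + crossed_fun (a i)) \<star> M) \<alpha> (cterm (\<chi> w) 0 w)))"

definition phi :: "complex \<Rightarrow> crossed \<Rightarrow> crossed" where
  "phi u = twist (\<lambda>i. rat_const u / rat_var i) (\<lambda>w. 1)"

definition psi :: "nat \<Rightarrow> complex \<Rightarrow> crossed \<Rightarrow> crossed" where
  "psi N \<kappa> = twist (\<lambda>i. \<Sum>j\<in>{1..N} - {i}. rat_const \<kappa> / (rat_var i - rat_var j)) (\<lambda>w. of_int (sign w))"

definition preserves_P :: "nat \<Rightarrow> crossed \<Rightarrow> bool" where
  "preserves_P N L \<longleftrightarrow> preserves L (laurent_polynomials N)"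

definition preserves_power_P_plus :: "nat \<Rightarrow> complex \<Rightarrow> crossed \<Rightarrow> bool" where
  "preserves_power_P_plus N u L \<longleftrightarrow> preserves (phi u L) (polynomials N)"

definition preserves_Delta_sign_P :: "nat \<Rightarrow> complex \<Rightarrow> crossed \<Rightarrow> bool" where
  "preserves_Delta_sign_P N \<kappa> L \<longleftrightarrow> preserves (psi N \<kappa> L) (laurent_polynomials N)"


section \<open>The degenerate DAHA by generators and relations\<close>

text \<open>Words form the free monoid under concatenation, so that \<open>word \<Rightarrow>\<^sub>0 complex\<close> with the
  convolution product is the free algebra.\<close>

instantiation list :: (type) monoid_add
begin
definition zero_list :: "'a list" where "zero_list = []"
definition plus_list :: "'a list \<Rightarrow> 'a list \<Rightarrow> 'a list" where "plus_list = (@)"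
instance by standard (simp_all add: zero_list_def plus_list_def)
end

datatype letter = Perm "nat \<Rightarrow> nat" | VarX nat | InvX nat | VarY nat

type_synonym free = "letter list \<Rightarrow>\<^sub>0 complex"

primrec letter_ok :: "nat \<Rightarrow> letter \<Rightarrow> bool" where
  "letter_ok N (Perm w) \<longleftrightarrow> w permutes {1..N}"
| "letter_ok N (VarX i) \<longleftrightarrow> i \<in> {1..N}"
| "letter_ok N (InvX i) \<longleftrightarrow> i \<in> {1..N}"
| "letter_ok N (VarY i) \<longleftrightarrow> i \<in> {1..N}"

definition free_algebra :: "nat \<Rightarrow> free ring" where
  "free_algebra N =
     \<lparr>carrier = {a. \<forall>u\<in>Poly_Mapping.keys a. \<forall>g\<in>set u. letter_ok N g},
      mult = (*), one = 1, zero = 0, add = (+)\<rparr>"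

definition scalar :: "complex \<Rightarrow> free" where "scalar c = Poly_Mapping.single [] c"
definition gen :: "letter \<Rightarrow> free" where "gen g = Poly_Mapping.single [g] 1"

abbreviation "gP w \<equiv> gen (Perm w)"
abbreviation "gX i \<equiv> gen (VarX i)"
abbreviation "gXinv i \<equiv> gen (InvX i)"
abbreviation "gY i \<equiv> gen (VarY i)"
abbreviation "s\<^sub>2 i j \<equiv> gen (Perm (transpose i j))"

text \<open>The first six rules present \<open>S\<^sub>N \<ltimes> \<int>\<^sup>N\<close>, with one letter for every permutation.\<close>

inductive_set daha_relators :: "nat \<Rightarrow> complex \<Rightarrow> complex \<Rightarrow> free set"
  for N :: nat and h k :: complex where
  perm_one: "gP id - 1 \<in> daha_relators N h k"
| perm_mult: "v permutes {1..N} \<Longrightarrow> w permutes {1..N} \<Longrightarrow>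
    gP v * gP w - gP (v \<circ> w) \<in> daha_relators N h k"
| X_Xinv: "i \<in> {1..N} \<Longrightarrow> gX i * gXinv i - 1 \<in> daha_relators N h k"
| Xinv_X: "i \<in> {1..N} \<Longrightarrow> gXinv i * gX i - 1 \<in> daha_relators N h k"
| X_X: "i \<in> {1..N} \<Longrightarrow> j \<in> {1..N} \<Longrightarrow> gX i * gX j - gX j * gX i \<in> daha_relators N h k"
| perm_X: "w permutes {1..N} \<Longrightarrow> i \<in> {1..N} \<Longrightarrow>
    gP w * gX i - gX (w i) * gP w \<in> daha_relators N h k"
| s_y: "1 \<le> i \<Longrightarrow> i + 1 \<le> N \<Longrightarrow>
    s\<^sub>2 i (i+1) * gY i - (gY (i+1) * s\<^sub>2 i (i+1) + scalar k) \<in> daha_relators N h k"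
| s_y_far: "1 \<le> i \<Longrightarrow> i + 1 \<le> N \<Longrightarrow> j \<in> {1..N} - {i, i+1} \<Longrightarrow>
    s\<^sub>2 i (i+1) * gY j - gY j * s\<^sub>2 i (i+1) \<in> daha_relators N h k"
| y_y: "i \<in> {1..N} \<Longrightarrow> j \<in> {1..N} \<Longrightarrow> gY i * gY j - gY j * gY i \<in> daha_relators N h k"
| y_X_gt: "1 \<le> j \<Longrightarrow> j < i \<Longrightarrow> i \<le> N \<Longrightarrow>
    gY i * gX j - gX j * gY i - scalar k * gX j * s\<^sub>2 i j \<in> daha_relators N h k"
| y_X_lt: "1 \<le> i \<Longrightarrow> i < j \<Longrightarrow> j \<le> N \<Longrightarrow>
    gY i * gX j - gX j * gY i - scalar k * gX i * s\<^sub>2 i j \<in> daha_relators N h k"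
| y_X_eq: "i \<in> {1..N} \<Longrightarrow>
    gY i * gX i - gX i * gY i - (scalar h * gX i - scalar k * (\<Sum>r\<in>{1..<i}. gX r * s\<^sub>2 i r)
      - scalar k * (\<Sum>r\<in>{i<..N}. gX i * s\<^sub>2 i r)) \<in> daha_relators N h k"

definition daha_ideal :: "nat \<Rightarrow> complex \<Rightarrow> complex \<Rightarrow> free set" where
  "daha_ideal N h k = Idl\<^bsub>free_algebra N\<^esub> (daha_relators N h k)"

definition daha :: "nat \<Rightarrow> complex \<Rightarrow> complex \<Rightarrow> free set ring" where
  "daha N h k = free_algebra N Quot daha_ideal N h k"

definition daha_class :: "nat \<Rightarrow> complex \<Rightarrow> complex \<Rightarrow> free \<Rightarrow> free set" where
  "daha_class N h k a = daha_ideal N h k +>\<^bsub>free_algebra N\<^esub> a"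

text \<open>The element \<open>\<pi> = X\<^sub>1 s\<^sub>1 \<cdots> s\<^bsub>N-1\<^esub>\<close> and \<open>\<pi>\<^sub>- = \<pi>\<^sup>-\<^sup>1 (y\<^sub>1 - z\<^sub>1) \<cdots> (y\<^sub>1 - z\<^sub>l)\<close> of the DAHA.\<close>

definition daha_pi :: "nat \<Rightarrow> complex \<Rightarrow> complex \<Rightarrow> free set" where
  "daha_pi N h k = daha_class N h k (gX 1 * prod_list (map (\<lambda>i. s\<^sub>2 i (i+1)) [1..<N]))"

definition daha_pi_minus :: "nat \<Rightarrow> nat \<Rightarrow> (nat \<Rightarrow> complex) \<Rightarrow> complex \<Rightarrow> complex \<Rightarrow> free set" where
  "daha_pi_minus N l z h k = inv\<^bsub>daha N h k\<^esub> (daha_pi N h k) \<otimes>\<^bsub>daha N h k\<^esub>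
     daha_class N h k (prod_list (map (\<lambda>i. gY 1 - scalar (z i)) [1..<l+1]))"

text \<open>The \<open>\<complex>\<close>-subalgebra generated by a set is the subring generated by it and the scalars.\<close>

definition cyclotomic_daha ::
    "nat \<Rightarrow> nat \<Rightarrow> (nat \<Rightarrow> complex) \<Rightarrow> complex \<Rightarrow> complex \<Rightarrow> free set set" where
  "cyclotomic_daha N l z h k = generate_ring (daha N h k)
     (Set.range (\<lambda>c. daha_class N h k (scalar c))
      \<union> {daha_class N h k (s\<^sub>2 i (i+1)) | i. 1 \<le> i \<and> i + 1 \<le> N}
      \<union> {daha_class N h k (gY i) | i. i \<in> {1..N}}
      \<union> {daha_pi N h k, daha_pi_minus N l z h k})"


section \<open>The polynomial representation at \<open>h = 1\<close>\<close>

definition dunkl :: "nat \<Rightarrow> complex \<Rightarrow> nat \<Rightarrow> crossed" where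
  "dunkl N k i = crossed_partial i - (\<Sum>j\<in>{1..N} - {i}.
     crossed_fun (rat_const k / (rat_var i - rat_var j)) \<star>
       (crossed_perm id - crossed_perm (transpose i j)))"

primrec letter_op :: "nat \<Rightarrow> complex \<Rightarrow> letter \<Rightarrow> crossed" where
  "letter_op N k (Perm w) = crossed_perm w"
| "letter_op N k (VarX i) = crossed_fun (rat_var i)"
| "letter_op N k (InvX i) = crossed_fun (1 / rat_var i)"
| "letter_op N k (VarY i) = crossed_fun (rat_var i) \<star> dunkl N k i
     - fun_mult (rat_const k) (\<Sum>j\<in>{1..<i}. crossed_perm (transpose i j))"

definition free_rep :: "nat \<Rightarrow> complex \<Rightarrow> free \<Rightarrow> crossed" where
  "free_rep N k a = (\<Sum>u\<in>Poly_Mapping.keys a. fun_mult (rat_const (Poly_Mapping.lookup a u))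
     (foldr (\<lambda>g M. letter_op N k g \<star> M) u (crossed_perm id)))"

text \<open>The map induced on the quotient \<open>daha N 1 k\<close>; it identifies the DAHA, and each of its
  subalgebras, with its image in \<open>\<complex>S\<^sub>N \<ltimes> D\<^sub>N\<close>.\<close>

definition poly_rep :: "nat \<Rightarrow> complex \<Rightarrow> free set \<Rightarrow> crossed" where
  "poly_rep N k C = the_elem (free_rep N k ` C)"

definition daha_in_crossed :: "nat \<Rightarrow> complex \<Rightarrow> crossed set" where
  "daha_in_crossed N k = poly_rep N k ` carrier (daha N 1 k)"

definition cyclotomic_in_crossed :: "nat \<Rightarrow> nat \<Rightarrow> (nat \<Rightarrow> complex) \<Rightarrow> complex \<Rightarrow> crossed set" where
  "cyclotomic_in_crossed N l z k = poly_rep N k ` cyclotomic_daha N l z 1 k"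

end

theory Submission
  imports Defs "HOL-Library.Multiset" "HOL-Computational_Algebra.Polynomial"
begin

text \<open>For (i), expand an element of the crossed product in Dunkl operators with coefficients that are
  Laurent polynomials divided by products of the \<open>X\<^sub>i - X\<^sub>j\<close>. Near a generic point of \<open>X\<^sub>i = X\<^sub>j\<close> the
  action is that of the rank one Dunkl operator with parameter \<open>k\<close> on one lattice and \<open>- k\<close> on the other,
  which lowers the order of vanishing by exactly one as long as \<open>k\<close> is not a half-integer. Its leading part
  mixes the components at \<open>w\<close> and \<open>s\<^bsub>ij\<^esub> w\<close>; the two lattices give the two combinations with opposite signs,
  so the numerators vanish on \<open>X\<^sub>i = X\<^sub>j\<close> and the poles cancel.

  For (ii), deform from \<open>k = 0\<close>. On the span of the standard monomials \<open>X\<^sup>a w y\<^sup>b\<close> of bounded degree the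
  conditions of preserving the lattices are linear equations with coefficients polynomial in \<open>k\<close>. At \<open>k = 0\<close>
  the \<open>y\<^sub>i\<close> are diagonal on monomials, and the coefficients of \<open>X\<^sup>a w\<close> form a polynomial in \<open>y\<close> vanishing on
  prescribed hyperplanes; its top-degree monomials are those realized by explicit words in the generators of
  the cyclotomic subalgebra. So for all but finitely many \<open>k\<close> the solution space is spanned by these words, and
  countably many degrees leave a countable exceptional set. Part (iii) combines (i) and (ii).\<close>

text \<open>Why 2k: conjugation by |Delta|^(2k) sign(Delta) replaces s by -s and adds 2k/(X_i - X_j)
  to the derivatives, which turns Dunkl operators with parameter k into those with parameter -k. Why
  half-integers: with x = X_i - X_j, the operator maps x^t to (t - k(1 - (-1)^t)) x^(t-1), and k is
  a half-integer exactly if one of these scalars, for k or for -k, vanishes. In (ii) the kernel of a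
  linear system can only shrink under generic deformation, so the solutions at k = 0 give an upper
  bound for generic k; the words must supply the matching lower bound, so there must be as many of
  them as coordinates left free at k = 0. Here the hypothesis on the z_i enters: it makes the zeros
  z_i + s forced on the coefficients distinct, so each unit of negative exponent costs y^l, which is
  what pi_- provides. Identities between elements are checked on rational functions, where the
  action is faithful.\<close>

abbreviation "lookup \<equiv> Poly_Mapping.lookup"
abbreviation "keys \<equiv> Poly_Mapping.keys"
abbreviation "single \<equiv> Poly_Mapping.single"

section \<open>Rational functions\<close>

lemma mpoly_induct [case_names const var add mult]:
  fixes p :: mpoly
  assumes const: "\<And>c. P (single 0 c)"
    and var: "\<And>i. P (single (single i 1) 1)"
    and add: "\<And>p q. P p \<Longrightarrow> P q \<Longrightarrow> P (p + q)"
    and mult: "\<And>p q. P p \<Longrightarrow> P q \<Longrightarrow> P (p * q)"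
  shows "P p"
proof -
  have 1: "P (single m 1)" for m
  proof (induction m rule: poly_mapping_additive_induct)
    case (2 i n)
    show ?case
    proof (induction n)
      case 0
      then show ?case using const[of 1] by simp
    next
      case (Suc n)
      have "single (single i (Suc n)) (1::complex)
          = single (single i 1) 1 * single (single i n) 1"
        by (simp add: mult_single flip: single_add)
      then show ?case using mult[OF var Suc] by simp
    qed
  next
    case (3 p q)
    then show ?case using mult[of "single p 1" "single q 1"] by (simp add: mult_single)
  qed (use const[of 1] in simp)
  show ?thesis
  proof (induction p rule: poly_mapping_additive_induct)
    case (2 m c)
    show ?case using mult[OF const[of c] 1[of m]] by (simp add: mult_single)
  qed (use const[of 0] add in auto)
qed

lemma Fract_add_1: "Fract (a + b) 1 = Fract a 1 + Fract (b::'a::idom) 1"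
  by simp

lemma Fract_mult_1: "Fract (a * b) 1 = Fract a 1 * Fract (b::'a::idom) 1"
  by simp

text \<open>Permutations and derivations of the function field are determined by constants and
  variables; this rule reduces identities between them to those cases.\<close>

lemma ratfun_induct [case_names const var add mult inverse]:
  fixes f :: ratfun
  assumes const: "\<And>c. P (rat_const c)" and var: "\<And>i. P (rat_var i)"
    and add: "\<And>f g. P f \<Longrightarrow> P g \<Longrightarrow> P (f + g)"
    and mult: "\<And>f g. P f \<Longrightarrow> P g \<Longrightarrow> P (f * g)"
    and inverse: "\<And>f. f \<noteq> 0 \<Longrightarrow> P f \<Longrightarrow> P (inverse f)"
  shows "P f"
proof -
  have 1: "P (Fract p 1)" for p :: mpoly
    by (induction p rule: mpoly_induct)
      (use const var add mult in \<open>auto simp add: rat_const_def rat_var_def Fract_add_1 Fract_mult_1 simp del: add_fract mult_fract\<close>)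
  obtain a b where f: "f = Fract a b" "b \<noteq> 0" by (cases f) auto
  have "f = Fract a 1 * inverse (Fract b 1)" using f by simp
  moreover have "Fract b 1 \<noteq> 0" using f by (simp add: Zero_fract_def eq_fract)
  ultimately show ?thesis using mult[OF 1 inverse[OF _ 1]] by metis
qed

lemma rat_const_0 [simp]: "rat_const 0 = 0"
  by (simp add: rat_const_def Zero_fract_def)

lemma rat_const_1 [simp]: "rat_const 1 = 1"
  by (simp add: rat_const_def One_fract_def)

lemma rat_const_add: "rat_const (a + b) = rat_const a + rat_const b"
  by (simp add: rat_const_def single_add)

lemma rat_const_mult: "rat_const (a * b) = rat_const a * rat_const b"
  by (simp add: rat_const_def mult_single)

lemma rat_const_minus: "rat_const (- a) = - rat_const a"
  by (simp add: rat_const_def single_uminus)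

lemma rat_const_diff: "rat_const (a - b) = rat_const a - rat_const b"
  using rat_const_add[of a "-b"] by (simp add: rat_const_minus)

lemma rat_const_eq_iff [simp]: "rat_const a = rat_const b \<longleftrightarrow> a = b"
proof -
  have "rat_const a = rat_const b \<longleftrightarrow> (single 0 a :: mpoly) = single 0 b"
    by (simp add: rat_const_def eq_fract)
  then show ?thesis using inj_eq[OF inj_single] by metis
qed

lemma rat_const_eq_0_iff [simp]: "rat_const a = 0 \<longleftrightarrow> a = 0"
  using rat_const_eq_iff[of a 0] by (simp del: rat_const_eq_iff)

lemma rat_const_power: "rat_const (a ^ n) = rat_const a ^ n"
  by (induction n) (simp_all add: rat_const_mult)

lemma rat_const_sum: "rat_const (sum f A) = (\<Sum>a\<in>A. rat_const (f a))"
  by (induction A rule: infinite_finite_induct) (simp_all add: rat_const_add)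

lemma rat_const_of_nat: "rat_const (of_nat n) = of_nat n"
  by (induction n) (simp_all add: rat_const_add)

lemma rat_const_of_int: "rat_const (of_int n) = of_int n"
  by (cases n) (simp_all add: rat_const_of_nat rat_const_minus rat_const_diff)

lemma rat_var_eq_iff [simp]: "rat_var i = rat_var j \<longleftrightarrow> i = j"
proof -
  have "rat_var i = rat_var j \<longleftrightarrow> (single (single i 1) 1 :: mpoly) = single (single j 1) 1"
    by (simp add: rat_var_def eq_fract)
  then show ?thesis
    by (metis keys_single lookup_single_eq singletonD singletonI zero_neq_one)
qed

lemma rat_var_nonzero [simp]: "rat_var i \<noteq> 0"
proof
  assume "rat_var i = 0"
  then have "(single (single i 1) 1 :: mpoly) = 0"
    by (simp add: rat_var_def Zero_fract_def eq_fract)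
  then show False by (metis lookup_single_eq lookup_zero zero_neq_one)
qed

lemma rat_perm_add [simp]: "bij w \<Longrightarrow> rat_perm w (f + g) = rat_perm w f + rat_perm w g"
  by (cases f; cases g)
    (simp add: rat_perm_Fract mpoly_perm_add mpoly_perm_mult mpoly_perm_eq_0)

lemma rat_perm_mult [simp]: "bij w \<Longrightarrow> rat_perm w (f * g) = rat_perm w f * rat_perm w g"
  by (cases f; cases g)
    (simp add: rat_perm_Fract mpoly_perm_mult mpoly_perm_eq_0)

lemma mpoly_perm_1: "bij w \<Longrightarrow> mpoly_perm w 1 = 1"
  by (simp add: mpoly_perm_single bij_is_inj bij_imp_bij_inv flip: single_one)

lemma rat_perm_1 [simp]: "bij w \<Longrightarrow> rat_perm w 1 = 1"
  by (simp add: One_fract_def rat_perm_Fract mpoly_perm_1)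

lemma rat_perm_const [simp]: "bij w \<Longrightarrow> rat_perm w (rat_const c) = rat_const c"
  by (simp add: rat_const_def rat_perm_Fract mpoly_perm_1 mpoly_perm_single bij_imp_bij_inv bij_is_inj)

lemma rat_perm_0 [simp]: "bij w \<Longrightarrow> rat_perm w 0 = 0"
  using rat_perm_const[of w 0] by (simp del: rat_perm_const)

lemma rat_perm_var [simp]: "bij w \<Longrightarrow> rat_perm w (rat_var i) = rat_var (w i)"
proof -
  assume w: "bij w"
  have "Poly_Mapping.map_key (inv_into UNIV w) (single i (1::nat)) = single (w i) 1"
    using map_key_single[of "inv_into UNIV w" "w i" "1::nat"] w
    by (simp add: bij_is_inj bij_imp_bij_inv)
  with w show ?thesis
    by (simp add: rat_var_def rat_perm_Fract mpoly_perm_1 mpoly_perm_single)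
qed

lemma rat_perm_minus [simp]: "bij w \<Longrightarrow> rat_perm w (- f) = - rat_perm w f"
  by (metis add_eq_0_iff rat_perm_0 rat_perm_add)

lemma rat_perm_diff [simp]: "bij w \<Longrightarrow> rat_perm w (f - g) = rat_perm w f - rat_perm w g"
  using rat_perm_add[of w f "- g"] by simp

lemma rat_perm_inverse [simp]: "bij w \<Longrightarrow> rat_perm w (inverse f) = inverse (rat_perm w f)"
  by (metis inverse_unique inverse_zero rat_perm_0 rat_perm_1 rat_perm_mult right_inverse)

lemma rat_perm_divide [simp]: "bij w \<Longrightarrow> rat_perm w (f / g) = rat_perm w f / rat_perm w g"
  by (simp add: divide_inverse)

lemma rat_perm_power [simp]: "bij w \<Longrightarrow> rat_perm w (f ^ n) = rat_perm w f ^ n"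
  by (induction n) auto

lemma rat_perm_sum: "bij w \<Longrightarrow> rat_perm w (sum f A) = (\<Sum>a\<in>A. rat_perm w (f a))"
  by (induction A rule: infinite_finite_induct) auto

lemma rat_perm_prod: "bij w \<Longrightarrow> rat_perm w (prod f A) = (\<Prod>a\<in>A. rat_perm w (f a))"
  by (induction A rule: infinite_finite_induct) auto

lemma rat_perm_comp: "bij v \<Longrightarrow> bij w \<Longrightarrow> rat_perm (v \<circ> w) f = rat_perm v (rat_perm w f)"
  by (induction f rule: ratfun_induct) (simp_all add: bij_comp)

lemma rat_perm_id [simp]: "rat_perm id f = f"
proof -
  have "bij (\<lambda>a::nat. a)" using bij_id by (simp add: id_def)
  then show ?thesis by (induction f rule: ratfun_induct) (simp_all add: id_def)
qed

lemma rat_perm_eq_0_iff [simp]: "bij w \<Longrightarrow> rat_perm w f = 0 \<longleftrightarrow> f = 0"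
  by (metis rat_perm_0 rat_perm_comp rat_perm_id bij_imp_bij_inv bij_is_inj inv_o_cancel)

lemma rat_deriv_add [simp]: "rat_deriv i (f + g) = rat_deriv i f + rat_deriv i g"
  by (cases f; cases g)
    (simp add: rat_deriv_Fract mpoly_deriv_add mpoly_deriv_mult eq_fract algebra_simps)

lemma rat_deriv_mult: "rat_deriv i (f * g) = rat_deriv i f * g + f * rat_deriv i g"
  by (cases f; cases g)
    (simp add: rat_deriv_Fract mpoly_deriv_mult eq_fract algebra_simps)

lemma mpoly_deriv_1: "mpoly_deriv i 1 = 0"
  by (simp add: mpoly_deriv_single flip: single_one)

lemma rat_deriv_const [simp]: "rat_deriv i (rat_const c) = 0"
  by (simp add: rat_const_def rat_deriv_Fract mpoly_deriv_single mpoly_deriv_1 Zero_fract_def)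

lemma rat_deriv_0 [simp]: "rat_deriv i 0 = 0"
  using rat_deriv_const[of i 0] by (simp del: rat_deriv_const)

lemma rat_deriv_1 [simp]: "rat_deriv i 1 = 0"
  using rat_deriv_const[of i 1] by (simp del: rat_deriv_const)

lemma rat_deriv_var: "rat_deriv i (rat_var j) = (if i = j then 1 else 0)"
proof -
  have "single j 1 - single i (1::nat) = 0" if "i = j"
    using that by simp
  then show ?thesis
    by (auto simp add: rat_var_def rat_deriv_Fract mpoly_deriv_single mpoly_deriv_1 Zero_fract_def One_fract_def
      lookup_single when_def)
qed

lemma rat_deriv_minus [simp]: "rat_deriv i (- f) = - rat_deriv i f"
  by (metis add_eq_0_iff rat_deriv_0 rat_deriv_add)

lemma rat_deriv_diff [simp]: "rat_deriv i (f - g) = rat_deriv i f - rat_deriv i g"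
  using rat_deriv_add[of i f "- g"] by simp

lemma rat_deriv_sum: "rat_deriv i (sum f A) = (\<Sum>a\<in>A. rat_deriv i (f a))"
  by (induction A rule: infinite_finite_induct) auto

lemma rat_deriv_inverse: "f \<noteq> 0 \<Longrightarrow> rat_deriv i (inverse f) = - rat_deriv i f / f ^ 2"
proof -
  assume f: "f \<noteq> 0"
  have "rat_deriv i f * inverse f + f * rat_deriv i (inverse f) = 0"
    using f rat_deriv_mult[of i f "inverse f"] by simp
  with f show ?thesis by (simp add: field_simps power2_eq_square eq_neg_iff_add_eq_0)
qed

lemma rat_deriv_scale: "rat_deriv i (rat_const c * f) = rat_const c * rat_deriv i f"
  by (simp add: rat_deriv_mult)

lemma rat_deriv_commute: "rat_deriv i (rat_deriv j f) = rat_deriv j (rat_deriv i f)"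
proof (induction f rule: ratfun_induct)
  case (inverse f)
  have "rat_deriv i (rat_deriv j (f * inverse f)) = rat_deriv j (rat_deriv i (f * inverse f))"
    using inverse.hyps by simp
  then have "f * rat_deriv i (rat_deriv j (inverse f)) = f * rat_deriv j (rat_deriv i (inverse f))"
    unfolding rat_deriv_mult rat_deriv_add inverse.IH by (simp add: algebra_simps)
  with inverse.hyps show ?case by simp
qed (simp_all add: rat_deriv_var rat_deriv_mult algebra_simps)

lemma rat_perm_deriv: "bij w \<Longrightarrow> rat_perm w (rat_deriv i f) = rat_deriv (w i) (rat_perm w f)"
  by (induction f rule: ratfun_induct)
    (auto simp add: rat_deriv_var rat_deriv_mult rat_deriv_inverse bij_is_inj inj_eq)

declare One_nat_def [simp del]

section \<open>Evaluation of polynomials\<close>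

abbreviation mconst :: "complex \<Rightarrow> mpoly" where "mconst \<equiv> single 0"
abbreviation mvar :: "nat \<Rightarrow> mpoly" where "mvar i \<equiv> single (single i 1) 1"

lemma lookup_mult_const: "lookup (mconst c * p) m = c * lookup p m"
  by (induction p rule: poly_mapping_additive_induct)
    (auto simp: mult_single lookup_add lookup_single when_def distrib_left)

definition vars_in :: "nat set \<Rightarrow> mpoly \<Rightarrow> bool" where
  "vars_in V p \<longleftrightarrow> (\<forall>m\<in>keys p. keys m \<subseteq> V)"

lemma vars_in_const [simp]: "vars_in V (mconst c)"
  by (simp add: vars_in_def)

lemma vars_in_var: "i \<in> V \<Longrightarrow> vars_in V (mvar i)"
  by (simp add: vars_in_def)

lemma vars_in_add: "vars_in V p \<Longrightarrow> vars_in V q \<Longrightarrow> vars_in V (p + q)"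
  using Poly_Mapping.keys_add[of p q] unfolding vars_in_def by blast

lemma vars_in_mult: "vars_in V p \<Longrightarrow> vars_in V q \<Longrightarrow> vars_in V (p * q)"
  unfolding vars_in_def
proof
  fix m assume pq: "\<forall>m\<in>keys p. keys m \<subseteq> V"
    "\<forall>m\<in>keys q. keys m \<subseteq> V" and "m \<in> keys (p * q)"
  then obtain a b where "m = a + b" "a \<in> keys p" "b \<in> keys q"
    using keys_mult[of p q] by blast
  with pq show "keys m \<subseteq> V" using Poly_Mapping.keys_add[of a b] by blast
qed

lemma vars_in_induct [consumes 1, case_names const var add mult]:
  fixes p :: mpoly
  assumes p: "vars_in V p"
    and const: "\<And>c. P (mconst c)"
    and var: "\<And>i. i \<in> V \<Longrightarrow> P (mvar i)"
    and add: "\<And>p q. vars_in V p \<Longrightarrow> vars_in V q \<Longrightarrow> P p \<Longrightarrow> P q \<Longrightarrow> P (p + q)"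
    and mult: "\<And>p q. vars_in V p \<Longrightarrow> vars_in V q \<Longrightarrow> P p \<Longrightarrow> P q \<Longrightarrow> P (p * q)"
  shows "P p"
proof -
  let ?Q = "\<lambda>p. vars_in V p \<and> P p"
  have one: "?Q 1" using const[of 1] vars_in_const[of V 1] by simp
  have mul: "?Q (p * q)" if "?Q p" "?Q q" for p q using that mult vars_in_mult by blast
  have pw: "?Q (single (single i n) 1)" if "i \<in> V" for i n
  proof (induction n)
    case (Suc n)
    have "single (single i (Suc n)) (1::complex)
        = mvar i * single (single i n) 1"
      by (simp add: mult_single One_nat_def flip: single_add)
    then show ?case using mul[OF _ Suc] var[OF that] vars_in_var[OF that] by metis
  qed (use one in simp)
  have 1: "?Q (single m 1)" if m: "keys m \<subseteq> V" for m
  proof -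
    have "?Q (single (\<Sum>i\<in>A. single i (lookup m i)) 1)"
      if "finite A" "A \<subseteq> V" for A
      using that
    proof (induction A)
      case (insert i A)
      then have "?Q (single (single i (lookup m i)) 1
          * single (\<Sum>i\<in>A. single i (lookup m i)) 1)"
        by (intro mul pw) auto
      then show ?case using insert.hyps by (simp add: mult_single)
    qed (use one in simp)
    from this[of "keys m"] m show ?thesis
      by (metis poly_mapping_eq_sum_single finite_keys)
  qed
  have "?Q (\<Sum>m\<in>A. single m (lookup p m))"
    if "finite A" "A \<subseteq> keys p" for A
    using that
  proof (induction A)
    case empty
    show ?case using const[of 0] vars_in_const[of V 0] by simp
  next
    case (insert m A)
    have "single m (lookup p m)
        = mconst (lookup p m) * single m 1"
      by (simp add: mult_single)
    moreover have "?Q (mconst (lookup p m) * single m 1)"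
      using insert.prems p const by (intro mul 1) (auto simp: vars_in_def)
    ultimately show ?case using insert add vars_in_add by auto
  qed
  from this[of "keys p"] show ?thesis
    by (metis poly_mapping_eq_sum_single finite_keys order_refl)
qed

lemma vars_in_UNIV [simp]: "vars_in UNIV p"
  by (simp add: vars_in_def)

definition mono_val :: "(nat \<Rightarrow> 'a::comm_monoid_mult) \<Rightarrow> (nat \<Rightarrow>\<^sub>0 nat) \<Rightarrow> 'a" where
  "mono_val x m = (\<Prod>i\<in>keys m. x i ^ lookup m i)"

lemma mono_val_superset:
  assumes "finite A" "keys m \<subseteq> A"
  shows "mono_val x m = (\<Prod>i\<in>A. x i ^ lookup m i)"
  unfolding mono_val_def using assms by (intro prod.mono_neutral_left) (auto simp: in_keys_iff)

lemma mono_val_0 [simp]: "mono_val x 0 = 1"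
  by (simp add: mono_val_def)

lemma mono_val_add: "mono_val x (m + n) = mono_val x m * mono_val x n"
proof -
  let ?A = "keys m \<union> keys n"
  have "keys (m + n) \<subseteq> ?A" by (rule Poly_Mapping.keys_add)
  then show ?thesis
    by (simp add: mono_val_superset[of ?A] lookup_add power_add prod.distrib)
qed

lemma mono_val_single [simp]: "mono_val x (single i n) = x i ^ n"
  by (cases "n = 0") (simp_all add: mono_val_def)

text \<open>Leaving the coefficient map open lets one development of \<open>pev\<close> serve both
  evaluation at complex points and substitution of polynomials.\<close>

definition coeff_hom :: "(complex \<Rightarrow> 'a::comm_ring_1) \<Rightarrow> bool" where
  "coeff_hom h \<longleftrightarrow> h 1 = 1 \<and> (\<forall>a b. h (a + b) = h a + h b \<and> h (a * b) = h a * h b)"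

lemma coeff_hom_id: "coeff_hom (\<lambda>c. c)"
  by (simp add: coeff_hom_def)

lemma coeff_hom_mconst: "coeff_hom mconst"
  by (simp add: coeff_hom_def single_add mult_single)

definition pev :: "(complex \<Rightarrow> 'a::comm_ring_1) \<Rightarrow> (nat \<Rightarrow> 'a) \<Rightarrow> mpoly \<Rightarrow> 'a" where
  "pev h x p = (\<Sum>m\<in>keys p. h (lookup p m) * mono_val x m)"

abbreviation ev :: "(nat \<Rightarrow> complex) \<Rightarrow> mpoly \<Rightarrow> complex" where
  "ev \<equiv> pev (\<lambda>c. c)"
abbreviation msubst :: "(nat \<Rightarrow> mpoly) \<Rightarrow> mpoly \<Rightarrow> mpoly" where
  "msubst \<equiv> pev mconst"

context
  fixes h :: "complex \<Rightarrow> 'a::comm_ring_1"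
  assumes h: "coeff_hom h"
begin

lemma coeff_hom_0: "h 0 = 0"
proof -
  have "h (0 + 0) = h 0 + h 0" using h unfolding coeff_hom_def by blast
  then show ?thesis by simp
qed

lemma pev_single: "pev h x (single m c) = h c * mono_val x m"
  by (simp add: pev_def coeff_hom_0)

lemma pev_0: "pev h x 0 = 0"
  by (simp add: pev_def)

lemma pev_const: "pev h x (mconst c) = h c"
  by (simp add: pev_single)

lemma pev_1: "pev h x 1 = 1"
  using pev_const[of x 1] h by (simp add: coeff_hom_def)

lemma pev_var: "pev h x (mvar i) = x i"
  using h by (simp add: pev_single coeff_hom_def)

lemma pev_add: "pev h x (p + q) = pev h x p + pev h x q"
  unfolding pev_def using h
  by (intro setsum_keys_plus_distrib) (simp_all add: coeff_hom_0 coeff_hom_def algebra_simps)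

lemma pev_mult: "pev h x (p * q) = pev h x p * pev h x q"
proof (induction p rule: poly_mapping_additive_induct)
  case (2 m c)
  show ?case
    by (induction q rule: poly_mapping_additive_induct)
      (use h in \<open>simp_all add: pev_0 pev_add pev_single mult_single distrib_left mono_val_add coeff_hom_def\<close>)
qed (simp_all add: pev_0 pev_add distrib_right)

lemma pev_minus: "pev h x (- p) = - pev h x p"
  by (metis add_eq_0_iff pev_0 pev_add)

lemma pev_diff: "pev h x (p - q) = pev h x p - pev h x q"
  using pev_add[of x p "- q"] by (simp add: pev_minus)

lemma pev_power: "pev h x (p ^ n) = pev h x p ^ n"
  by (induction n) (simp_all add: pev_1 pev_mult)

lemma pev_sum: "pev h x (sum f A) = (\<Sum>a\<in>A. pev h x (f a))"
  by (induction A rule: infinite_finite_induct) (simp_all add: pev_0 pev_add)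

lemma pev_prod: "pev h x (prod f A) = (\<Prod>a\<in>A. pev h x (f a))"
  by (induction A rule: infinite_finite_induct) (simp_all add: pev_1 pev_mult)

lemma dvd_pev_diff:
  assumes "\<And>i. d dvd x i - y i"
  shows "d dvd pev h x p - pev h y p"
proof (induction p rule: mpoly_induct)
  case (add p q)
  have "pev h x (p + q) - pev h y (p + q) = (pev h x p - pev h y p) + (pev h x q - pev h y q)"
    by (simp add: pev_add)
  with add show ?case by (metis dvd_add)
next
  case (mult p q)
  have "pev h x (p * q) - pev h y (p * q)
      = (pev h x p - pev h y p) * pev h x q + pev h y p * (pev h x q - pev h y q)"
    by (simp add: pev_mult algebra_simps)
  with mult show ?case by (metis dvd_add dvd_mult dvd_mult2)
qed (use assms in \<open>simp_all add: pev_const pev_var\<close>)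

end

lemmas ev_simps = pev_const[OF coeff_hom_id] pev_1[OF coeff_hom_id] pev_var[OF coeff_hom_id]
  pev_0[OF coeff_hom_id] pev_add[OF coeff_hom_id] pev_mult[OF coeff_hom_id] pev_minus[OF coeff_hom_id]
  pev_diff[OF coeff_hom_id] pev_power[OF coeff_hom_id] pev_sum[OF coeff_hom_id] pev_prod[OF coeff_hom_id]
lemmas msubst_simps = pev_const[OF coeff_hom_mconst] pev_1[OF coeff_hom_mconst] pev_var[OF coeff_hom_mconst]
  pev_0[OF coeff_hom_mconst] pev_add[OF coeff_hom_mconst] pev_mult[OF coeff_hom_mconst] pev_minus[OF coeff_hom_mconst]
  pev_diff[OF coeff_hom_mconst] pev_power[OF coeff_hom_mconst] pev_sum[OF coeff_hom_mconst] pev_prod[OF coeff_hom_mconst]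

lemma msubst_var_id [simp]: "msubst mvar p = p"
  by (induction p rule: mpoly_induct) (simp_all add: msubst_simps)

lemma ev_msubst: "ev x (msubst s p) = ev (\<lambda>i. ev x (s i)) p"
  by (induction p rule: mpoly_induct) (simp_all add: msubst_simps ev_simps)

lemma msubst_msubst: "msubst r (msubst s p) = msubst (\<lambda>i. msubst r (s i)) p"
  by (induction p rule: mpoly_induct) (simp_all add: msubst_simps)

lemma ev_cong_vars:
  assumes "vars_in V p" "\<And>i. i \<in> V \<Longrightarrow> x i = y i"
  shows "ev x p = ev y p"
  using assms by (induction rule: vars_in_induct) (simp_all add: ev_simps)

lemma msubst_cong_vars:
  assumes "vars_in V p" "\<And>i. i \<in> V \<Longrightarrow> x i = y i"
  shows "msubst x p = msubst y p"
  using assms by (induction rule: vars_in_induct) (simp_all add: msubst_simps)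

lemma vars_in_msubst:
  assumes "\<And>i. vars_in V (s i)"
  shows "vars_in V (msubst s p)"
  by (induction p rule: mpoly_induct)
    (use assms vars_in_add vars_in_mult in \<open>auto simp add: msubst_simps\<close>)

text \<open>Dedekind's argument: distinct monomials are distinct characters of the multiplicative monoid of
  positive points.\<close>

lemma monomials_independent:
  fixes c :: "(nat \<Rightarrow>\<^sub>0 nat) \<Rightarrow> complex"
  assumes "finite A" "\<And>x. (\<And>i. x i > 0) \<Longrightarrow> (\<Sum>m\<in>A. c m * of_nat (mono_val x m)) = 0" "m \<in> A"
  shows "c m = 0"
  using assms
proof (induction A arbitrary: c m)
  case (insert m' A)
  have *: "c m = 0" if "m \<in> A" for m
  proof -
    have "m \<noteq> m'" using that insert.hyps by auto
    then obtain i where i: "lookup m i \<noteq> lookup m' i"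
      by (metis poly_mapping_eqI)
    define y :: "nat \<Rightarrow> nat" where "y j = (if j = i then 2 else 1)" for j
    have y: "mono_val (\<lambda>j. y j * x j) n = 2 ^ lookup n i * mono_val x n" for x n
    proof -
      have "mono_val (\<lambda>j. y j * x j) n = mono_val y n * mono_val x n"
        by (simp add: mono_val_def power_mult_distrib prod.distrib)
      moreover have "mono_val y n = (\<Prod>j\<in>insert i (keys n). y j ^ lookup n j)"
        by (intro mono_val_superset) auto
      moreover have "\<dots> = (\<Prod>j\<in>insert i (keys n). if j = i then 2 ^ lookup n i else 1)"
        by (intro prod.cong) (auto simp: y_def)
      ultimately show ?thesis by simp
    qed
    have "c m * (2 ^ lookup m i - 2 ^ lookup m' i) = 0"
    proof (rule insert.IH[OF _ that])
      fix x :: "nat \<Rightarrow> nat" assume x: "\<And>i. x i > 0"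
      have "(\<Sum>n\<in>insert m' A. c n * of_nat (mono_val (\<lambda>j. y j * x j) n)) = 0"
        by (intro insert.prems) (use x in \<open>auto simp: y_def\<close>)
      moreover have "(\<Sum>n\<in>insert m' A. c n * of_nat (mono_val x n)) = 0"
        by (intro insert.prems) (use x in auto)
      ultimately have "(\<Sum>n\<in>insert m' A. c n * of_nat (mono_val (\<lambda>j. y j * x j) n))
          - 2 ^ lookup m' i * (\<Sum>n\<in>insert m' A. c n * of_nat (mono_val x n)) = 0"
        by (metis diff_zero mult_zero_right)
      then have "(\<Sum>n\<in>insert m' A. c n * of_nat (mono_val (\<lambda>j. y j * x j) n)
          - 2 ^ lookup m' i * (c n * of_nat (mono_val x n))) = 0"
        by (simp only: sum_subtractf sum_distrib_left)
      then show "(\<Sum>n\<in>A. c n * (2 ^ lookup n i - 2 ^ lookup m' i)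
          * of_nat (mono_val x n)) = 0"
        using insert.hyps unfolding y by (simp add: algebra_simps)
    qed
    moreover have "(2::complex) ^ lookup m i \<noteq> 2 ^ lookup m' i"
    proof
      assume "(2::complex) ^ lookup m i = 2 ^ lookup m' i"
      then have "of_nat (2 ^ lookup m i) = (of_nat (2 ^ lookup m' i) :: complex)"
        by simp
      then show False using i by (simp only: of_nat_eq_iff) simp
    qed
    ultimately show ?thesis by simp
  qed
  have "(\<Sum>m\<in>insert m' A. c m * of_nat (mono_val (\<lambda>_. 1) m)) = 0" by (intro insert.prems) simp
  then have "c m' = 0" using insert.hyps * by (simp add: mono_val_def)
  with * insert.prems show ?case by auto
qed simp

lemma mono_val_of_nat: "mono_val (\<lambda>i. of_nat (x i)) m = (of_nat (mono_val x m) :: 'a::comm_semiring_1)"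
  by (simp add: mono_val_def)

text \<open>Positive natural points are enough, and convenient: they avoid the hyperplanes X_i = 0
  and can serve as exponents of monomials.\<close>

lemma mpoly_zeroI:
  assumes "\<And>x :: nat \<Rightarrow> nat. (\<And>i. x i > 0) \<Longrightarrow> ev (\<lambda>i. of_nat (x i)) p = 0"
  shows "p = 0"
proof -
  have "lookup p m = 0" if "m \<in> keys p" for m
    by (rule monomials_independent[of "keys p" "lookup p", OF _ _ that])
      (use assms in \<open>simp_all add: pev_def mono_val_of_nat\<close>)
  then show ?thesis by (metis in_keys_iff poly_mapping_eqI lookup_zero)
qed

lemma mvar_diff_nonzero: "i \<noteq> j \<Longrightarrow> mvar i - mvar j \<noteq> 0"
  by (metis eq_iff_diff_eq_0 keys_single one_neq_zero singletonD singletonI)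

text \<open>Replacing X_i by X_j changes p by a multiple of X_i - X_j, and the result is zero
  because its values are values of p on the diagonal.\<close>

lemma diagonal_dvd:
  assumes "i \<noteq> j" "\<And>q. q i = q j \<Longrightarrow> ev q p = 0"
  shows "(mvar i - mvar j) dvd p"
proof -
  define s where "s = (\<lambda>n. if n = i then mvar j else mvar n)"
  have "msubst s p = 0"
  proof (rule mpoly_zeroI)
    fix x :: "nat \<Rightarrow> nat"
    show "ev (\<lambda>i. of_nat (x i)) (msubst s p) = 0"
      unfolding ev_msubst by (rule assms(2)) (use assms(1) in \<open>simp add: s_def ev_simps\<close>)
  qed
  moreover have "(mvar i - mvar j) dvd msubst mvar p - msubst s p"
    by (rule dvd_pev_diff[OF coeff_hom_mconst]) (simp add: s_def)
  ultimately show ?thesis by simp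
qed

lemma hyperplane_dvd:
  assumes "\<And>q. q i = c \<Longrightarrow> ev q p = 0"
  shows "(mvar i - mconst c) dvd p"
proof -
  define s where "s = (\<lambda>n. if n = i then mconst c else mvar n)"
  have "msubst s p = 0"
  proof (rule mpoly_zeroI)
    fix x :: "nat \<Rightarrow> nat"
    show "ev (\<lambda>i. of_nat (x i)) (msubst s p) = 0"
      unfolding ev_msubst by (rule assms) (simp add: s_def ev_simps)
  qed
  moreover have "(mvar i - mconst c) dvd msubst mvar p - msubst s p"
    by (rule dvd_pev_diff[OF coeff_hom_mconst]) (simp add: s_def)
  ultimately show ?thesis by simp
qed

text \<open>Setting the variables outside V to zero fixes d and d * r, hence also r after cancelling
  d.\<close>

lemma vars_in_factor:
  assumes "vars_in V (d * r)" "vars_in V d" "d \<noteq> 0"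
  shows "vars_in V r"
proof -
  define t where "t = (\<lambda>i. if i \<in> V then mvar i else 0)"
  have fix_t: "msubst t p = p" if "vars_in V p" for p
    using msubst_cong_vars[OF that, of t mvar] by (simp add: t_def)
  have "d * msubst t r = d * r"
    using fix_t[OF assms(1)] fix_t[OF assms(2)] by (simp add: msubst_simps)
  with \<open>d \<noteq> 0\<close> have "msubst t r = r" by simp
  moreover have "vars_in V (msubst t r)"
    using vars_in_const[of V 0] by (intro vars_in_msubst) (auto simp: t_def vars_in_var)
  ultimately show ?thesis by simp
qed

section \<open>Polynomials, Laurent polynomials and regular functions as subrings\<close>

abbreviation Xd :: "nat \<Rightarrow> nat \<Rightarrow> ratfun" where "Xd i j \<equiv> rat_var i - rat_var j"

lemma Xd_nonzero [simp]: "Xd i j = 0 \<longleftrightarrow> i = j"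
  by simp

lemma polynomials_iff: "f \<in> polynomials N \<longleftrightarrow> (\<exists>p. f = Fract p 1 \<and> vars_in {1..N} p)"
  by (auto simp: polynomials_def vars_in_def)

lemma polynomials_const [simp, intro]: "rat_const c \<in> polynomials N"
  unfolding polynomials_iff rat_const_def using vars_in_const by blast

lemma polynomials_var [intro]: "i \<in> {1..N} \<Longrightarrow> rat_var i \<in> polynomials N"
  unfolding polynomials_iff rat_var_def using vars_in_var by blast

lemma polynomials_add [intro]: "f \<in> polynomials N \<Longrightarrow> g \<in> polynomials N \<Longrightarrow> f + g \<in> polynomials N"
  unfolding polynomials_iff by (metis Fract_add_1 vars_in_add)

lemma polynomials_mult [intro]: "f \<in> polynomials N \<Longrightarrow> g \<in> polynomials N \<Longrightarrow> f * g \<in> polynomials N"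
  unfolding polynomials_iff by (metis Fract_mult_1 vars_in_mult)

lemma polynomials_0 [simp, intro]: "0 \<in> polynomials N"
  using polynomials_const[of 0 N] by (simp del: polynomials_const)

lemma polynomials_1 [simp, intro]: "1 \<in> polynomials N"
  using polynomials_const[of 1 N] by (simp del: polynomials_const)

lemma polynomials_minus [intro]: "f \<in> polynomials N \<Longrightarrow> - f \<in> polynomials N"
  using polynomials_mult[OF polynomials_const[of "-1" N], of f] by (simp add: rat_const_minus del: polynomials_const)

lemma polynomials_diff [intro]: "f \<in> polynomials N \<Longrightarrow> g \<in> polynomials N \<Longrightarrow> f - g \<in> polynomials N"
  using polynomials_add[of f N "- g"] by auto

lemma polynomials_sum: "(\<And>a. a \<in> A \<Longrightarrow> f a \<in> polynomials N) \<Longrightarrow> sum f A \<in> polynomials N"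
  by (induction A rule: infinite_finite_induct) auto

lemma polynomials_prod: "(\<And>a. a \<in> A \<Longrightarrow> f a \<in> polynomials N) \<Longrightarrow> prod f A \<in> polynomials N"
  by (induction A rule: infinite_finite_induct) auto

lemma polynomials_power: "f \<in> polynomials N \<Longrightarrow> f ^ n \<in> polynomials N"
  by (induction n) auto

lemma polynomials_induct [consumes 1, case_names const var add mult]:
  assumes f: "f \<in> polynomials N"
    and const: "\<And>c. P (rat_const c)"
    and var: "\<And>i. i \<in> {1..N} \<Longrightarrow> P (rat_var i)"
    and add: "\<And>f g. f \<in> polynomials N \<Longrightarrow> g \<in> polynomials N \<Longrightarrow> P f \<Longrightarrow> P g \<Longrightarrow> P (f + g)"
    and mult: "\<And>f g. f \<in> polynomials N \<Longrightarrow> g \<in> polynomials N \<Longrightarrow> P f \<Longrightarrow> P g \<Longrightarrow> P (f * g)"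
  shows "P f"
proof -
  obtain p where p: "f = Fract p 1" "vars_in {1..N} p" using f polynomials_iff by blast
  from p(2) have "P (Fract p 1)"
  proof (induction rule: vars_in_induct)
    case (const c) then show ?case using assms(2)[of c] by (simp add: rat_const_def)
  next
    case (var i) then show ?case using assms(3)[of i] by (simp add: rat_var_def)
  next
    case (add p q) then show ?case using assms(4)[of "Fract p 1" "Fract q 1"] by (auto simp: polynomials_iff)
  next
    case (mult p q) then show ?case using assms(5)[of "Fract p 1" "Fract q 1"] by (auto simp: polynomials_iff)
  qed
  with p show ?thesis by simp
qed

lemma polynomials_perm:
  assumes "w permutes {1..N}" "f \<in> polynomials N"
  shows "rat_perm w f \<in> polynomials N"
  using assms(2)
proof (induction f rule: polynomials_induct)
  case (var i)
  then show ?case using permutes_in_image[OF assms(1), of i] assms(1) by (auto simp: permutes_bij)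
qed (use assms(1) in \<open>auto simp: permutes_bij\<close>)

lemma polynomials_deriv: "f \<in> polynomials N \<Longrightarrow> rat_deriv i f \<in> polynomials N"
  by (induction rule: polynomials_induct) (auto simp: rat_deriv_var rat_deriv_mult)

lemma permutes_transpose: "i \<in> S \<Longrightarrow> j \<in> S \<Longrightarrow> transpose i j permutes S"
  by (rule permutes_swap_id)

lemma bij_transpose [simp]: "bij (transpose i j)"
  by simp

section \<open>Divided differences\<close>

definition ddiff :: "nat \<Rightarrow> nat \<Rightarrow> ratfun \<Rightarrow> ratfun" where
  "ddiff i j f = (f - rat_perm (transpose i j) f) / Xd i j"

lemma ddiff_const [simp]: "ddiff i j (rat_const c) = 0"
  by (simp add: ddiff_def)

lemma ddiff_add: "ddiff i j (f + g) = ddiff i j f + ddiff i j g"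
  by (simp add: ddiff_def add_divide_distrib diff_divide_distrib)

lemma ddiff_mult: "ddiff i j (f * g) = ddiff i j f * g + rat_perm (transpose i j) f * ddiff i j g"
proof -
  have "rat_perm (transpose i j) (f * g) = rat_perm (transpose i j) f * rat_perm (transpose i j) g" by simp
  then have "f * g - rat_perm (transpose i j) (f * g)
      = (f - rat_perm (transpose i j) f) * g + rat_perm (transpose i j) f * (g - rat_perm (transpose i j) g)"
    by (simp add: algebra_simps)
  then show ?thesis unfolding ddiff_def by (simp add: add_divide_distrib)
qed

lemma ddiff_scale: "ddiff i j (rat_const c * g) = rat_const c * ddiff i j g"
  by (simp add: ddiff_mult)

lemma ddiff_var: "i \<noteq> j \<Longrightarrow> ddiff i j (rat_var n) = (if n = i then 1 else if n = j then -1 else 0)"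
  by (auto simp: ddiff_def field_simps)

text \<open>The twisted Leibniz rule reduces divisibility by X_i - X_j to the generators, where the
  quotient is 0, 1 or -1.\<close>

lemma polynomials_ddiff:
  assumes "f \<in> polynomials N" "i \<in> {1..N}" "j \<in> {1..N}" "i \<noteq> j"
  shows "ddiff i j f \<in> polynomials N"
  using assms(1)
proof (induction rule: polynomials_induct)
  case (mult f g)
  then show ?case
    unfolding ddiff_mult using assms polynomials_perm[OF permutes_transpose] by (intro polynomials_add polynomials_mult) auto
qed (use assms in \<open>auto simp: ddiff_add ddiff_var\<close>)

text \<open>Laurent polynomials and regular functions both arise by inverting one polynomial, so
  their closure properties are proved once.\<close>

definition localized :: "nat \<Rightarrow> ratfun \<Rightarrow> ratfun set" where
  "localized N d = {f. \<exists>n. f * d ^ n \<in> polynomials N}"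

context
  fixes N :: nat and d :: ratfun
  assumes d: "d \<in> polynomials N" "d \<noteq> 0"
begin

lemma localizedI: "f * d ^ n \<in> polynomials N \<Longrightarrow> f \<in> localized N d"
  by (auto simp: localized_def)

lemma localized_ge: "f * d ^ n \<in> polynomials N \<Longrightarrow> n \<le> m \<Longrightarrow> f * d ^ m \<in> polynomials N"
proof -
  assume a: "f * d ^ n \<in> polynomials N" "n \<le> m"
  then have "f * d ^ m = f * d ^ n * d ^ (m - n)" by (simp add: mult.assoc flip: power_add)
  then show ?thesis using polynomials_mult[OF a(1) polynomials_power[OF d(1), of "m - n"]]
    by (simp only:)
qed

lemma localized_polynomials: "f \<in> polynomials N \<Longrightarrow> f \<in> localized N d"
  by (rule localizedI[of _ 0]) simp

lemma localized_add:
  assumes "f \<in> localized N d" "g \<in> localized N d"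
  shows "f + g \<in> localized N d"
proof -
  obtain m n where mn: "f * d ^ m \<in> polynomials N" "g * d ^ n \<in> polynomials N"
    using assms by (auto simp: localized_def)
  have "f * d ^ (m + n) \<in> polynomials N" "g * d ^ (m + n) \<in> polynomials N"
    using localized_ge mn by auto
  then show ?thesis by (intro localizedI[of _ "m + n"]) (auto simp: distrib_right)
qed

lemma localized_mult:
  assumes "f \<in> localized N d" "g \<in> localized N d"
  shows "f * g \<in> localized N d"
proof -
  obtain m n where mn: "f * d ^ m \<in> polynomials N" "g * d ^ n \<in> polynomials N"
    using assms by (auto simp: localized_def)
  then have "(f * d ^ m) * (g * d ^ n) \<in> polynomials N" by blast
  then show ?thesis by (intro localizedI[of _ "m + n"]) (simp add: power_add mult_ac)
qed

lemma localized_minus: "f \<in> localized N d \<Longrightarrow> - f \<in> localized N d"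
  using localized_mult[OF localized_polynomials[OF polynomials_const[of "-1"]]] by (auto simp: rat_const_minus)

lemma localized_diff: "f \<in> localized N d \<Longrightarrow> g \<in> localized N d \<Longrightarrow> f - g \<in> localized N d"
  using localized_add[of f "- g"] localized_minus by simp

lemma localized_sum: "(\<And>a. a \<in> A \<Longrightarrow> f a \<in> localized N d) \<Longrightarrow> sum f A \<in> localized N d"
  by (induction A rule: infinite_finite_induct) (auto intro: localized_add localized_polynomials)

lemma localized_prod: "(\<And>a. a \<in> A \<Longrightarrow> f a \<in> localized N d) \<Longrightarrow> prod f A \<in> localized N d"
  by (induction A rule: infinite_finite_induct) (auto intro: localized_mult localized_polynomials)

lemma localized_power: "f \<in> localized N d \<Longrightarrow> f ^ n \<in> localized N d"
  by (induction n) (auto intro: localized_mult localized_polynomials)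

lemma localized_inverse: "inverse d \<in> localized N d"
  using d by (intro localizedI[of _ 1]) simp

lemma localized_factor: "g \<in> polynomials N \<Longrightarrow> d = f * g \<Longrightarrow> inverse f \<in> localized N d"
  using d by (intro localizedI[of _ 1]) (auto simp: field_simps)

lemma localized_deriv:
  assumes "f \<in> localized N d" shows "rat_deriv i f \<in> localized N d"
proof -
  obtain n where n: "f * d ^ n \<in> polynomials N" using assms by (auto simp: localized_def)
  define g where "g = f * d ^ n"
  have "rat_deriv i (inverse d) = - rat_deriv i d * inverse d ^ 2"
    using d by (simp add: rat_deriv_inverse power_inverse divide_inverse)
  then have "rat_deriv i (inverse d) \<in> localized N d"
    using localized_mult[OF localized_polynomials[OF polynomials_minus[OF polynomials_deriv[OF d(1)]]]
      localized_power[OF localized_inverse, of 2]] by simp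
  then have p: "rat_deriv i (inverse d ^ n) \<in> localized N d" for n
  proof (induction n)
    case (Suc n)
    then show ?case unfolding power_Suc rat_deriv_mult
      using \<open>rat_deriv i (inverse d) \<in> localized N d\<close> localized_power[OF localized_inverse] localized_inverse
      by (intro localized_add localized_mult)
  qed (simp add: localized_polynomials)
  have "f = g * inverse d ^ n" using d by (simp add: g_def power_inverse)
  moreover have "g \<in> localized N d" "rat_deriv i g \<in> localized N d"
    using n polynomials_deriv localized_polynomials by (auto simp: g_def)
  ultimately show ?thesis using p localized_power[OF localized_inverse]
    by (simp only: rat_deriv_mult) (intro localized_add localized_mult)
qed

text \<open>The Vandermonde product is invariant only up to sign, so the hypothesis asks just that
  the image of 1/d stays in the localization.\<close>

lemma localized_perm:
  assumes w: "w permutes {1..N}" and "rat_perm w (inverse d) \<in> localized N d" and "f \<in> localized N d"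
  shows "rat_perm w f \<in> localized N d"
proof -
  obtain n where n: "f * d ^ n \<in> polynomials N" using assms by (auto simp: localized_def)
  define g where "g = f * d ^ n"
  have "f = g * inverse d ^ n" using d by (simp add: g_def power_inverse)
  then have "rat_perm w f = rat_perm w g * rat_perm w (inverse d) ^ n"
    using permutes_bij[OF w] by (simp only: rat_perm_mult rat_perm_power)
  then show ?thesis
    using localized_mult[OF localized_polynomials[OF polynomials_perm[OF w n]] localized_power[OF assms(2)], of n]
    by (simp add: g_def)
qed

end

section \<open>Laurent polynomials and regular functions as localizations\<close>

definition Xall :: "nat \<Rightarrow> ratfun" where "Xall N = (\<Prod>i=1..N. rat_var i)"

lemma Xall_polynomials [simp, intro]: "Xall N \<in> polynomials N"
  unfolding Xall_def by (intro polynomials_prod) auto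

lemma Xall_nonzero [simp]: "Xall N \<noteq> 0"
  by (simp add: Xall_def)

lemma Xall_perm: "w permutes {1..N} \<Longrightarrow> rat_perm w (Xall N) = Xall N"
  using prod.permute[of w "{1..N}" rat_var, symmetric]
  unfolding Xall_def by (subst rat_perm_prod) (simp_all add: permutes_bij comp_def)

lemma vandermonde_polynomials [simp, intro]: "vandermonde N \<in> polynomials N"
  unfolding vandermonde_def by (intro polynomials_prod polynomials_diff polynomials_var) auto

lemma vandermonde_nonzero [simp]: "vandermonde N \<noteq> 0"
  by (auto simp: vandermonde_def)

abbreviation LP :: "nat \<Rightarrow> ratfun set" where "LP \<equiv> laurent_polynomials"
abbreviation RF :: "nat \<Rightarrow> ratfun set" where "RF \<equiv> regular_functions"

lemma laurent_eq_localized: "LP N = localized N (Xall N)"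
proof -
  have "f \<in> LP N \<longleftrightarrow> (\<exists>n. f * Xall N ^ n \<in> polynomials N)" for f
  proof
    assume "f \<in> LP N"
    then obtain p n where "f = p / Xall N ^ n" "p \<in> polynomials N"
      by (auto simp: laurent_polynomials_def Xall_def)
    then show "\<exists>n. f * Xall N ^ n \<in> polynomials N" by (auto intro!: exI[of _ n])
  next
    assume "\<exists>n. f * Xall N ^ n \<in> polynomials N"
    then obtain n where "f * Xall N ^ n \<in> polynomials N" by blast
    moreover have "f = (f * Xall N ^ n) / Xall N ^ n" by simp
    ultimately show "f \<in> LP N" unfolding laurent_polynomials_def Xall_def by blast
  qed
  then show ?thesis by (auto simp: localized_def)
qed

lemma regular_eq_localized: "RF N = localized N (Xall N * vandermonde N)"
proof -
  have "f \<in> RF N \<longleftrightarrow> (\<exists>n. f * (Xall N * vandermonde N) ^ n \<in> polynomials N)" for f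
  proof
    assume "f \<in> RF N"
    then obtain g n where f: "f = g / vandermonde N ^ n" "g \<in> LP N"
      by (auto simp: regular_functions_def)
    then obtain m where m: "g * Xall N ^ m \<in> polynomials N"
      by (auto simp: laurent_eq_localized localized_def)
    have "f * (Xall N * vandermonde N) ^ (m + n) = (g * Xall N ^ m) * (Xall N ^ n * vandermonde N ^ m)"
      by (simp add: f power_add power_mult_distrib)
    also have "\<dots> \<in> polynomials N" by (intro polynomials_mult[OF m]) (auto intro!: polynomials_power)
    finally show "\<exists>n. f * (Xall N * vandermonde N) ^ n \<in> polynomials N" by blast
  next
    assume "\<exists>n. f * (Xall N * vandermonde N) ^ n \<in> polynomials N"
    then obtain n where "f * (Xall N * vandermonde N) ^ n \<in> polynomials N" by blast
    then have "f * vandermonde N ^ n \<in> LP N"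
      by (auto simp: laurent_eq_localized localized_def power_mult_distrib mult_ac intro!: exI[of _ n])
    moreover have "f = (f * vandermonde N ^ n) / vandermonde N ^ n" by simp
    ultimately show "f \<in> RF N" unfolding regular_functions_def by blast
  qed
  then show ?thesis by (auto simp: localized_def)
qed

lemmas LP_closed = localized_polynomials[OF Xall_polynomials Xall_nonzero] localized_add[OF Xall_polynomials Xall_nonzero]
  localized_mult[OF Xall_polynomials Xall_nonzero] localized_minus[OF Xall_polynomials Xall_nonzero]
  localized_diff[OF Xall_polynomials Xall_nonzero] localized_sum[OF Xall_polynomials Xall_nonzero]
  localized_prod[OF Xall_polynomials Xall_nonzero] localized_power[OF Xall_polynomials Xall_nonzero]
  localized_deriv[OF Xall_polynomials Xall_nonzero]
lemmas LP_intros = LP_closed[folded laurent_eq_localized]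

lemma disc_polynomials: "Xall N * vandermonde N \<in> polynomials N" by auto
lemma disc_nonzero: "Xall N * vandermonde N \<noteq> 0" by simp

lemmas RF_closed = localized_polynomials[OF disc_polynomials disc_nonzero] localized_add[OF disc_polynomials disc_nonzero]
  localized_mult[OF disc_polynomials disc_nonzero] localized_minus[OF disc_polynomials disc_nonzero]
  localized_diff[OF disc_polynomials disc_nonzero] localized_sum[OF disc_polynomials disc_nonzero]
  localized_prod[OF disc_polynomials disc_nonzero] localized_power[OF disc_polynomials disc_nonzero]
  localized_deriv[OF disc_polynomials disc_nonzero]
lemmas RF_intros = RF_closed[folded regular_eq_localized]

lemmas LP_poly = LP_intros(1)
lemmas LP_ring = LP_intros(2-9)
lemmas RF_poly = RF_intros(1)
lemmas RF_ring = RF_intros(2-9)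

lemma LP_const [simp, intro]: "rat_const c \<in> LP N" by (rule LP_intros) simp
lemma RF_const [simp, intro]: "rat_const c \<in> RF N" by (rule RF_intros) simp

lemma LP_subset_RF: "LP N \<subseteq> RF N"
  unfolding regular_functions_def by (rule subsetI, rule CollectI, rule exI, rule exI[of _ 0]) simp

lemma Xall_split: "i \<in> {1..N} \<Longrightarrow> Xall N = rat_var i * (\<Prod>j\<in>{1..N} - {i}. rat_var j)"
  unfolding Xall_def by (rule prod.remove) auto

lemma LP_inverse_var: "i \<in> {1..N} \<Longrightarrow> inverse (rat_var i) \<in> LP N"
  unfolding laurent_eq_localized
  by (rule localized_factor[OF Xall_polynomials Xall_nonzero _ Xall_split]) (auto intro!: polynomials_prod)

lemma LP_perm: "w permutes {1..N} \<Longrightarrow> f \<in> LP N \<Longrightarrow> rat_perm w f \<in> LP N"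
  unfolding laurent_eq_localized
  by (rule localized_perm[OF Xall_polynomials Xall_nonzero])
    (auto simp: permutes_bij Xall_perm localized_inverse[OF Xall_polynomials Xall_nonzero])

text \<open>The denominator can be taken to be a power of the symmetric function
  \<open>Xall\<close>, which passes through the divided difference.\<close>

lemma LP_ddiff:
  assumes "f \<in> LP N" "i \<in> {1..N}" "j \<in> {1..N}" "i \<noteq> j"
  shows "ddiff i j f \<in> LP N"
proof -
  obtain n where n: "f * Xall N ^ n \<in> polynomials N"
    using assms by (auto simp: laurent_eq_localized localized_def)
  have "ddiff i j (inverse (Xall N ^ n)) = 0"
    using Xall_perm[OF permutes_transpose[OF assms(2,3)]] by (simp add: ddiff_def)
  moreover have f: "f = (f * Xall N ^ n) * inverse (Xall N ^ n)" by simp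
  ultimately have "ddiff i j f = ddiff i j (f * Xall N ^ n) * inverse (Xall N ^ n)"
    using ddiff_mult[of i j "f * Xall N ^ n" "inverse (Xall N ^ n)", folded f] by simp
  then have "ddiff i j f * Xall N ^ n = ddiff i j (f * Xall N ^ n)" by simp
  then show ?thesis using polynomials_ddiff[OF n assms(2-4)]
    by (auto simp: laurent_eq_localized localized_def intro!: exI[of _ n])
qed

lemma vandermonde_split:
  assumes "i \<in> {1..N}" "j \<in> {i+1..N}"
  shows "\<exists>g\<in>polynomials N. vandermonde N = Xd i j * g"
proof -
  have "vandermonde N = (\<Prod>j=i+1..N. Xd i j) * (\<Prod>i\<in>{1..N}-{i}. \<Prod>j=i+1..N. Xd i j)"
    unfolding vandermonde_def by (rule prod.remove) (use assms in auto)
  also have "(\<Prod>j=i+1..N. Xd i j) = Xd i j * (\<Prod>j\<in>{i+1..N} - {j}. Xd i j)"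
    by (rule prod.remove) (use assms in auto)
  finally have "vandermonde N = Xd i j * ((\<Prod>j\<in>{i+1..N} - {j}. Xd i j) * (\<Prod>i\<in>{1..N}-{i}. \<Prod>j=i+1..N. Xd i j))"
    by (simp add: mult_ac)
  moreover have "(\<Prod>j\<in>{i+1..N} - {j}. Xd i j) * (\<Prod>i\<in>{1..N}-{i}. \<Prod>j=i+1..N. Xd i j) \<in> polynomials N"
    using assms by (intro polynomials_mult polynomials_prod polynomials_diff polynomials_var) auto
  ultimately show ?thesis by blast
qed

lemma RF_inverse_Xd:
  assumes "i \<in> {1..N}" "j \<in> {1..N}" "i \<noteq> j"
  shows "inverse (Xd i j) \<in> RF N"
proof -
  have *: "inverse (Xd i j) \<in> RF N" if ij: "i \<in> {1..N}" "j \<in> {1..N}" "i < j" for i j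
  proof -
    obtain g where "g \<in> polynomials N" "vandermonde N = Xd i j * g"
      using vandermonde_split[of i N j] ij by auto
    then show ?thesis unfolding regular_eq_localized
      by (intro localized_factor[OF disc_polynomials disc_nonzero, of "Xall N * g"]) auto
  qed
  have "inverse (Xd i j) = - inverse (Xd j i)" by (metis inverse_minus_eq minus_diff_eq)
  then show ?thesis using *[of i j] *[of j i] assms RF_intros(4) by (metis linorder_neqE_nat)
qed

lemma RF_perm: 
  assumes w: "w permutes {1..N}" and "f \<in> RF N"
  shows "rat_perm w f \<in> RF N"
proof -
  have inj: "w i = w j \<longleftrightarrow> i = j" for i j using permutes_inj[OF w] by (simp add: inj_eq)
  have "rat_perm w (inverse (Xall N * vandermonde N))
      = inverse (Xall N) * (\<Prod>i=1..N. \<Prod>j=i+1..N. inverse (Xd (w i) (w j)))"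
    by (simp add: permutes_bij[OF w] Xall_perm[OF w] vandermonde_def rat_perm_prod
        flip: prod_inversef[unfolded comp_def])
  also have "\<dots> \<in> RF N"
  proof -
    have "inverse (Xall N) \<in> RF N"
      using localized_inverse[OF Xall_polynomials Xall_nonzero] LP_subset_RF by (auto simp: laurent_eq_localized)
    moreover have "(\<Prod>i=1..N. \<Prod>j=i+1..N. inverse (Xd (w i) (w j))) \<in> RF N"
      using permutes_in_image[OF w] by (intro RF_ring RF_inverse_Xd) (auto simp: inj)
    ultimately show ?thesis by (rule RF_ring)
  qed
  finally show ?thesis
    using assms localized_perm[OF disc_polynomials disc_nonzero w] by (simp add: regular_eq_localized)
qed

section \<open>Values at a point\<close>

text \<open>The local ring at the point \<open>q\<close>, with residue map \<open>val\<close>; by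
  \<open>val_Fract\<close> the choice made in \<open>val\<close> does not depend on the
  fraction.\<close>

definition reg :: "(nat \<Rightarrow> complex) \<Rightarrow> ratfun set" where
  "reg q = {f. \<exists>a b. f = Fract a b \<and> ev q b \<noteq> 0}"

definition val :: "(nat \<Rightarrow> complex) \<Rightarrow> ratfun \<Rightarrow> complex" where
  "val q f = (SOME c. \<exists>a b. f = Fract a b \<and> ev q b \<noteq> 0 \<and> c = ev q a / ev q b)"

lemma val_Fract: "ev q b \<noteq> 0 \<Longrightarrow> val q (Fract a b) = ev q a / ev q b"
proof -
  assume b: "ev q b \<noteq> 0"
  have "\<exists>a' b'. Fract a b = Fract a' b' \<and> ev q b' \<noteq> 0 \<and> val q (Fract a b) = ev q a' / ev q b'"
    unfolding val_def by (rule someI_ex) (use b in blast)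
  then obtain a' b' where *: "Fract a b = Fract a' b'" "ev q b' \<noteq> 0" "val q (Fract a b) = ev q a' / ev q b'"
    by blast
  have "b \<noteq> 0" "b' \<noteq> 0" using b *(2) by (auto simp: ev_simps)
  with *(1) have "a * b' = a' * b" by (simp add: eq_fract)
  then have "ev q a * ev q b' = ev q a' * ev q b" by (metis ev_simps(6))
  with b *(2) have "ev q a / ev q b = ev q a' / ev q b'" by (simp add: frac_eq_eq)
  with *(3) show ?thesis by simp
qed

lemma regE:
  assumes "f \<in> reg q"
  obtains a b where "f = Fract a b" "ev q b \<noteq> 0" "b \<noteq> 0" "val q f = ev q a / ev q b"
proof -
  obtain a b where "f = Fract a b" "ev q b \<noteq> 0" using assms by (auto simp: reg_def)
  moreover from this have "b \<noteq> 0" by (auto simp: ev_simps)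
  ultimately show ?thesis using that val_Fract by blast
qed

lemma reg_Fract [intro]: "ev q b \<noteq> 0 \<Longrightarrow> Fract a b \<in> reg q"
  by (auto simp: reg_def)

lemma reg_add: "f \<in> reg q \<Longrightarrow> g \<in> reg q \<Longrightarrow> f + g \<in> reg q"
  and val_add: "f \<in> reg q \<Longrightarrow> g \<in> reg q \<Longrightarrow> val q (f + g) = val q f + val q g"
proof -
  assume f: "f \<in> reg q" and g: "g \<in> reg q"
  obtain a b where ab: "f = Fract a b" "ev q b \<noteq> 0" "b \<noteq> 0" "val q f = ev q a / ev q b" using f by (rule regE)
  obtain c d where cd: "g = Fract c d" "ev q d \<noteq> 0" "d \<noteq> 0" "val q g = ev q c / ev q d" using g by (rule regE)
  have e: "f + g = Fract (a * d + c * b) (b * d)" using ab cd by simp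
  show "f + g \<in> reg q" unfolding e using ab cd by (intro reg_Fract) (simp add: ev_simps)
  show "val q (f + g) = val q f + val q g"
    unfolding e using ab cd by (subst val_Fract) (simp_all add: ev_simps add_frac_eq)
qed

lemma reg_mult: "f \<in> reg q \<Longrightarrow> g \<in> reg q \<Longrightarrow> f * g \<in> reg q"
  and val_mult: "f \<in> reg q \<Longrightarrow> g \<in> reg q \<Longrightarrow> val q (f * g) = val q f * val q g"
proof -
  assume f: "f \<in> reg q" and g: "g \<in> reg q"
  obtain a b where ab: "f = Fract a b" "ev q b \<noteq> 0" "b \<noteq> 0" "val q f = ev q a / ev q b" using f by (rule regE)
  obtain c d where cd: "g = Fract c d" "ev q d \<noteq> 0" "d \<noteq> 0" "val q g = ev q c / ev q d" using g by (rule regE)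
  have e: "f * g = Fract (a * c) (b * d)" using ab cd by simp
  show "f * g \<in> reg q" unfolding e using ab cd by (intro reg_Fract) (simp add: ev_simps)
  show "val q (f * g) = val q f * val q g"
    unfolding e using ab cd by (subst val_Fract) (simp_all add: ev_simps)
qed

lemma reg_poly: "Fract p 1 \<in> reg q" and val_poly: "val q (Fract p 1) = ev q p"
  by (auto simp: ev_simps val_Fract intro!: reg_Fract)

lemma reg_const [simp]: "rat_const c \<in> reg q" and val_const [simp]: "val q (rat_const c) = c"
  using reg_poly[of "mconst c" q] val_poly[of q "mconst c"] by (auto simp: rat_const_def ev_simps)

lemma reg_var [simp]: "rat_var i \<in> reg q" and val_var [simp]: "val q (rat_var i) = q i"
  using reg_poly[of "mvar i" q] val_poly[of q "mvar i"] by (auto simp: rat_var_def ev_simps)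

lemma reg_0 [simp]: "0 \<in> reg q" and val_0 [simp]: "val q 0 = 0"
  using reg_const[of 0 q] val_const[of q 0] by (simp_all del: reg_const val_const)

lemma reg_1 [simp]: "1 \<in> reg q" and val_1 [simp]: "val q 1 = 1"
  using reg_const[of 1 q] val_const[of q 1] by (simp_all del: reg_const val_const)

lemma reg_minus: "f \<in> reg q \<Longrightarrow> - f \<in> reg q" and val_minus: "f \<in> reg q \<Longrightarrow> val q (- f) = - val q f"
  using reg_mult[OF reg_const[of "-1"], of f q] val_mult[OF reg_const[of "-1"], of f q] val_const[of q "-1"]
  by (auto simp: rat_const_minus simp del: reg_const val_const)

lemma reg_diff: "f \<in> reg q \<Longrightarrow> g \<in> reg q \<Longrightarrow> f - g \<in> reg q"
  and val_diff: "f \<in> reg q \<Longrightarrow> g \<in> reg q \<Longrightarrow> val q (f - g) = val q f - val q g"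
  using reg_add[of f q "- g"] val_add[of f q "- g"] by (auto simp: reg_minus val_minus)

lemma reg_sum: "(\<And>a. a \<in> A \<Longrightarrow> f a \<in> reg q) \<Longrightarrow> sum f A \<in> reg q"
  by (induction A rule: infinite_finite_induct) (auto intro: reg_add)

lemma val_sum: "(\<And>a. a \<in> A \<Longrightarrow> f a \<in> reg q) \<Longrightarrow> val q (sum f A) = (\<Sum>a\<in>A. val q (f a))"
  by (induction A rule: infinite_finite_induct) (auto simp: val_add reg_sum)

lemma reg_prod: "(\<And>a. a \<in> A \<Longrightarrow> f a \<in> reg q) \<Longrightarrow> prod f A \<in> reg q"
  by (induction A rule: infinite_finite_induct) (auto intro: reg_mult)

lemma val_prod: "(\<And>a. a \<in> A \<Longrightarrow> f a \<in> reg q) \<Longrightarrow> val q (prod f A) = (\<Prod>a\<in>A. val q (f a))"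
  by (induction A rule: infinite_finite_induct) (auto simp: val_mult reg_prod)

lemma reg_power: "f \<in> reg q \<Longrightarrow> f ^ n \<in> reg q"
  by (induction n) (auto intro: reg_mult)

lemma val_power: "f \<in> reg q \<Longrightarrow> val q (f ^ n) = val q f ^ n"
  by (induction n) (auto simp: val_mult reg_power)

lemma reg_inverse:
  assumes "f \<in> reg q" "val q f \<noteq> 0"
  shows "inverse f \<in> reg q" "val q (inverse f) = inverse (val q f)"
proof -
  obtain a b where ab: "f = Fract a b" "ev q b \<noteq> 0" "b \<noteq> 0" "val q f = ev q a / ev q b" using assms(1) by (rule regE)
  then have "inverse f = Fract b a" "ev q a \<noteq> 0" using assms by auto
  then show "inverse f \<in> reg q" "val q (inverse f) = inverse (val q f)"
    using ab by (auto simp: val_Fract)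
qed

lemma polynomials_reg: "f \<in> polynomials N \<Longrightarrow> f \<in> reg q"
  by (auto simp: polynomials_iff reg_poly)

lemma LP_reg:
  assumes "f \<in> LP N" "\<And>i. i \<in> {1..N} \<Longrightarrow> q i \<noteq> 0"
  shows "f \<in> reg q"
proof -
  obtain n where n: "f * Xall N ^ n \<in> polynomials N"
    using assms by (auto simp: laurent_eq_localized localized_def)
  have "inverse (rat_var i) \<in> reg q" if "i \<in> {1..N}" for i
    using that assms reg_inverse[OF reg_var] by simp
  then have "inverse (Xall N) \<in> reg q"
    unfolding Xall_def prod_inversef[symmetric, unfolded comp_def] by (intro reg_prod) auto
  moreover have "f = (f * Xall N ^ n) * inverse (Xall N) ^ n" by (simp add: power_inverse)
  ultimately show ?thesis using polynomials_reg[OF n] reg_mult reg_power by metis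
qed

lemma ev_perm: "bij w \<Longrightarrow> ev q (mpoly_perm w p) = ev (q \<circ> w) p"
proof (induction p rule: mpoly_induct)
  case (const c)
  then show ?case by (simp add: mpoly_perm_single ev_simps bij_is_inj bij_imp_bij_inv)
next
  case (var i)
  have "Poly_Mapping.map_key (inv_into UNIV w) (single i (1::nat)) = single (w i) 1"
    using map_key_single[of "inv_into UNIV w" "w i" "1::nat"] var by (simp add: bij_is_inj bij_imp_bij_inv)
  with var show ?case by (simp add: mpoly_perm_single ev_simps)
qed (simp_all add: mpoly_perm_add mpoly_perm_mult ev_simps)

lemma reg_perm: "bij w \<Longrightarrow> f \<in> reg (q \<circ> w) \<Longrightarrow> rat_perm w f \<in> reg q"
  and val_perm: "bij w \<Longrightarrow> f \<in> reg (q \<circ> w) \<Longrightarrow> val q (rat_perm w f) = val (q \<circ> w) f"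
  by (auto elim!: regE simp: rat_perm_Fract ev_perm val_Fract intro!: reg_Fract)

lemma polynomials_divide_Xd:
  assumes f: "f \<in> polynomials N" and ij: "i \<in> {1..N}" "j \<in> {1..N}" "i \<noteq> j"
    and van: "\<And>q. q i = q j \<Longrightarrow> val q f = 0"
  shows "f / Xd i j \<in> polynomials N"
proof -
  obtain p where p: "f = Fract p 1" "vars_in {1..N} p" using f polynomials_iff by blast
  have "(mvar i - mvar j) dvd p" using van p by (intro diagonal_dvd ij) (auto simp: val_poly)
  then obtain r where r: "p = (mvar i - mvar j) * r" by blast
  have "vars_in {1..N} (mvar i - mvar j)"
    using vars_in_add[of "{1..N}" "mvar i" "mconst (-1) * mvar j"]
      vars_in_mult[OF vars_in_const[of "{1..N}" "-1"], of "mvar j"] ij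
    by (simp add: vars_in_var mult_single single_uminus)
  then have "vars_in {1..N} r"
    using vars_in_factor[of "{1..N}" "mvar i - mvar j" r] p r mvar_diff_nonzero[OF ij(3)] by auto
  moreover have "f / Xd i j = Fract r 1"
  proof -
    have "f = Xd i j * Fract r 1" by (simp add: p r rat_var_def)
    then show ?thesis using ij by (simp del: mult_fract)
  qed
  ultimately show ?thesis by (auto simp: polynomials_iff)
qed

section \<open>Iterated operators\<close>

definition tdeg :: "(nat \<Rightarrow>\<^sub>0 nat) \<Rightarrow> nat" where
  "tdeg m = (\<Sum>i\<in>keys m. lookup m i)"

lemma tdeg_superset: "finite A \<Longrightarrow> keys m \<subseteq> A \<Longrightarrow> tdeg m = (\<Sum>i\<in>A. lookup m i)"
  unfolding tdeg_def by (intro sum.mono_neutral_left) (auto simp: in_keys_iff)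

lemma tdeg_add [simp]: "tdeg (m + n) = tdeg m + tdeg n"
proof -
  let ?A = "keys m \<union> keys n"
  have "keys (m + n) \<subseteq> ?A" by (rule Poly_Mapping.keys_add)
  then show ?thesis by (simp add: tdeg_superset[of ?A] lookup_add sum.distrib)
qed

lemma tdeg_single [simp]: "tdeg (single i n) = n"
  by (cases "n = 0") (simp_all add: tdeg_def)

lemma tdeg_0 [simp]: "tdeg 0 = 0"
  by (simp add: tdeg_def)

lemma tdeg_eq_0_iff [simp]: "tdeg m = 0 \<longleftrightarrow> m = 0"
  by (auto simp: tdeg_def in_keys_iff intro: poly_mapping_eqI)

text \<open>The exponent \<open>m\<close> spelled out as the word \<open>1 \<cdots> 1 2 \<cdots> 2 \<cdots>\<close>.\<close>

definition word :: "(nat \<Rightarrow>\<^sub>0 nat) \<Rightarrow> nat list" where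
  "word m = concat (map (\<lambda>i. replicate (lookup m i) i) (sorted_list_of_set (keys m)))"

lemma foldr_replicate: "foldr f (replicate n i) = f i ^^ n"
  by (induction n) auto

lemma iterate_eq_foldr: "iterate T m g = foldr T (word m) g"
proof -
  have "foldr (\<lambda>i. T i ^^ lookup m i) xs g
      = foldr T (concat (map (\<lambda>i. replicate (lookup m i) i) xs)) g" for xs
    by (induction xs) (auto simp: foldr_replicate)
  then show ?thesis by (simp add: iterate_def word_def)
qed

lemma count_word [simp]: "count (mset (word m)) i = lookup m i"
proof -
  have "count (mset (concat (map (\<lambda>i. replicate (lookup m i) i) xs))) i
      = (if i \<in> set xs then lookup m i else 0)" if "distinct xs" for xs
    using that by (induction xs) (auto simp: count_eq_zero_iff)
  then show ?thesis by (simp add: word_def in_keys_iff)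
qed

lemma set_word [simp]: "set (word m) = keys m"
  by (metis count_mset_0_iff count_word in_keys_iff subsetI subset_antisym)

lemma mset_word_add: "mset (word (m + n)) = mset (word m) + mset (word n)"
  by (rule multiset_eqI) (simp add: lookup_add)

lemma word_0 [simp]: "word 0 = []"
  by (simp add: word_def)

lemma word_single_1 [simp]: "word (single i 1) = [i]"
  by (simp add: word_def One_nat_def)

lemma length_word [simp]: "length (word m) = tdeg m"
  unfolding tdeg_def word_def by (simp add: length_concat comp_def sum_list_distinct_conv_sum_set)

lemma word_induct_aux: "\<exists>m. mset (word m) = mset xs"
proof (induction xs)
  case (Cons x xs)
  then obtain m where "mset (word m) = mset xs" by blast
  then have "mset (word (m + single x 1)) = mset (x # xs)"
    by (simp add: mset_word_add)
  then show ?case by blast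
qed (auto intro: exI[of _ 0])

text \<open>Words in commuting operators depend only on their multiset of letters. This is applied
  to derivatives, twisted derivatives, Dunkl operators and the elements y.\<close>

lemma foldr_mset_cong:
  assumes "\<And>i j. i \<in> set xs \<Longrightarrow> j \<in> set xs \<Longrightarrow> T i \<circ> T j = T j \<circ> T i" "mset xs = mset ys"
  shows "foldr T xs = foldr T ys"
  unfolding foldr_conv_fold by (rule fold_multiset_equiv) (use assms in auto)

lemma mset_word_map_key:
  assumes "bij v"
  shows "mset (word (Poly_Mapping.map_key (inv_into UNIV v) m)) = mset (map v (word m))"
proof (rule multiset_eqI)
  fix j
  have "lookup (Poly_Mapping.map_key (inv_into UNIV v) m) j = lookup m (inv_into UNIV v j)"
    using assms by (simp add: lookup_map_key bij_is_inj bij_imp_bij_inv)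
  moreover have "count (image_mset v M) (v i) = count M i" for M i
    using assms by (induction M) (auto simp: bij_is_inj inj_eq)
  from this[of "mset (word m)" "inv_into UNIV v j"]
  have "count (image_mset v (mset (word m))) j = lookup m (inv_into UNIV v j)"
    using assms by (simp add: bij_is_surj surj_f_inv_f)
  ultimately show "count (mset (word (Poly_Mapping.map_key (inv_into UNIV v) m))) j = count (mset (map v (word m))) j"
    by simp
qed

section \<open>The crossed product and its twisted actions\<close>

text \<open>The set S is kept variable: S = UNIV gives the ambient ring, while the twists are flat
  and equivariant only over S = {1..N}.\<close>

definition adm :: "nat set \<Rightarrow> crossed \<Rightarrow> bool" where
  "adm S L \<longleftrightarrow> (\<forall>(w, m)\<in>keys L. w permutes S \<and> keys m \<subseteq> S)"

lemma adm_0 [simp]: "adm S 0"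
  by (simp add: adm_def)

lemma adm_cterm: "w permutes S \<Longrightarrow> keys m \<subseteq> S \<Longrightarrow> adm S (cterm f m w)"
  by (simp add: adm_def cterm_def)

lemma adm_add: "adm S L \<Longrightarrow> adm S M \<Longrightarrow> adm S (L + M)"
  using Poly_Mapping.keys_add[of L M] unfolding adm_def by blast

lemma adm_sum: "(\<And>a. a \<in> A \<Longrightarrow> adm S (f a)) \<Longrightarrow> adm S (sum f A)"
  by (induction A rule: infinite_finite_induct) (auto intro: adm_add)

lemma adm_uminus: "adm S L \<Longrightarrow> adm S (- L)"
  by (simp add: adm_def)

lemma adm_diff: "adm S L \<Longrightarrow> adm S M \<Longrightarrow> adm S (L - M)"
  using adm_add[OF _ adm_uminus, of S L M] by simp

lemma permutes_UNIV_iff: "w permutes UNIV \<longleftrightarrow> bij w"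
  by (simp add: permutes_def bij_iff)

lemma adm_UNIV: "adm UNIV L \<longleftrightarrow> (\<forall>(w, m)\<in>keys L. bij w)"
  by (simp add: adm_def permutes_UNIV_iff)

lemma adm_induct [consumes 1, case_names zero cterm add]:
  assumes "adm S L" and "P 0"
    and "\<And>f m w. w permutes S \<Longrightarrow> keys m \<subseteq> S \<Longrightarrow> P (cterm f m w)"
    and "\<And>L M. adm S L \<Longrightarrow> adm S M \<Longrightarrow> P L \<Longrightarrow> P M \<Longrightarrow> P (L + M)"
  shows "P L"
proof -
  have "adm S (\<Sum>k\<in>A. single k (lookup L k)) \<and> P (\<Sum>k\<in>A. single k (lookup L k))"
    if "finite A" "A \<subseteq> keys L" for A
    using that
  proof (induction A)
    case (insert k A)
    obtain w m where k: "k = (w, m)" by (cases k)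
    then have "w permutes S" "keys m \<subseteq> S" using insert.prems assms(1) by (auto simp: adm_def)
    then have "adm S (single k (lookup L k))" "P (single k (lookup L k))"
      using assms(3) adm_cterm unfolding k cterm_def by metis+
    with insert show ?case using assms(4) adm_add by auto
  qed (use assms in simp)
  from this[of "keys L"] show ?thesis
    by (simp flip: poly_mapping_eq_sum_single)
qed

lemma cterm_0 [simp]: "cterm 0 m w = 0"
  by (simp add: cterm_def)

lemma cterm_add: "cterm (f + g) m w = cterm f m w + cterm g m w"
  by (simp add: cterm_def single_add)

lemma fun_mult_cterm [simp]: "fun_mult h (cterm f m w) = cterm (h * f) m w"
  by (cases "f = 0") (simp_all add: fun_mult_def cterm_def)

lemma fun_mult_0 [simp]: "fun_mult h 0 = 0"
  by (simp add: fun_mult_def)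

lemma fun_mult_add: "fun_mult h (L + M) = fun_mult h L + fun_mult h M"
  unfolding fun_mult_def split_beta prod.collapse
  by (rule setsum_keys_plus_distrib) (simp_all add: distrib_left cterm_add)

lemma partial_mult_cterm [simp]:
  "partial_mult i (cterm f m w) = cterm f (m + single i 1) w + cterm (rat_deriv i f) m w"
  by (cases "f = 0") (simp_all add: partial_mult_def cterm_def)

lemma partial_mult_0 [simp]: "partial_mult i 0 = 0"
  by (simp add: partial_mult_def)

lemma partial_mult_add: "partial_mult i (L + M) = partial_mult i L + partial_mult i M"
  unfolding partial_mult_def split_beta prod.collapse
  by (rule setsum_keys_plus_distrib) (simp_all add: cterm_add)

lemma perm_mult_cterm [simp]:
  "bij v \<Longrightarrow> perm_mult v (cterm f m w)
    = cterm (rat_perm v f) (Poly_Mapping.map_key (inv_into UNIV v) m) (v \<circ> w)"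
  by (cases "f = 0") (simp_all add: perm_mult_def cterm_def)

lemma perm_mult_0 [simp]: "perm_mult i 0 = 0"
  by (simp add: perm_mult_def)

lemma perm_mult_add: "bij v \<Longrightarrow> perm_mult v (L + M) = perm_mult v L + perm_mult v M"
  unfolding perm_mult_def split_beta prod.collapse
  by (rule setsum_keys_plus_distrib) (simp_all add: cterm_add)

lemma adm_fun_mult: "adm S L \<Longrightarrow> adm S (fun_mult h L)"
  by (induction rule: adm_induct) (auto simp: fun_mult_add adm_cterm adm_add)

lemma adm_partial_mult:
  assumes "i \<in> S" "adm S L" shows "adm S (partial_mult i L)"
  using assms(2)
proof (induction rule: adm_induct)
  case (cterm f m w)
  moreover have "keys (m + single i 1) \<subseteq> S"
    using Poly_Mapping.keys_add[of m "single i 1"] cterm assms(1) by auto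
  ultimately show ?case by (auto intro!: adm_add adm_cterm)
qed (auto simp: partial_mult_add adm_add)

lemma keys_map_key_inv:
  assumes "v permutes S" "keys m \<subseteq> S"
  shows "keys (Poly_Mapping.map_key (inv_into UNIV v) m) \<subseteq> S"
proof
  have "bij v" using assms permutes_bij by blast
  fix x assume "x \<in> keys (Poly_Mapping.map_key (inv_into UNIV v) m)"
  then have "inv_into UNIV v x \<in> keys m"
    using \<open>bij v\<close> by (simp add: in_keys_iff lookup_map_key bij_is_inj bij_imp_bij_inv)
  then show "x \<in> S" using assms permutes_in_image[OF permutes_inv[OF assms(1)]] by blast
qed

lemma adm_perm_mult:
  assumes "v permutes S" "adm S L" shows "adm S (perm_mult v L)"
  using assms(2)
proof (induction rule: adm_induct)
  case (cterm f m w)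
  then show ?case using assms(1) keys_map_key_inv[OF assms(1), of m]
    by (simp add: permutes_bij adm_cterm permutes_compose)
qed (use assms(1) in \<open>auto simp: perm_mult_add adm_add permutes_bij\<close>)

lemma adm_foldr:
  assumes "\<And>i L. i \<in> set xs \<Longrightarrow> adm S L \<Longrightarrow> adm S (T i L)" "adm S L"
  shows "adm S (foldr T xs L)"
  using assms by (induction xs) auto

lemma adm_mult:
  assumes "adm S L" "adm S M" shows "adm S (L \<star> M)"
  unfolding crossed_mult_def split_beta iterate_eq_foldr
  by (intro adm_sum adm_fun_mult adm_foldr adm_perm_mult adm_partial_mult)
    (use assms in \<open>auto simp: adm_def split_beta\<close>)

text \<open>The action of the twisted element \<open>twist a \<chi> L\<close>, written without
  forming that element; \<open>act_twist\<close> identifies the two.\<close>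

definition tact :: "(nat \<Rightarrow> ratfun) \<Rightarrow> ((nat \<Rightarrow> nat) \<Rightarrow> ratfun) \<Rightarrow> crossed \<Rightarrow> ratfun \<Rightarrow> ratfun" where
  "tact a \<chi> L g = (\<Sum>(w, m)\<in>keys L.
     lookup L (w, m) * foldr (\<lambda>i f. rat_deriv i f + a i * f) (word m) (\<chi> w * rat_perm w g))"

lemma act_eq_tact: "act L g = tact (\<lambda>_. 0) (\<lambda>_. 1) L g"
  by (simp add: act_def tact_def iterate_eq_foldr)

lemma tact_cterm: "tact a \<chi> (cterm f m w) g = f * foldr (\<lambda>i f. rat_deriv i f + a i * f) (word m) (\<chi> w * rat_perm w g)"
  by (cases "f = 0") (simp_all add: tact_def cterm_def)

lemma tact_0 [simp]: "tact a \<chi> 0 g = 0"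
  by (simp add: tact_def)

lemma tact_add_left: "tact a \<chi> (L + M) g = tact a \<chi> L g + tact a \<chi> M g"
  unfolding tact_def split_beta prod.collapse
  by (rule setsum_keys_plus_distrib) (simp_all add: algebra_simps)

lemma tact_sum_left: "tact a \<chi> (sum f A) g = (\<Sum>x\<in>A. tact a \<chi> (f x) g)"
  by (induction A rule: infinite_finite_induct) (simp_all add: tact_add_left)

lemma foldr_twisted_add:
  "foldr (\<lambda>i f. rat_deriv i f + a i * f) xs (f + g)
    = foldr (\<lambda>i f. rat_deriv i f + a i * f) xs f + foldr (\<lambda>i f. rat_deriv i f + a i * f) xs g"
  by (induction xs) (simp_all add: algebra_simps)

lemma tact_add_right: "adm S L \<Longrightarrow> tact a \<chi> L (f + g) = tact a \<chi> L f + tact a \<chi> L g"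
  by (induction rule: adm_induct)
    (simp_all add: tact_add_left tact_cterm permutes_bij foldr_twisted_add distrib_left)

lemma tact_fun_mult: "adm S L \<Longrightarrow> tact a \<chi> (fun_mult h L) g = h * tact a \<chi> L g"
  by (induction rule: adm_induct)
    (simp_all add: tact_add_left tact_cterm fun_mult_add distrib_left)

text \<open>These conditions make the twist an automorphism: \<open>curl\<close> is flatness of the
  connection with form \<open>a\<close>, so that the operators \<open>T i\<close> commute, and the
  remaining ones are compatibility with permutations and with a scalar character.\<close>

locale twist_data =
  fixes S :: "nat set" and a :: "nat \<Rightarrow> ratfun" and \<chi> :: "(nat \<Rightarrow> nat) \<Rightarrow> ratfun"
  assumes curl: "i \<in> S \<Longrightarrow> j \<in> S \<Longrightarrow> rat_deriv i (a j) = rat_deriv j (a i)"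
    and equivariant: "w permutes S \<Longrightarrow> i \<in> S \<Longrightarrow> rat_perm w (a i) = a (w i)"
    and char_const: "w permutes S \<Longrightarrow> \<exists>c. \<chi> w = rat_const c"
    and char_id: "\<chi> id = 1"
    and char_comp: "v permutes S \<Longrightarrow> w permutes S \<Longrightarrow> \<chi> (v \<circ> w) = \<chi> v * \<chi> w"
begin

abbreviation T :: "nat \<Rightarrow> ratfun \<Rightarrow> ratfun" where
  "T i f \<equiv> rat_deriv i f + a i * f"

lemma T_commute: "i \<in> S \<Longrightarrow> j \<in> S \<Longrightarrow> T i \<circ> T j = T j \<circ> T i"
  by (rule ext) (simp add: rat_deriv_mult rat_deriv_commute[of i j] curl[of i j] algebra_simps)

lemma T_word_cong: "set xs \<subseteq> S \<Longrightarrow> mset xs = mset ys \<Longrightarrow> foldr T xs = foldr T ys"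
  using T_commute by (intro foldr_mset_cong) auto

lemma T_perm: "w permutes S \<Longrightarrow> i \<in> S \<Longrightarrow> rat_perm w (T i f) = T (w i) (rat_perm w f)"
  by (simp add: permutes_bij rat_perm_deriv equivariant)

lemma T_foldr_perm:
  "w permutes S \<Longrightarrow> set xs \<subseteq> S \<Longrightarrow> rat_perm w (foldr T xs f) = foldr T (map w xs) (rat_perm w f)"
  by (induction xs) (simp_all add: T_perm permutes_bij del: rat_perm_add)

lemma T_foldr_char: "w permutes S \<Longrightarrow> foldr T xs (\<chi> w * f) = \<chi> w * foldr T xs f"
proof -
  assume "w permutes S"
  then obtain c where c: "\<chi> w = rat_const c" using char_const by blast
  show ?thesis unfolding c by (induction xs) (simp_all add: rat_deriv_mult algebra_simps)
qed

lemma tact_partial_mult: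
  assumes "adm S L" "i \<in> S"
  shows "tact a \<chi> (partial_mult i L) g = T i (tact a \<chi> L g)"
  using assms(1)
proof (induction rule: adm_induct)
  case (cterm f m w)
  have "foldr T (word (m + single i 1)) = foldr T (i # word m)"
    using cterm Poly_Mapping.keys_add[of m "single i 1"] assms(2)
    by (intro T_word_cong) (auto simp: mset_word_add)
  then show ?case
    by (simp add: tact_add_left tact_cterm rat_deriv_mult algebra_simps)
qed (simp_all add: tact_add_left partial_mult_add algebra_simps)

lemma tact_perm_mult:
  assumes "adm S L" "v permutes S"
  shows "tact a \<chi> (perm_mult v L) g = \<chi> v * rat_perm v (tact a \<chi> L g)"
  using assms(1)
proof (induction rule: adm_induct)
  case (cterm f m w)
  have v: "bij v" using assms(2) permutes_bij by blast
  obtain c where c: "\<chi> w = rat_const c" using char_const cterm by blast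
  have "foldr T (word (Poly_Mapping.map_key (inv_into UNIV v) m)) = foldr T (map v (word m))"
    using cterm assms(2) keys_map_key_inv[OF assms(2)] mset_word_map_key[OF v]
    by (intro T_word_cong) auto
  moreover have "rat_perm v (\<chi> w) = \<chi> w" using v by (simp add: c)
  ultimately show ?case
    using cterm assms(2) v
    by (simp add: tact_cterm T_foldr_perm T_foldr_char char_comp permutes_bij rat_perm_comp mult.assoc mult.left_commute)
qed (use assms(2) in \<open>simp_all add: tact_add_left perm_mult_add permutes_bij algebra_simps\<close>)

lemma tact_foldr_partial_mult:
  "adm S L \<Longrightarrow> set xs \<subseteq> S \<Longrightarrow>
    tact a \<chi> (foldr partial_mult xs L) g = foldr T xs (tact a \<chi> L g)"
  by (induction xs) (auto simp: tact_partial_mult adm_foldr adm_partial_mult subset_iff)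

text \<open>The product is built by left multiplication with functions, derivatives and
  permutations, and each of these steps is compatible with the twisted action.\<close>

lemma tact_mult:
  assumes "adm S L" "adm S M"
  shows "tact a \<chi> (L \<star> M) g = tact a \<chi> L (tact a \<chi> M g)"
proof -
  have "tact a \<chi> (L \<star> M) g = (\<Sum>(w, m)\<in>keys L. tact a \<chi>
      (fun_mult (lookup L (w, m)) (foldr partial_mult (word m) (perm_mult w M))) g)"
    unfolding crossed_mult_def split_beta tact_sum_left iterate_eq_foldr ..
  also have "\<dots> = (\<Sum>(w, m)\<in>keys L.
      lookup L (w, m) * foldr T (word m) (\<chi> w * rat_perm w (tact a \<chi> M g)))"
  proof (rule sum.cong)
    fix k assume k: "k \<in> keys L"
    obtain w m where wm: "k = (w, m)" by (cases k)
    then have *: "w permutes S" "keys m \<subseteq> S" using k assms by (auto simp: adm_def)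
    have "adm S (foldr partial_mult (word m) (perm_mult w M))"
      using * assms(2) by (intro adm_foldr adm_partial_mult adm_perm_mult) auto
    then show "(case k of (w, m) \<Rightarrow> tact a \<chi>
        (fun_mult (lookup L (w, m)) (foldr partial_mult (word m) (perm_mult w M))) g)
      = (case k of (w, m) \<Rightarrow> lookup L (w, m) * foldr T (word m) (\<chi> w * rat_perm w (tact a \<chi> M g)))"
      using * assms(2) by (simp add: wm tact_fun_mult tact_foldr_partial_mult adm_perm_mult tact_perm_mult)
  qed simp
  finally show ?thesis by (simp add: tact_def)
qed

end

interpretation untwisted: twist_data UNIV "\<lambda>_. 0" "\<lambda>_. 1"
  by unfold_locales (simp_all add: permutes_UNIV_iff, metis rat_const_1)

lemmas act_mult = untwisted.tact_mult[folded act_eq_tact]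

lemma act_add_left: "act (L + M) g = act L g + act M g"
  by (simp add: act_eq_tact tact_add_left)

lemma act_sum_left: "act (sum f A) g = (\<Sum>x\<in>A. act (f x) g)"
  by (simp add: act_eq_tact tact_sum_left)

lemma act_cterm: "act (cterm f m w) g = f * foldr rat_deriv (word m) (rat_perm w g)"
  by (simp add: act_eq_tact tact_cterm)

lemma act_fun_mult: "adm UNIV L \<Longrightarrow> act (fun_mult h L) g = h * act L g"
  by (simp add: act_eq_tact tact_fun_mult)

lemma act_crossed_partial: "act (crossed_partial i) g = rat_deriv i g"
  by (simp add: crossed_partial_def act_cterm)

lemma act_crossed_fun: "act (crossed_fun f) g = f * g"
  by (simp add: crossed_fun_def act_cterm)

lemma act_crossed_perm: "act (crossed_perm w) g = rat_perm w g"
  by (simp add: crossed_perm_def act_cterm)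

lemma adm_generators [simp]:
  "adm UNIV (crossed_partial i)" "adm UNIV (crossed_fun f)" "bij w \<Longrightarrow> adm UNIV (crossed_perm w)"
  by (auto simp: crossed_partial_def crossed_fun_def crossed_perm_def permutes_UNIV_iff intro!: adm_cterm)

lemma act_twist:
  assumes "adm UNIV L"
  shows "act (twist a \<chi> L) g = tact a \<chi> L g"
proof -
  let ?U = "\<lambda>i M. (crossed_partial i + crossed_fun (a i)) \<star> M"
  have U: "adm UNIV (?U i M)" if "adm UNIV M" for i M
    using that by (intro adm_mult adm_add) auto
  have F: "act (foldr ?U xs M) g = foldr (\<lambda>i f. rat_deriv i f + a i * f) xs (act M g)" if "adm UNIV M" for xs M
  proof (induction xs)
    case (Cons i xs)
    have "act (?U i (foldr ?U xs M)) g
        = act (crossed_partial i + crossed_fun (a i)) (act (foldr ?U xs M) g)"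
      using that U by (intro act_mult adm_add adm_foldr) auto
    with Cons show ?case by (simp add: act_add_left act_crossed_partial act_crossed_fun)
  qed simp
  have "act (twist a \<chi> L) g = (\<Sum>(w, m)\<in>keys L. act
      (fun_mult (lookup L (w, m)) (foldr ?U (word m) (cterm (\<chi> w) 0 w))) g)"
    unfolding twist_def split_beta act_sum_left iterate_eq_foldr ..
  also have "\<dots> = tact a \<chi> L g"
    unfolding tact_def
  proof (rule sum.cong)
    fix k assume k: "k \<in> keys L"
    obtain w m where wm: "k = (w, m)" by (cases k)
    then have "w permutes UNIV" using k assms by (auto simp: adm_def)
    then have *: "adm UNIV (cterm (\<chi> w) 0 w)" by (intro adm_cterm) auto
    have "adm UNIV (foldr ?U (word m) (cterm (\<chi> w) 0 w))"
      using * U by (intro adm_foldr) auto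
    then show "(case k of (w, m) \<Rightarrow> act
      (fun_mult (lookup L (w, m)) (foldr ?U (word m) (cterm (\<chi> w) 0 w))) g)
      = (case k of (w, m) \<Rightarrow> lookup L (w, m) *
          foldr (\<lambda>i f. rat_deriv i f + a i * f) (word m) (\<chi> w * rat_perm w g))"
      using F[OF *] by (simp add: wm act_fun_mult act_cterm)
  qed simp
  finally show ?thesis .
qed

text \<open>The operator \<open>g \<mapsto> L (X\<^sub>c g) - X\<^bsub>v c\<^esub> L g\<close>; it kills the top-order part of the
  component of \<open>L\<close> at \<open>v\<close>.\<close>

definition adX :: "nat \<Rightarrow> (nat \<Rightarrow> nat) \<Rightarrow> crossed \<Rightarrow> crossed" where
  "adX c v L = (\<Sum>(w, m)\<in>keys L.
     cterm (Xd (w c) (v c) * lookup L (w, m)) m w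
     + cterm (of_nat (lookup m (w c)) * lookup L (w, m)) (m - single (w c) 1) w)"

lemma foldr_deriv_var:
  "foldr rat_deriv xs (rat_var j * g)
    = rat_var j * foldr rat_deriv xs g + of_nat (count (mset xs) j) * foldr rat_deriv (remove1 j xs) g"
proof (induction xs)
  case (Cons i xs)
  have *: "rat_deriv i (of_nat n) = 0" for n
    using rat_deriv_const[of i "of_nat n"] by (simp add: rat_const_of_nat)
  have c0: "count (mset xs) j = 0" "remove1 j xs = xs" if "j \<notin> set xs"
    using that by (simp_all add: count_eq_zero_iff remove1_idem)
  have "foldr rat_deriv xs g = rat_deriv j (foldr rat_deriv (remove1 j xs) g)" if "j \<in> set xs"
  proof -
    have "foldr rat_deriv xs = foldr rat_deriv (j # remove1 j xs)"
      using that by (intro foldr_mset_cong) (auto simp: rat_deriv_commute fun_eq_iff)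
    then show ?thesis by simp
  qed
  then show ?case using Cons
    by (cases "j \<in> set xs") (auto simp: rat_deriv_mult rat_deriv_var * c0 algebra_simps)
qed simp

lemma act_adX:
  assumes "adm UNIV L"
  shows "act (adX c v L) g = act L (rat_var c * g) - rat_var (v c) * act L g"
proof -
  have "lookup L (w, m) * foldr rat_deriv (word m) (rat_perm w (rat_var c * g))
      - rat_var (v c) * (lookup L (w, m) * foldr rat_deriv (word m) (rat_perm w g))
     = act (cterm (Xd (w c) (v c) * lookup L (w, m)) m w
     + cterm (of_nat (lookup m (w c)) * lookup L (w, m)) (m - single (w c) 1) w) g"
    if "(w, m) \<in> keys L" for w m
  proof -
    have w: "bij w" using that assms by (auto simp: adm_UNIV)
    have "foldr rat_deriv (remove1 (w c) (word m)) = foldr rat_deriv (word (m - single (w c) 1))"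
    proof (rule foldr_mset_cong)
      show "mset (remove1 (w c) (word m)) = mset (word (m - single (w c) 1))"
        by (rule multiset_eqI) (auto simp: lookup_minus lookup_single when_def)
    qed (auto simp: rat_deriv_commute fun_eq_iff)
    then show ?thesis
      using w by (simp add: act_add_left act_cterm foldr_deriv_var) (simp add: algebra_simps)
  qed
  then show ?thesis
    unfolding adX_def split_beta act_sum_left act_def[of L] iterate_eq_foldr sum_distrib_left sum_subtractf[symmetric]
    by (intro sum.cong) (auto simp: split_beta)
qed

lemma lookup_adX:
  assumes "inj w"
  shows "lookup (adX c v L) (w, m) = Xd (w c) (v c) * lookup L (w, m)
    + of_nat (Suc (lookup m (w c))) * lookup L (w, m + single (w c) 1)"
proof -
  let ?e = "single (w c) (1::nat)"
  have "lookup (adX c v L) (w, m)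
    = (\<Sum>k\<in>keys L. (if k = (w, m) then Xd (w c) (v c) * lookup L k else 0)
        + (if k = (w, m + ?e) then of_nat (Suc (lookup m (w c))) * lookup L k else 0))"
    unfolding adX_def lookup_sum
  proof (rule sum.cong)
    fix k assume "k \<in> keys L"
    obtain u n where k: "k = (u, n)" by (cases k)
    have "n - single (w c) 1 = m \<longleftrightarrow> n = m + ?e" if "lookup n (w c) \<noteq> 0"
    proof
      assume m: "n - single (w c) 1 = m"
      show "n = m + ?e"
        by (rule poly_mapping_eqI) (use that in \<open>auto simp flip: m simp: lookup_add lookup_minus lookup_single when_def\<close>)
    qed simp
    moreover have "?e \<noteq> 0" by (metis lookup_single_eq lookup_zero one_neq_zero)
    ultimately show "lookup (case k of (w, m) \<Rightarrow> cterm (Xd (w c) (v c) * lookup L (w, m)) m w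
      + cterm (of_nat (lookup m (w c)) * lookup L (w, m)) (m - single (w c) 1) w) (w, m)
      = (if k = (w, m) then Xd (w c) (v c) * lookup L k else 0)
        + (if k = (w, m + ?e) then of_nat (Suc (lookup m (w c))) * lookup L k else 0)"
      unfolding k
      by (cases "u = w"; cases "lookup n (w c) = 0")
        (auto simp: lookup_add cterm_def lookup_single when_def)
  qed simp
  also have "\<dots> = Xd (w c) (v c) * lookup L (w, m)
    + of_nat (Suc (lookup m (w c))) * lookup L (w, m + single (w c) 1)"
    by (simp add: sum.distrib in_keys_iff)
  finally show ?thesis .
qed

lemma adm_adX: "adm UNIV L \<Longrightarrow> adm UNIV (adX c v L)"
  unfolding adX_def split_beta by (intro adm_sum adm_add adm_cterm) (auto simp: adm_def)

text \<open>Induction on the order d, then on the number of permutations occurring in order d. If v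
  is one of them, \<open>adX c v\<close> removes it from order d and creates no new one, so every
  \<open>adX c v L\<close> is zero. Reading this off coefficientwise leaves only v in order d; a
  nonzero top multi-index then contradicts characteristic 0, and for d = 0 the element is a function
  times v, detected by acting on 1.\<close>

lemma act_faithful_aux:
  assumes "adm UNIV L" "\<And>g. act L g = 0"
    and "\<And>w m. lookup L (w, m) \<noteq> 0 \<Longrightarrow> tdeg m \<le> d"
    and "card {w. \<exists>m. tdeg m = d \<and> lookup L (w, m) \<noteq> 0} \<le> n"
  shows "L = 0"
  using assms
proof (induction d arbitrary: L n rule: less_induct)
  case (less d)
  from less.prems show ?case
  proof (induction n arbitrary: L)
    case (0 L)
    have fin: "finite {w. \<exists>m. tdeg m = d \<and> lookup L (w, m) \<noteq> 0}"
      by (rule finite_subset[of _ "fst ` keys L"]) (auto simp: in_keys_iff intro: rev_image_eqI)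
    with 0 have no: "lookup L (w, m) = 0" if "tdeg m = d" for w m using that by auto
    show ?case
    proof (cases "d = 0")
      case True
      show ?thesis
        using 0(3) no True by (intro poly_mapping_eqI) (metis lookup_zero prod.exhaust_sel le_zero_eq)
    next
      case False
      show ?thesis
      proof (rule less.IH)
        show "d - 1 < d" using False by simp
        show "tdeg m \<le> d - 1" if "lookup L (w, m) \<noteq> 0" for w m
          using that 0(3)[of w m] no[of m w] by (cases "tdeg m = d") auto
      qed (use 0 in auto)
    qed
  next
    case (Suc n L)
    define W where "W = {w. \<exists>m. tdeg m = d \<and> lookup L (w, m) \<noteq> 0}"
    have fin: "finite W" unfolding W_def
      by (rule finite_subset[of _ "fst ` keys L"]) (auto simp: in_keys_iff intro: rev_image_eqI)
    have bij: "bij w" if "lookup L (w, m) \<noteq> 0" for w m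
      using that Suc.prems(1) by (auto simp: adm_UNIV in_keys_iff)
    show ?case
    proof (cases "W = {}")
      case True
      then have "card {w. \<exists>m. tdeg m = d \<and> lookup L (w, m) \<noteq> 0} \<le> n"
        by (simp only: W_def) simp
      with Suc show ?thesis by blast
    next
      case False
      then obtain v where v: "v \<in> W" by blast
      have z: "adX c v L = 0" for c
      proof (rule Suc.IH)
        show "adm UNIV (adX c v L)" using Suc.prems(1) adm_adX by blast
        show "act (adX c v L) g = 0" for g using act_adX Suc.prems(1,2) by simp
        have *: "lookup (adX c v L) (w, m) = Xd (w c) (v c) * lookup L (w, m)
          + of_nat (Suc (lookup m (w c))) * lookup L (w, m + single (w c) 1)"
          and bw: "bij w" if "lookup (adX c v L) (w, m) \<noteq> 0" for w m
        proof -
          have "(w, m) \<in> keys (adX c v L)" using that by (simp add: in_keys_iff)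
          then show "bij w" using adm_adX[OF Suc.prems(1), of c v] by (auto simp: adm_UNIV)
          then show "lookup (adX c v L) (w, m) = Xd (w c) (v c) * lookup L (w, m)
          + of_nat (Suc (lookup m (w c))) * lookup L (w, m + single (w c) 1)"
            by (rule lookup_adX[OF bij_is_inj])
        qed
        show "tdeg m \<le> d" if "lookup (adX c v L) (w, m) \<noteq> 0" for w m
        proof -
          have "lookup L (w, m) \<noteq> 0 \<or> lookup L (w, m + single (w c) 1) \<noteq> 0"
            using that *[OF that] by auto
          then show ?thesis using Suc.prems(3) by fastforce
        qed
        have "{w. \<exists>m. tdeg m = d \<and> lookup (adX c v L) (w, m) \<noteq> 0} \<subseteq> W - {v}"
        proof
          fix w assume "w \<in> {w. \<exists>m. tdeg m = d \<and> lookup (adX c v L) (w, m) \<noteq> 0}"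
          then obtain m where m: "tdeg m = d" "lookup (adX c v L) (w, m) \<noteq> 0" by blast
          have "lookup L (w, m + single (w c) 1) = 0"
            using Suc.prems(3)[of w "m + single (w c) 1"] m(1) by fastforce
          then have "Xd (w c) (v c) * lookup L (w, m) \<noteq> 0" using *[OF m(2)] m(2) by simp
          then show "w \<in> W - {v}" using m by (auto simp: W_def)
        qed
        then have "card {w. \<exists>m. tdeg m = d \<and> lookup (adX c v L) (w, m) \<noteq> 0} \<le> card (W - {v})"
          using fin by (intro card_mono) auto
        also have "\<dots> \<le> n" using Suc.prems(4) v fin by (simp add: W_def)
        finally show "card {w. \<exists>m. tdeg m = d \<and> lookup (adX c v L) (w, m) \<noteq> 0} \<le> n" .
      qed
      have top: "w = v" if "lookup L (w, m) \<noteq> 0" "tdeg m = d" for w m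
      proof
        fix c
        have "lookup L (w, m + single (w c) 1) = 0"
          using Suc.prems(3)[of w "m + single (w c) 1"] that by fastforce
        then have "Xd (w c) (v c) * lookup L (w, m) = 0"
          using lookup_adX[OF bij_is_inj[OF bij[OF that(1)]], of c v L m] z by simp
        then show "w c = v c" using that by simp
      qed
      obtain m where m: "tdeg m = d" "lookup L (v, m) \<noteq> 0" using v by (auto simp: W_def)
      show ?thesis
      proof (cases "m = 0")
        case True
        then have d: "d = 0" using m by simp
        have "L = cterm (lookup L (v, 0)) 0 v"
        proof (rule poly_mapping_eqI)
          fix k :: "(nat \<Rightarrow> nat) \<times> (nat \<Rightarrow>\<^sub>0 nat)"
          obtain w m' where k: "k = (w, m')" by (cases k)
          show "lookup L k = lookup (cterm (lookup L (v, 0)) 0 v) k"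
          proof (cases "lookup L (w, m') = 0")
            case False
            then have "m' = 0" using Suc.prems(3)[of w m'] d by simp
            then show ?thesis using top[OF False] d by (simp add: k cterm_def)
          qed (auto simp: k cterm_def lookup_single when_def)
        qed
        then have "act L 1 = lookup L (v, 0)"
          using bij[OF m(2)] act_cterm[of "lookup L (v, 0)" 0 v 1] by simp
        with Suc.prems(2)[of 1] m True show ?thesis by simp
      next
        case False
        then obtain i where i: "i \<in> keys m" by (metis keys_eq_empty all_not_in_conv tdeg_eq_0_iff tdeg_def sum.empty)
        obtain c where c: "i = v c" using bij[OF m(2)] by (metis bij_pointE)
        define m' where "m' = m - single i 1"
        have m': "m = m' + single i 1" unfolding m'_def
          by (rule poly_mapping_eqI) (use i in \<open>auto simp: lookup_add lookup_minus lookup_single when_def in_keys_iff\<close>)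
        have "of_nat (Suc (lookup m' (v c))) * lookup L (v, m) = 0"
          using lookup_adX[OF bij_is_inj[OF bij[OF m(2)]], of c v L m'] z m' c by simp
        then have "(of_nat (Suc (lookup m' (v c))) :: ratfun) = 0" using m by simp
        then have "rat_const (of_nat (Suc (lookup m' (v c)))) = 0" by (simp only: rat_const_of_nat)
        then show ?thesis by (simp only: rat_const_eq_0_iff of_nat_eq_0_iff)
      qed
    qed
  qed
qed

lemma act_faithful:
  assumes "adm UNIV L" "\<And>g. act L g = 0"
  shows "L = 0"
proof (rule act_faithful_aux[OF assms])
  show "tdeg m \<le> Max ((\<lambda>(w, m). tdeg m) ` keys L)" if "lookup L (w, m) \<noteq> 0" for w m
    using that by (intro Max_ge) (auto simp: in_keys_iff intro: rev_image_eqI)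
qed (rule order_refl)

lemma act_eqI:
  assumes "adm UNIV L" "adm UNIV M" "\<And>g. act L g = act M g"
  shows "L = M"
proof -
  have "act (L - M) g = 0" for g
    using act_add_left[of "L - M" M g] assms(3)[of g] by simp
  then have "L - M = 0" using assms adm_diff by (intro act_faithful) auto
  then show ?thesis by simp
qed

section \<open>The crossed product as a ring\<close>

text \<open>As a type the crossed product becomes an instance of \<open>ring_1\<close>; its axioms
  are read off from the faithful action.\<close>

typedef cra = "{L. adm UNIV L}" morphisms rep_cra abs_cra
  by (rule exI[of _ 0]) simp

setup_lifting type_definition_cra

lift_definition op :: "cra \<Rightarrow> ratfun \<Rightarrow> ratfun" is act .

lemma op_eqI: "(\<And>g. op L g = op M g) \<Longrightarrow> L = M"
  by transfer (auto intro: act_eqI)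

lemma op_add_right: "op L (f + g) = op L f + op L g"
  by transfer (simp add: act_eq_tact tact_add_right)

instantiation cra :: ring_1
begin

lift_definition zero_cra :: cra is 0 by simp
lift_definition one_cra :: cra is "crossed_perm id" by simp
lift_definition plus_cra :: "cra \<Rightarrow> cra \<Rightarrow> cra" is "(+)" by (rule adm_add)
lift_definition minus_cra :: "cra \<Rightarrow> cra \<Rightarrow> cra" is "(-)" by (rule adm_diff)
lift_definition uminus_cra :: "cra \<Rightarrow> cra" is uminus by (rule adm_uminus)
lift_definition times_cra :: "cra \<Rightarrow> cra \<Rightarrow> cra" is "(\<star>)" by (rule adm_mult)

lemma op_mult: "op (L * M) g = op L (op M g)"
  by transfer (rule act_mult)

lemma op_one: "op 1 g = g"
  by transfer (simp add: act_crossed_perm)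

lemma op_add: "op (L + M) g = op L g + op M g"
  by transfer (rule act_add_left)

lemma op_0: "op 0 g = 0"
  by transfer (simp add: act_def)

instance
proof
  show "(0::cra) \<noteq> 1"
  proof
    assume "(0::cra) = 1"
    then have "op 0 1 = op 1 1" by simp
    then show False by (simp add: op_0 op_one)
  qed
  fix a b c :: cra
  show "a + b + c = a + (b + c)" by transfer (rule add.assoc)
  show "a + b = b + a" by transfer (rule add.commute)
  show "0 + a = a" by transfer simp
  show "- a + a = 0" by transfer simp
  show "a - b = a + - b" by transfer simp
  show "a * b * c = a * (b * c)" by (rule op_eqI) (simp add: op_mult)
  show "1 * a = a" "a * 1 = a" by (rule op_eqI, simp add: op_mult op_one)+
  show "(a + b) * c = a * c + b * c" by (rule op_eqI) (simp add: op_mult op_add)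
  show "a * (b + c) = a * b + a * c" by (rule op_eqI) (simp add: op_mult op_add op_add_right)
qed

end

lemma op_0_right [simp]: "op L 0 = 0"
  using op_add_right[of L 0 0] by (metis add.right_neutral add_left_cancel)

lemma op_uminus: "op (- L) g = - op L g"
  using op_add[of "- L" L g] by (simp add: op_0 eq_neg_iff_add_eq_0)

lemma op_diff: "op (L - M) g = op L g - op M g"
  using op_add[of L "- M" g] by (simp add: op_uminus)

lemma op_sum: "op (sum L A) g = (\<Sum>x\<in>A. op (L x) g)"
  by (induction A rule: infinite_finite_induct) (simp_all add: op_add op_0)

lemma op_minus_right: "op L (- g) = - op L g"
  using op_add_right[of L "- g" g] by (simp add: eq_neg_iff_add_eq_0)

lemma op_diff_right: "op L (f - g) = op L f - op L g"
  using op_add_right[of L f "- g"] by (simp add: op_minus_right)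

lift_definition cM :: "ratfun \<Rightarrow> cra" is crossed_fun by simp
lift_definition cD :: "nat \<Rightarrow> cra" is crossed_partial by simp
text \<open>The value 0 off bijections only keeps the lift inside the type.\<close>

lift_definition cP :: "(nat \<Rightarrow> nat) \<Rightarrow> cra" is "\<lambda>w. if bij w then crossed_perm w else 0" by simp

lemma op_cM [simp]: "op (cM f) g = f * g"
  by transfer (rule act_crossed_fun)

lemma op_cD [simp]: "op (cD i) g = rat_deriv i g"
  by transfer (rule act_crossed_partial)

lemma op_cP [simp]: "bij w \<Longrightarrow> op (cP w) g = rat_perm w g"
  by (simp add: op.rep_eq cP.rep_eq act_crossed_perm)

lemmas op_simps = op_mult op_one op_add op_0 op_uminus op_diff op_sum

abbreviation cC :: "complex \<Rightarrow> cra" where "cC c \<equiv> cM (rat_const c)"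

lemma op_scale: "op L (rat_const c * g) = rat_const c * op L g"
proof (transfer fixing: c g)
  fix L assume "adm UNIV L"
  have f: "foldr rat_deriv xs (rat_const c * g) = rat_const c * foldr rat_deriv xs g" for xs g
    by (induction xs) (simp_all add: rat_deriv_scale)
  from \<open>adm UNIV L\<close> show "act L (rat_const c * g) = rat_const c * act L g"
    by (induction rule: adm_induct)
      (simp_all add: act_add_left act_cterm f permutes_bij act_def[of 0] distrib_left mult.left_commute)
qed

lemma cC_commute: "L * cC c = cC c * L"
  by (rule op_eqI) (simp add: op_simps op_scale)

lemma cC_left_commute: "L * (cC c * M) = cC c * (L * M)"
  by (metis cC_commute mult.assoc)

lemma cM_add: "cM (f + g) = cM f + cM g"
  by (rule op_eqI) (simp add: op_simps distrib_right)

lemma cM_mult: "cM (f * g) = cM f * cM g"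
  by (rule op_eqI) (simp add: op_simps mult.assoc)

lemma cM_0 [simp]: "cM 0 = 0"
  by (rule op_eqI) (simp add: op_simps)

lemma cM_1 [simp]: "cM 1 = 1"
  by (rule op_eqI) (simp add: op_simps)

lemma cM_minus: "cM (- f) = - cM f"
  by (rule op_eqI) (simp add: op_simps)

lemma cM_diff: "cM (f - g) = cM f - cM g"
  by (rule op_eqI) (simp add: op_simps left_diff_distrib)

lemma cM_sum: "cM (sum f A) = (\<Sum>x\<in>A. cM (f x))"
  by (induction A rule: infinite_finite_induct) (simp_all add: cM_add)

lemma cM_commute: "cM f * cM g = cM g * cM f"
  by (metis cM_mult mult.commute)

lemma cP_id [simp]: "cP id = 1"
  by (rule op_eqI) (simp add: op_simps)

lemma cP_comp: "bij v \<Longrightarrow> bij w \<Longrightarrow> cP v * cP w = cP (v \<circ> w)"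
  by (rule op_eqI) (simp add: op_simps bij_comp rat_perm_comp)

lemma cP_cM: "bij w \<Longrightarrow> cP w * cM f = cM (rat_perm w f) * cP w"
  by (rule op_eqI) (simp add: op_simps)

lemma cD_cM: "cD i * cM f = cM f * cD i + cM (rat_deriv i f)"
  by (rule op_eqI) (simp add: op_simps rat_deriv_mult)

lemma cP_transpose_square [simp]: "cP (transpose i j) * cP (transpose i j) = 1"
  by (simp add: cP_comp)

lemma cP_transpose_square' [simp]: "cP (transpose i j) * (cP (transpose i j) * L) = L"
  by (simp flip: mult.assoc)

section \<open>Dunkl operators\<close>

definition cDk :: "nat \<Rightarrow> complex \<Rightarrow> nat \<Rightarrow> cra" where
  "cDk N k i = cD i - (\<Sum>j\<in>{1..N} - {i}. cM (rat_const k / Xd i j) * (1 - cP (transpose i j)))"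

definition cY :: "nat \<Rightarrow> complex \<Rightarrow> nat \<Rightarrow> cra" where
  "cY N k i = cM (rat_var i) * cDk N k i - cC k * (\<Sum>j\<in>{1..<i}. cP (transpose i j))"

definition dk :: "nat \<Rightarrow> complex \<Rightarrow> nat \<Rightarrow> ratfun \<Rightarrow> ratfun" where
  "dk N k i g = rat_deriv i g - (\<Sum>j\<in>{1..N} - {i}. rat_const k * ddiff i j g)"

lemma op_cDk: "op (cDk N k i) g = dk N k i g"
  by (simp add: cDk_def dk_def op_simps ddiff_def)

lemma op_cY: "op (cY N k i) g = rat_var i * dk N k i g - rat_const k * (\<Sum>j\<in>{1..<i}. rat_perm (transpose i j) g)"
  by (simp add: cY_def op_simps op_cDk)

lemma transpose_conj: "bij w \<Longrightarrow> w \<circ> transpose i j = transpose (w i) (w j) \<circ> w"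
  by (auto simp: fun_eq_iff transpose_def bij_is_inj inj_eq)

lemma ddiff_perm:
  assumes "bij w"
  shows "rat_perm w (ddiff i j g) = ddiff (w i) (w j) (rat_perm w g)"
  using assms by (simp add: ddiff_def transpose_conj flip: rat_perm_comp)

lemma sum_permutes_minus:
  assumes w: "w permutes A" and "i \<in> A"
  shows "(\<Sum>j\<in>A - {i}. f (w j)) = (\<Sum>j\<in>A - {w i}. f j)"
proof -
  have "w ` (A - {i}) = A - {w i}"
    using permutes_image[OF w] permutes_inj[OF w] by (auto simp: inj_eq)
  moreover have "inj_on w (A - {i})" using permutes_inj_on[OF w] .
  ultimately show ?thesis by (metis (mono_tags, lifting) sum.reindex_cong)
qed

lemma dk_perm:
  assumes w: "w permutes {1..N}" and i: "i \<in> {1..N}"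
  shows "rat_perm w (dk N k i g) = dk N k (w i) (rat_perm w g)"
  using permutes_bij[OF w] sum_permutes_minus[OF assms, of "\<lambda>j. rat_const k * ddiff (w i) j (rat_perm w g)"]
  by (simp add: dk_def rat_perm_deriv rat_perm_sum ddiff_perm)

lemma cP_cDk:
  assumes "w permutes {1..N}" "i \<in> {1..N}"
  shows "cP w * cDk N k i = cDk N k (w i) * cP w"
  using permutes_bij[OF assms(1)] by (intro op_eqI) (simp add: op_simps op_cDk dk_perm[OF assms])

lemma dk_mult:
  "dk N k i (f * g) = f * dk N k i g + rat_deriv i f * g
    - (\<Sum>j\<in>{1..N} - {i}. rat_const k * ddiff i j f * rat_perm (transpose i j) g)"
proof -
  have "ddiff i j (f * g) = f * ddiff i j g + ddiff i j f * rat_perm (transpose i j) g" for j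
    using ddiff_mult[of i j g f] by (simp add: mult.commute add.commute)
  then show ?thesis
    by (simp add: dk_def rat_deriv_mult algebra_simps sum.distrib sum_distrib_left)
qed

lemma cDk_cM:
  "cDk N k i * cM f = cM f * cDk N k i + cM (rat_deriv i f)
    - cC k * (\<Sum>j\<in>{1..N} - {i}. cM (ddiff i j f) * cP (transpose i j))"
  by (rule op_eqI) (simp add: op_simps op_cDk dk_mult sum_distrib_left mult.assoc)

lemma cDk_var_neq:
  assumes "i \<in> {1..N}" "l \<in> {1..N}" "l \<noteq> i"
  shows "cDk N k i * cM (rat_var l) = cM (rat_var l) * cDk N k i + cC k * cP (transpose i l)"
proof -
  have "(\<Sum>j\<in>{1..N} - {i}. cM (ddiff i j (rat_var l)) * cP (transpose i j))
    = (\<Sum>j\<in>{1..N} - {i}. if j = l then - cP (transpose i l) else 0)"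
    using assms by (intro sum.cong) (auto simp: ddiff_var cM_minus)
  then show ?thesis using assms by (simp add: cDk_cM rat_deriv_var)
qed

lemma cDk_var_eq:
  assumes "i \<in> {1..N}"
  shows "cDk N k i * cM (rat_var i) = cM (rat_var i) * cDk N k i + 1
    - cC k * (\<Sum>j\<in>{1..N} - {i}. cP (transpose i j))"
proof -
  have "(\<Sum>j\<in>{1..N} - {i}. cM (ddiff i j (rat_var i)) * cP (transpose i j))
    = (\<Sum>j\<in>{1..N} - {i}. cP (transpose i j))"
    using assms by (intro sum.cong) (auto simp: ddiff_var)
  then show ?thesis using assms by (simp add: cDk_cM rat_deriv_var)
qed

lemma cDk_var_outside:
  assumes "i \<in> {1..N}" "l \<notin> {1..N}"
  shows "cDk N k i * cM (rat_var l) = cM (rat_var l) * cDk N k i"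
proof -
  have "(\<Sum>j\<in>{1..N} - {i}. cM (ddiff i j (rat_var l)) * cP (transpose i j)) = 0"
    using assms by (intro sum.neutral) (auto simp: ddiff_var)
  moreover have "i \<noteq> l" using assms by auto
  ultimately show ?thesis by (simp add: cDk_cM rat_deriv_var)
qed

lemma cDk_transpose:
  assumes "i \<in> {1..N}" "j \<in> {1..N}"
  shows "cP (transpose i j) * cDk N k i = cDk N k j * cP (transpose i j)"
    "cP (transpose i j) * cDk N k j = cDk N k i * cP (transpose i j)"
    "m \<in> {1..N} \<Longrightarrow> m \<noteq> i \<Longrightarrow> m \<noteq> j \<Longrightarrow> cP (transpose i j) * cDk N k m = cDk N k m * cP (transpose i j)"
  using cP_cDk[OF permutes_transpose[OF assms]] assms by simp_all

text \<open>The commutator of two Dunkl operators commutes with all \<open>X\<^sub>l\<close> by the Jacobi identity and kills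
  \<open>1\<close>, hence it vanishes.\<close>

lemma commutator_var_aux:
  assumes "i \<in> {1..N}" "j \<in> {1..N}" "i \<noteq> j"
    and p: "cDk N k i * cM (rat_var l) = cM (rat_var l) * cDk N k i + p"
    and q: "cDk N k j * cM (rat_var l) = cM (rat_var l) * cDk N k j + q"
    and l: "l \<noteq> j"
  shows "cDk N k i * q - q * cDk N k i = cDk N k j * p - p * cDk N k j"
proof -
  note comm = cDk_transpose cC_left_commute mult.assoc
  consider "l \<notin> {1..N}" | "l \<in> {1..N}" "l \<noteq> i" | "l = i" by blast
  then show ?thesis
  proof cases
    case 1
    then have "p = 0" "q = 0" using p q cDk_var_outside assms by simp_all
    then show ?thesis by simp
  next
    case 2
    then have pq: "p = cC k * cP (transpose i l)" "q = cC k * cP (transpose j l)"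
      using p q cDk_var_neq[of i N l k] cDk_var_neq[of j N l k] assms by simp_all
    have "cP (transpose j l) * cDk N k i = cDk N k i * cP (transpose j l)"
      "cP (transpose i l) * cDk N k j = cDk N k j * cP (transpose i l)"
      using 2 assms cDk_transpose(3) by auto
    then show ?thesis by (simp add: pq cC_left_commute mult.assoc)
  next
    case 3
    then have pq: "p = 1 - cC k * (\<Sum>m\<in>{1..N} - {i}. cP (transpose i m))" "q = cC k * cP (transpose j i)"
      using p q cDk_var_eq[of i N k] cDk_var_neq[of j N i k] assms by simp_all
    define R where "R = (\<Sum>m\<in>{1..N} - {i} - {j}. cP (transpose i m))"
    have R: "(\<Sum>m\<in>{1..N} - {i}. cP (transpose i m)) = cP (transpose i j) + R"
      unfolding R_def by (rule sum.remove) (use assms in auto)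
    have "R * cDk N k j = cDk N k j * R"
      unfolding R_def sum_distrib_left sum_distrib_right
      using assms by (intro sum.cong cDk_transpose(3)) auto
    moreover have "cP (transpose i j) * cDk N k i = cDk N k j * cP (transpose i j)"
      "cP (transpose i j) * cDk N k j = cDk N k i * cP (transpose i j)"
      using assms cDk_transpose by auto
    ultimately show ?thesis
      unfolding pq R by (simp add: transpose_commute[of j i] cC_left_commute mult.assoc algebra_simps)
  qed
qed

lemma cDk_commute:
  assumes i: "i \<in> {1..N}" and j: "j \<in> {1..N}"
  shows "cDk N k i * cDk N k j = cDk N k j * cDk N k i"
proof (cases "i = j")
  case False
  define Z where "Z = cDk N k i * cDk N k j - cDk N k j * cDk N k i"
  have Z: "Z * cM (rat_var l) = cM (rat_var l) * Z" for l
  proof -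
    define x where "x = cM (rat_var l)"
    define p where "p = cDk N k i * x - x * cDk N k i"
    define q where "q = cDk N k j * x - x * cDk N k j"
    have p: "cDk N k i * x = x * cDk N k i + p" and q: "cDk N k j * x = x * cDk N k j + q"
      by (simp_all add: p_def q_def)
    have "cDk N k i * q - q * cDk N k i = cDk N k j * p - p * cDk N k j"
    \<comment> \<open>The auxiliary lemma excludes l = j; its conclusion is symmetric under
      exchanging i with j and p with q, which covers that case.\<close>
    proof (cases "l = j")
      case True
      then show ?thesis using commutator_var_aux[OF j i _ q[unfolded x_def] p[unfolded x_def]] False by simp
    next
      case neq: False
      then show ?thesis using commutator_var_aux[OF i j _ p[unfolded x_def] q[unfolded x_def]] False by simp
    qed
    moreover have "Z * x = x * Z + (cDk N k i * q - q * cDk N k i) - (cDk N k j * p - p * cDk N k j)"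
      unfolding Z_def p_def q_def by (simp add: algebra_simps)
    ultimately show ?thesis by (simp add: x_def)
  qed
  \<comment> \<open>From the variables the commutation extends to all rational functions, whence Z g
    = g Z(1).\<close>
  have Zf: "Z * cM f = cM f * Z" for f
  proof (induction f rule: ratfun_induct)
    case (const c) then show ?case by (rule cC_commute)
  next
    case (var l) then show ?case by (rule Z)
  next
    case (add f g) then show ?case by (simp add: cM_add algebra_simps)
  next
    case (mult f g) then show ?case by (metis cM_mult mult.assoc)
  next
    case (inverse f)
    then have inv: "cM (inverse f) * cM f = 1" "cM f * cM (inverse f) = 1" by (simp_all flip: cM_mult)
    have "Z * cM (inverse f) = cM (inverse f) * (cM f * Z) * cM (inverse f)"
      by (simp add: inv mult.assoc[symmetric])
    also have "\<dots> = cM (inverse f) * Z"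
      by (simp only: inverse.IH[symmetric] mult.assoc inv mult_1_right)
    finally show ?case .
  qed
  have "Z = 0"
  proof (rule op_eqI)
    fix g
    have "op Z 1 = 0" by (simp add: Z_def op_simps op_cDk dk_def ddiff_def)
    moreover have "op Z g = g * op Z 1" using arg_cong[OF Zf[of g], of "\<lambda>L. op L 1"] by (simp add: op_mult)
    ultimately show "op Z g = op 0 g" by (simp add: op_0)
  qed
  then show ?thesis by (simp add: Z_def)
qed simp

section \<open>Relations of the degenerate double affine Hecke algebra\<close>

definition cU :: "nat \<Rightarrow> complex \<Rightarrow> nat \<Rightarrow> cra" where
  "cU N k i = cM (rat_var i) * cDk N k i"

text \<open>The Jucys-Murphy element. Subtracting k times it from the equivariant \<open>cU\<close>
  is what makes the y_i commute.\<close>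

definition cA :: "nat \<Rightarrow> cra" where
  "cA i = (\<Sum>j\<in>{1..<i}. cP (transpose i j))"

lemma cY_eq: "cY N k i = cU N k i - cC k * cA i"
  by (simp add: cY_def cU_def cA_def)

lemma cP_cU:
  assumes "w permutes {1..N}" "i \<in> {1..N}"
  shows "cP w * cU N k i = cU N k (w i) * cP w"
  unfolding cU_def using cP_cDk[OF assms, of k] cP_cM[OF permutes_bij[OF assms(1)], of "rat_var i"]
    permutes_bij[OF assms(1)]
  by (metis mult.assoc rat_perm_var)

lemma cU_commutator:
  assumes "i \<in> {1..N}" "j \<in> {1..N}" "i \<noteq> j"
  shows "cU N k i * cU N k j - cU N k j * cU N k i = cC k * (cU N k i - cU N k j) * cP (transpose i j)"
proof -
  have half: "cU N k i * cU N k j = cM (rat_var i) * cM (rat_var j) * cDk N k i * cDk N k j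
      + cC k * cU N k i * cP (transpose i j)" if "i \<in> {1..N}" "j \<in> {1..N}" "i \<noteq> j" for i j
  proof -
    have "cU N k i * cU N k j = cM (rat_var i) * (cDk N k i * cM (rat_var j)) * cDk N k j"
      by (simp add: cU_def mult.assoc)
    also have "\<dots> = cM (rat_var i) * (cM (rat_var j) * cDk N k i + cC k * cP (transpose i j)) * cDk N k j"
      using cDk_var_neq[of i N j k] that by simp
    also have "\<dots> = cM (rat_var i) * cM (rat_var j) * cDk N k i * cDk N k j
      + cC k * (cM (rat_var i) * (cP (transpose i j) * cDk N k j))"
      by (simp add: distrib_left distrib_right mult.assoc cC_left_commute)
    finally show ?thesis using that by (simp add: cDk_transpose cU_def mult.assoc)
  qed
  have "cM (rat_var i) * cM (rat_var j) * cDk N k i * cDk N k j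
      = cM (rat_var j) * cM (rat_var i) * cDk N k j * cDk N k i"
    using cDk_commute[OF assms(1,2)] cM_commute by (simp add: mult.assoc)
  then show ?thesis
    using half[OF assms] half[OF assms(2,1)] assms(3)
    by (simp add: transpose_commute[of j i] algebra_simps)
qed

lemma cP_cA_transpose:
  assumes "w permutes {1..N}" "i \<in> {1..N}"
  shows "cP w * cA i = (\<Sum>j\<in>{1..<i}. cP (transpose (w i) (w j))) * cP w"
  unfolding cA_def sum_distrib_left sum_distrib_right
  using permutes_bij[OF assms(1)] by (intro sum.cong) (simp_all add: cP_comp transpose_conj)

lemma cP_cY:
  assumes "w permutes {1..N}" "i \<in> {1..N}"
  shows "cP w * cY N k i = cY N k (w i) * cP w
    + cC k * ((\<Sum>j\<in>{1..<w i}. cP (transpose (w i) j)) - (\<Sum>j\<in>{1..<i}. cP (transpose (w i) (w j)))) * cP w"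
  using cP_cU[OF assms, of k] cP_cA_transpose[OF assms] 
  by (simp add: cY_eq right_diff_distrib left_diff_distrib cC_left_commute mult.assoc)
    (simp add: cA_def)

text \<open>For m < i < j the transposition of i and m permutes the indices below j, so it commutes
  with the sum defining \<open>cA j\<close>.\<close>

lemma cA_commute:
  assumes "i < j" "j \<in> {1..N}" "i \<in> {1..N}"
  shows "cA i * cA j = cA j * cA i"
proof -
  have "cP (transpose i m) * cA j = cA j * cP (transpose i m)" if m: "m \<in> {1..<i}" for m
  proof -
    have p: "transpose i m permutes {1..<j}" using m assms by (intro permutes_transpose) auto
    have "cP (transpose i m) * cA j = (\<Sum>n\<in>{1..<j}. cP (transpose j (transpose i m n))) * cP (transpose i m)"
      using cP_cA_transpose[of "transpose i m" N j] m assms permutes_transpose[of i "{1..N}" m] by auto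
    also have "(\<Sum>n\<in>{1..<j}. cP (transpose j (transpose i m n))) = cA j"
      unfolding cA_def using sum.permute[OF p, of "\<lambda>n. cP (transpose j n)"] by (simp add: comp_def)
    finally show ?thesis .
  qed
  then show ?thesis unfolding cA_def[of i] sum_distrib_left sum_distrib_right by (intro sum.cong) auto
qed

text \<open>For i < j, the transposition of i and j occurring in \<open>cA j\<close> turns
  \<open>cU N k i\<close> into \<open>cU N k j\<close>; this defect cancels the commutator of the
  two.\<close>

lemma cY_commute:
  assumes "i \<in> {1..N}" "j \<in> {1..N}"
  shows "cY N k i * cY N k j = cY N k j * cY N k i"
proof -
  have *: "cY N k i * cY N k j = cY N k j * cY N k i" if ij: "i \<in> {1..N}" "j \<in> {1..N}" "i < j" for i j
  proof -
    have f1: "cA i * cU N k j = cU N k j * cA i"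
      unfolding cA_def sum_distrib_left sum_distrib_right
    proof (rule sum.cong)
      fix m assume "m \<in> {1..<i}"
      then show "cP (transpose i m) * cU N k j = cU N k j * cP (transpose i m)"
        using cP_cU[of "transpose i m" N j k] permutes_transpose[of i "{1..N}" m] ij by auto
    qed simp
    have f2: "cA j * cU N k i = cU N k i * cA j + (cU N k j - cU N k i) * cP (transpose i j)"
    proof -
      define R where "R = (\<Sum>m\<in>{1..<j} - {i}. cP (transpose j m))"
      have A: "cA j = cP (transpose j i) + R"
        unfolding cA_def R_def by (rule sum.remove) (use ij in auto)
      have "R * cU N k i = cU N k i * R"
        unfolding R_def sum_distrib_left sum_distrib_right
      proof (rule sum.cong)
        fix m assume "m \<in> {1..<j} - {i}"
        then show "cP (transpose j m) * cU N k i = cU N k i * cP (transpose j m)"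
          using cP_cU[of "transpose j m" N i k] permutes_transpose[of j "{1..N}" m] ij by auto
      qed simp
      moreover have "cP (transpose j i) * cU N k i = cU N k j * cP (transpose j i)"
        using cP_cU[of "transpose j i" N i k] permutes_transpose[of j "{1..N}" i] ij by auto
      ultimately show ?thesis unfolding A by (simp add: algebra_simps transpose_commute[of j i])
    qed
    have f3: "cA i * cA j = cA j * cA i" using cA_commute ij by blast
    have f4: "cU N k i * cU N k j = cU N k j * cU N k i + cC k * (cU N k i - cU N k j) * cP (transpose i j)"
      using cU_commutator[of i N j k] ij by (simp add: algebra_simps)
    have E: "(a - cC k * \<alpha>) * (b - cC k * \<beta>) = a * b - cC k * (a * \<beta> + \<alpha> * b) + cC k * (cC k * (\<alpha> * \<beta>))"
      for a b \<alpha> \<beta> :: cra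
      by (simp add: algebra_simps cC_left_commute[of a] cC_left_commute[of \<alpha>])
    show ?thesis
      unfolding cY_eq E f1 f2 f3 f4 by (simp add: algebra_simps)
  qed
  show ?thesis using *[of i j] *[of j i] assms by (metis linorder_neqE_nat)
qed

text \<open>The common source of the relations between y and X and of the straightening of y past
  Laurent monomials.\<close>

lemma cY_cM:
  "cY N k i * cM f = cM f * cY N k i + cM (rat_var i * rat_deriv i f)
    - cC k * (\<Sum>j\<in>{1..N} - {i}. cM (rat_var i * ddiff i j f) * cP (transpose i j))
    + cC k * (\<Sum>j\<in>{1..<i}. cM (f - rat_perm (transpose i j) f) * cP (transpose i j))"
proof (rule op_eqI)
  fix g
  show "op (cY N k i * cM f) g = op (cM f * cY N k i + cM (rat_var i * rat_deriv i f)
    - cC k * (\<Sum>j\<in>{1..N} - {i}. cM (rat_var i * ddiff i j f) * cP (transpose i j))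
    + cC k * (\<Sum>j\<in>{1..<i}. cM (f - rat_perm (transpose i j) f) * cP (transpose i j))) g"
    unfolding op_simps op_cY op_cM op_cP[OF bij_transpose] dk_mult[of N k i f g]
    by (simp add: sum_distrib_left algebra_simps sum_subtractf sum.distrib)
qed

section \<open>The polynomial representation of the degenerate DAHA\<close>

lemma transpose_permutes: "1 \<le> i \<Longrightarrow> i \<le> N \<Longrightarrow> 1 \<le> j \<Longrightarrow> j \<le> N \<Longrightarrow> transpose i j permutes {1..N}"
  by (rule permutes_transpose) auto

lemma permutes_range:
  assumes "w permutes {1..N}" "1 \<le> i" "i \<le> N" shows "1 \<le> w i" "w i \<le> N"
  using permutes_in_image[OF assms(1), of i] assms(2,3) by auto

lemma rep_cra_sum: "rep_cra (sum f A) = (\<Sum>x\<in>A. rep_cra (f x))"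
  by (induction A rule: infinite_finite_induct) (simp_all add: zero_cra.rep_eq plus_cra.rep_eq)

lemma adm_rep_cra [simp]: "adm UNIV (rep_cra L)"
  using rep_cra by blast

lemma crossed_fun_mult:
  assumes "adm UNIV L" shows "crossed_fun f \<star> L = fun_mult f L"
  by (rule act_eqI) (use assms in \<open>auto simp: act_mult act_crossed_fun act_fun_mult intro!: adm_mult adm_fun_mult\<close>)

lemma rep_cM_mult: "rep_cra (cM f * L) = fun_mult f (rep_cra L)"
  by (simp add: times_cra.rep_eq cM.rep_eq crossed_fun_mult)

lemma rep_cDk: "rep_cra (cDk N k i) = dunkl N k i"
  by (simp add: cDk_def dunkl_def minus_cra.rep_eq rep_cra_sum times_cra.rep_eq cM.rep_eq cD.rep_eq cP.rep_eq one_cra.rep_eq)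

primrec letter_cra :: "nat \<Rightarrow> complex \<Rightarrow> letter \<Rightarrow> cra" where
  "letter_cra N k (Perm w) = cP w"
| "letter_cra N k (VarX i) = cM (rat_var i)"
| "letter_cra N k (InvX i) = cM (1 / rat_var i)"
| "letter_cra N k (VarY i) = cY N k i"

lemma rep_letter_cra: "letter_ok N g \<Longrightarrow> rep_cra (letter_cra N k g) = letter_op N k g"
proof (cases g)
  case (VarY i)
  have "rep_cra (cC k * (\<Sum>j\<in>{1..<i}. cP (transpose i j)))
      = fun_mult (rat_const k) (\<Sum>j\<in>{1..<i}. crossed_perm (transpose i j))"
    by (simp add: rep_cM_mult rep_cra_sum cP.rep_eq)
  then show ?thesis
    by (simp add: VarY cY_def minus_cra.rep_eq times_cra.rep_eq[of "cM (rat_var i)"] cM.rep_eq rep_cDk)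
qed (auto simp: cP.rep_eq cM.rep_eq permutes_bij)

definition free_cra :: "nat \<Rightarrow> complex \<Rightarrow> free \<Rightarrow> cra" where
  "free_cra N k a = (\<Sum>u\<in>keys a. cC (lookup a u) * prod_list (map (letter_cra N k) u))"

abbreviation FA :: "nat \<Rightarrow> free ring" where "FA \<equiv> free_algebra"

lemma FA_carrier: "a \<in> carrier (FA N) \<longleftrightarrow> (\<forall>u\<in>keys a. \<forall>g\<in>set u. letter_ok N g)"
  by (simp add: free_algebra_def)

lemma FA_simps [simp]: "mult (FA N) = (*)" "one (FA N) = 1" "zero (FA N) = 0" "add (FA N) = (+)"
  by (simp_all add: free_algebra_def)

lemma rep_free_cra:
  assumes "a \<in> carrier (FA N)" shows "rep_cra (free_cra N k a) = free_rep N k a"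
proof -
  have "rep_cra (prod_list (map (letter_cra N k) u)) = foldr (\<lambda>g M. letter_op N k g \<star> M) u (crossed_perm id)"
    if "\<forall>g\<in>set u. letter_ok N g" for u
    using that by (induction u) (auto simp: one_cra.rep_eq times_cra.rep_eq rep_letter_cra)
  then show ?thesis
    using assms by (simp add: free_cra_def free_rep_def rep_cra_sum rep_cM_mult FA_carrier)
qed

lemma free_cra_single: "free_cra N k (single u c) = cC c * prod_list (map (letter_cra N k) u)"
  by (simp add: free_cra_def)

lemma free_cra_0 [simp]: "free_cra N k 0 = 0"
  by (simp add: free_cra_def)

lemma free_cra_add: "free_cra N k (a + b) = free_cra N k a + free_cra N k b"
  unfolding free_cra_def
  by (rule setsum_keys_plus_distrib) (simp_all add: rat_const_add cM_add distrib_right)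

lemma free_cra_mult: "free_cra N k (a * b) = free_cra N k a * free_cra N k b"
proof (induction a rule: poly_mapping_additive_induct)
  case (2 u c)
  show ?case
  proof (induction b rule: poly_mapping_additive_induct)
    case (2 v d)
    then show ?case
      by (simp add: free_cra_single mult_single plus_list_def rat_const_mult cM_mult mult.assoc
          cC_left_commute[of "prod_list (map (letter_cra N k) u)"])
  qed (simp_all add: free_cra_add distrib_left)
qed (simp_all add: free_cra_add distrib_right)

lemma free_cra_minus: "free_cra N k (- a) = - free_cra N k a"
  using free_cra_add[of N k "- a" a] by (simp add: eq_neg_iff_add_eq_0)

lemma free_cra_diff: "free_cra N k (a - b) = free_cra N k a - free_cra N k b"
  using free_cra_add[of N k a "- b"] by (simp add: free_cra_minus)

lemma free_cra_gen [simp]: "free_cra N k (gen g) = letter_cra N k g"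
  by (simp add: gen_def free_cra_single)

lemma free_cra_scalar [simp]: "free_cra N k (scalar c) = cC c"
  by (simp add: scalar_def free_cra_single)

lemma free_cra_1 [simp]: "free_cra N k 1 = 1"
proof -
  have "(1 :: free) = scalar 1" by (simp add: scalar_def zero_list_def[symmetric])
  then show ?thesis by (metis free_cra_scalar cM_1 rat_const_1)
qed

lemma free_cra_sum: "free_cra N k (sum f A) = (\<Sum>x\<in>A. free_cra N k (f x))"
  by (induction A rule: infinite_finite_induct) (simp_all add: free_cra_add)

lemma free_cra_prod_list: "free_cra N k (prod_list xs) = prod_list (map (free_cra N k) xs)"
  by (induction xs) (simp_all add: free_cra_mult)

lemma free_carrier_0 [simp]: "0 \<in> carrier (FA N)"
  by (simp add: FA_carrier)

lemma free_carrier_1 [simp]: "1 \<in> carrier (FA N)"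
  by (simp add: FA_carrier zero_list_def)

lemma free_carrier_add [intro]: "a \<in> carrier (FA N) \<Longrightarrow> b \<in> carrier (FA N) \<Longrightarrow> a + b \<in> carrier (FA N)"
  using Poly_Mapping.keys_add[of a b] unfolding FA_carrier by blast

lemma free_carrier_minus [intro]: "a \<in> carrier (FA N) \<Longrightarrow> - a \<in> carrier (FA N)"
  by (simp add: FA_carrier)

lemma free_carrier_diff [intro]: "a \<in> carrier (FA N) \<Longrightarrow> b \<in> carrier (FA N) \<Longrightarrow> a - b \<in> carrier (FA N)"
  using free_carrier_add[of a N "- b"] by auto

lemma free_carrier_mult [intro]:
  assumes "a \<in> carrier (FA N)" "b \<in> carrier (FA N)" shows "a * b \<in> carrier (FA N)"
  unfolding FA_carrier
proof (intro ballI)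
  fix u g assume "u \<in> keys (a * b)" and g: "g \<in> set u"
  then obtain v w where "u = v + w" "v \<in> keys a" "w \<in> keys b"
    using keys_mult[of a b] by blast
  then show "letter_ok N g" using assms g by (auto simp: FA_carrier plus_list_def)
qed

lemma free_carrier_gen: "letter_ok N g \<Longrightarrow> gen g \<in> carrier (FA N)"
  by (simp add: FA_carrier gen_def)

lemma free_carrier_scalar [simp]: "scalar c \<in> carrier (FA N)"
  by (simp add: FA_carrier scalar_def)

lemma free_carrier_sum: "(\<And>x. x \<in> A \<Longrightarrow> f x \<in> carrier (FA N)) \<Longrightarrow> sum f A \<in> carrier (FA N)"
  by (induction A rule: infinite_finite_induct) auto

lemma free_carrier_prod_list: "(\<And>x. x \<in> set xs \<Longrightarrow> x \<in> carrier (FA N)) \<Longrightarrow> prod_list xs \<in> carrier (FA N)"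
  by (induction xs) auto

lemma FA_ring: "ring (FA N)"
proof (rule ringI)
  show "abelian_group (FA N)"
  proof (rule abelian_groupI)
    show "\<exists>y\<in>carrier (FA N). y \<oplus>\<^bsub>FA N\<^esub> x = \<zero>\<^bsub>FA N\<^esub>" if "x \<in> carrier (FA N)" for x
      using that by (intro bexI[of _ "- x"]) auto
  qed (auto simp: add_ac)
  show "Group.monoid (FA N)" by (rule monoidI) (auto simp: mult.assoc)
qed (auto simp: distrib_left distrib_right)

interpretation FA: ring "FA N" for N by (rule FA_ring)

lemma FA_a_inv: "x \<in> carrier (FA N) \<Longrightarrow> \<ominus>\<^bsub>FA N\<^esub> x = - x"
  by (rule FA.minus_equality) auto

lemma free_carrier_transpose: "i \<in> {1..N} \<Longrightarrow> j \<in> {1..N} \<Longrightarrow> s\<^sub>2 i j \<in> carrier (FA N)"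
  by (intro free_carrier_gen) (auto intro: transpose_permutes)

lemma daha_relators_carrier: "daha_relators N h k \<subseteq> carrier (FA N)"
proof
  fix a assume "a \<in> daha_relators N h k"
  then show "a \<in> carrier (FA N)"
    by cases
      (auto intro!: free_carrier_diff free_carrier_add free_carrier_mult free_carrier_gen free_carrier_sum
        simp: permutes_range permutes_id permutes_compose transpose_permutes)
qed

lemma cY_var_neq:
  assumes "i \<in> {1..N}" "l \<in> {1..N}" "l \<noteq> i"
  shows "cY N k i * cM (rat_var l)
    = cM (rat_var l) * cY N k i + cC k * cM (rat_var (if l < i then l else i)) * cP (transpose i l)"
proof -
  have 1: "(\<Sum>j\<in>{1..N} - {i}. cM (rat_var i * ddiff i j (rat_var l)) * cP (transpose i j))
    = (\<Sum>j\<in>{1..N} - {i}. if j = l then - (cM (rat_var i) * cP (transpose i l)) else 0)"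
    using assms by (intro sum.cong) (auto simp: ddiff_var cM_minus)
  have 2: "(\<Sum>j\<in>{1..<i}. cM (rat_var l - rat_perm (transpose i j) (rat_var l)) * cP (transpose i j))
    = (\<Sum>j\<in>{1..<i}. if j = l then cM (rat_var l - rat_var i) * cP (transpose i l) else 0)"
    using assms by (intro sum.cong) auto
  show ?thesis unfolding cY_cM 1 2 using assms
    by (auto simp: rat_deriv_var cM_diff algebra_simps)
qed

lemma cY_var_eq:
  assumes "i \<in> {1..N}"
  shows "cY N k i * cM (rat_var i) = cM (rat_var i) * cY N k i + cM (rat_var i)
    - cC k * (\<Sum>r\<in>{1..<i}. cM (rat_var r) * cP (transpose i r))
    - cC k * (\<Sum>r\<in>{i<..N}. cM (rat_var i) * cP (transpose i r))"
proof -
  have split: "{1..N} - {i} = {1..<i} \<union> {i<..N}" using assms by auto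
  have "(\<Sum>j\<in>{1..N} - {i}. cM (rat_var i * ddiff i j (rat_var i)) * cP (transpose i j))
    = (\<Sum>j\<in>{1..N} - {i}. cM (rat_var i) * cP (transpose i j))"
    using assms by (intro sum.cong) (auto simp: ddiff_var)
  also have "\<dots> = (\<Sum>j\<in>{1..<i}. cM (rat_var i) * cP (transpose i j)) + (\<Sum>j\<in>{i<..N}. cM (rat_var i) * cP (transpose i j))"
    unfolding split by (rule sum.union_disjoint) auto
  finally have 1: "(\<Sum>j\<in>{1..N} - {i}. cM (rat_var i * ddiff i j (rat_var i)) * cP (transpose i j)) = \<dots>" .
  have 2: "(\<Sum>j\<in>{1..<i}. cM (rat_var i - rat_perm (transpose i j) (rat_var i)) * cP (transpose i j))
    = (\<Sum>j\<in>{1..<i}. cM (rat_var i) * cP (transpose i j)) - (\<Sum>j\<in>{1..<i}. cM (rat_var j) * cP (transpose i j))"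
    unfolding sum_subtractf[symmetric] by (intro sum.cong) (auto simp: cM_diff algebra_simps)
  show ?thesis unfolding cY_cM 1 2 by (simp add: rat_deriv_var algebra_simps)
qed

lemma cP_cY_simple:
  assumes "1 \<le> i" "i + 1 \<le> N"
  shows "cP (transpose i (i + 1)) * cY N k i = cY N k (i + 1) * cP (transpose i (i + 1)) + cC k"
proof -
  have "(\<Sum>j\<in>{1..<i + 1}. cP (transpose (i + 1) j))
      = (\<Sum>j\<in>{1..<i}. cP (transpose (i + 1) j)) + cP (transpose (i + 1) i)"
    using assms by (simp flip: Suc_eq_plus1)
  moreover have "(\<Sum>j\<in>{1..<i}. cP (transpose (i + 1) (transpose i (i + 1) j))) = (\<Sum>j\<in>{1..<i}. cP (transpose (i + 1) j))"
    by (intro sum.cong) (auto simp: transpose_def)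
  ultimately show ?thesis
    using cP_cY[OF permutes_transpose[of i "{1..N}" "i + 1"], of i k] assms
    by (simp add: mult.assoc transpose_commute[of "i + 1" i])
qed

lemma cP_cY_far:
  assumes "1 \<le> i" "i + 1 \<le> N" "j \<in> {1..N} - {i, i + 1}"
  shows "cP (transpose i (i + 1)) * cY N k j = cY N k j * cP (transpose i (i + 1))"
proof -
  have "(\<Sum>m\<in>{1..<j}. cP (transpose j (transpose i (i + 1) m))) = (\<Sum>m\<in>{1..<j}. cP (transpose j m))"
  proof (cases "j < i")
    case True
    then show ?thesis by (intro sum.cong) (auto simp: transpose_def)
  next
    case False
    then have "transpose i (i + 1) permutes {1..<j}" using assms by (intro permutes_transpose) auto
    from sum.permute[OF this, of "\<lambda>m. cP (transpose j m)"] show ?thesis by (simp add: comp_def)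
  qed
  moreover have "transpose i (i + 1) j = j" using assms by auto
  ultimately show ?thesis
    using cP_cY[OF permutes_transpose[of i "{1..N}" "i + 1"], of j k] assms by simp
qed

lemma free_cra_relators:
  assumes "a \<in> daha_relators N 1 k" shows "free_cra N k a = 0"
  using assms
proof cases
  case perm_one
  then show ?thesis by (simp add: free_cra_diff flip: id_def)
next
  case (perm_mult v w)
  then show ?thesis by (simp add: free_cra_diff free_cra_mult cP_comp permutes_bij)
next
  case (X_Xinv i)
  then show ?thesis by (simp add: free_cra_diff free_cra_mult flip: cM_mult)
next
  case (Xinv_X i)
  then show ?thesis by (simp add: free_cra_diff free_cra_mult flip: cM_mult)
next
  case (X_X i j)
  then show ?thesis using cM_commute by (simp add: free_cra_diff free_cra_mult)
next
  case (perm_X w i)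
  then show ?thesis by (simp add: free_cra_diff free_cra_mult cP_cM permutes_bij)
next
  case (s_y i)
  then show ?thesis using cP_cY_simple[of i N k] by (simp add: free_cra_diff free_cra_add free_cra_mult)
next
  case (s_y_far i j)
  then show ?thesis using cP_cY_far[of i N j k] by (simp add: free_cra_diff free_cra_mult)
next
  case (y_y i j)
  then show ?thesis using cY_commute[of i N j k] by (simp add: free_cra_diff free_cra_mult)
next
  case (y_X_gt j i)
  then show ?thesis using cY_var_neq[of i N j k] by (simp add: free_cra_diff free_cra_mult)
next
  case (y_X_lt i j)
  then show ?thesis using cY_var_neq[of i N j k] by (simp add: free_cra_diff free_cra_mult)
next
  case (y_X_eq i)
  then show ?thesis using cY_var_eq[of i N k] by (simp add: free_cra_diff free_cra_mult free_cra_sum)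
qed

lemma daha_ideal_ideal: "ideal (daha_ideal N h k) (FA N)"
  unfolding daha_ideal_def by (rule FA.genideal_ideal[OF daha_relators_carrier])

lemma daha_relators_ideal: "a \<in> daha_relators N h k \<Longrightarrow> a \<in> daha_ideal N h k"
  unfolding daha_ideal_def using FA.genideal_self[OF daha_relators_carrier] by blast

lemma free_cra_ideal: "a \<in> daha_ideal N 1 k \<Longrightarrow> free_cra N k a = 0"
proof -
  let ?K = "{a \<in> carrier (FA N). free_cra N k a = 0}"
  have "ideal ?K (FA N)"
  proof (rule idealI[OF FA_ring])
    show "subgroup ?K (add_monoid (FA N))"
    proof (rule group.subgroupI)
      show "Group.group (add_monoid (FA N))" by (rule FA.a_group)
      show "?K \<noteq> {}" using free_carrier_0 by fastforce
      fix a assume "a \<in> ?K"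
      then show "inv\<^bsub>add_monoid (FA N)\<^esub> a \<in> ?K"
        using FA_a_inv[of a N] by (auto simp: a_inv_def free_cra_minus)
    qed (auto simp: free_cra_add)
  qed (auto simp: free_cra_mult)
  then have "daha_ideal N 1 k \<subseteq> ?K"
    unfolding daha_ideal_def using daha_relators_carrier free_cra_relators
    by (intro FA.genideal_minimal) auto
  then show "a \<in> daha_ideal N 1 k \<Longrightarrow> free_cra N k a = 0" by blast
qed

text \<open>The ideal lies in the kernel, so \<open>free_rep\<close> is constant on the coset and
  \<open>the_elem\<close> returns that constant.\<close>

lemma poly_rep_class:
  assumes "a \<in> carrier (FA N)"
  shows "poly_rep N k (daha_class N 1 k a) = rep_cra (free_cra N k a)"
proof -
  interpret I: ideal "daha_ideal N 1 k" "FA N" by (rule daha_ideal_ideal)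
  have "free_rep N k (h + a) = rep_cra (free_cra N k a)" if "h \<in> daha_ideal N 1 k" for h
    using rep_free_cra[OF free_carrier_add[OF I.a_Hcarr[OF that] assms], of k] free_cra_ideal[OF that]
    by (simp add: free_cra_add)
  moreover have "daha_class N 1 k a = (\<lambda>h. h + a) ` daha_ideal N 1 k"
    by (auto simp: daha_class_def a_r_coset_def')
  moreover have "daha_ideal N 1 k \<noteq> {}" using I.zero_closed by auto
  ultimately have "free_rep N k ` daha_class N 1 k a = {rep_cra (free_cra N k a)}"
    by (auto simp: image_image)
  then show ?thesis by (simp add: poly_rep_def)
qed

interpretation daha: ring "daha N h k" for N h k
  unfolding daha_def by (rule ideal.quotient_is_ring[OF daha_ideal_ideal])

lemma daha_class_hom: "daha_class N h k \<in> ring_hom (FA N) (daha N h k)"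
proof -
  have "daha_class N h k = (+>\<^bsub>FA N\<^esub>) (daha_ideal N h k)" by (rule ext) (simp add: daha_class_def)
  then show ?thesis unfolding daha_def using ideal.rcos_ring_hom[OF daha_ideal_ideal] by simp
qed

interpretation daha_class: ring_hom_ring "FA N" "daha N h k" "daha_class N h k" for N h k
  by (rule ring_hom_ringI2[OF FA_ring daha.ring_axioms daha_class_hom])

lemma daha_carrier: "carrier (daha N h k) = daha_class N h k ` carrier (FA N)"
  by (auto simp: daha_def FactRing_def A_RCOSETS_def' daha_class_def)

definition H :: "nat \<Rightarrow> complex \<Rightarrow> cra set" where
  "H N k = free_cra N k ` carrier (FA N)"

lemma daha_in_crossed_eq: "daha_in_crossed N k = rep_cra ` H N k"
  unfolding daha_in_crossed_def H_def daha_carrier image_image by (rule image_cong) (auto simp: poly_rep_class)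

lemma H_letter: "letter_ok N g \<Longrightarrow> letter_cra N k g \<in> H N k"
  unfolding H_def by (rule image_eqI[of _ _ "gen g"]) (auto intro: free_carrier_gen)

lemma H_cC [simp]: "cC c \<in> H N k"
  unfolding H_def by (rule image_eqI[of _ _ "scalar c"]) auto

lemma H_add: "L \<in> H N k \<Longrightarrow> M \<in> H N k \<Longrightarrow> L + M \<in> H N k"
  unfolding H_def by (auto simp: image_iff simp flip: free_cra_add)

lemma H_mult: "L \<in> H N k \<Longrightarrow> M \<in> H N k \<Longrightarrow> L * M \<in> H N k"
  unfolding H_def by (auto simp: image_iff simp flip: free_cra_mult)

lemma H_0 [simp]: "0 \<in> H N k" and H_1 [simp]: "1 \<in> H N k"
  using H_cC[of 0 N k] H_cC[of 1 N k] by (simp_all del: H_cC)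

lemma H_sum: "(\<And>x. x \<in> A \<Longrightarrow> f x \<in> H N k) \<Longrightarrow> sum f A \<in> H N k"
  by (induction A rule: infinite_finite_induct) (auto intro: H_add)

lemma H_induct [consumes 1, case_names const letter add mult]:
  assumes "L \<in> H N k"
    and "\<And>c. P (cC c)" "\<And>g. letter_ok N g \<Longrightarrow> P (letter_cra N k g)"
    and "\<And>L M. P L \<Longrightarrow> P M \<Longrightarrow> P (L + M)" "\<And>L M. P L \<Longrightarrow> P M \<Longrightarrow> P (L * M)"
  shows "P L"
proof -
  obtain a where a: "a \<in> carrier (FA N)" "L = free_cra N k a" using assms(1) by (auto simp: H_def)
  have "P (prod_list (map (letter_cra N k) u))" if "\<forall>g\<in>set u. letter_ok N g" for u
    using that assms(2)[of 1] by (induction u) (auto intro: assms)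
  then have *: "P (cC (lookup a u) * prod_list (map (letter_cra N k) u))" if "u \<in> keys a" for u
    using that a assms by (auto simp: FA_carrier)
  have "P (\<Sum>u\<in>A. cC (lookup a u) * prod_list (map (letter_cra N k) u))"
    if "finite A" "A \<subseteq> keys a" for A
    using that assms(2)[of 0] * by (induction A rule: finite_induct) (auto intro: assms)
  then show ?thesis by (simp add: a(2) free_cra_def)
qed

section \<open>The cyclotomic subalgebra\<close>

definition Cyc :: "nat \<Rightarrow> nat \<Rightarrow> (nat \<Rightarrow> complex) \<Rightarrow> complex \<Rightarrow> cra set" where
  "Cyc N l z k = {free_cra N k a | a. a \<in> carrier (FA N) \<and> daha_class N 1 k a \<in> cyclotomic_daha N l z 1 k}"

definition cyc_gens :: "nat \<Rightarrow> nat \<Rightarrow> (nat \<Rightarrow> complex) \<Rightarrow> complex \<Rightarrow> free set set" where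
  "cyc_gens N l z k = Set.range (\<lambda>c. daha_class N 1 k (scalar c))
      \<union> {daha_class N 1 k (s\<^sub>2 i (i+1)) | i. 1 \<le> i \<and> i + 1 \<le> N}
      \<union> {daha_class N 1 k (gY i) | i. i \<in> {1..N}}
      \<union> {daha_pi N 1 k, daha_pi_minus N l z 1 k}"

lemma cyclotomic_daha_eq: "cyclotomic_daha N l z 1 k = generate_ring (daha N 1 k) (cyc_gens N l z k)"
  by (simp add: cyclotomic_daha_def cyc_gens_def)

definition pi_word :: "nat \<Rightarrow> free" where
  "pi_word N = gX 1 * prod_list (map (\<lambda>i. s\<^sub>2 i (i+1)) [1..<N])"

lemma pi_word_carrier: "N \<ge> 1 \<Longrightarrow> pi_word N \<in> carrier (FA N)"
  unfolding pi_word_def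
  by (intro free_carrier_mult free_carrier_prod_list free_carrier_gen) (auto intro!: free_carrier_transpose)

lemma daha_pi_eq: "daha_pi N h k = daha_class N h k (pi_word N)"
  by (simp add: daha_pi_def pi_word_def)

definition cpi :: "nat \<Rightarrow> cra" where
  "cpi N = cM (rat_var 1) * prod_list (map (\<lambda>i. cP (transpose i (i+1))) [1..<N])"

definition cpi_inv :: "nat \<Rightarrow> cra" where
  "cpi_inv N = prod_list (map (\<lambda>i. cP (transpose i (i+1))) (rev [1..<N])) * cM (1 / rat_var 1)"

definition cpi_minus :: "nat \<Rightarrow> nat \<Rightarrow> (nat \<Rightarrow> complex) \<Rightarrow> complex \<Rightarrow> cra" where
  "cpi_minus N l z k = cpi_inv N * prod_list (map (\<lambda>i. cY N k 1 - cC (z i)) [1..<l+1])"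

lemma free_cra_pi_word: "free_cra N k (pi_word N) = cpi N"
  by (simp add: pi_word_def cpi_def free_cra_mult free_cra_prod_list comp_def)

lemma prod_list_transpose_inverse:
  "prod_list (map (\<lambda>i. cP (transpose i (i+1))) xs) * (prod_list (map (\<lambda>i. cP (transpose i (i+1))) (rev xs)) * L) = L"
  by (induction xs arbitrary: L) (simp_all add: mult.assoc)

lemma daha_class_eqI:
  assumes "a \<in> carrier (FA N)" "b \<in> carrier (FA N)" "a - b \<in> daha_ideal N h k"
  shows "daha_class N h k a = daha_class N h k b"
proof -
  interpret I: ideal "daha_ideal N h k" "FA N" by (rule daha_ideal_ideal)
  have "daha_class N h k ((a - b) + b) = daha_class N h k (a - b) \<oplus>\<^bsub>daha N h k\<^esub> daha_class N h k b"
    using daha_class.hom_add[of "a - b" N b h k] assms by auto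
  moreover have "daha_class N h k (a - b) = \<zero>\<^bsub>daha N h k\<^esub>"
    using I.a_rcos_const[OF assms(3)] by (simp add: daha_class_def daha_def FactRing_def)
  ultimately show ?thesis using assms by simp
qed

lemma daha_class_transpose_unit:
  assumes "i \<in> {1..N}" "j \<in> {1..N}"
  shows "daha_class N h k (s\<^sub>2 i j) \<in> Units (daha N h k)"
proof -
  have c: "s\<^sub>2 i j \<in> carrier (FA N)" using free_carrier_transpose assms by blast
  have p: "gP id \<in> carrier (FA N)" by (intro free_carrier_gen) (simp add: permutes_id)
  have "daha_class N h k (s\<^sub>2 i j * s\<^sub>2 i j) = daha_class N h k (gP (transpose i j \<circ> transpose i j))"
    using c p permutes_transpose[OF assms]
    by (intro daha_class_eqI daha_relators_ideal daha_relators.perm_mult) auto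
  also have "\<dots> = daha_class N h k 1"
    using p daha_relators.perm_one by (intro daha_class_eqI daha_relators_ideal) auto
  finally have "daha_class N h k (s\<^sub>2 i j) \<otimes>\<^bsub>daha N h k\<^esub> daha_class N h k (s\<^sub>2 i j) = \<one>\<^bsub>daha N h k\<^esub>"
    using c daha_class.hom_mult[of "s\<^sub>2 i j" N "s\<^sub>2 i j" h k] daha_class.hom_one by simp
  then show ?thesis using daha_class.hom_closed[OF c, of h k] unfolding Units_def by blast
qed

lemma daha_class_X_unit:
  assumes "i \<in> {1..N}"
  shows "daha_class N h k (gX i) \<in> Units (daha N h k)"
proof -
  have c: "gX i \<in> carrier (FA N)" "gXinv i \<in> carrier (FA N)" using assms by (auto intro: free_carrier_gen)
  have "daha_class N h k (gX i * gXinv i) = daha_class N h k 1"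
    by (rule daha_class_eqI[OF free_carrier_mult[OF c] free_carrier_1 daha_relators_ideal[OF daha_relators.X_Xinv[OF assms]]])
  moreover have "daha_class N h k (gXinv i * gX i) = daha_class N h k 1"
    by (rule daha_class_eqI[OF free_carrier_mult[OF c(2,1)] free_carrier_1 daha_relators_ideal[OF daha_relators.Xinv_X[OF assms]]])
  ultimately have "daha_class N h k (gX i) \<otimes>\<^bsub>daha N h k\<^esub> daha_class N h k (gXinv i) = \<one>\<^bsub>daha N h k\<^esub>"
    "daha_class N h k (gXinv i) \<otimes>\<^bsub>daha N h k\<^esub> daha_class N h k (gX i) = \<one>\<^bsub>daha N h k\<^esub>"
    using c daha_class.hom_mult[of "gX i" N "gXinv i" h k] daha_class.hom_mult[of "gXinv i" N "gX i" h k]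
      daha_class.hom_one[of N h k] by simp_all
  then show ?thesis using c daha_class.hom_closed unfolding Units_def by blast
qed

lemma daha_class_prod_list_unit:
  assumes "\<And>x. x \<in> set xs \<Longrightarrow> x \<in> carrier (FA N) \<and> daha_class N h k x \<in> Units (daha N h k)"
  shows "daha_class N h k (prod_list xs) \<in> Units (daha N h k)"
  using assms
proof (induction xs)
  case (Cons x xs)
  then have "prod_list xs \<in> carrier (FA N)" "x \<in> carrier (FA N)" by (auto intro: free_carrier_prod_list)
  then show ?case using Cons daha_class.hom_mult[of x N "prod_list xs" h k] daha.Units_m_closed by simp
qed (use daha_class.hom_one[of N h k] in simp)

lemma daha_pi_unit:
  assumes "N \<ge> 1" shows "daha_pi N h k \<in> Units (daha N h k)"
proof -
  have "daha_class N h k (prod_list (gX 1 # map (\<lambda>i. s\<^sub>2 i (i+1)) [1..<N])) \<in> Units (daha N h k)"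
    using assms daha_class_X_unit[of 1 N h k] daha_class_transpose_unit
    by (intro daha_class_prod_list_unit) (auto intro!: free_carrier_gen simp: transpose_permutes)
  then show ?thesis by (simp add: daha_pi_eq pi_word_def)
qed

text \<open>The inverse of pi in the quotient is given abstractly. Its representative maps to a
  right inverse of \<open>cpi N\<close>, which must agree with the explicit left inverse
  \<open>cpi_inv N\<close>.\<close>

lemma daha_pi_minus_eq:
  assumes "N \<ge> 1"
  shows "\<exists>a\<in>carrier (FA N). daha_pi_minus N l z 1 k = daha_class N 1 k a \<and> free_cra N k a = cpi_minus N l z k"
proof -
  let ?D = "daha N 1 k" and ?c = "daha_class N 1 k"
  note u = daha_pi_unit[OF assms, of 1 k]
  obtain b where b: "b \<in> carrier (FA N)" "inv\<^bsub>?D\<^esub> (daha_pi N 1 k) = ?c b"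
    using daha.Units_inv_closed[OF u] by (auto simp: daha_carrier)
  have "?c (pi_word N * b) = daha_pi N 1 k \<otimes>\<^bsub>?D\<^esub> inv\<^bsub>?D\<^esub> (daha_pi N 1 k)"
    using daha_class.hom_mult[OF pi_word_carrier[OF assms] b(1), of 1 k] by (simp add: daha_pi_eq b(2)[unfolded daha_pi_eq])
  also have "\<dots> = ?c 1" using daha.Units_r_inv[OF u] daha_class.hom_one[of N 1 k] by simp
  finally have "poly_rep N k (?c (pi_word N * b)) = poly_rep N k (?c 1)" by simp
  then have "rep_cra (free_cra N k (pi_word N * b)) = rep_cra (free_cra N k 1)"
    using free_carrier_mult[OF pi_word_carrier[OF assms] b(1)] by (simp only: poly_rep_class free_carrier_1)
  then have e: "cpi N * free_cra N k b = 1" by (simp add: rep_cra_inject free_cra_mult free_cra_pi_word)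
  have "cpi_inv N * cpi N = 1"
  proof -
    have r: "prod_list (map (\<lambda>i. cP (transpose i (i+1))) (rev [1..<N])) * (prod_list (map (\<lambda>i. cP (transpose i (i+1))) [1..<N]) * L) = L" for L
      using prod_list_transpose_inverse[of "rev [1..<N]" L] by simp
    have x: "cM (1 / rat_var 1) * (cM (rat_var 1) * L) = L" for L
      by (simp flip: mult.assoc cM_mult)
    show ?thesis using r[of 1] unfolding cpi_def cpi_inv_def
      by (simp add: mult.assoc x)
  qed
  then have fb: "free_cra N k b = cpi_inv N" using e by (metis mult.assoc mult_1_left mult_1_right)
  let ?p = "prod_list (map (\<lambda>i. gY 1 - scalar (z i)) [1..<l+1])"
  have p: "?p \<in> carrier (FA N)"
    using assms by (intro free_carrier_prod_list) (auto intro!: free_carrier_diff free_carrier_gen)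
  have "daha_pi_minus N l z 1 k = ?c (b * ?p)"
    using daha_class.hom_mult[OF b(1) p, of 1 k] b(2) by (simp add: daha_pi_minus_def)
  moreover have "free_cra N k (b * ?p) = cpi_minus N l z k"
    by (simp add: free_cra_mult fb free_cra_prod_list cpi_minus_def comp_def free_cra_diff)
  ultimately show ?thesis using b p by blast
qed

lemma cyc_gens_carrier: assumes "N \<ge> 1" shows "cyc_gens N l z k \<subseteq> carrier (daha N 1 k)"
  using daha_pi_minus_eq[OF assms, of l z k] pi_word_carrier[OF assms] assms
  by (auto simp: cyc_gens_def daha_pi_eq transpose_permutes intro!: daha_class.hom_closed free_carrier_gen)

lemma cyclotomic_daha_carrier: assumes "N \<ge> 1" shows "cyclotomic_daha N l z 1 k \<subseteq> carrier (daha N 1 k)"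
  unfolding cyclotomic_daha_eq by (rule daha.generate_ring_incl[OF cyc_gens_carrier[OF assms]])

lemma cyclotomic_in_crossed_eq:
  assumes "N \<ge> 1" shows "cyclotomic_in_crossed N l z k = rep_cra ` Cyc N l z k"
proof
  show "cyclotomic_in_crossed N l z k \<subseteq> rep_cra ` Cyc N l z k"
  proof
    fix L assume "L \<in> cyclotomic_in_crossed N l z k"
    then obtain C where C: "C \<in> cyclotomic_daha N l z 1 k" "L = poly_rep N k C"
      by (auto simp: cyclotomic_in_crossed_def)
    then obtain a where "a \<in> carrier (FA N)" "C = daha_class N 1 k a"
      using cyclotomic_daha_carrier[OF assms, of l z k] unfolding daha_carrier by blast
    with C show "L \<in> rep_cra ` Cyc N l z k" by (auto simp: Cyc_def poly_rep_class)
  qed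
  show "rep_cra ` Cyc N l z k \<subseteq> cyclotomic_in_crossed N l z k"
    by (auto simp: Cyc_def cyclotomic_in_crossed_def simp flip: poly_rep_class)
qed

lemma Cyc_memI:
  assumes "a \<in> carrier (FA N)" "daha_class N 1 k a \<in> cyclotomic_daha N l z 1 k" "free_cra N k a = L"
  shows "L \<in> Cyc N l z k"
  using assms by (auto simp: Cyc_def)

lemma Cyc_add: "L \<in> Cyc N l z k \<Longrightarrow> M \<in> Cyc N l z k \<Longrightarrow> L + M \<in> Cyc N l z k"
  unfolding Cyc_def mem_Collect_eq
proof (elim exE conjE)
  fix a b assume "L = free_cra N k a" "M = free_cra N k b" "a \<in> carrier (FA N)" "b \<in> carrier (FA N)"
    "daha_class N 1 k a \<in> cyclotomic_daha N l z 1 k" "daha_class N 1 k b \<in> cyclotomic_daha N l z 1 k"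
  then show "\<exists>a. L + M = free_cra N k a \<and> a \<in> carrier (FA N) \<and> daha_class N 1 k a \<in> cyclotomic_daha N l z 1 k"
    using daha_class.hom_add[of a N b 1 k]
    by (intro exI[of _ "a + b"]) (auto simp: cyclotomic_daha_eq free_cra_add intro: generate_ring.eng_add)
qed

lemma Cyc_mult: "L \<in> Cyc N l z k \<Longrightarrow> M \<in> Cyc N l z k \<Longrightarrow> L * M \<in> Cyc N l z k"
  unfolding Cyc_def mem_Collect_eq
proof (elim exE conjE)
  fix a b assume "L = free_cra N k a" "M = free_cra N k b" "a \<in> carrier (FA N)" "b \<in> carrier (FA N)"
    "daha_class N 1 k a \<in> cyclotomic_daha N l z 1 k" "daha_class N 1 k b \<in> cyclotomic_daha N l z 1 k"
  then show "\<exists>a. L * M = free_cra N k a \<and> a \<in> carrier (FA N) \<and> daha_class N 1 k a \<in> cyclotomic_daha N l z 1 k"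
    using daha_class.hom_mult[of a N b 1 k]
    by (intro exI[of _ "a * b"]) (auto simp: cyclotomic_daha_eq free_cra_mult intro: generate_ring.eng_mult)
qed

lemma Cyc_incl: "a \<in> carrier (FA N) \<Longrightarrow> daha_class N 1 k a \<in> cyc_gens N l z k \<Longrightarrow> free_cra N k a \<in> Cyc N l z k"
  by (rule Cyc_memI) (auto simp: cyclotomic_daha_eq intro: generate_ring.incl)

lemma Cyc_cC [simp]: "cC c \<in> Cyc N l z k"
  using Cyc_incl[of "scalar c" N k l z] by (auto simp: cyc_gens_def)

lemma Cyc_simple: "1 \<le> i \<Longrightarrow> i + 1 \<le> N \<Longrightarrow> cP (transpose i (i + 1)) \<in> Cyc N l z k"
  using Cyc_incl[of "s\<^sub>2 i (i+1)" N k l z] free_carrier_transpose[of i N "i + 1"] by (auto simp: cyc_gens_def)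

lemma Cyc_cY: "i \<in> {1..N} \<Longrightarrow> cY N k i \<in> Cyc N l z k"
  using Cyc_incl[of "gY i" N k l z] free_carrier_gen[of N "VarY i"] by (auto simp: cyc_gens_def)

lemma Cyc_cpi: "N \<ge> 1 \<Longrightarrow> cpi N \<in> Cyc N l z k"
  using Cyc_incl[of "pi_word N" N k l z] pi_word_carrier[of N] by (auto simp: cyc_gens_def daha_pi_eq free_cra_pi_word)

lemma Cyc_cpi_minus:
  assumes "N \<ge> 1" shows "cpi_minus N l z k \<in> Cyc N l z k"
proof -
  obtain a where "a \<in> carrier (FA N)" "daha_pi_minus N l z 1 k = daha_class N 1 k a" "free_cra N k a = cpi_minus N l z k"
    using daha_pi_minus_eq[OF assms, of l z k] by blast
  then show ?thesis using Cyc_incl[of a N k l z] by (auto simp: cyc_gens_def)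
qed

lemma Cyc_induct [consumes 2, case_names const simple Y pi pi_minus add mult]:
  assumes "L \<in> Cyc N l z k" and N: "N \<ge> 1"
    and const: "\<And>c. P (cC c)" and simple: "\<And>i. 1 \<le> i \<Longrightarrow> i + 1 \<le> N \<Longrightarrow> P (cP (transpose i (i + 1)))"
    and Y: "\<And>i. i \<in> {1..N} \<Longrightarrow> P (cY N k i)" and pi: "P (cpi N)" and pi_minus: "P (cpi_minus N l z k)"
    and add: "\<And>L M. P L \<Longrightarrow> P M \<Longrightarrow> P (L + M)" and mult: "\<And>L M. P L \<Longrightarrow> P M \<Longrightarrow> P (L * M)"
  shows "P L"
proof -
  have "\<exists>a\<in>carrier (FA N). C = daha_class N 1 k a \<and> P (free_cra N k a)"
    if "C \<in> generate_ring (daha N 1 k) (cyc_gens N l z k)" for C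
    using that
  proof (induction rule: generate_ring.induct)
    case one
    show ?case using daha_class.hom_one[of N 1 k] const[of 1] by (intro bexI[of _ 1]) auto
  next
    case (incl C)
    then consider (c) c where "C = daha_class N 1 k (scalar c)"
      | (s) i where "1 \<le> i" "i + 1 \<le> N" "C = daha_class N 1 k (s\<^sub>2 i (i+1))"
      | (Y) i where "i \<in> {1..N}" "C = daha_class N 1 k (gY i)"
      | (pi) "C = daha_class N 1 k (pi_word N)" | (pi_minus) "C = daha_pi_minus N l z 1 k"
      unfolding cyc_gens_def daha_pi_eq by blast
    then show ?case
    proof cases
      case c
      then show ?thesis using const by (intro bexI[of _ "scalar c"]) simp_all
    next
      case s
      then show ?thesis using simple[OF s(1,2)] free_carrier_transpose[of i N "i+1"]
        by (intro bexI[of _ "s\<^sub>2 i (i+1)"]) auto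
    next
      case Y
      then show ?thesis using \<open>\<And>i. i \<in> {1..N} \<Longrightarrow> P (cY N k i)\<close> by (intro bexI[of _ "gY i"]) (auto intro: free_carrier_gen)
    next
      case pi
      then show ?thesis using \<open>P (cpi N)\<close> pi_word_carrier[OF N] by (intro bexI[of _ "pi_word N"]) (simp_all add: free_cra_pi_word)
    next
      case pi_minus
      then show ?thesis using \<open>P (cpi_minus N l z k)\<close> daha_pi_minus_eq[OF N, of l z k] by metis
    qed
  next
    case (a_inv C)
    then obtain a where a: "a \<in> carrier (FA N)" "C = daha_class N 1 k a" "P (free_cra N k a)" by blast
    have "free_cra N k (- a) = cC (-1) * free_cra N k a" by (simp add: free_cra_minus rat_const_minus cM_minus)
    then have "P (free_cra N k (- a))" using mult[OF const[of "-1"] a(3)] by (simp del: rat_const_minus)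
    moreover have "\<ominus>\<^bsub>daha N 1 k\<^esub> C = daha_class N 1 k (- a)"
      using a daha_class.hom_a_inv[of a N 1 k] FA_a_inv[of a N] by simp
    ultimately show ?case using a by auto
  next
    case (eng_add C D)
    then obtain a b where "a \<in> carrier (FA N)" "C = daha_class N 1 k a" "P (free_cra N k a)"
      "b \<in> carrier (FA N)" "D = daha_class N 1 k b" "P (free_cra N k b)" by blast
    then show ?case using add daha_class.hom_add[of a N b 1 k] by (intro bexI[of _ "a + b"]) (auto simp: free_cra_add)
  next
    case (eng_mult C D)
    then obtain a b where "a \<in> carrier (FA N)" "C = daha_class N 1 k a" "P (free_cra N k a)"
      "b \<in> carrier (FA N)" "D = daha_class N 1 k b" "P (free_cra N k b)" by blast
    then show ?case using mult daha_class.hom_mult[of a N b 1 k] by (intro bexI[of _ "a * b"]) (auto simp: free_cra_mult)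
  qed
  moreover obtain a where a: "a \<in> carrier (FA N)" "L = free_cra N k a" "daha_class N 1 k a \<in> cyclotomic_daha N l z 1 k"
    using assms(1) by (auto simp: Cyc_def)
  ultimately obtain b where b: "b \<in> carrier (FA N)" "daha_class N 1 k a = daha_class N 1 k b" "P (free_cra N k b)"
    unfolding cyclotomic_daha_eq by blast
  \<comment> \<open>The induction over classes yields some representative \<open>b\<close> in place
    of \<open>a\<close>; equal classes have equal images.\<close>
  then have "rep_cra (free_cra N k a) = rep_cra (free_cra N k b)" using poly_rep_class a(1) by metis
  then show ?thesis using a b by (simp add: rep_cra_inject)
qed

section \<open>Twisted modules over the crossed product\<close>

lemma crossed_algebra_iff:
  "L \<in> crossed_algebra N \<longleftrightarrow> adm {1..N} L \<and> (\<forall>x. lookup L x \<in> RF N)"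
proof -
  have "(\<forall>x. lookup L x \<in> RF N) \<longleftrightarrow> (\<forall>x\<in>keys L. lookup L x \<in> RF N)"
    using RF_const[of 0 N] by (auto simp: in_keys_iff simp del: RF_const)
  then show ?thesis by (auto simp: crossed_algebra_def adm_def)
qed

lemma crossed_algebra_add: "L \<in> crossed_algebra N \<Longrightarrow> M \<in> crossed_algebra N \<Longrightarrow> L + M \<in> crossed_algebra N"
  by (simp add: crossed_algebra_iff adm_add lookup_add RF_ring)

lemma crossed_algebra_cterm:
  "f \<in> RF N \<Longrightarrow> w permutes {1..N} \<Longrightarrow> keys m \<subseteq> {1..N} \<Longrightarrow> cterm f m w \<in> crossed_algebra N"
  using RF_const[of 0 N] adm_cterm[of w "{1..N}" m f]
  by (simp add: crossed_algebra_iff) (simp add: cterm_def lookup_single when_def)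

lemma crossed_algebra_0 [simp]: "0 \<in> crossed_algebra N"
  using RF_const[of 0 N] by (simp add: crossed_algebra_iff del: RF_const)

lemma crossed_algebra_sum: "(\<And>x. x \<in> A \<Longrightarrow> f x \<in> crossed_algebra N) \<Longrightarrow> sum f A \<in> crossed_algebra N"
  by (induction A rule: infinite_finite_induct) (auto intro: crossed_algebra_add)

lemma crossed_algebra_induct [consumes 1, case_names zero cterm add]:
  assumes "L \<in> crossed_algebra N" and "P 0"
    and "\<And>f m w. f \<in> RF N \<Longrightarrow> w permutes {1..N} \<Longrightarrow> keys m \<subseteq> {1..N} \<Longrightarrow> P (cterm f m w)"
    and "\<And>L M. P L \<Longrightarrow> P M \<Longrightarrow> P (L + M)"
  shows "P L"
proof -
  have "P (\<Sum>k\<in>A. single k (lookup L k))"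
    if "finite A" "A \<subseteq> keys L" for A
    using that
  proof (induction A)
    case (insert k A)
    obtain w m where k: "k = (w, m)" by (cases k)
    then have "w permutes {1..N}" "keys m \<subseteq> {1..N}" "lookup L k \<in> RF N"
      using insert.prems assms(1) by (auto simp: crossed_algebra_iff adm_def)
    then have "P (single k (lookup L k))"
      using assms(3) unfolding k cterm_def by metis
    with insert show ?case using assms(4) by auto
  qed (use assms in simp)
  from this[of "keys L"] show ?thesis
    by (simp flip: poly_mapping_eq_sum_single)
qed

lemma crossed_algebra_fun_mult: "L \<in> crossed_algebra N \<Longrightarrow> h \<in> RF N \<Longrightarrow> fun_mult h L \<in> crossed_algebra N"
  by (induction rule: crossed_algebra_induct)
    (auto simp: fun_mult_add intro!: crossed_algebra_add crossed_algebra_cterm RF_ring)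

lemma crossed_algebra_partial_mult:
  assumes "L \<in> crossed_algebra N" "i \<in> {1..N}" shows "partial_mult i L \<in> crossed_algebra N"
  using assms(1)
proof (induction rule: crossed_algebra_induct)
  case (cterm f m w)
  moreover have "keys (m + single i 1) \<subseteq> {1..N}"
    using Poly_Mapping.keys_add[of m "single i 1"] cterm assms(2) by auto
  ultimately show ?case
    unfolding partial_mult_cterm by (intro crossed_algebra_add crossed_algebra_cterm RF_ring)
qed (auto simp: partial_mult_add crossed_algebra_add)

lemma crossed_algebra_perm_mult:
  assumes "L \<in> crossed_algebra N" "v permutes {1..N}" shows "perm_mult v L \<in> crossed_algebra N"
  using assms(1)
proof (induction rule: crossed_algebra_induct)
  case (cterm f m w)
  then show ?case using assms(2) keys_map_key_inv[OF assms(2), of m]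
    by (simp add: permutes_bij crossed_algebra_cterm permutes_compose RF_perm)
qed (use assms(2) in \<open>auto simp: perm_mult_add crossed_algebra_add permutes_bij\<close>)

lemma crossed_algebra_mult:
  assumes "L \<in> crossed_algebra N" "M \<in> crossed_algebra N" shows "L \<star> M \<in> crossed_algebra N"
  unfolding crossed_mult_def split_beta iterate_eq_foldr
proof (rule crossed_algebra_sum)
  fix x assume x: "x \<in> keys L"
  then have "case x of (w, m) \<Rightarrow> w permutes {1..N} \<and> keys m \<subseteq> {1..N}"
    using assms(1) unfolding crossed_algebra_iff adm_def by blast
  then have *: "fst x permutes {1..N}" "keys (snd x) \<subseteq> {1..N}" by (simp_all add: split_beta)
  have "foldr partial_mult xs (perm_mult (fst x) M) \<in> crossed_algebra N" if "set xs \<subseteq> {1..N}" for xs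
    using that * assms(2) by (induction xs) (auto intro: crossed_algebra_partial_mult crossed_algebra_perm_mult)
  moreover have "lookup L x \<in> RF N" using assms(1) unfolding crossed_algebra_iff by blast
  ultimately show "fun_mult (lookup L (fst x, snd x)) (foldr partial_mult (word (snd x)) (perm_mult (fst x) M)) \<in> crossed_algebra N"
    using *(2) by (intro crossed_algebra_fun_mult) simp_all
qed

section \<open>The crossed product with regular coefficients inside \<open>cra\<close>\<close>

definition CA :: "nat \<Rightarrow> cra set" where
  "CA N = {L. rep_cra L \<in> crossed_algebra N}"

lemma CA_add: "L \<in> CA N \<Longrightarrow> M \<in> CA N \<Longrightarrow> L + M \<in> CA N"
  by (simp add: CA_def plus_cra.rep_eq crossed_algebra_add)

lemma CA_mult: "L \<in> CA N \<Longrightarrow> M \<in> CA N \<Longrightarrow> L * M \<in> CA N"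
  by (simp add: CA_def times_cra.rep_eq crossed_algebra_mult)

lemma CA_cM: "f \<in> RF N \<Longrightarrow> cM f \<in> CA N"
  by (auto simp: CA_def cM.rep_eq crossed_fun_def permutes_id intro: crossed_algebra_cterm)

lemma CA_cP: "w permutes {1..N} \<Longrightarrow> cP w \<in> CA N"
  using RF_const[of 1 N]
  by (auto simp: CA_def cP.rep_eq crossed_perm_def permutes_bij intro!: crossed_algebra_cterm simp del: RF_const)

lemma CA_cD: "i \<in> {1..N} \<Longrightarrow> cD i \<in> CA N"
  using RF_const[of 1 N]
  by (auto simp: CA_def cD.rep_eq crossed_partial_def permutes_id intro!: crossed_algebra_cterm simp del: RF_const)

lemma CA_cC [simp]: "cC c \<in> CA N"
  by (rule CA_cM) simp

lemma CA_0 [simp]: "0 \<in> CA N" and CA_1 [simp]: "1 \<in> CA N"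
  using CA_cC[of 0 N] CA_cC[of 1 N] by (simp_all del: CA_cC)

lemma CA_uminus: "L \<in> CA N \<Longrightarrow> - L \<in> CA N"
  using CA_mult[OF CA_cC[of "-1"], of L N] by (simp add: rat_const_minus cM_minus del: CA_cC)

lemma CA_diff: "L \<in> CA N \<Longrightarrow> M \<in> CA N \<Longrightarrow> L - M \<in> CA N"
  using CA_add[OF _ CA_uminus] by simp

lemma CA_sum: "(\<And>x. x \<in> A \<Longrightarrow> f x \<in> CA N) \<Longrightarrow> sum f A \<in> CA N"
  by (induction A rule: infinite_finite_induct) (auto intro: CA_add)

lemma CA_prod_list: "(\<And>x. x \<in> set xs \<Longrightarrow> x \<in> CA N) \<Longrightarrow> prod_list xs \<in> CA N"
  by (induction xs) (auto intro: CA_mult)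

lemma CA_cDk:
  assumes "i \<in> {1..N}" shows "cDk N k i \<in> CA N"
  unfolding cDk_def divide_inverse
  by (intro CA_diff CA_sum CA_mult CA_cM CA_cD CA_cP CA_1 RF_ring RF_const RF_inverse_Xd permutes_transpose) (use assms in auto)

lemma CA_cY:
  assumes "i \<in> {1..N}" shows "cY N k i \<in> CA N"
  unfolding cY_def
  by (intro CA_diff CA_sum CA_mult CA_cM CA_cDk CA_cP RF_const permutes_transpose RF_poly polynomials_var) (use assms in auto)

lemma H_subset_CA: "L \<in> H N k \<Longrightarrow> L \<in> CA N"
proof (induction rule: H_induct)
  case (letter g)
  then show ?case
  proof (cases g)
    case (InvX i)
    then have "1 / rat_var i \<in> RF N"
      using LP_inverse_var[of i N] LP_subset_RF[of N] letter by (auto simp: divide_inverse)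
    then show ?thesis using InvX by (simp add: CA_cM)
  qed (auto intro!: CA_cP CA_cM CA_cY RF_poly)
qed (auto intro: CA_add CA_mult)

context twist_data
begin

definition tw :: "cra \<Rightarrow> ratfun \<Rightarrow> ratfun" where
  "tw L g = tact a \<chi> (rep_cra L) g"

lemma tw_add: "tw (L + M) g = tw L g + tw M g"
  by (simp add: tw_def plus_cra.rep_eq tact_add_left)

lemma tw_0: "tw 0 g = 0"
  by (simp add: tw_def zero_cra.rep_eq)

lemma tw_uminus: "tw (- L) g = - tw L g"
  using tw_add[of "- L" L g] by (simp add: tw_0 eq_neg_iff_add_eq_0)

lemma tw_diff: "tw (L - M) g = tw L g - tw M g"
  using tw_add[of L "- M" g] by (simp add: tw_uminus)

lemma tw_sum: "tw (sum f A) g = (\<Sum>x\<in>A. tw (f x) g)"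
  by (induction A rule: infinite_finite_induct) (simp_all add: tw_add tw_0)

lemma tw_cM: "tw (cM f) g = f * g"
  by (simp add: tw_def cM.rep_eq crossed_fun_def tact_cterm char_id)

lemma tw_1: "tw 1 g = g"
  using tw_cM[of 1 g] by simp

lemma tw_cM_mult: "tw (cM f * L) g = f * tw L g"
  by (simp add: tw_def rep_cM_mult tact_fun_mult[OF adm_rep_cra])

lemma tw_cP: "w permutes S \<Longrightarrow> tw (cP w) g = \<chi> w * rat_perm w g"
  by (simp add: tw_def cP.rep_eq crossed_perm_def tact_cterm permutes_bij)

lemma tw_cD: "tw (cD i) g = rat_deriv i g + a i * g"
  by (simp add: tw_def cD.rep_eq crossed_partial_def tact_cterm char_id)

lemma tw_mult: "adm S (rep_cra L) \<Longrightarrow> adm S (rep_cra M) \<Longrightarrow> tw (L * M) g = tw L (tw M g)"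
  by (simp add: tw_def times_cra.rep_eq tact_mult)

lemma tw_add_right: "tw L (f + g) = tw L f + tw L g"
  by (simp add: tw_def tact_add_right[OF adm_rep_cra])

lemma tw_0_right [simp]: "tw L 0 = 0"
  using tw_add_right[of L 0 0] by (metis add.right_neutral add_left_cancel)

end

lemma CA_adm: "L \<in> CA N \<Longrightarrow> adm {1..N} (rep_cra L)"
  by (simp add: CA_def crossed_algebra_iff)

lemma sign_cases: "(of_int (sign w) :: ratfun) = rat_const (of_int (sign w))"
  by (simp add: rat_const_of_int)

text \<open>The i-th logarithmic derivative of |Delta|^\<kappa>.\<close>

definition psi_form :: "nat \<Rightarrow> complex \<Rightarrow> nat \<Rightarrow> ratfun" where
  "psi_form N \<kappa> i = (\<Sum>j\<in>{1..N} - {i}. rat_const \<kappa> / Xd i j)"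

lemma psi_form_deriv:
  assumes "i \<in> {1..N}" "j \<in> {1..N}" "i \<noteq> j"
  shows "rat_deriv i (psi_form N \<kappa> j) = rat_const \<kappa> / (Xd i j) ^ 2"
proof -
  have "rat_deriv i (rat_const \<kappa> / Xd j m) = (if m = i then rat_const \<kappa> / (Xd i j) ^ 2 else 0)"
    if "m \<in> {1..N} - {j}" for m
    using that assms
    by (simp add: divide_inverse rat_deriv_scale rat_deriv_inverse rat_deriv_var power2_commute)
  then have "rat_deriv i (psi_form N \<kappa> j) = (\<Sum>m\<in>{1..N} - {j}. if m = i then rat_const \<kappa> / (Xd i j) ^ 2 else 0)"
    unfolding psi_form_def rat_deriv_sum by (intro sum.cong) auto
  then show ?thesis using assms by simp
qed

interpretation psi: twist_data "{1..N}" "psi_form N \<kappa>" "\<lambda>w. of_int (sign w)" for N \<kappa>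
proof
  show "rat_deriv i (psi_form N \<kappa> j) = rat_deriv j (psi_form N \<kappa> i)" if "i \<in> {1..N}" "j \<in> {1..N}" for i j
    using psi_form_deriv[OF that] psi_form_deriv[OF that(2,1)] by (cases "i = j") (auto simp: power2_commute)
  show "rat_perm w (psi_form N \<kappa> i) = psi_form N \<kappa> (w i)" if "w permutes {1..N}" "i \<in> {1..N}" for w i
    using permutes_bij[OF that(1)] sum_permutes_minus[OF that, of "\<lambda>j. rat_const \<kappa> / Xd (w i) j"]
    by (simp add: psi_form_def rat_perm_sum)
  show "(of_int (sign (v \<circ> w)) :: ratfun) = of_int (sign v) * of_int (sign w)"
    if "v permutes {1..N}" "w permutes {1..N}" for v w
    using that permutes_imp_permutation[of "{1..N}"] by (simp add: sign_compose)
qed (auto simp: sign_cases)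

interpretation phi: twist_data "{1..N}" "\<lambda>i. rat_const u / rat_var i" "\<lambda>_. 1" for N u
proof
  show "rat_deriv i (rat_const u / rat_var j) = rat_deriv j (rat_const u / rat_var i)" for i j
    by (cases "i = j") (simp_all add: divide_inverse rat_deriv_scale rat_deriv_inverse rat_deriv_var)
  show "\<exists>c. (1::ratfun) = rat_const c" by (metis rat_const_1)
qed (auto simp: permutes_bij)

lemma act_psi: "act (psi N \<kappa> (rep_cra L)) g = psi.tw N \<kappa> L g"
proof -
  have "(\<lambda>i. \<Sum>j\<in>{1..N} - {i}. rat_const \<kappa> / Xd i j) = psi_form N \<kappa>"
    by (simp add: psi_form_def fun_eq_iff)
  then show ?thesis unfolding psi_def psi.tw_def by (simp add: act_twist)
qed

lemma act_phi: "act (phi u (rep_cra L)) g = phi.tw u L g"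
  unfolding phi_def phi.tw_def by (rule act_twist[OF adm_rep_cra])

text \<open>The twist changes 1 - s into 1 + s in the reflection terms; the added 2k/(X_i - X_j)
  minus k(1 + s)/(X_i - X_j) equals k(1 - s)/(X_i - X_j), the reflection term with parameter -k.
  This fixes the exponent 2k.\<close>

lemma psi_tw_cDk:
  assumes i: "i \<in> {1..N}"
  shows "psi.tw N (2 * k) (cDk N k i) g = dk N (- k) i g"
proof -
  have "psi.tw N (2 * k) (cM (rat_const k / Xd i j) * (1 - cP (transpose i j))) g
      = rat_const (2 * k) / Xd i j * g - rat_const k * ddiff i j g" if "j \<in> {1..N} - {i}" for j
  proof -
    have "sign (transpose i j) = - 1" using that by (auto simp: sign_swap_id)
    then have "psi.tw N (2 * k) (cM (rat_const k / Xd i j) * (1 - cP (transpose i j))) g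
        = rat_const k / Xd i j * (g + rat_perm (transpose i j) g)"
      using psi.tw_cP[OF permutes_transpose[of i "{1..N}" j]] i that
      by (simp add: psi.tw_cM_mult psi.tw_diff psi.tw_1)
    moreover have "rat_const (2 * k) = rat_const k + rat_const k" by (simp only: mult_2 rat_const_add)
    ultimately show ?thesis
      by (simp add: ddiff_def add_divide_distrib diff_divide_distrib algebra_simps)
  qed
  then have "psi.tw N (2 * k) (cDk N k i) g = rat_deriv i g + psi_form N (2 * k) i * g
     - (\<Sum>j\<in>{1..N} - {i}. rat_const (2 * k) / Xd i j * g - rat_const k * ddiff i j g)"
    unfolding cDk_def psi.tw_diff psi.tw_sum psi.tw_cD by simp
  then show ?thesis
    by (simp add: dk_def psi_form_def sum_subtractf sum_distrib_right rat_const_minus sum_negf)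
qed

text \<open>The product of all variables is symmetric, so conjugation by its power affects the
  derivative only.\<close>

lemma phi_tw_cDk:
  assumes i: "i \<in> {1..N}"
  shows "phi.tw u (cDk N k i) g = dk N k i g + rat_const u / rat_var i * g"
proof -
  have "phi.tw u (cM (rat_const k / Xd i j) * (1 - cP (transpose i j))) g = rat_const k * ddiff i j g"
    if "j \<in> {1..N} - {i}" for j
    using that permutes_transpose[of i "{1..N}" j] i
    by (simp add: phi.tw_cM_mult phi.tw_diff phi.tw_1 phi.tw_cP ddiff_def)
  then show ?thesis unfolding cDk_def phi.tw_diff phi.tw_sum phi.tw_cD by (simp add: dk_def)
qed

lemma LP_dk: "i \<in> {1..N} \<Longrightarrow> g \<in> LP N \<Longrightarrow> dk N k i g \<in> LP N"
  unfolding dk_def by (intro LP_ring LP_const LP_ddiff) auto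

lemma polynomials_dk: "i \<in> {1..N} \<Longrightarrow> g \<in> polynomials N \<Longrightarrow> dk N k i g \<in> polynomials N"
  unfolding dk_def by (intro polynomials_diff polynomials_sum polynomials_mult polynomials_const polynomials_ddiff polynomials_deriv) auto

lemma LP_var: "i \<in> {1..N} \<Longrightarrow> rat_var i \<in> LP N"
  by (intro LP_poly polynomials_var)

lemma H_preserves_LP: "L \<in> H N k \<Longrightarrow> g \<in> LP N \<Longrightarrow> op L g \<in> LP N"
proof (induction arbitrary: g rule: H_induct)
  case (letter x)
  then show ?case
    using LP_inverse_var
    by (cases x)
      (auto simp: permutes_bij op_cY inverse_eq_divide[symmetric] divide_inverse LP_perm LP_dk LP_var transpose_permutes
        intro!: LP_ring LP_var LP_const LP_perm)
qed (auto simp: op_add op_mult intro: LP_ring)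

lemma H_preserves_psi:
  assumes "L \<in> H N k" "g \<in> LP N" shows "psi.tw N (2 * k) L g \<in> LP N"
proof -
  have tr: "psi.tw N (2 * k) (cP w) g \<in> LP N" if "w permutes {1..N}" "g \<in> LP N" for w g
  proof -
    have "psi.tw N (2 * k) (cP w) g = rat_const (of_int (sign w)) * rat_perm w g"
      by (simp only: psi.tw_cP[OF that(1)] rat_const_of_int)
    then show ?thesis using that by (simp only: LP_ring LP_const LP_perm)
  qed
  \<comment> \<open>Membership in \<open>CA\<close> is carried along because multiplicativity of the
    twisted action asks for admissibility over {1..N}.\<close>
  have "L \<in> CA N \<and> (\<forall>g\<in>LP N. psi.tw N (2 * k) L g \<in> LP N)"
    using assms(1)
  proof (induction rule: H_induct)
    case (letter x)
    then have "letter_cra N k x \<in> CA N" using H_letter H_subset_CA by blast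
    moreover have "psi.tw N (2 * k) (letter_cra N k x) g \<in> LP N" if g: "g \<in> LP N" for g
    proof (cases x)
      case (VarY i)
      then have i: "i \<in> {1..N}" using letter by simp
      have "psi.tw N (2 * k) (cY N k i) g = rat_var i * dk N (- k) i g
          - rat_const k * (\<Sum>j\<in>{1..<i}. psi.tw N (2 * k) (cP (transpose i j)) g)"
        unfolding cY_def psi.tw_diff psi.tw_cM_mult psi.tw_sum psi_tw_cDk[OF i] ..
      also have "\<dots> \<in> LP N"
        using i g by (intro LP_ring LP_const LP_var LP_dk tr permutes_transpose) auto
      finally show ?thesis by (simp add: VarY)
    qed (use letter tr g LP_inverse_var in \<open>auto simp: psi.tw_cM divide_inverse LP_var intro!: LP_ring\<close>)
    ultimately show ?case by blast
  next
    case (add L M)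
    then show ?case by (auto simp: psi.tw_add intro: LP_ring CA_add)
  next
    case (mult L M)
    then show ?case by (auto simp: psi.tw_mult CA_adm intro: CA_mult)
  qed (auto simp: psi.tw_cM intro: LP_ring)
  with assms(2) show ?thesis by blast
qed

section \<open>Expansion in Dunkl operators\<close>

definition Dw :: "nat \<Rightarrow> complex \<Rightarrow> nat list \<Rightarrow> cra" where
  "Dw N k xs = prod_list (map (cDk N k) xs)"

text \<open>The element with the coefficients of \<open>G\<close>, but with Dunkl operators in place
  of derivatives. They commute as well, so multi-indices still make sense.\<close>

definition dunkl_exp :: "nat \<Rightarrow> complex \<Rightarrow> crossed \<Rightarrow> cra" where
  "dunkl_exp N k G = (\<Sum>(w, m)\<in>keys G. cM (lookup G (w, m)) * Dw N k (word m) * cP w)"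

lemma dunkl_exp_cterm: "dunkl_exp N k (cterm f m w) = cM f * Dw N k (word m) * cP w"
  by (cases "f = 0") (simp_all add: dunkl_exp_def cterm_def)

lemma dunkl_exp_add: "dunkl_exp N k (G + G') = dunkl_exp N k G + dunkl_exp N k G'"
  unfolding dunkl_exp_def split_beta prod.collapse
  by (rule setsum_keys_plus_distrib) (simp_all add: cM_add distrib_right)

lemma Dw_mset_cong:
  assumes "set xs \<subseteq> {1..N}" "mset xs = mset ys" shows "Dw N k xs = Dw N k ys"
proof -
  have "Dw N k xs = foldr (\<lambda>i. (*) (cDk N k i)) xs 1" for xs
    by (induction xs) (simp_all add: Dw_def)
  moreover have "foldr (\<lambda>i. (*) (cDk N k i)) xs = foldr (\<lambda>i. (*) (cDk N k i)) ys"
  proof (rule foldr_mset_cong)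
    fix i j assume "i \<in> set xs" "j \<in> set xs"
    then have "cDk N k i * cDk N k j = cDk N k j * cDk N k i" using assms(1) by (intro cDk_commute) auto
    then show "(*) (cDk N k i) \<circ> (*) (cDk N k j) = (*) (cDk N k j) \<circ> (*) (cDk N k i)"
      by (simp add: fun_eq_iff flip: mult.assoc)
  qed (use assms in auto)
  ultimately show ?thesis by simp
qed

lemma Dw_Nil [simp]: "Dw N k [] = 1" and Dw_Cons: "Dw N k (x # xs) = cDk N k x * Dw N k xs"
  by (simp_all add: Dw_def)

lemma cP_Dw: "w permutes {1..N} \<Longrightarrow> set xs \<subseteq> {1..N} \<Longrightarrow> cP w * Dw N k xs = Dw N k (map w xs) * cP w"
proof (induction xs)
  case (Cons x xs)
  then have "cP w * (cDk N k x * Dw N k xs) = cDk N k (w x) * (cP w * Dw N k xs)"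
    using cP_cDk[of w N x k] by (metis mult.assoc insert_subset list.simps(15))
  then show ?case using Cons by (simp add: Dw_Cons mult.assoc)
qed simp

definition DE :: "nat \<Rightarrow> complex \<Rightarrow> cra set" where
  "DE N k = dunkl_exp N k ` crossed_algebra N"

lemma DE_add: "L \<in> DE N k \<Longrightarrow> M \<in> DE N k \<Longrightarrow> L + M \<in> DE N k"
  unfolding DE_def by (auto simp: image_iff crossed_algebra_add simp flip: dunkl_exp_add)

lemma DE_term:
  assumes "f \<in> RF N" "set xs \<subseteq> {1..N}" "w permutes {1..N}"
  shows "cM f * Dw N k xs * cP w \<in> DE N k"
proof -
  obtain m where m: "mset (word m) = mset xs" using word_induct_aux by blast
  then have "keys m \<subseteq> {1..N}" using assms(2) by (metis set_mset_mset set_word)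
  then have "cterm f m w \<in> crossed_algebra N" using assms by (intro crossed_algebra_cterm)
  moreover have "cM f * Dw N k xs * cP w = dunkl_exp N k (cterm f m w)"
    using Dw_mset_cong[OF assms(2) m[symmetric]] by (simp add: dunkl_exp_cterm)
  ultimately show ?thesis by (auto simp: DE_def)
qed

lemma DE_induct [consumes 1, case_names zero dterm add]:
  assumes "L \<in> DE N k" and "P 0"
    and "\<And>f xs w. f \<in> RF N \<Longrightarrow> set xs \<subseteq> {1..N} \<Longrightarrow> w permutes {1..N} \<Longrightarrow> P (cM f * Dw N k xs * cP w)"
    and "\<And>L M. P L \<Longrightarrow> P M \<Longrightarrow> P (L + M)"
  shows "P L"
proof -
  obtain G where "G \<in> crossed_algebra N" "L = dunkl_exp N k G" using assms(1) by (auto simp: DE_def)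
  moreover from this(1) have "P (dunkl_exp N k G)"
  proof (induction rule: crossed_algebra_induct)
    case zero then show ?case using assms(2) by (simp add: dunkl_exp_def)
  next
    case (cterm f m w) then show ?case using assms(3)[of f "word m" w] by (simp add: dunkl_exp_cterm)
  next
    case (add L M) then show ?case using assms(4) by (simp add: dunkl_exp_add)
  qed
  ultimately show ?thesis by simp
qed

lemma DE_0: "0 \<in> DE N k"
  unfolding DE_def by (rule image_eqI[of _ _ 0]) (simp_all add: dunkl_exp_def)

lemma DE_cM: "L \<in> DE N k \<Longrightarrow> f \<in> RF N \<Longrightarrow> cM f * L \<in> DE N k"
proof (induction rule: DE_induct)
  case (dterm g xs w)
  then show ?case using DE_term[of "f * g" N xs w k] by (simp add: cM_mult mult.assoc RF_ring)
qed (auto simp: DE_0 distrib_left intro: DE_add)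

lemma DE_uminus: "L \<in> DE N k \<Longrightarrow> - L \<in> DE N k"
  using DE_cM[OF _ RF_const[of "-1"], of L N k] by (simp add: rat_const_minus cM_minus del: RF_const)

lemma DE_sum: "(\<And>x. x \<in> A \<Longrightarrow> f x \<in> DE N k) \<Longrightarrow> sum f A \<in> DE N k"
  by (induction A rule: infinite_finite_induct) (auto intro: DE_add DE_0)

text \<open>A derivative is a Dunkl operator plus reflection terms, and a reflection passes through
  a word in Dunkl operators by permuting its letters, so the normal form is restored.\<close>

lemma DE_cD: "L \<in> DE N k \<Longrightarrow> i \<in> {1..N} \<Longrightarrow> cD i * L \<in> DE N k"
proof (induction rule: DE_induct)
  case (dterm f xs w)
  define T where "T = Dw N k xs * cP w"
  have T: "T \<in> DE N k" using DE_term[of 1 N xs w k] dterm RF_const[of 1 N] by (simp add: T_def del: RF_const)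
  have s: "cP (transpose i j) * T \<in> DE N k" if "j \<in> {1..N}" for j
  proof -
    have p: "transpose i j permutes {1..N}" using that dterm by (intro permutes_transpose)
    have "cP (transpose i j) * T = cM 1 * Dw N k (map (transpose i j) xs) * cP (transpose i j \<circ> w)"
      using cP_Dw[OF p dterm(2), of k] cP_comp[of "transpose i j" w] permutes_bij[OF dterm(3)]
      by (simp add: T_def mult.assoc[symmetric]) (simp add: mult.assoc)
    also have "\<dots> \<in> DE N k"
      using dterm p permutes_in_image[OF p] RF_const[of 1 N]
      by (intro DE_term permutes_compose) (auto simp del: RF_const)
    finally show ?thesis .
  qed
  have DT: "cDk N k i * T \<in> DE N k"
    using DE_term[of 1 N "i # xs" w k] dterm RF_const[of 1 N] by (simp add: T_def Dw_def mult.assoc del: RF_const)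
  have "cD i * T = cDk N k i * T + (\<Sum>j\<in>{1..N} - {i}. cM (rat_const k / Xd i j) * (T + - (cP (transpose i j) * T)))"
    by (simp add: cDk_def algebra_simps sum_distrib_right sum_subtractf sum.distrib sum_distrib_left)
  also have "\<dots> \<in> DE N k"
    using dterm(4) s T DT unfolding divide_inverse
    by (intro DE_add DE_sum DE_cM DE_uminus RF_ring RF_const RF_inverse_Xd) auto
  finally have "cM f * (cD i * T) + cM (rat_deriv i f) * T \<in> DE N k"
    using T dterm(1) by (intro DE_add DE_cM RF_ring)
  then show ?case by (simp add: T_def cD_cM distrib_right mult.assoc flip: cD_cM) (metis cD_cM distrib_right mult.assoc)
qed (auto simp: DE_0 distrib_left intro: DE_add)

lemma CA_subset_DE:
  assumes "L \<in> CA N" shows "L \<in> DE N k"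
proof -
  have "\<exists>M\<in>DE N k. rep_cra M = L'" if "L' \<in> crossed_algebra N" for L'
    using that
  proof (induction rule: crossed_algebra_induct)
    case zero
    then show ?case using DE_0 zero_cra.rep_eq by metis
  next
    case (add L M)
    then show ?case using DE_add plus_cra.rep_eq by metis
  next
    case (cterm f m w)
    have "prod_list (map cD xs) * cP w \<in> DE N k" if "set xs \<subseteq> {1..N}" for xs
      using that
    proof (induction xs)
      case Nil
      then show ?case using DE_term[of 1 N "[]" w k] cterm RF_const[of 1 N] by (simp add: Dw_def del: RF_const)
    qed (auto simp: mult.assoc intro!: DE_cD)
    then have "cM f * (prod_list (map cD (word m)) * cP w) \<in> DE N k" using cterm by (intro DE_cM) auto
    moreover have "rep_cra (cM f * (prod_list (map cD (word m)) * cP w)) = cterm f m w"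
    proof (rule act_eqI)
      have *: "op (prod_list (map cD xs)) g = foldr rat_deriv xs g" for xs g
        by (induction xs) (simp_all add: op_simps)
      show "act (rep_cra (cM f * (prod_list (map cD (word m)) * cP w))) g = act (cterm f m w) g" for g
        using cterm(2) by (simp add: op.rep_eq[symmetric] op_mult * act_cterm permutes_bij)
      show "adm UNIV (cterm f m w)" using cterm(2) by (auto intro!: adm_cterm simp: permutes_UNIV_iff permutes_bij)
    qed simp
    ultimately show ?case by blast
  qed
  from this[of "rep_cra L"] assms show ?thesis by (auto simp: CA_def rep_cra_inject)
qed

section \<open>Order of vanishing at a point\<close>

text \<open>The n-th power of the maximal ideal of the local ring at \<open>q\<close>, generated so
  that Leibniz rules can be applied by induction.\<close>

inductive van :: "(nat \<Rightarrow> complex) \<Rightarrow> nat \<Rightarrow> ratfun \<Rightarrow> bool" for q where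
  van_0: "f \<in> reg q \<Longrightarrow> van q 0 f"
| van_step: "g \<in> reg q \<Longrightarrow> val q g = 0 \<Longrightarrow> van q n f \<Longrightarrow> van q (Suc n) (g * f)"
| van_add: "van q n f \<Longrightarrow> van q n g \<Longrightarrow> van q n (f + g)"

lemma van_reg: "van q n f \<Longrightarrow> f \<in> reg q"
  by (induction rule: van.induct) (auto intro: reg_add reg_mult)

lemma van_val: "van q n f \<Longrightarrow> n > 0 \<Longrightarrow> val q f = 0"
  by (induction rule: van.induct) (auto simp: val_add val_mult van_reg)

lemma van_ideal: "van q n f \<Longrightarrow> h \<in> reg q \<Longrightarrow> van q n (h * f)"
proof (induction rule: van.induct)
  case (van_step g n f)
  then have "van q (Suc n) (g * (h * f))" by (intro van.van_step) auto
  then show ?case by (simp add: mult.left_commute)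
qed (auto simp: distrib_left intro: van.intros reg_mult)

lemma van_zero [simp]: "van q n 0"
proof (induction n)
  case (Suc n)
  then show ?case using van_step[of 0 q n 0] by simp
qed (simp add: van_0)

lemma van_SucD: "van q n f \<Longrightarrow> van q (n - 1) f"
proof (induction rule: van.induct)
  case (van_step g n f)
  then show ?case using van_ideal by simp
qed (auto intro: van.intros)

lemma van_mono:
  assumes "van q m f" "n \<le> m" shows "van q n f"
proof -
  have "van q (m - d) f" for d
  proof (induction d)
    case (Suc d)
    then show ?case using van_SucD[OF Suc] by (simp add: One_nat_def)
  qed (use assms in simp)
  from this[of "m - n"] show ?thesis using assms(2) by simp
qed

lemma van_minus: "van q n f \<Longrightarrow> van q n (- f)"
  using van_ideal[OF _ reg_const[of "-1"], of q n f] by (simp add: rat_const_minus del: reg_const)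

lemma van_diff: "van q n f \<Longrightarrow> van q n g \<Longrightarrow> van q n (f - g)"
  using van_add[of q n f "- g"] van_minus by simp

lemma van_sum: "(\<And>x. x \<in> A \<Longrightarrow> van q n (f x)) \<Longrightarrow> van q n (sum f A)"
  by (induction A rule: infinite_finite_induct) (auto intro: van_add)

lemma van_mult: "van q m f \<Longrightarrow> van q n g \<Longrightarrow> van q (m + n) (f * g)"
proof (induction rule: van.induct)
  case (van_step h m f)
  then have "van q (Suc (m + n)) (h * (f * g))" by (intro van.van_step) auto
  then show ?case by (simp add: mult.assoc)
qed (auto simp: distrib_right intro: van_ideal van.van_add)

lemma van_power: "g \<in> reg q \<Longrightarrow> val q g = 0 \<Longrightarrow> van q n (g ^ n)"
  by (induction n) (auto intro: van_0 van_step)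

lemma van_prod:
  "(\<And>x. x \<in> A \<Longrightarrow> van q (n x) (f x)) \<Longrightarrow> finite A \<Longrightarrow> van q (\<Sum>x\<in>A. n x) (\<Prod>x\<in>A. f x)"
  by (induction A rule: infinite_finite_induct) (auto intro: van_mult van_0)

lemma reg_deriv: "f \<in> reg q \<Longrightarrow> rat_deriv i f \<in> reg q"
  by (auto elim!: regE simp: rat_deriv_Fract ev_simps intro!: reg_Fract)

lemma comp_transpose_fix: "q a = q b \<Longrightarrow> q \<circ> transpose a b = q"
  by (auto simp: fun_eq_iff transpose_def)

text \<open>For polynomials the twisted Leibniz rule suffices. For an inverse 1/h the quotient has
  denominator h times its reflection, and the latter is a unit at \<open>q\<close> because the
  reflection fixes \<open>q\<close>.\<close>

lemma reg_ddiff: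
  assumes q: "q a = q b" and f: "f \<in> reg q" shows "ddiff a b f \<in> reg q"
proof (cases "a = b")
  case False
  let ?s = "transpose a b"
  have p: "ddiff a b (Fract p 1) \<in> reg q" for p
  proof (induction p rule: mpoly_induct)
    case (const c)
    then show ?case by (simp flip: rat_const_def)
  next
    case (var i)
    have "ddiff a b (rat_var i) = rat_const (if i = a then 1 else if i = b then - 1 else 0)"
      using False by (simp add: ddiff_var rat_const_minus)
    then show ?case by (simp flip: rat_var_def)
  next
    case (add p r)
    then show ?case unfolding Fract_add_1 ddiff_add by (rule reg_add)
  next
    case (mult p r)
    then show ?case unfolding Fract_mult_1 ddiff_mult
      by (intro reg_add reg_mult reg_perm) (auto intro: reg_poly)
  qed
  obtain A B where f: "f = Fract A B" "ev q B \<noteq> 0" "B \<noteq> 0" using regE[OF f] by metis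
  define h where "h = Fract B 1"
  have h: "h \<in> reg q" "val q h \<noteq> 0" "h \<noteq> 0" using f by (auto simp: h_def reg_poly val_poly Zero_fract_def eq_fract)
  have sh: "rat_perm ?s h \<in> reg q" "val q (rat_perm ?s h) \<noteq> 0"
    using h reg_perm[of ?s h q] val_perm[of ?s h q] comp_transpose_fix[of q, OF q] by auto
  then have "rat_perm ?s h \<noteq> 0" by auto
  then have "ddiff a b (inverse h) = - (ddiff a b h * inverse h * inverse (rat_perm ?s h))"
    using h False by (simp add: ddiff_def field_simps)
  moreover have "ddiff a b h \<in> reg q" using p by (simp add: h_def)
  then have "- (ddiff a b h * inverse h * inverse (rat_perm ?s h)) \<in> reg q"
    using h sh by (intro reg_minus reg_mult reg_inverse)
  ultimately have "ddiff a b (inverse h) \<in> reg q" by simp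
  moreover have "f = Fract A 1 * inverse h" using f by (simp add: h_def)
  then have "ddiff a b f = ddiff a b (Fract A 1) * inverse h + rat_perm ?s (Fract A 1) * ddiff a b (inverse h)"
    by (simp only: ddiff_mult)
  moreover have "rat_perm ?s (Fract A 1) \<in> reg q" by (intro reg_perm reg_poly) simp
  ultimately show ?thesis using reg_add[OF reg_mult[OF p reg_inverse(1)[OF h(1,2)]] reg_mult] by metis
qed (simp add: ddiff_def)

lemma van_deriv: "van q n f \<Longrightarrow> van q (n - 1) (rat_deriv i f)"
proof (induction rule: van.induct)
  case (van_step g n f)
  have "van q n (rat_deriv i g * f)" using van_step by (intro van_ideal reg_deriv)
  moreover have "van q n (g * rat_deriv i f)"
    using van_step.IH van_step.hyps van.van_step[of g q "n - 1" "rat_deriv i f"] van_ideal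
    by (cases n) auto
  ultimately show ?case by (simp add: rat_deriv_mult van_add)
qed (auto intro: van.intros reg_deriv)

text \<open>A reflection fixing \<open>q\<close> preserves its maximal ideal, so in the twisted
  Leibniz rule the divided difference behaves like a derivative.\<close>

lemma van_ddiff_fix: "van q n f \<Longrightarrow> q a = q b \<Longrightarrow> van q (n - 1) (ddiff a b f)"
proof (induction rule: van.induct)
  case (van_step g n f)
  let ?g = "rat_perm (transpose a b) g"
  have g: "?g \<in> reg q" "val q ?g = 0"
    using van_step reg_perm[of "transpose a b" g q] val_perm[of "transpose a b" g q] comp_transpose_fix[of q a b] by auto
  have "van q n (ddiff a b g * f)" using van_step by (intro van_ideal reg_ddiff)
  moreover have "van q n (?g * ddiff a b f)"
    using van_step g van.van_step[of ?g q "n - 1" "ddiff a b f"] van_ideal by (cases n) auto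
  ultimately show ?case by (simp add: ddiff_mult van_add)
qed (auto simp: ddiff_add intro: van.intros reg_ddiff)

lemma van_perm: "van q' n f \<Longrightarrow> q' = q \<circ> w \<Longrightarrow> bij w \<Longrightarrow> van q n (rat_perm w f)"
  proof (induction rule: van.induct)
  case (van_step g n f)
  then have "rat_perm w g \<in> reg q" "val q (rat_perm w g) = 0" "van q n (rat_perm w f)"
    using reg_perm[of w g q] val_perm[of w g q] by metis+
  then show ?case using van_step.prems by (simp add: van.van_step)
next
  case (van_0 f)
  then have "rat_perm w f \<in> reg q" using reg_perm[of w f q] by metis
  then show ?case by (rule van.van_0)
qed (auto intro: van.van_add)

text \<open>Off the hyperplane the denominator is a unit and no order is lost, but the value at
  \<open>q\<close> now also involves the reflected point; hence the second hypothesis.\<close>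

lemma van_ddiff_free:
  assumes "q a \<noteq> q b" "van q n f" "van (q \<circ> transpose a b) n f"
  shows "van q n (ddiff a b f)"
proof -
  have "inverse (Xd a b) \<in> reg q" using assms(1) by (intro reg_inverse reg_diff reg_var) (simp add: val_diff)
  moreover have "van q n (f - rat_perm (transpose a b) f)"
    using assms van_perm[OF assms(3) refl] by (intro van_diff) auto
  moreover have "ddiff a b f = inverse (Xd a b) * (f - rat_perm (transpose a b) f)"
    by (simp add: ddiff_def divide_inverse)
  ultimately show ?thesis using van_ideal by metis
qed

lemma mono_val_word: "mono_val x m = prod_list (map x (word m))"
proof -
  have "prod_list (map x (concat (map (\<lambda>i. replicate (n i) i) xs))) = (\<Prod>i\<in>set xs. x i ^ n i)" if "distinct xs" for n xs
    using that by (induction xs) (auto simp: prod_list_replicate)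
  from this[of "sorted_list_of_set (keys m)" "lookup m"]
  show ?thesis by (simp add: mono_val_def word_def)
qed

section \<open>Dunkl operators near a generic point of a reflection hyperplane\<close>

text \<open>The analogue of the factorial for the rank one Dunkl operator: with x = X_i - X_j, the
  t-th factor is the scalar by which x^t is sent to x^(t-1).\<close>

definition cfac :: "complex \<Rightarrow> nat \<Rightarrow> complex" where
  "cfac k n = (\<Prod>t=1..n. of_nat t - k * (1 - (-1) ^ t))"

text \<open>Genericity leaves a single reflection fixing \<open>p\<close>, so only one divided
  difference in the Dunkl operators is singular there.\<close>

locale generic_point =
  fixes N i j :: nat and p :: "nat \<Rightarrow> complex" and k :: complex
  assumes ij: "i \<in> {1..N}" "j \<in> {1..N}" "i \<noteq> j"
    and p_eq: "p i = p j"
    and p_neq: "a \<in> {1..N} \<Longrightarrow> b \<in> {1..N} \<Longrightarrow> p a = p b \<Longrightarrow> a \<noteq> b \<Longrightarrow> {a, b} = {i, j}"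
    and cfac_nonzero: "cfac k n \<noteq> 0"
begin

abbreviation s :: "nat \<Rightarrow> nat" where "s \<equiv> transpose i j"

text \<open>Permutations move the base point, so orders of vanishing are tracked along its whole
  orbit. \<open>Phi\<close> allows a lower order at one chosen point \<open>r\<close>,
  \<open>Psi\<close> treats all points alike.\<close>

definition orbit :: "(nat \<Rightarrow> complex) set" where
  "orbit = {p \<circ> w | w. w permutes {1..N}}"

definition Phi :: "(nat \<Rightarrow> complex) \<Rightarrow> nat \<Rightarrow> ratfun \<Rightarrow> bool" where
  "Phi r m f \<longleftrightarrow> (\<forall>q\<in>orbit. van q (if q = r then m else Suc m) f)"

definition Psi :: "nat \<Rightarrow> ratfun \<Rightarrow> bool" where
  "Psi m f \<longleftrightarrow> (\<forall>q\<in>orbit. van q m f)"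

lemma p_orbit: "p \<in> orbit"
  unfolding orbit_def by (auto intro!: exI[of _ id] permutes_id)

lemma orbit_comp: "q \<in> orbit \<Longrightarrow> w permutes {1..N} \<Longrightarrow> q \<circ> w \<in> orbit"
  unfolding orbit_def using permutes_compose by (fastforce simp: comp_assoc)

lemma orbit_transpose: "q \<in> orbit \<Longrightarrow> a \<in> {1..N} \<Longrightarrow> b \<in> {1..N} \<Longrightarrow> q \<circ> transpose a b \<in> orbit"
  by (intro orbit_comp permutes_transpose)

lemma s_perm: "s permutes {1..N}"
  using ij by (intro permutes_transpose)

lemma p_s: "p \<circ> s = p"
  by (rule comp_transpose_fix[of p, OF p_eq])

lemma Psi_imp_Phi: "Psi (Suc m) f \<Longrightarrow> Phi r m f"
  unfolding Psi_def Phi_def using van_mono[of _ "Suc m" f m] by auto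

lemma Phi_imp_Psi: "Phi r m f \<Longrightarrow> Psi m f"
  unfolding Psi_def Phi_def using van_mono[of _ "Suc m" f m] by (metis lessI less_imp_le)

lemma Psi_add: "Psi m f \<Longrightarrow> Psi m g \<Longrightarrow> Psi m (f + g)"
  by (simp add: Psi_def van_add)

lemma Phi_diff: "Phi r m f \<Longrightarrow> Phi r m g \<Longrightarrow> Phi r m (f - g)"
  by (simp add: Phi_def van_diff)

lemma van_ddiff_orbit:
  assumes "q \<in> orbit" "a \<in> {1..N}" "b \<in> {1..N}" "Psi (Suc m) f" "q a \<noteq> q b \<or> van q (Suc (Suc m)) f"
  shows "van q (Suc m) (ddiff a b f)"
proof (cases "q a = q b")
  case True
  then show ?thesis using assms van_ddiff_fix[of q "Suc (Suc m)" f a b] by simp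
next
  case False
  then show ?thesis using assms orbit_transpose[OF assms(1-3)] by (intro van_ddiff_free) (auto simp: Psi_def)
qed

lemma Psi_dk:
  assumes "Psi (Suc m) f" "a \<in> {1..N}" shows "Psi m (dk N k a f)"
  unfolding Psi_def
proof
  fix q assume q: "q \<in> orbit"
  have "van q m (ddiff a b f)" if "b \<in> {1..N}" for b
  proof (cases "q a = q b")
    case True
    then show ?thesis using assms q van_ddiff_fix[of q "Suc m" f a b] by (simp add: Psi_def)
  next
    case False
    then show ?thesis using van_ddiff_orbit[OF q assms(2) that assms(1)] van_mono by auto
  qed
  moreover have "van q m (rat_deriv a f)" using assms q van_deriv[of q "Suc m" f a] by (simp add: Psi_def)
  ultimately show "van q m (dk N k a f)"
    unfolding dk_def by (intro van_diff van_sum van_ideal) auto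
qed

lemma Phi_dk:
  assumes "Phi r (Suc m) f" "a \<in> {1..N}" shows "Phi r m (dk N k a f)"
  unfolding Phi_def
proof
  fix q assume q: "q \<in> orbit"
  have P: "Psi (Suc m) f" using assms Phi_imp_Psi by blast
  show "van q (if q = r then m else Suc m) (dk N k a f)"
  proof (cases "q = r")
    case True
    then show ?thesis using Psi_dk[OF P assms(2)] q by (simp add: Psi_def)
  next
    case False
    then have v: "van q (Suc (Suc m)) f" using assms(1)[unfolded Phi_def, rule_format, OF q] by simp
    then have "van q (Suc m) (rat_deriv a f)" using van_deriv[OF v, of a] by simp
    moreover have "van q (Suc m) (ddiff a b f)" if "b \<in> {1..N}" for b
      using van_ddiff_orbit[OF q assms(2) that P] v by simp
    ultimately show ?thesis using False
      unfolding dk_def by (auto intro!: van_diff van_sum van_ideal)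
  qed
qed

text \<open>The rank one model of a Dunkl operator at \<open>p\<close>: the reflections that move
  \<open>p\<close> to another point of its orbit are dropped.\<close>

definition loc :: "nat \<Rightarrow> ratfun \<Rightarrow> ratfun" where
  "loc a f = rat_deriv a f - rat_const k * (if a = i then ddiff i j f else if a = j then ddiff j i f else 0)"

lemma dk_minus_loc:
  assumes "a \<in> {1..N}"
  shows "dk N k a f - loc a f = - (\<Sum>b\<in>{1..N} - {a}. if {a, b} = {i, j} then 0 else rat_const k * ddiff a b f)"
proof -
  have "(\<Sum>b\<in>{1..N} - {a}. rat_const k * ddiff a b f)
      = (\<Sum>b\<in>{1..N} - {a}. if {a, b} = {i, j} then 0 else rat_const k * ddiff a b f)
        + (\<Sum>b\<in>{1..N} - {a}. if {a, b} = {i, j} then rat_const k * ddiff a b f else 0)"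
    unfolding sum.distrib[symmetric] by (rule sum.cong) auto
  moreover have "(\<Sum>b\<in>{1..N} - {a}. if {a, b} = {i, j} then rat_const k * ddiff a b f else 0)
      = rat_const k * (if a = i then ddiff i j f else if a = j then ddiff j i f else 0)"
  proof -
    consider "a = i" | "a = j" | "a \<noteq> i" "a \<noteq> j" by blast
    then show ?thesis
    proof cases
      case 1
      then have "(\<Sum>b\<in>{1..N} - {a}. if {a, b} = {i, j} then rat_const k * ddiff a b f else 0)
        = (\<Sum>b\<in>{1..N} - {a}. if b = j then rat_const k * ddiff i j f else 0)"
        using ij by (intro sum.cong) (auto simp: doubleton_eq_iff)
      then show ?thesis using ij 1 by simp
    next
      case 2
      then have "(\<Sum>b\<in>{1..N} - {a}. if {a, b} = {i, j} then rat_const k * ddiff a b f else 0)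
        = (\<Sum>b\<in>{1..N} - {a}. if b = i then rat_const k * ddiff j i f else 0)"
        using ij by (intro sum.cong) (auto simp: doubleton_eq_iff)
      then show ?thesis using ij 2 by simp
    next
      case 3
      then have "(\<Sum>b\<in>{1..N} - {a}. if {a, b} = {i, j} then rat_const k * ddiff a b f else 0) = 0"
        by (intro sum.neutral) (auto simp: doubleton_eq_iff)
      then show ?thesis using 3 by simp
    qed
  qed
  ultimately show ?thesis by (simp add: dk_def loc_def)
qed

text \<open>At \<open>p\<close> the dropped divided differences have invertible denominators, and at
  the other points of the orbit the function vanishes to one order more; so no order is
  lost.\<close>

lemma Psi_dk_minus_loc:
  assumes "Phi p (Suc m) f" "a \<in> {1..N}" shows "Psi (Suc m) (dk N k a f - loc a f)"
  unfolding Psi_def dk_minus_loc[OF assms(2)]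
proof (intro ballI van_minus van_sum)
  fix q b assume q: "q \<in> orbit" and b: "b \<in> {1..N} - {a}"
  show "van q (Suc m) (if {a, b} = {i, j} then 0 else rat_const k * ddiff a b f)"
  proof (cases "{a, b} = {i, j}")
    case False
    then have "q \<noteq> p \<or> q a \<noteq> q b" using p_neq[OF assms(2), of b] b by auto
    then have "q a \<noteq> q b \<or> van q (Suc (Suc m)) f"
      using assms(1)[unfolded Phi_def, rule_format, OF q] by (cases "q = p") auto
    then have "van q (Suc m) (ddiff a b f)"
      using van_ddiff_orbit[OF q assms(2)] Phi_imp_Psi[OF assms(1)] b by blast
    then show ?thesis by (simp add: van_ideal)
  qed simp
qed

lemma Phi_loc:
  assumes "Phi p (Suc m) f" "a \<in> {1..N}" shows "Phi p m (loc a f)"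
proof -
  have "loc a f = dk N k a f - (dk N k a f - loc a f)" by simp
  then show ?thesis
    using Phi_diff[OF Phi_dk[OF assms] Psi_imp_Phi[OF Psi_dk_minus_loc[OF assms]]] by simp
qed

lemma dk_diff: "dk N k a (f - g) = dk N k a f - dk N k a g"
  using op_diff_right[of "cDk N k a" f g] by (simp add: op_cDk)

lemma foldr_loc:
  assumes "set xs \<subseteq> {1..N}" "Phi p (n + length xs) f"
  shows "Phi p n (foldr loc xs f) \<and> Psi (Suc n) (foldr (dk N k) xs f - foldr loc xs f)"
  using assms
proof (induction xs arbitrary: n)
  case Nil
  then show ?case by (simp add: Psi_def)
next
  case (Cons a xs)
  let ?L = "foldr loc xs f" and ?D = "foldr (dk N k) xs f"
  have a: "a \<in> {1..N}" using Cons by simp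
  have IH: "Phi p (Suc n) ?L" "Psi (Suc (Suc n)) (?D - ?L)" using Cons.IH[of "Suc n"] Cons.prems by auto
  have "dk N k a ?D - loc a ?L = dk N k a (?D - ?L) + (dk N k a ?L - loc a ?L)"
    by (simp add: dk_diff)
  then have "Psi (Suc n) (dk N k a ?D - loc a ?L)"
    using Psi_add[OF Psi_dk[OF IH(2) a] Psi_dk_minus_loc[OF IH(1) a]] by (simp only:)
  then show ?case using Phi_loc[OF IH(1) a] by simp
qed

lemma foldr_dk_Phi:
  assumes "set xs \<subseteq> {1..N}" "Phi r (n + length xs) f"
  shows "Phi r n (foldr (dk N k) xs f)"
  using assms
proof (induction xs arbitrary: n)
  case (Cons a xs)
  then show ?case using Cons.IH[of "Suc n"] Phi_dk[of r n _ a] by auto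
qed simp

lemma loc_invariant_mult:
  assumes "rat_perm s B = B" shows "loc a (B * h) = B * loc a h + rat_deriv a B * h"
proof -
  have "rat_perm (transpose j i) B = B" using assms by (simp add: transpose_commute)
  then have "ddiff i j (B * h) = B * ddiff i j h" "ddiff j i (B * h) = B * ddiff j i h"
    using assms by (auto simp: ddiff_mult) (auto simp: ddiff_def)
  then show ?thesis by (auto simp: loc_def rat_deriv_mult algebra_simps)
qed

lemma van_loc: "van p (Suc n) f \<Longrightarrow> van p n (loc a f)"
  using van_deriv[of p "Suc n" f a] van_ddiff_fix[of p "Suc n" f i j] van_ddiff_fix[of p "Suc n" f j i] p_eq
  by (auto simp: loc_def intro!: van_diff van_ideal)

lemma foldr_loc_van: "van p (n + length xs) h \<Longrightarrow> van p n (foldr loc xs h)"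
proof (induction xs arbitrary: n)
  case (Cons a xs)
  then show ?case using Cons.IH[of "Suc n"] van_loc by auto
qed simp

lemma loc_add: "loc a (f + g) = loc a f + loc a g"
  by (simp add: loc_def ddiff_add algebra_simps)

lemma loc_scale: "loc a (rat_const c * f) = rat_const c * loc a f"
  by (simp add: loc_def ddiff_scale rat_deriv_scale right_diff_distrib mult.left_commute)

lemma loc_diff: "loc a (f - g) = loc a f - loc a g"
  using loc_add[of a "f - g" g] by simp

text \<open>Moving an s-invariant factor past \<open>loc\<close> costs its derivative, which is of
  higher order; on leading terms the factor acts as a scalar.\<close>

lemma foldr_loc_invariant_mult:
  assumes B: "rat_perm s B = B" "B \<in> reg p" and h: "van p (n + length xs) h"
  shows "van p (Suc n) (foldr loc xs (B * h) - B * foldr loc xs h)"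
  using h
proof (induction xs arbitrary: n)
  case (Cons a xs)
  let ?H = "foldr loc xs h" and ?E = "foldr loc xs (B * h) - B * foldr loc xs h"
  have "van p (Suc (Suc n)) ?E" using Cons.IH[of "Suc n"] Cons.prems by simp
  then have "van p (Suc n) (loc a ?E)" by (rule van_loc)
  moreover have "van p (Suc n) (rat_deriv a B * ?H)"
    using B foldr_loc_van[of "Suc n" xs h] Cons.prems by (intro van_ideal reg_deriv) auto
  moreover have "loc a (foldr loc xs (B * h)) - B * loc a ?H = loc a ?E + rat_deriv a B * ?H"
    by (simp add: loc_diff loc_invariant_mult[OF B(1)])
  ultimately show ?case by (simp add: van_add)
qed simp

section \<open>Divided powers adapted to the local Dunkl operators\<close>

definition hx :: "nat \<Rightarrow> ratfun" where
  "hx n = rat_const (inverse (cfac k n)) * Xd i j ^ n"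

text \<open>Slot j carries X_i + X_j, while slot i, through \<open>hx\<close>, carries X_i - X_j; in
  these coordinates s changes one sign only. The normalizations by \<open>cfac\<close> and the
  factorial let \<open>loc\<close> lower exponents without further constants.\<close>

definition hc :: "(nat \<Rightarrow>\<^sub>0 nat) \<Rightarrow> nat \<Rightarrow> ratfun" where
  "hc m c = rat_const (inverse (fact (lookup m c)))
     * (if c = j then rat_var i + rat_var j - rat_const (2 * p i) else rat_var c - rat_const (p c)) ^ lookup m c"

definition h :: "(nat \<Rightarrow>\<^sub>0 nat) \<Rightarrow> ratfun" where
  "h m = hx (lookup m i) * (\<Prod>c\<in>{1..N} - {i}. hc m c)"

lemma cfac_0: "cfac k 0 = 1"
  by (simp add: cfac_def)

lemma cfac_Suc: "cfac k (Suc n) = cfac k n * (of_nat (Suc n) - k * (1 - (-1) ^ Suc n))"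
  by (simp add: cfac_def prod.nat_ivl_Suc' mult.commute)

lemma hx_s: "rat_perm s (hx n) = rat_const ((-1) ^ n) * hx n"
proof -
  have "rat_perm s (Xd i j ^ n) = (- Xd i j) ^ n" by simp
  also have "\<dots> = (-1) ^ n * Xd i j ^ n" by (rule power_minus)
  finally show ?thesis by (simp add: hx_def rat_const_power rat_const_minus)
qed

lemma rat_deriv_power: "rat_deriv a (f ^ Suc n) = rat_const (of_nat (Suc n)) * f ^ n * rat_deriv a f"
  unfolding rat_const_of_nat by (induction n) (simp_all add: rat_deriv_mult algebra_simps)

lemma hx_loc:
  "rat_deriv i (hx n) - rat_const k * ddiff i j (hx n) = (if n = 0 then 0 else hx (n - 1))"
  "rat_deriv j (hx n) - rat_const k * ddiff j i (hx n) = (if n = 0 then 0 else - hx (n - 1))"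
proof -
  have e: "ddiff i j (hx n) = rat_const (1 - (-1) ^ n) * hx n / Xd i j"
    by (simp add: ddiff_def hx_s rat_const_diff left_diff_distrib)
  have ji: "ddiff j i f = - ddiff i j f" for f
    by (simp add: ddiff_def transpose_commute[of j i]) (metis minus_diff_eq minus_divide_right)
  have "rat_deriv i (hx n) - rat_const k * ddiff i j (hx n) = (if n = 0 then 0 else hx (n - 1))
     \<and> rat_deriv j (hx n) = - rat_deriv i (hx n)"
  proof (cases n)
    case 0
    have "ddiff i j 1 = 0" using ddiff_const[of i j 1] by simp
    then show ?thesis using 0 by (simp add: hx_def cfac_0)
  next
    case (Suc m)
    let ?c = "rat_const (inverse (cfac k (Suc m)))"
    have d: "rat_deriv i (hx n) = ?c * (rat_const (of_nat (Suc m)) * Xd i j ^ m)"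
      "rat_deriv j (hx n) = - (?c * (rat_const (of_nat (Suc m)) * Xd i j ^ m))"
      using ij by (simp_all add: Suc hx_def rat_deriv_scale rat_deriv_power rat_deriv_var del: power_Suc)
    have "hx n / Xd i j = ?c * Xd i j ^ m" using ij by (simp add: Suc hx_def)
    then have "ddiff i j (hx n) = ?c * (rat_const (1 - (-1) ^ Suc m) * Xd i j ^ m)"
      unfolding e times_divide_eq_right[symmetric] by (simp only: Suc mult.left_commute)
    then have "rat_deriv i (hx n) - rat_const k * ddiff i j (hx n)
        = ?c * rat_const (of_nat (Suc m) - k * (1 - (-1) ^ Suc m)) * Xd i j ^ m"
      unfolding d rat_const_diff[of "of_nat (Suc m)"] rat_const_mult[of k] by (simp add: algebra_simps del: of_nat_Suc power_Suc)
    also have "?c * rat_const (of_nat (Suc m) - k * (1 - (-1) ^ Suc m)) = rat_const (inverse (cfac k m))"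
      proof -
      have "inverse (c * d) * d = inverse c" if "c * d \<noteq> 0" for c d :: complex using that by (simp add: field_simps)
      then show ?thesis
        using cfac_nonzero[of "Suc m"] unfolding rat_const_mult[symmetric] rat_const_eq_iff cfac_Suc by blast
    qed
    finally show ?thesis using d by (simp add: Suc hx_def)
  qed
  then show "rat_deriv i (hx n) - rat_const k * ddiff i j (hx n) = (if n = 0 then 0 else hx (n - 1))"
    "rat_deriv j (hx n) - rat_const k * ddiff j i (hx n) = (if n = 0 then 0 else - hx (n - 1))"
    by (auto simp: ji eq_neg_iff_add_eq_0 eq_diff_eq diff_eq_eq add_ac)
      qed

lemma hc_deriv:
  assumes "c \<in> {1..N} - {i}"
  shows "rat_deriv a (hc m c) = (if a = c \<or> a = i \<and> c = j then
     if lookup m c = 0 then 0 else hc (m - single c 1) c else 0)"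
proof (cases "lookup m c")
  case 0
  then show ?thesis by (simp add: hc_def)
next
  case (Suc n)
  define l where "l = (if c = j then rat_var i + rat_var j - rat_const (2 * p i) else rat_var c - rat_const (p c))"
  have l: "rat_deriv a l = (if a = c \<or> a = i \<and> c = j then 1 else 0)"
    using assms ij by (auto simp: l_def rat_deriv_var)
  have "rat_const (inverse (fact (Suc n))) * rat_const (of_nat (Suc n)) = rat_const (inverse (fact n))"
    unfolding rat_const_mult[symmetric] by (simp add: field_simps del: of_nat_Suc)
  then have "rat_deriv a (hc m c) = rat_const (inverse (fact n)) * l ^ n * rat_deriv a l"
    unfolding hc_def l_def[symmetric] Suc rat_deriv_scale rat_deriv_power by (simp flip: mult.assoc)
  then show ?thesis using Suc l
    by (simp add: hc_def lookup_minus flip: l_def)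
qed

lemma hc_s: "c \<in> {1..N} - {i} \<Longrightarrow> rat_perm s (hc m c) = hc m c"
  using ij by (auto simp: hc_def transpose_def add.commute)

abbreviation e :: "nat \<Rightarrow> nat \<Rightarrow>\<^sub>0 nat" where "e a \<equiv> single a 1"

lemma prod_hc_deriv:
  assumes "c \<in> {1..N} - {i}" "a = c \<or> a = i \<and> c = j"
  shows "rat_deriv a (\<Prod>b\<in>{1..N} - {i}. hc m b) =
    (if lookup m c = 0 then 0 else (\<Prod>b\<in>{1..N} - {i}. hc (m - e c) b))"
proof -
  let ?A = "{1..N} - {i}"
  have z: "rat_deriv a (\<Prod>b\<in>A. hc m b) = 0" if "A \<subseteq> ?A - {c}" "finite A" for A
    using that(2,1)
  proof (induction A)
    case (insert b A)
    then have "rat_deriv a (hc m b) = 0" using hc_deriv[of b a m] assms by auto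
    then show ?case using insert by (simp add: rat_deriv_mult)
  qed simp
  have "(\<Prod>b\<in>?A - {c}. hc (m - e c) b) = (\<Prod>b\<in>?A - {c}. hc m b)"
    by (intro prod.cong) (auto simp: hc_def lookup_minus lookup_single when_def)
  then show ?thesis
    using assms hc_deriv[of c a m] z[of "?A - {c}"]
    by (simp add: prod.remove[of ?A c] rat_deriv_mult)
qed

lemma h_loc:
  assumes "a \<in> {1..N}"
  shows "loc a (h m) =
     (if a = i then (if lookup m i = 0 then 0 else h (m - e i)) + (if lookup m j = 0 then 0 else h (m - e j))
      else if a = j then (if lookup m j = 0 then 0 else h (m - e j)) - (if lookup m i = 0 then 0 else h (m - e i))
      else if lookup m a = 0 then 0 else h (m - e a))"
proof -
  let ?A = "{1..N} - {i}"
  define R where "R m = (\<Prod>c\<in>?A. hc m c)" for m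
  have Rs: "rat_perm s (R m) = R m" for m
    unfolding R_def by (subst rat_perm_prod) (auto intro!: prod.cong hc_s)
  have Ri: "R (m - e i) = R m"
    unfolding R_def by (intro prod.cong) (auto simp: hc_def lookup_minus lookup_single when_def)
  have hR: "h m = R m * hx (lookup m i)" for m by (simp add: h_def R_def)
  have L: "loc a (h m) = R m * loc a (hx (lookup m i)) + rat_deriv a (R m) * hx (lookup m i)"
    unfolding hR by (rule loc_invariant_mult[OF Rs])
  have li: "lookup (m - e c) i = lookup m i" if "c \<noteq> i" for c
    using that by (simp add: lookup_minus lookup_single)
  have hi: "h (m - e i) = R m * hx (lookup m i - 1)" by (simp add: hR Ri lookup_minus)
  have hcc: "h (m - e c) = R (m - e c) * hx (lookup m i)" if "c \<noteq> i" for c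
    using li[OF that] by (simp add: hR)
  consider "a = i" | "a = j" | "a \<noteq> i" "a \<noteq> j" by blast
  then show ?thesis
  proof cases
    case 1
    have "loc i (hx n) = (if n = 0 then 0 else hx (n - 1))" for n using hx_loc(1) by (simp add: loc_def)
    moreover have "rat_deriv i (R m) = (if lookup m j = 0 then 0 else R (m - e j))"
      unfolding R_def using prod_hc_deriv[of j i m] ij by simp
    ultimately show ?thesis unfolding 1 L[unfolded 1] using ij hi hcc[of j] by simp
  next
    case 2
    have "loc j (hx n) = (if n = 0 then 0 else - hx (n - 1))" for n using hx_loc(2) ij by (simp add: loc_def)
    moreover have "rat_deriv j (R m) = (if lookup m j = 0 then 0 else R (m - e j))"
      unfolding R_def using prod_hc_deriv[of j j m] ij by simp
    ultimately show ?thesis unfolding 2 L[unfolded 2] using ij hi hcc[of j] by simp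
  next
    case 3
    have "rat_deriv a (Xd i j ^ n) = 0" for n using 3 by (induction n) (auto simp: rat_deriv_mult rat_deriv_var)
    then have "loc a (hx n) = 0" for n using 3 by (simp add: loc_def hx_def rat_deriv_scale)
    moreover have "rat_deriv a (R m) = (if lookup m a = 0 then 0 else R (m - e a))"
      unfolding R_def using prod_hc_deriv[of a a m] assms 3 by simp
    ultimately show ?thesis unfolding L using 3 hcc[of a] by simp
  qed
qed

text \<open>The symbol of \<open>loc a\<close> in the slots of \<open>h\<close>: the sum and the
  difference for i and j reflect the coordinates X_i + X_j and X_i - X_j.\<close>

definition sg :: "nat \<Rightarrow> mpoly" where
  "sg a = (if a = i then mvar i + mvar j else if a = j then mvar j - mvar i else mvar a)"

definition hm :: "(nat \<Rightarrow>\<^sub>0 nat) \<Rightarrow> (nat \<Rightarrow>\<^sub>0 nat) \<Rightarrow> ratfun" where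
  "hm b d = (if \<forall>c. lookup d c \<le> lookup b c then h (b - d) else 0)"

text \<open>Contraction of a polynomial with the divided power of exponent \<open>b\<close>. It
  turns \<open>loc a\<close> into multiplication by \<open>sg a\<close>, which makes iterated local
  operators computable.\<close>

definition ctr :: "mpoly \<Rightarrow> (nat \<Rightarrow>\<^sub>0 nat) \<Rightarrow> ratfun" where
  "ctr Q b = (\<Sum>d\<in>keys Q. rat_const (lookup Q d) * hm b d)"

lemma ctr_add: "ctr (P + Q) b = ctr P b + ctr Q b"
  unfolding ctr_def by (rule setsum_keys_plus_distrib) (simp_all add: rat_const_add distrib_right)

lemma ctr_single: "ctr (single d c) b = rat_const c * hm b d"
  by (cases "c = 0") (simp_all add: ctr_def)

lemma ctr_0: "ctr 0 b = 0"
  by (simp add: ctr_def)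

lemma ctr_minus: "ctr (- P) b = - ctr P b"
  using ctr_add[of "- P" P b] by (simp add: ctr_0 eq_neg_iff_add_eq_0)

lemma ctr_diff: "ctr (P - Q) b = ctr P b - ctr Q b"
  using ctr_add[of P "- Q" b] by (simp add: ctr_minus)

lemma hm_step:
  "hm b (e a + d) = (if \<forall>c. lookup d c \<le> lookup b c then
     if lookup (b - d) a = 0 then 0 else h (b - d - e a) else 0)"
proof -
  have "(\<forall>c. lookup (e a + d) c \<le> lookup b c) \<longleftrightarrow>
      (\<forall>c. lookup d c \<le> lookup b c) \<and> lookup (b - d) a \<noteq> 0"
  proof (intro iffI conjI allI)
    assume *: "\<forall>c. lookup (e a + d) c \<le> lookup b c"
    show "lookup d c \<le> lookup b c" for c using *[rule_format, of c] by (simp add: lookup_add)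
    show "lookup (b - d) a \<noteq> 0"
      using *[rule_format, of a] by (simp add: lookup_add lookup_minus)
  next
    fix c assume *: "(\<forall>c. lookup d c \<le> lookup b c) \<and> lookup (b - d) a \<noteq> 0"
    then have "lookup d c \<le> lookup b c" by blast
    then show "lookup (e a + d) c \<le> lookup b c"
      using * by (auto simp: lookup_add lookup_minus lookup_single when_def)
  qed
  moreover have "b - (e a + d) = b - d - e a" by (simp add: diff_diff_add add.commute)
  ultimately show ?thesis by (simp add: hm_def)
qed

lemma loc_0: "loc a 0 = 0"
  using loc_diff[of a 0 0] by simp

lemma loc_ctr:
  assumes "a \<in> {1..N}" shows "loc a (ctr Q b) = ctr (sg a * Q) b"
proof (induction Q rule: poly_mapping_additive_induct)
  case 1
  then show ?case by (simp add: ctr_0 loc_0)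
next
  case (2 d c)
  have "loc a (hm b d) = (if a = i then hm b (e i + d) + hm b (e j + d)
      else if a = j then hm b (e j + d) - hm b (e i + d) else hm b (e a + d))"
  proof (cases "\<forall>c. lookup d c \<le> lookup b c")
    case True
    then have "hm b d = h (b - d)"
      "hm b (e a + d) = (if lookup (b - d) a = 0 then 0 else h (b - d - e a))" for a
      by (simp_all add: hm_step) (simp add: hm_def)
    then show ?thesis by (simp only: h_loc[OF assms])
  next
    case False
    have "hm b d = 0" unfolding hm_def by (simp only: False if_False)
    moreover have "hm b (e a + d) = 0" for a unfolding hm_step by (simp only: False if_False)
    ultimately show ?thesis by (simp add: loc_0)
  qed
  then show ?case
    by (simp add: ctr_single loc_scale sg_def distrib_right left_diff_distrib mult_single ctr_add ctr_diff distrib_left right_diff_distrib)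
next
  case (3 P Q)
  then show ?case by (simp add: ctr_add loc_add distrib_left)
qed

lemma foldr_loc_h: "set xs \<subseteq> {1..N} \<Longrightarrow> foldr loc xs (h b) = ctr (prod_list (map sg xs)) b"
proof (induction xs)
  case Nil
  have "ctr 1 b = h b" using ctr_single[of 0 1 b] by (simp add: hm_def)
  then show ?case by simp
qed (simp add: loc_ctr)

lemma hx_poly: "hx n \<in> polynomials N"
  unfolding hx_def using ij by (intro polynomials_mult polynomials_power polynomials_diff) auto

lemma hc_poly: "c \<in> {1..N} \<Longrightarrow> hc m c \<in> polynomials N"
  unfolding hc_def using ij by (intro polynomials_mult polynomials_power) (auto intro!: polynomials_diff polynomials_add)

lemma h_poly: "h m \<in> polynomials N"
  unfolding h_def using hx_poly hc_poly by (intro polynomials_mult polynomials_prod) auto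

lemma van_hx: "van p n (hx n)"
  unfolding hx_def using p_eq by (intro van_ideal van_power reg_diff) (auto simp: val_diff)

lemma van_hc: "van p (lookup m c) (hc m c)"
  unfolding hc_def using p_eq
  by (intro van_ideal van_power) (auto intro!: reg_diff reg_add simp: val_diff val_add reg_add)

lemma tdeg_split:
  assumes "keys m \<subseteq> {1..N}"
  shows "tdeg m = lookup m i + (\<Sum>c\<in>{1..N} - {i}. lookup m c)"
  using tdeg_superset[OF _ assms] ij by (simp add: sum.remove)

lemma van_h: "keys m \<subseteq> {1..N} \<Longrightarrow> van p (tdeg m) (h m)"
  unfolding h_def tdeg_split by (intro van_mult van_prod van_hx van_hc) auto

lemma val_h:
  assumes "keys m \<subseteq> {1..N}" shows "val p (h m) = (if m = 0 then 1 else 0)"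
proof (cases "m = 0")
  case True
  then have "h m = 1" by (simp add: h_def hx_def hc_def cfac_0)
  then show ?thesis using True by simp
next
  case False
  then have "tdeg m > 0" by (metis gr0I tdeg_eq_0_iff)
  then show ?thesis using van_val[OF van_h[OF assms]] False by simp
qed

text \<open>All divided powers except \<open>h 0 = 1\<close> vanish at \<open>p\<close>, so a single
  coefficient survives.\<close>

lemma val_ctr:
  assumes "keys b \<subseteq> {1..N}" shows "val p (ctr Q b) = lookup Q b"
proof -
  have hm: "hm b d \<in> reg p" "val p (hm b d) = (if d = b then 1 else 0)" for d
  proof -
    have k: "keys (b - d) \<subseteq> {1..N}"
      using assms by (auto simp: in_keys_iff lookup_minus)
    show "hm b d \<in> reg p" using polynomials_reg[OF h_poly] by (simp add: hm_def)
    have "b - d = 0 \<longleftrightarrow> d = b" if "\<forall>c. lookup d c \<le> lookup b c"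
    proof
      assume "b - d = 0"
      then have "lookup b c - lookup d c = 0" for c by (metis lookup_minus lookup_zero)
      then show "d = b" using that by (intro poly_mapping_eqI) (metis diff_is_0_eq le_antisym)
    qed simp
    then show "val p (hm b d) = (if d = b then 1 else 0)" using val_h[OF k] by (auto simp: hm_def)
  qed
  have "val p (ctr Q b) = (\<Sum>d\<in>keys Q. lookup Q d * (if d = b then 1 else 0))"
    unfolding ctr_def by (subst val_sum) (auto simp: val_mult hm intro!: reg_mult)
  then show ?thesis by (simp add: in_keys_iff if_distrib cong: if_cong split: if_splits)
qed

text \<open>Since \<open>B\<close> vanishes to high order at the other points of the orbit, the
  Dunkl operators may be replaced by the local ones; \<open>B\<close> then factors out by
  invariance, and the remaining contraction reads off a coefficient of the symbol.\<close>

lemma val_foldr_dk: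
  assumes B: "rat_perm s B = B" "B \<in> polynomials N" and van: "\<And>q. q \<in> orbit \<Longrightarrow> q \<noteq> p \<Longrightarrow> van q (Suc (tdeg b)) B"
    and b: "keys b \<subseteq> {1..N}" and xs: "set xs \<subseteq> {1..N}" "length xs = tdeg b"
  shows "val p (foldr (dk N k) xs (B * h b)) = val p B * lookup (prod_list (map sg xs)) b"
proof -
  have reg: "B \<in> reg q" "h b \<in> reg q" for q using B h_poly polynomials_reg by blast+
  have "Phi p (0 + length xs) (B * h b)"
    unfolding Phi_def xs
  proof (intro ballI)
    fix q assume q: "q \<in> orbit"
    show "van q (if q = p then 0 + tdeg b else Suc (0 + tdeg b)) (B * h b)"
      using van_ideal[OF van_h[OF b] reg(1)] van_ideal[OF van[OF q] reg(2)] by (auto simp: mult.commute)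
  qed
  from foldr_loc[OF xs(1) this] have "van p 1 (foldr (dk N k) xs (B * h b) - foldr loc xs (B * h b))"
    using p_orbit by (simp add: Psi_def One_nat_def)
  moreover have "van p 1 (foldr loc xs (B * h b) - B * foldr loc xs (h b))"
    using foldr_loc_invariant_mult[OF B(1) reg(1), of 0 xs "h b"] van_h[OF b] xs by (simp add: One_nat_def)
  ultimately have "van p 1 (foldr (dk N k) xs (B * h b) - B * foldr loc xs (h b))"
    using van_add by fastforce
  then have z: "val p (foldr (dk N k) xs (B * h b) - B * foldr loc xs (h b)) = 0"
    and r: "foldr (dk N k) xs (B * h b) - B * foldr loc xs (h b) \<in> reg p"
    using van_val van_reg by auto
  have l: "foldr loc xs (h b) \<in> reg p" using foldr_loc_van[of 0 xs "h b"] van_h[OF b] xs van_reg by auto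
  have "val p (foldr (dk N k) xs (B * h b))
      = val p ((foldr (dk N k) xs (B * h b) - B * foldr loc xs (h b)) + B * foldr loc xs (h b))" by simp
  also have "\<dots> = val p B * val p (foldr loc xs (h b))"
    using r l z reg by (subst val_add) (auto intro: reg_mult simp: val_mult)
  finally show ?thesis using val_ctr[OF b] foldr_loc_h[OF xs(1)] by simp
qed

lemma val_foldr_dk_vanish:
  assumes "Phi r n F" "set xs \<subseteq> {1..N}" "length xs \<le> n" "length xs < n \<or> r \<noteq> p"
  shows "val p (foldr (dk N k) xs F) = 0"
proof -
  have "Phi r (n - length xs) (foldr (dk N k) xs F)"
    using assms by (intro foldr_dk_Phi) auto
  then have "van p (if p = r then n - length xs else Suc (n - length xs)) (foldr (dk N k) xs F)"
    using p_orbit by (simp add: Phi_def)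
  then show ?thesis using assms(4) by (intro van_val) (auto split: if_splits)
qed

lemma Phi_perm:
  assumes "Phi r n F" "v permutes {1..N}" shows "Phi (r \<circ> inv_into UNIV v) n (rat_perm v F)"
  unfolding Phi_def
proof
  fix q assume q: "q \<in> orbit"
  have b: "bij v" using assms permutes_bij by blast
  have "q \<circ> v = r \<longleftrightarrow> q = r \<circ> inv_into UNIV v"
    using b by (metis bij_is_inj bij_is_surj comp_assoc comp_id inv_o_cancel surj_iff)
  then have "van (q \<circ> v) (if q = r \<circ> inv_into UNIV v then n else Suc n) F"
    using assms(1) orbit_comp[OF q assms(2)] by (auto simp: Phi_def)
  then show "van q (if q = r \<circ> inv_into UNIV v then n else Suc n) (rat_perm v F)"
    using van_perm[OF _ refl b] by blast
qed

text \<open>An index moved by v has the same coordinate as its image, so genericity forces the pair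
  to be i and j.\<close>

lemma stabilizer:
  assumes "v permutes {1..N}" "p \<circ> inv_into UNIV v = p" shows "v = id \<or> v = s"
proof -
  have b: "bij v" using assms permutes_bij by blast
  have pv: "p (v c) = p c" for c
    using fun_cong[OF assms(2), of "v c"] b by (simp add: bij_is_inj)
  have out: "v c = c" if "c \<notin> {1..N}" for c using assms(1) that by (simp add: permutes_def)
  have moved: "{v c, c} = {i, j}" if "v c \<noteq> c" for c
    using p_neq[of "v c" c] pv[of c] that out permutes_in_image[OF assms(1), of c] by blast
  show ?thesis
  proof (cases "v = id")
    case False
    then obtain c where c: "v c \<noteq> c" by (auto simp: fun_eq_iff)
    have "v i = j \<and> v j = i"
    proof -
      consider "c = i" "v i = j" | "c = j" "v j = i" using moved[OF c] by (auto simp: doubleton_eq_iff)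
      then show ?thesis
      proof cases
        case 1
        then have "v j \<noteq> j" using ij(3) b by (metis bij_is_inj inj_eq)
        then show ?thesis using 1 moved[of j] by (auto simp: doubleton_eq_iff)
      next
        case 2
        then have "v i \<noteq> i" using ij(3) b by (metis bij_is_inj inj_eq)
        then show ?thesis using 2 moved[of i] by (auto simp: doubleton_eq_iff)
      qed
    qed
    moreover have "v c = c" if "c \<noteq> i" "c \<noteq> j" for c using moved[of c] that by (auto simp: doubleton_eq_iff)
    ultimately have "v = s" by (auto simp: fun_eq_iff transpose_def)
    then show ?thesis ..
  qed simp
qed

end

section \<open>The degenerate DAHA is cut out by the two lattices\<close>

text \<open>The action on P is the case of parameter k and trivial character, that on the twisted
  lattice the case of -k and the sign character.\<close>

definition dunkl_act :: "nat \<Rightarrow> complex \<Rightarrow> ((nat \<Rightarrow> nat) \<Rightarrow> complex) \<Rightarrow> crossed \<Rightarrow> ratfun \<Rightarrow> ratfun" where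
  "dunkl_act N k \<epsilon> G f = (\<Sum>x\<in>keys G. lookup G x
     * (rat_const (\<epsilon> (fst x)) * foldr (dk N k) (word (snd x)) (rat_perm (fst x) f)))"

lemma foldr_dk_scale: "foldr (dk N k) xs (rat_const c * f) = rat_const c * foldr (dk N k) xs f"
  using op_scale[of "cDk N k _" c] by (induction xs) (simp_all add: op_cDk)

lemma foldr_dk_poly: "set xs \<subseteq> {1..N} \<Longrightarrow> f \<in> polynomials N \<Longrightarrow> foldr (dk N k) xs f \<in> polynomials N"
  by (induction xs) (auto intro: polynomials_dk)

lemma polynomials_prod_list: "(\<And>f. f \<in> set fs \<Longrightarrow> f \<in> polynomials N) \<Longrightarrow> prod_list fs \<in> polynomials N"
  by (induction fs) auto

text \<open>The additional set \<open>A'\<close> lets the sums for different permutations range over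
  one common set of multi-indices.\<close>

lemma sum_keys_fiber:
  fixes G :: crossed
  assumes "\<And>x. lookup G x = 0 \<Longrightarrow> g x = (0::complex)"
    and A: "A = {m. (u, m) \<in> keys G \<and> Q m} \<union> A'" "finite A'" "\<And>m. m \<in> A' \<Longrightarrow> Q m"
  shows "(\<Sum>x\<in>keys G. if fst x = u \<and> Q (snd x) then g x else 0) = (\<Sum>m\<in>A. g (u, m))"
proof -
  have "(\<Sum>x\<in>keys G. if fst x = u \<and> Q (snd x) then g x else 0)
      = (\<Sum>x\<in>{x \<in> keys G. fst x = u \<and> Q (snd x)}. g x)"
    by (intro sum.mono_neutral_cong_right) auto
  also have "\<dots> = (\<Sum>x\<in>Pair u ` {m. (u, m) \<in> keys G \<and> Q m}. g x)"
    by (intro sum.cong) (auto simp: image_iff)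
  also have "\<dots> = (\<Sum>m\<in>{m. (u, m) \<in> keys G \<and> Q m}. g (u, m))"
    by (subst sum.reindex) (auto simp: inj_on_def)
  also have "\<dots> = (\<Sum>m\<in>A. g (u, m))"
  proof (rule sum.mono_neutral_left)
    have "finite (Pair u -` keys G)" by (intro finite_vimageI) (auto simp: inj_on_def)
    then have "finite {m. (u, m) \<in> keys G \<and> Q m}" by (rule rev_finite_subset) auto
    then show "finite A" using A by simp
    show "\<forall>m\<in>A - {m. (u, m) \<in> keys G \<and> Q m}. g (u, m) = 0"
      using A assms(1) by (auto simp: in_keys_iff)
  qed (use A in auto)
  finally show ?thesis .
qed

section \<open>Leading terms at a generic point of a reflection hyperplane\<close>

context generic_point
begin

text \<open>Each other point q of the orbit is separated from \<open>p\<close> by a linear form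
  vanishing at q. Multiplying the form by its reflection makes it invariant, and the value at
  \<open>p\<close> stays nonzero because s fixes \<open>p\<close>.\<close>

lemma bump_exists:
  obtains B where "B \<in> polynomials N" "rat_perm s B = B" "val p B \<noteq> 0"
    "\<And>q. q \<in> orbit \<Longrightarrow> q \<noteq> p \<Longrightarrow> van q m B"
proof -
  have fin: "finite orbit"
  proof -
    have "orbit = (\<lambda>w. p \<circ> w) ` {w. w permutes {1..N}}" by (auto simp: orbit_def)
    then show ?thesis by (simp add: finite_permutations)
  qed
  have "\<exists>c\<in>{1..N}. q c \<noteq> p c" if "q \<in> orbit" "q \<noteq> p" for q
  proof -
    obtain w where w: "w permutes {1..N}" "q = p \<circ> w" using \<open>q \<in> orbit\<close> by (auto simp: orbit_def)
    have "q c = p c" if "c \<notin> {1..N}" for c using w that by (auto simp: permutes_def)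
    then show ?thesis using that by (metis ext)
  qed
  then obtain c where c: "\<And>q. q \<in> orbit \<Longrightarrow> q \<noteq> p \<Longrightarrow> c q \<in> {1..N} \<and> q (c q) \<noteq> p (c q)" by metis
  define l where "l q = (rat_var (c q) - rat_const (q (c q)))" for q
  define B where "B = (\<Prod>q\<in>orbit - {p}. (l q * rat_perm s (l q)) ^ m)"
  have l: "l q \<in> polynomials N" if "q \<in> orbit - {p}" for q
    using c that unfolding l_def by (intro polynomials_diff polynomials_var) auto
  have ls: "rat_perm s (l q) \<in> polynomials N" if "q \<in> orbit - {p}" for q
    using polynomials_perm[OF s_perm l[OF that]] .
  have vl: "val p (l q) = p (c q) - q (c q)" for q
    by (simp add: l_def val_diff)
  have vls: "val p (rat_perm s (l q)) = p (c q) - q (c q)" for q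
    using vl[of q] fun_cong[OF p_s, of "c q"] by (simp add: l_def val_diff)
  show thesis
  proof
    show "B \<in> polynomials N" unfolding B_def using l ls by (intro polynomials_prod polynomials_power polynomials_mult)
    show "rat_perm s B = B"
      unfolding B_def by (subst rat_perm_prod) (auto simp: mult.commute simp flip: rat_perm_comp)
    have "val p B = (\<Prod>q\<in>orbit - {p}. ((p (c q) - q (c q)) * (p (c q) - q (c q))) ^ m)"
      unfolding B_def using polynomials_reg[OF l, of _ p] polynomials_reg[OF ls, of _ p]
      by (subst val_prod) (auto simp: val_power val_mult vl vls reg_mult reg_power intro!: prod.cong)
    moreover have "p (c q) - q (c q) \<noteq> 0" if "q \<in> orbit - {p}" for q using c[of q] that by auto
    ultimately show "val p B \<noteq> 0" using fin by (simp add: prod_zero_iff)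
    fix q assume q: "q \<in> orbit" "q \<noteq> p"
    let ?R = "\<Prod>q\<in>orbit - {p} - {q}. (l q * rat_perm s (l q)) ^ m"
    have "B = (?R * rat_perm s (l q) ^ m) * l q ^ m"
      unfolding B_def using q fin by (subst prod.remove[of _ q]) (auto simp: power_mult_distrib mult_ac)
    moreover have "?R * rat_perm s (l q) ^ m \<in> reg q"
      using l ls q by (intro reg_mult reg_prod reg_power) (auto intro: polynomials_reg)
    moreover have "van q m (l q ^ m)" by (rule van_power) (auto simp: l_def val_diff intro: reg_diff)
    ultimately show "van q m B" using van_ideal[of q m "l q ^ m" "?R * rat_perm s (l q) ^ m"] by (simp only:)
  qed
qed

lemma h_s: "rat_perm s (h b) = rat_const ((-1) ^ lookup b i) * h b"
proof -
  have "rat_perm s (\<Prod>c\<in>{1..N} - {i}. hc b c) = (\<Prod>c\<in>{1..N} - {i}. hc b c)"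
    by (subst rat_perm_prod) (auto intro!: prod.cong hc_s)
  then show ?thesis by (simp add: h_def hx_s del: rat_perm_power)
qed

text \<open>The test function is the inverse of u applied to a bump times \<open>h b\<close>, so the
  component at w acts on that product through v = w u^(-1). At \<open>p\<close> only v = 1 and v = s
  and only terms of order exactly m survive; \<open>val_foldr_dk\<close> evaluates them, and s
  contributes the sign (-1)^(b_i).\<close>

lemma leading_equation:
  assumes G: "\<And>x. lookup G x \<in> polynomials N" "adm {1..N} G"
    and z: "\<And>f. f \<in> polynomials N \<Longrightarrow> val p (dunkl_act N k \<epsilon> G f) = 0"
    and top: "\<And>x. val p (lookup G x) \<noteq> 0 \<Longrightarrow> tdeg (snd x) \<le> m"
    and u: "u permutes {1..N}" and b: "keys b \<subseteq> {1..N}" "tdeg b = m"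
    and K: "K = {a. (\<exists>w. (w, a) \<in> keys G) \<and> tdeg a = m}"
  shows "(\<Sum>a\<in>K. (\<epsilon> u * val p (lookup G (u, a))
      + (-1) ^ lookup b i * \<epsilon> (s \<circ> u) * val p (lookup G (s \<circ> u, a)))
      * lookup (prod_list (map sg (word a))) b) = 0"
proof -
  obtain B where B: "B \<in> polynomials N" "rat_perm s B = B" "val p B \<noteq> 0"
    "\<And>q. q \<in> orbit \<Longrightarrow> q \<noteq> p \<Longrightarrow> van q (Suc m) B" using bump_exists by metis
  define F where "F = B * h b"
  define f where "f = rat_perm (inv_into UNIV u) F"
  define g where "g x = val p (lookup G x)" for x
  define S where "S a = lookup (prod_list (map sg (word a))) b" for a
  have Fpoly: "F \<in> polynomials N" unfolding F_def using B h_poly by auto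
  have ui: "inv_into UNIV u permutes {1..N}" using u by (rule permutes_inv)
  have f: "f \<in> polynomials N" unfolding f_def by (rule polynomials_perm[OF ui Fpoly])
  have PhiF: "Phi p m F"
    unfolding Phi_def
  proof
    fix q assume q: "q \<in> orbit"
    have "B \<in> reg p" "h b \<in> reg q" using B h_poly polynomials_reg by blast+
    then show "van q (if q = p then m else Suc m) F"
      using van_ideal[OF van_h[OF b(1)], of B] van_ideal[OF B(4)[OF q], of "h b"] b(2)
      by (auto simp: F_def mult.commute)
  qed
  have sF: "rat_perm s F = rat_const ((-1) ^ lookup b i) * F"
    by (simp add: F_def h_s B)
  have V1: "val p (foldr (dk N k) (word a) F) = val p B * S a" if "keys a \<subseteq> {1..N}" "tdeg a = m" for a
    unfolding F_def S_def using that B b by (intro val_foldr_dk) auto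
  have trm: "val p (lookup G x * (rat_const (\<epsilon> (fst x)) * foldr (dk N k) (word (snd x)) (rat_perm (fst x) f)))
    = (if fst x = u \<and> tdeg (snd x) = m then g x * \<epsilon> u * (val p B * S (snd x)) else 0)
    + (if fst x = s \<circ> u \<and> tdeg (snd x) = m
       then g x * \<epsilon> (s \<circ> u) * ((-1) ^ lookup b i * (val p B * S (snd x))) else 0)"
    (is "?l = ?r") and trm_reg: "lookup G x * (rat_const (\<epsilon> (fst x)) * foldr (dk N k) (word (snd x)) (rat_perm (fst x) f)) \<in> reg p"
    if "x \<in> keys G" for x
  proof -
    obtain w a where x: "x = (w, a)" by (cases x)
    have w: "w permutes {1..N}" "keys a \<subseteq> {1..N}" using G(2) that x by (auto simp: adm_def)
    define v where "v = w \<circ> inv_into UNIV u"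
    have v: "v permutes {1..N}" unfolding v_def by (rule permutes_compose[OF ui w(1)])
    have vu: "v \<circ> u = w" unfolding v_def using permutes_inv_o(2)[OF u] by (simp add: comp_assoc)
    have wf: "rat_perm w f = rat_perm v F"
      unfolding f_def v_def using ui w permutes_bij by (metis rat_perm_comp)
    have su: "s \<circ> u \<noteq> u"
    proof
      assume "s \<circ> u = u"
      then have "s (u (inv_into UNIV u i)) = u (inv_into UNIV u i)" by (metis comp_apply)
      then show False using ij permutes_inverses(1)[OF u] by simp
    qed
    have r: "lookup G x \<in> reg p" using G(1) polynomials_reg by blast
    have ff: "foldr (dk N k) (word a) (rat_perm v F) \<in> polynomials N"
      using w v Fpoly by (intro foldr_dk_poly polynomials_perm) auto
    then show "lookup G x * (rat_const (\<epsilon> (fst x)) * foldr (dk N k) (word (snd x)) (rat_perm (fst x) f)) \<in> reg p"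
      using r polynomials_reg by (auto simp: x wf intro!: reg_mult)
    have l: "?l = g x * (\<epsilon> w * val p (foldr (dk N k) (word a) (rat_perm v F)))"
      using r ff polynomials_reg by (simp add: x wf val_mult reg_mult g_def)
    \<comment> \<open>Terms of higher order have coefficients vanishing at \<open>p\<close>, those
      of lower order do not exhaust the order of vanishing, and v outside the stabilizer moves the
      point of lowest order away from \<open>p\<close>.\<close>
    consider "tdeg a > m" | "tdeg a < m" | "tdeg a = m" "p \<circ> inv_into UNIV v \<noteq> p" | "tdeg a = m" "v = id" | "tdeg a = m" "v = s"
      using stabilizer[OF v] by (metis linorder_neqE_nat)
    then show "?l = ?r"
    proof cases
      case 1
      then have "g x = 0" using top[of x] x by (auto simp: g_def)
      then show ?thesis using l 1 x by simp
    next
      case 2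
      then show ?thesis unfolding l using val_foldr_dk_vanish[OF Phi_perm[OF PhiF v], of "word a"] w x by simp
    next
      case 3
      have "p \<circ> inv_into UNIV s = p" using p_s by (simp add: inv_swap_id)
      then have "v \<noteq> id" "v \<noteq> s" using 3 by auto
      then have "w \<noteq> u" "w \<noteq> s \<circ> u"
        unfolding v_def using permutes_inv_o(1)[OF u] by (auto simp: comp_assoc)
      then show ?thesis unfolding l using val_foldr_dk_vanish[OF Phi_perm[OF PhiF v], of "word a"] w x 3 by simp
    next
      case 4
      then have "w = u" using vu by simp
      then show ?thesis unfolding l using 4 V1[OF w(2)] x su by simp
    next
      case 5
      then have "w = s \<circ> u" using vu by simp
      moreover have "val p (foldr (dk N k) (word a) (rat_perm v F)) = (-1) ^ lookup b i * (val p B * S a)"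
        unfolding 5 sF foldr_dk_scale
        using V1[OF w(2)] 5 polynomials_reg[OF foldr_dk_poly[OF _ Fpoly, of "word a" k]] w by (simp add: val_mult)
      ultimately show ?thesis unfolding l using 5 x su by simp
    qed
  qed
  have finK: "finite K"
    unfolding K by (rule finite_subset[of _ "snd ` keys G"]) force+
  have sub: "{a. (w, a) \<in> keys G \<and> tdeg a = m} \<union> K = K" for w unfolding K by auto
  have "0 = val p (dunkl_act N k \<epsilon> G f)" using z[OF f] by simp
  also have "\<dots> = (\<Sum>x\<in>keys G. val p (lookup G x * (rat_const (\<epsilon> (fst x)) * foldr (dk N k) (word (snd x)) (rat_perm (fst x) f))))"
    unfolding dunkl_act_def by (rule val_sum) (rule trm_reg)
  also have "\<dots> = (\<Sum>x\<in>keys G. (if fst x = u \<and> tdeg (snd x) = m then g x * \<epsilon> u * (val p B * S (snd x)) else 0))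
    + (\<Sum>x\<in>keys G. (if fst x = s \<circ> u \<and> tdeg (snd x) = m
       then g x * \<epsilon> (s \<circ> u) * ((-1) ^ lookup b i * (val p B * S (snd x))) else 0))"
    unfolding sum.distrib[symmetric] by (rule sum.cong) (use trm in auto)
  also have "(\<Sum>x\<in>keys G. (if fst x = u \<and> tdeg (snd x) = m then g x * \<epsilon> u * (val p B * S (snd x)) else 0))
    = (\<Sum>a\<in>K. g (u, a) * \<epsilon> u * (val p B * S (snd (u, a))))"
    by (rule sum_keys_fiber[where A' = K]) (use finK sub K in \<open>auto simp: g_def\<close>)
  also have "(\<Sum>x\<in>keys G. (if fst x = s \<circ> u \<and> tdeg (snd x) = m
       then g x * \<epsilon> (s \<circ> u) * ((-1) ^ lookup b i * (val p B * S (snd x))) else 0))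
    = (\<Sum>a\<in>K. g (s \<circ> u, a) * \<epsilon> (s \<circ> u) * ((-1) ^ lookup b i * (val p B * S (snd (s \<circ> u, a)))))"
    by (rule sum_keys_fiber[where A' = K]) (use finK sub K in \<open>auto simp: g_def\<close>)
  finally have "0 = val p B * (\<Sum>a\<in>K. (\<epsilon> u * g (u, a) + (-1) ^ lookup b i * \<epsilon> (s \<circ> u) * g (s \<circ> u, a)) * S a)"
    by (simp add: sum_distrib_left sum.distrib[symmetric] algebra_simps)
  then show ?thesis using B(3) by (simp add: g_def S_def)
qed

end


lemma cfac_half_integer:
  assumes "k - 1 / 2 \<notin> \<int>" shows "cfac k n \<noteq> 0" "cfac (- k) n \<noteq> 0"
proof -
  have "of_nat t - r * k * (1 - (-1) ^ t) \<noteq> 0" if t: "t \<ge> 1" and r: "r = 1 \<or> r = -1" for t :: nat and r :: complex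
  proof (cases "even t")
    case False
    then obtain b where b: "t = 2 * b + 1" by (metis oddE)
    show ?thesis
    proof
      assume "of_nat t - r * k * (1 - (-1) ^ t) = 0"
      then have "2 * r * k = of_nat t" using False by simp
      then have "2 * r * r * k = r * of_nat t" by (metis mult.assoc mult.commute)
      moreover have "r * r = 1" using r by auto
      ultimately have "2 * k = r * of_nat t" by (simp add: mult.assoc)
      then have "k = r * of_nat t / 2" by (metis nonzero_mult_div_cancel_left zero_neq_numeral)
      moreover have "r * of_nat t / 2 - 1 / 2 \<in> \<int>"
      proof (cases "r = 1")
        case True
        then have "r * of_nat t / 2 - 1 / 2 = of_nat b" by (simp add: b field_simps)
        then show ?thesis by simp
      next
        case False
        then have "r * of_nat t / 2 - 1 / 2 = - of_nat (b + 1)" using r by (simp add: b field_simps)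
        then show ?thesis by (metis Ints_minus Ints_of_nat)
      qed
      ultimately have "k - 1 / 2 \<in> \<int>" by metis
      then show False using assms by contradiction
    qed
  qed (use t in simp)
  from this[of _ 1] this[of _ "-1"] show "cfac k n \<noteq> 0" "cfac (- k) n \<noteq> 0"
    by (simp_all add: cfac_def)
qed

text \<open>On the diagonal, parametrized by substituting X_j for X_i, the product of g with all
  forms that must not vanish is a nonzero polynomial; a positive natural point outside its zeros
  will do.\<close>

lemma generic_diagonal_point:
  assumes ij: "i \<in> {1..N}" "j \<in> {1..N}" "i \<noteq> j" and g: "g \<in> polynomials N" "q0 i = q0 j" "val q0 g \<noteq> 0"
  shows "\<exists>p. p i = p j \<and> (\<forall>c\<in>{1..N}. p c \<noteq> 0) \<and> val p g \<noteq> 0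
    \<and> (\<forall>a\<in>{1..N}. \<forall>b\<in>{1..N}. p a = p b \<longrightarrow> a \<noteq> b \<longrightarrow> {a, b} = {i, j})"
proof -
  obtain r where r: "g = Fract r 1" using g(1) polynomials_iff by blast
  define st where "st n = (if n = i then mvar j else mvar n)" for n
  define A where "A = {x \<in> {1..N} \<times> {1..N}. fst x \<noteq> snd x \<and> {fst x, snd x} \<noteq> {i, j}}"
  define Q where "Q = msubst st r * (\<Prod>c\<in>{1..N}. mvar c) * (\<Prod>x\<in>A. st (fst x) - st (snd x))"
  have "(\<lambda>n. ev q0 (st n)) = q0" using g(2) by (auto simp: st_def ev_simps fun_eq_iff)
  then have "ev q0 (msubst st r) \<noteq> 0" using g(3) r by (simp add: ev_msubst val_poly)
  then have "msubst st r \<noteq> 0" by (auto simp: ev_simps)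
  moreover have "mvar c \<noteq> 0" for c by (metis lookup_single_eq lookup_zero one_neq_zero)
  moreover have "st (fst x) - st (snd x) \<noteq> 0" if "x \<in> A" for x
    using that mvar_diff_nonzero[of "if fst x = i then j else fst x" "if snd x = i then j else snd x"]
    by (auto simp: A_def st_def split: if_splits)
  moreover have "finite A" unfolding A_def by simp
  ultimately have "Q \<noteq> 0" unfolding Q_def by (simp add: prod_zero_iff)
  then obtain x :: "nat \<Rightarrow> nat" where x: "\<And>i. x i > 0" "ev (\<lambda>i. of_nat (x i)) Q \<noteq> 0" using mpoly_zeroI by blast
  define p where "p n = ev (\<lambda>i. of_nat (x i)) (st n)" for n
  have p: "p n = of_nat (x (if n = i then j else n))" for n by (simp add: p_def st_def ev_simps)
  have ne: "ev p r \<noteq> 0" "(\<Prod>x\<in>A. p (fst x) - p (snd x)) \<noteq> 0"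
    using x(2) by (auto simp: Q_def ev_simps ev_msubst p_def[symmetric])
  show ?thesis
  proof (intro exI[of _ p] conjI ballI impI)
    show "p i = p j" by (simp add: p)
    show "p c \<noteq> 0" for c using x(1) by (simp add: p)
    show "val p g \<noteq> 0" using ne by (simp add: r val_poly)
    show "{a, b} = {i, j}" if ab: "a \<in> {1..N}" "b \<in> {1..N}" "p a = p b" "a \<noteq> b" for a b
    proof (rule ccontr)
      assume "{a, b} \<noteq> {i, j}"
      then have "(a, b) \<in> A" using ab by (simp add: A_def)
      then have "(\<Prod>x\<in>A. p (fst x) - p (snd x)) = 0"
        using \<open>finite A\<close> ab(3) by (intro prod_zero bexI[of _ "(a, b)"]) auto
      then show False using ne by simp
    qed
  qed
qed

context generic_point
begin

lemma sg_word_lookup: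
  "lookup (prod_list (map sg xs)) b \<noteq> 0 \<Longrightarrow> tdeg b = length xs \<and> keys b \<subseteq> set xs \<union> {i, j}"
proof (induction xs arbitrary: b)
  case Nil
  then show ?case by (auto simp: lookup_one when_def split: if_splits)
next
  case (Cons a xs)
  then have "b \<in> keys (sg a * prod_list (map sg xs))" by (simp add: in_keys_iff)
  then obtain c d where cd: "b = c + d" "c \<in> keys (sg a)" "d \<in> keys (prod_list (map sg xs))"
    using keys_mult by blast
  then have "tdeg d = length xs" "keys d \<subseteq> set xs \<union> {i, j}" using Cons.IH by (auto simp: in_keys_iff)
  moreover have "c = e a \<or> c = e i \<or> c = e j"
    using cd(2) Poly_Mapping.keys_add[of "mvar i" "mvar j"] keys_diff[of "mvar j" "mvar i"] by (auto simp: sg_def split: if_splits)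
  ultimately show ?case using cd(1) Poly_Mapping.keys_add[of c d] by auto
qed

text \<open>The symbols form an invertible linear change of variables; \<open>t\<close> is its
  inverse.\<close>

lemma msubst_sg_inject:
  assumes "msubst sg R = 0" shows "R = 0"
proof -
  define t where "t c = (if c = i then mconst (1/2) * (mvar i - mvar j)
    else if c = j then mconst (1/2) * (mvar i + mvar j) else mvar c)" for c
  have two: "mconst (1/2) * x + mconst (1/2) * x = x" for x :: mpoly
    by (simp add: distrib_right[symmetric] single_add[symmetric])
  have "mconst (1/2) * (mvar i - mvar j) + mconst (1/2) * (mvar i + mvar j) = mvar i"
    "mconst (1/2) * (mvar i + mvar j) - mconst (1/2) * (mvar i - mvar j) = mvar j"
    using two[of "mvar i"] two[of "mvar j"] by (simp_all add: algebra_simps)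
  then have "msubst t (sg c) = mvar c" for c
    using ij by (simp add: sg_def t_def msubst_simps)
  then have "msubst t (msubst sg R) = R" by (simp add: msubst_msubst)
  then show ?thesis using assms by (simp add: msubst_simps)
qed

end

text \<open>If a coefficient survived on the diagonal, take a generic point \<open>p\<close> where
  it is nonzero and the leading terms there. The lattice for k controls a sum, and the one for -k
  the corresponding difference, of the components at u and at s u; so the component at u alone pairs
  to zero with all divided powers, and its symbol vanishes.\<close>

lemma dunkl_lattice_key:
  assumes G: "\<And>x. lookup G x \<in> polynomials N" "adm {1..N} G"
    and ij: "i \<in> {1..N}" "j \<in> {1..N}" "i \<noteq> j" and k: "k - 1 / 2 \<notin> \<int>"
    and z: "\<And>f q. f \<in> polynomials N \<Longrightarrow> q i = q j \<Longrightarrow> (\<And>c. c \<in> {1..N} \<Longrightarrow> q c \<noteq> 0) \<Longrightarrow>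
        val q (dunkl_act N k (\<lambda>_. 1) G f) = 0 \<and> val q (dunkl_act N (- k) (\<lambda>w. of_int (sign w)) G f) = 0"
  shows "lookup G x / Xd i j \<in> polynomials N"
proof (rule ccontr)
  assume "lookup G x / Xd i j \<notin> polynomials N"
  then obtain q0 where q0: "q0 i = q0 j" "val q0 (lookup G x) \<noteq> 0"
    using polynomials_divide_Xd[OF G(1) ij] by blast
  obtain p where p: "p i = p j" "\<forall>c\<in>{1..N}. p c \<noteq> 0" "val p (lookup G x) \<noteq> 0"
    "\<forall>a\<in>{1..N}. \<forall>b\<in>{1..N}. p a = p b \<longrightarrow> a \<noteq> b \<longrightarrow> {a, b} = {i, j}"
    using generic_diagonal_point[OF ij G(1) q0] by (elim exE conjE)
  have gp: "generic_point N i j p c" if "\<And>n. cfac c n \<noteq> 0" for c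
    using ij p(1) bspec[OF bspec[OF p(4)]] that by (intro generic_point.intro) blast+
  interpret P: generic_point N i j p k by (rule gp[OF cfac_half_integer(1)[OF k]])
  interpret Q: generic_point N i j p "- k" by (rule gp[OF cfac_half_integer(2)[OF k]])
  define g where "g x = val p (lookup G x)" for x
  define X where "X = {x \<in> keys G. g x \<noteq> 0}"
  \<comment> \<open>Only terms whose coefficient is nonzero at \<open>p\<close> count; terms of
    higher order may still be present in \<open>G\<close>.\<close>
  define m where "m = Max ((tdeg \<circ> snd) ` X)"
  have X: "finite X" "x \<in> X" using p(3) by (auto simp: X_def g_def in_keys_iff)
  have top: "tdeg (snd y) \<le> m" if "g y \<noteq> 0" for y
  proof -
    have "y \<in> X" using that by (auto simp: X_def g_def in_keys_iff)
    then show ?thesis unfolding m_def using X by (intro Max_ge) auto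
  qed
  have "m \<in> (tdeg \<circ> snd) ` X" unfolding m_def using X by (intro Max_in) auto
  then obtain u a0 where u: "(u, a0) \<in> keys G" "g (u, a0) \<noteq> 0" "tdeg a0 = m" by (auto simp: X_def)
  have up: "u permutes {1..N}" using G(2) u(1) by (auto simp: adm_def)
  define K where "K = {a. (\<exists>w. (w, a) \<in> keys G) \<and> tdeg a = m}"
  define S where "S a b = lookup (prod_list (map P.sg (word a))) b" for a b
  have finK: "finite K"
    unfolding K_def by (rule finite_subset[of _ "snd ` keys G"]) force+
  have K: "tdeg a = m" "keys a \<subseteq> {1..N}" if "a \<in> K" for a
    using that G(2) by (auto simp: K_def adm_def)
  have zero: "(\<Sum>a\<in>K. g (u, a) * S a b) = 0" for b
  proof (cases "keys b \<subseteq> {1..N} \<and> tdeg b = m")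
    case True
    let ?c = "(-1) ^ lookup b i :: complex" and ?v = "transpose i j \<circ> u"
    have E1: "(\<Sum>a\<in>K. (g (u, a) + ?c * g (?v, a)) * S a b) = 0"
      using P.leading_equation[OF G, of "\<lambda>_. 1" m u b K] z p top True up by (simp add: g_def K_def S_def)
    have sg: "sign ?v = - sign u"
      using up ij permutes_imp_permutation[of "{1..N}" u] by (simp add: sign_compose sign_swap_id permutation_swap_id)
    \<comment> \<open>\<open>sg\<close> does not involve k, so the equation for -k has the same
      coefficients \<open>S\<close>; the sign character flips the relative sign of the two
      components.\<close>
    have "(\<Sum>a\<in>K. (of_int (sign u) * g (u, a) + ?c * of_int (sign ?v) * g (?v, a)) * S a b) = 0"
      using Q.leading_equation[OF G, of "\<lambda>w. of_int (sign w)" m u b K] z p top True up by (simp add: g_def K_def S_def)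
    then have "of_int (sign u) * (\<Sum>a\<in>K. (g (u, a) - ?c * g (?v, a)) * S a b) = 0"
      unfolding sg by (simp add: sum_distrib_left algebra_simps)
    then have E2: "(\<Sum>a\<in>K. (g (u, a) - ?c * g (?v, a)) * S a b) = 0"
      by (auto simp: sign_def split: if_splits)
    have "2 * (\<Sum>a\<in>K. g (u, a) * S a b)
      = (\<Sum>a\<in>K. (g (u, a) + ?c * g (?v, a)) * S a b) + (\<Sum>a\<in>K. (g (u, a) - ?c * g (?v, a)) * S a b)"
      unfolding sum.distrib[symmetric] sum_distrib_left by (intro sum.cong) (auto simp: algebra_simps)
    then show ?thesis using E1 E2 by simp
  next
    case False
    have "S a b = 0" if "a \<in> K" for a
    proof (rule ccontr)
      assume "S a b \<noteq> 0"
      then have "tdeg b = tdeg a" "keys b \<subseteq> keys a \<union> {i, j}"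
        using P.sg_word_lookup[of "word a" b] by (auto simp: S_def)
      then show False using K[OF that] False ij(1,2) by blast
    qed
    then show ?thesis by simp
  qed
  \<comment> \<open>The leading symbol, at \<open>p\<close>, of the component at u.\<close>
  define R where "R = (\<Sum>a\<in>K. single a (g (u, a)))"
  have "msubst P.sg R = (\<Sum>a\<in>K. mconst (g (u, a)) * prod_list (map P.sg (word a)))"
    unfolding R_def by (simp add: msubst_simps pev_single[OF coeff_hom_mconst] mono_val_word)
  then have "lookup (msubst P.sg R) b = 0" for b
    using zero[of b] by (simp add: lookup_sum S_def lookup_mult_const)
  then have "msubst P.sg R = 0" by (intro poly_mapping_eqI) simp
  then have "R = 0" by (rule P.msubst_sg_inject)
  moreover have "lookup R a0 = g (u, a0)"
    using u finK by (auto simp: R_def lookup_sum lookup_single when_def K_def)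
  ultimately show False using u(2) by simp
qed

section \<open>Removal of the poles along the reflection hyperplanes\<close>

lemma lookup_fun_mult: "lookup (fun_mult h L) x = h * lookup L x"
proof -
  have "lookup (fun_mult h L) x
      = (\<Sum>y\<in>keys L. if y = x then h * lookup L y else 0)"
    unfolding fun_mult_def lookup_sum by (rule sum.cong) (auto simp: cterm_def lookup_single when_def)
  then show ?thesis by (simp add: in_keys_iff)
qed

lemma dunkl_act_fun_mult: "dunkl_act N k \<epsilon> (fun_mult h G) f = h * dunkl_act N k \<epsilon> G f"
proof -
  have "keys (fun_mult h G) \<subseteq> keys G"
    by (auto simp: in_keys_iff lookup_fun_mult)
  then have "dunkl_act N k \<epsilon> (fun_mult h G) f = (\<Sum>x\<in>keys G. lookup (fun_mult h G) x
     * (rat_const (\<epsilon> (fst x)) * foldr (dk N k) (word (snd x)) (rat_perm (fst x) f)))"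
    unfolding dunkl_act_def by (intro sum.mono_neutral_left) (auto simp: in_keys_iff)
  then show ?thesis by (simp add: dunkl_act_def lookup_fun_mult sum_distrib_left mult.assoc)
qed

text \<open>One linear factor is removed at a time. Multiplying by the whole remaining denominator
  makes the coefficients polynomial, while the resulting Laurent values become multiples of X_i -
  X_j and vanish on that hyperplane; \<open>dunkl_lattice_key\<close> then divides the factor
  out.\<close>

lemma dunkl_lattice_peel:
  assumes k: "k - 1 / 2 \<notin> \<int>" and G: "adm {1..N} G"
    and ps: "\<And>x. x \<in> set ps \<Longrightarrow> fst x \<in> {1..N} \<and> snd x \<in> {1..N} \<and> fst x \<noteq> snd x"
    and den: "\<And>x. lookup G x * prod_list (map (\<lambda>x. Xd (fst x) (snd x)) ps) \<in> polynomials N"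
    and pres: "\<And>f. f \<in> polynomials N \<Longrightarrow>
        dunkl_act N k (\<lambda>_. 1) G f \<in> LP N \<and> dunkl_act N (- k) (\<lambda>w. of_int (sign w)) G f \<in> LP N"
  shows "lookup G x \<in> polynomials N"
  using ps den
proof (induction ps arbitrary: x)
  case (Cons y ps)
  let ?P = "prod_list (map (\<lambda>x. Xd (fst x) (snd x)) ps)" and ?i = "fst y" and ?j = "snd y"
  define G' where "G' = fun_mult (Xd ?i ?j * ?P) G"
  have y: "?i \<in> {1..N}" "?j \<in> {1..N}" "?i \<noteq> ?j" using Cons.prems by auto
  have P: "?P \<in> polynomials N"
    proof (rule polynomials_prod_list)
    fix f assume "f \<in> set (map (\<lambda>x. Xd (fst x) (snd x)) ps)"
    then obtain x where "x \<in> set ps" "f = Xd (fst x) (snd x)" by auto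
    then show "f \<in> polynomials N" using Cons.prems(1)[of x] by (auto intro!: polynomials_diff polynomials_var)
  qed
  have van: "val q (Xd ?i ?j * ?P * f) = 0" if "q ?i = q ?j" "\<And>c. c \<in> {1..N} \<Longrightarrow> q c \<noteq> 0" "f \<in> LP N" for q f
    using LP_reg[OF that(3,2)] polynomials_reg[OF P, of q] that(1)
    by (simp add: mult.assoc val_mult val_diff reg_mult reg_diff)
  have "lookup G' x / Xd ?i ?j \<in> polynomials N" for x
  proof (rule dunkl_lattice_key[OF _ _ y k])
    show "lookup G' x \<in> polynomials N" for x
      using Cons.prems(2)[of x] by (simp add: G'_def lookup_fun_mult mult.commute)
    show "adm {1..N} G'" using G by (simp add: G'_def adm_fun_mult)
  qed (use van pres in \<open>simp add: G'_def dunkl_act_fun_mult\<close>)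
  then have "lookup G x * ?P \<in> polynomials N" for x
    using y by (simp add: G'_def lookup_fun_mult mult_ac)
  then show ?case using Cons by simp
qed simp

lemma vandermonde_list:
  obtains ps where "vandermonde N = prod_list (map (\<lambda>x. Xd (fst x) (snd x)) ps)"
    "\<And>x. x \<in> set ps \<Longrightarrow> fst x \<in> {1..N} \<and> snd x \<in> {1..N} \<and> fst x \<noteq> snd x"
proof -
  define A where "A = Sigma {1..N} (\<lambda>i. {i+1..N})"
  obtain ps where ps: "set ps = A" "distinct ps" using finite_distinct_list[of A] by (auto simp: A_def)
  have "vandermonde N = (\<Prod>x\<in>A. Xd (fst x) (snd x))"
    unfolding vandermonde_def A_def by (subst prod.Sigma) (auto simp: split_beta)
  also have "\<dots> = prod_list (map (\<lambda>x. Xd (fst x) (snd x)) ps)"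
    by (simp add: prod.distinct_set_conv_list[OF ps(2)] flip: ps(1))
  finally have v: "vandermonde N = \<dots>" .
  show thesis by (rule that[OF v]) (use ps in \<open>auto simp: A_def\<close>)
qed

lemma op_dunkl_exp:
  assumes "adm {1..N} G"
  shows "op (dunkl_exp N k G) f = dunkl_act N k (\<lambda>_. 1) G f"
proof -
  have "op (Dw N k xs) g = foldr (dk N k) xs g" for xs g
    by (induction xs) (simp_all add: Dw_Cons op_simps op_cDk)
  then show ?thesis unfolding dunkl_exp_def dunkl_act_def op_sum
    using assms by (intro sum.cong) (auto simp: adm_def op_mult permutes_bij split_beta)
qed

lemma CA_Dw: "set xs \<subseteq> {1..N} \<Longrightarrow> Dw N k xs \<in> CA N"
  proof (induction xs)
  case (Cons a xs)
  then show ?case using CA_mult[OF CA_cDk[of a N k], of "Dw N k xs"] by (simp add: Dw_Cons)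
qed simp

lemma psi_dunkl_exp:
  assumes "adm {1..N} G"
  shows "psi.tw N (2 * k) (dunkl_exp N k G) f = dunkl_act N (- k) (\<lambda>w. of_int (sign w)) G f"
proof -
  have D: "psi.tw N (2 * k) (Dw N k xs) g = foldr (dk N (- k)) xs g" if "set xs \<subseteq> {1..N}" for xs g
    using that
  proof (induction xs)
    case (Cons a xs)
    then show ?case
      by (simp add: Dw_Cons psi.tw_mult CA_adm CA_Dw CA_cDk psi_tw_cDk)
  qed (simp add: psi.tw_1)
  have "psi.tw N (2 * k) (cM h * Dw N k (word m) * cP w) f
      = h * (rat_const (of_int (sign w)) * foldr (dk N (- k)) (word m) (rat_perm w f))"
    if "w permutes {1..N}" "keys m \<subseteq> {1..N}" for h w m
  proof -
    have "psi.tw N (2 * k) (cP w) f = rat_const (of_int (sign w)) * rat_perm w f"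
      by (simp only: psi.tw_cP[OF that(1)] rat_const_of_int)
    then show ?thesis
      using that D[of "word m"]
      by (simp add: mult.assoc psi.tw_cM_mult psi.tw_mult CA_adm CA_Dw CA_cP foldr_dk_scale)
  qed
  then show ?thesis unfolding dunkl_exp_def dunkl_act_def psi.tw_sum
    using assms by (intro sum.cong) (auto simp: adm_def split_beta)
qed

lemma H_cM_LP:
  assumes "f \<in> LP N" shows "cM f \<in> H N k"
proof -
  have var: "cM (rat_var i) \<in> H N k" "cM (1 / rat_var i) \<in> H N k" if "i \<in> {1..N}" for i
    using that H_letter[of N "VarX i" k] H_letter[of N "InvX i" k] by simp_all
  have p: "cM g \<in> H N k" if "g \<in> polynomials N" for g
    using that by (induction rule: polynomials_induct) (auto simp: cM_add cM_mult intro: H_add H_mult var)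
  have "cM (\<Prod>i\<in>A. 1 / rat_var i) \<in> H N k" if "A \<subseteq> {1..N}" for A
    using that by (induction A rule: infinite_finite_induct) (auto simp: cM_mult intro!: H_mult var simp del: times_divide_eq_left)
  from this[of "{1..N}"] have "cM (inverse (Xall N)) \<in> H N k" by (simp add: Xall_def prod_dividef divide_inverse prod_inversef[symmetric])
  then have i: "cM (inverse (Xall N) ^ n) \<in> H N k" for n
    by (induction n) (auto simp: cM_mult intro: H_mult)
  obtain n where n: "f * Xall N ^ n \<in> polynomials N"
    using assms by (auto simp: laurent_eq_localized localized_def)
  have "f = (f * Xall N ^ n) * inverse (Xall N) ^ n" by (simp add: power_inverse)
  then show ?thesis using p[OF n] i[of n] H_mult by (metis cM_mult)
qed

lemma H_cDk:
  assumes "i \<in> {1..N}" shows "cDk N k i \<in> H N k"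
proof -
  have "cP (transpose i j) \<in> H N k" if "j \<in> {1..<i}" for j
    using H_letter[of N "Perm (transpose i j)" k] that assms permutes_transpose[of i "{1..N}" j] by simp
  moreover have "cM (1 / rat_var i) \<in> H N k" "cY N k i \<in> H N k"
    using assms H_letter[of N "InvX i" k] H_letter[of N "VarY i" k] by simp_all
  moreover have "cM (1 / rat_var i) * (cY N k i + cC k * (\<Sum>j\<in>{1..<i}. cP (transpose i j))) = cDk N k i"
    by (simp add: cY_def flip: mult.assoc cM_mult)
  ultimately show ?thesis by (metis H_add H_mult H_sum H_cC)
qed

lemma H_eq_lattice_preservers:
  assumes k: "k - 1 / 2 \<notin> \<int>"
  shows "H N k = {L \<in> CA N. \<forall>f\<in>LP N. op L f \<in> LP N \<and> psi.tw N (2 * k) L f \<in> LP N}"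
proof
  show "H N k \<subseteq> {L \<in> CA N. \<forall>f\<in>LP N. op L f \<in> LP N \<and> psi.tw N (2 * k) L f \<in> LP N}"
    using H_subset_CA H_preserves_LP H_preserves_psi by blast
  show "{L \<in> CA N. \<forall>f\<in>LP N. op L f \<in> LP N \<and> psi.tw N (2 * k) L f \<in> LP N} \<subseteq> H N k"
  proof clarify
    fix L assume L: "L \<in> CA N" "\<forall>f\<in>LP N. op L f \<in> LP N \<and> psi.tw N (2 * k) L f \<in> LP N"
    obtain G where G: "G \<in> crossed_algebra N" "L = dunkl_exp N k G"
      using CA_subset_DE[OF L(1), of k] by (auto simp: DE_def)
    then have adm: "adm {1..N} G" and RF: "\<And>x. lookup G x \<in> RF N"
      unfolding crossed_algebra_iff by blast+
    have "\<exists>n. lookup G x * (Xall N * vandermonde N) ^ n \<in> polynomials N" for x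
      using RF by (auto simp: regular_eq_localized localized_def)
    then obtain n where n: "\<And>x. lookup G x * (Xall N * vandermonde N) ^ n x \<in> polynomials N" by metis
    \<comment> \<open>A common exponent clearing all denominators; the inserted 0 covers
      \<open>G = 0\<close>.\<close>
    define M where "M = Max (insert 0 (n ` keys G))"
    have M: "lookup G x * (Xall N * vandermonde N) ^ M \<in> polynomials N" for x
    proof (cases "x \<in> keys G")
      case True
      then have "n x \<le> M" unfolding M_def by (intro Max_ge) auto
      then show ?thesis using localized_ge[OF disc_polynomials disc_nonzero n] by blast
    qed (simp add: in_keys_iff)
    obtain ps where ps: "vandermonde N = prod_list (map (\<lambda>x. Xd (fst x) (snd x)) ps)"
      "\<And>x. x \<in> set ps \<Longrightarrow> fst x \<in> {1..N} \<and> snd x \<in> {1..N} \<and> fst x \<noteq> snd x" using vandermonde_list by blast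
    have vm: "vandermonde N ^ m = prod_list (map (\<lambda>x. Xd (fst x) (snd x)) (concat (replicate m ps)))" for m
      by (induction m) (simp_all add: ps(1))
    \<comment> \<open>\<open>Xall\<close> is a unit of the Laurent ring: multiplying by its power
      keeps the lattice conditions and leaves only factors X_i - X_j in the denominators.\<close>
    define G' where "G' = fun_mult (Xall N ^ M) G"
    have "lookup G' x \<in> polynomials N" for x
    proof (rule dunkl_lattice_peel[OF k, of _ _ "concat (replicate M ps)"])
      show "adm {1..N} G'" using adm by (simp add: G'_def adm_fun_mult)
      show "fst x \<in> {1..N} \<and> snd x \<in> {1..N} \<and> fst x \<noteq> snd x" if "x \<in> set (concat (replicate M ps))" for x
        using that ps(2) by auto
      show "lookup G' x * prod_list (map (\<lambda>x. Xd (fst x) (snd x)) (concat (replicate M ps))) \<in> polynomials N" for x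
        using M[of x] unfolding vm[symmetric] by (simp add: G'_def lookup_fun_mult power_mult_distrib mult_ac)
      fix f assume "f \<in> polynomials N"
      then have "f \<in> LP N" by (rule LP_poly)
      then have "dunkl_act N k (\<lambda>_. 1) G f \<in> LP N" "dunkl_act N (- k) (\<lambda>w. of_int (sign w)) G f \<in> LP N"
        using L(2) unfolding G(2) op_dunkl_exp[OF adm] psi_dunkl_exp[OF adm] by blast+
      moreover have "Xall N ^ M \<in> LP N" by (intro LP_poly polynomials_power) simp
      ultimately show "dunkl_act N k (\<lambda>_. 1) G' f \<in> LP N \<and> dunkl_act N (- k) (\<lambda>w. of_int (sign w)) G' f \<in> LP N"
        unfolding G'_def dunkl_act_fun_mult by (blast intro: LP_ring)
    qed
    then have "lookup G x * Xall N ^ M \<in> polynomials N" for x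
      unfolding G'_def lookup_fun_mult by (metis mult.commute)
    then have LP: "lookup G x \<in> LP N" for x
      unfolding laurent_eq_localized localized_def by blast
    have Dw: "Dw N k xs \<in> H N k" if "set xs \<subseteq> {1..N}" for xs
      using that
    proof (induction xs)
      case (Cons a xs)
      then show ?case using H_mult[OF H_cDk[of a N k], of "Dw N k xs"] by (simp add: Dw_Cons)
    qed simp
    have P: "cP w \<in> H N k" if "w permutes {1..N}" for w
      using H_letter[of N "Perm w" k] that by simp
    show "L \<in> H N k"
      unfolding G(2) dunkl_exp_def split_beta
      using adm LP by (intro H_sum H_mult H_cM_LP Dw P) (auto simp: adm_def split_beta)
  qed
qed

section \<open>Linear systems depending polynomially on a parameter\<close>

text \<open>Gaussian elimination without division: a system which is injective at \<open>0\<close> stays injective outside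
  the zeros of the pivots.\<close>

lemma poly_system_injective:
  fixes A :: "'r \<Rightarrow> 'c \<Rightarrow> complex poly"
  assumes "finite I" "\<And>c. (\<And>r. r \<in> R \<Longrightarrow> (\<Sum>i\<in>I. poly (A r i) 0 * c i) = 0) \<Longrightarrow> \<forall>i\<in>I. c i = 0"
  shows "\<exists>F. finite F \<and> (\<forall>k. k \<notin> F \<longrightarrow> (\<forall>c. (\<forall>r\<in>R. (\<Sum>i\<in>I. poly (A r i) k * c i) = 0) \<longrightarrow> (\<forall>i\<in>I. c i = 0)))"
  using assms
proof (induction I arbitrary: A)
  case (insert i I)
  have "\<exists>\<rho>\<in>R. poly (A \<rho> i) 0 \<noteq> 0"
  proof (rule ccontr)
    assume "\<not> ?thesis"
    then have z: "poly (A r i) 0 = 0" if "r \<in> R" for r using that by blast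
    have "(\<Sum>j\<in>insert i I. poly (A r j) 0 * (if j = i then 1 else 0)) = 0" if "r \<in> R" for r
      using z[OF that] insert.hyps by (intro sum.neutral) auto
    from insert.prems[OF this] show False by simp
  qed
  then obtain \<rho> where \<rho>: "\<rho> \<in> R" "poly (A \<rho> i) 0 \<noteq> 0" by blast
  define B where "B r j = A \<rho> i * A r j - A r i * A \<rho> j" for r j
  have elim: "(\<Sum>j\<in>I. poly (B r j) k * c j)
    = poly (A \<rho> i) k * (\<Sum>j\<in>I. poly (A r j) k * c j) - poly (A r i) k * (\<Sum>j\<in>I. poly (A \<rho> j) k * c j)" for r k c
    by (simp add: B_def sum_distrib_left sum_subtractf algebra_simps)
  have "\<exists>F. finite F \<and> (\<forall>k. k \<notin> F \<longrightarrow> (\<forall>c. (\<forall>r\<in>R. (\<Sum>j\<in>I. poly (B r j) k * c j) = 0) \<longrightarrow> (\<forall>j\<in>I. c j = 0)))"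
  proof (rule insert.IH)
    fix c assume c: "\<And>r. r \<in> R \<Longrightarrow> (\<Sum>j\<in>I. poly (B r j) 0 * c j) = 0"
    \<comment> \<open>The eliminated unknown is recovered by solving the pivot row at parameter
      0.\<close>
    define c' where "c' = c(i := - (\<Sum>j\<in>I. poly (A \<rho> j) 0 * c j) / poly (A \<rho> i) 0)"
    have "(\<Sum>j\<in>insert i I. poly (A r j) 0 * c' j) = 0" if r: "r \<in> R" for r
    proof -
      have "(\<Sum>j\<in>I. poly (A r j) 0 * c' j) = (\<Sum>j\<in>I. poly (A r j) 0 * c j)"
        using insert.hyps by (intro sum.cong) (auto simp: c'_def)
      then have "(\<Sum>j\<in>insert i I. poly (A r j) 0 * c' j) = poly (A r i) 0 * c' i + (\<Sum>j\<in>I. poly (A r j) 0 * c j)"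
        using insert.hyps by simp
      also have "\<dots> = (\<Sum>j\<in>I. poly (B r j) 0 * c j) / poly (A \<rho> i) 0"
        using \<rho>(2) unfolding elim by (simp add: c'_def field_simps)
      finally show ?thesis using c[OF r] by simp
    qed
    from insert.prems[OF this] have "\<forall>j\<in>insert i I. c' j = 0" by blast
    moreover have "c' j = c j" if "j \<in> I" for j using that insert.hyps by (auto simp: c'_def)
    ultimately show "\<forall>j\<in>I. c j = 0" by simp
  qed
  then obtain F where F: "finite F"
    "\<forall>k. k \<notin> F \<longrightarrow> (\<forall>c. (\<forall>r\<in>R. (\<Sum>j\<in>I. poly (B r j) k * c j) = 0) \<longrightarrow> (\<forall>j\<in>I. c j = 0))" by (elim exE conjE)
  have "A \<rho> i \<noteq> 0" using \<rho> by auto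
  then have fin: "finite (F \<union> {k. poly (A \<rho> i) k = 0})" using F(1) poly_roots_finite[of "A \<rho> i"] by simp
  have "\<forall>j\<in>insert i I. c j = 0" if k: "k \<notin> F \<union> {k. poly (A \<rho> i) k = 0}"
    and c: "\<forall>r\<in>R. (\<Sum>j\<in>insert i I. poly (A r j) k * c j) = 0" for k c
  proof -
    have S: "(\<Sum>j\<in>I. poly (A r j) k * c j) = - (poly (A r i) k * c i)" if "r \<in> R" for r
      using c that insert.hyps by (simp add: eq_neg_iff_add_eq_0 add.commute)
    then have "\<forall>r\<in>R. (\<Sum>j\<in>I. poly (B r j) k * c j) = 0" using \<rho>(1) unfolding elim by simp
    moreover have "k \<notin> F" using k by simp
    ultimately have I: "\<forall>j\<in>I. c j = 0" using F(2)[THEN spec, THEN mp, THEN spec, THEN mp, of k c] by simp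
    then have "poly (A \<rho> i) k * c i = 0" using S[OF \<rho>(1)] by simp
    then show ?thesis using I k by simp
  qed
  then show ?case using fin by (intro exI[of _ "F \<union> {k. poly (A \<rho> i) k = 0}"] conjI allI impI) simp_all
qed auto

lemma homogeneous_system_solution:
  fixes a :: "'r \<Rightarrow> 'c \<Rightarrow> complex"
  assumes "finite R" "finite I" "card R < card I"
  shows "\<exists>x. (\<exists>i\<in>I. x i \<noteq> 0) \<and> (\<forall>r\<in>R. (\<Sum>i\<in>I. a r i * x i) = 0)"
  using assms
proof (induction R arbitrary: a I)
  case empty
  then have "I \<noteq> {}" by auto
  then show ?case by (auto intro!: exI[of _ "\<lambda>_. 1"])
next
  case (insert r R)
  show ?case
  proof (cases "\<forall>i\<in>I. a r i = 0")
    case True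
    then show ?thesis using insert.IH[of I a] insert by auto
  next
    case False
    then obtain i where i: "i \<in> I" "a r i \<noteq> 0" by blast
    define b where "b s j = a s j - a s i * a r j / a r i" for s j
    have "\<exists>x. (\<exists>j\<in>I - {i}. x j \<noteq> 0) \<and> (\<forall>s\<in>R. (\<Sum>j\<in>I - {i}. b s j * x j) = 0)"
      using insert i by (intro insert.IH) auto
    then obtain x j where x: "j \<in> I - {i}" "x j \<noteq> 0" "\<forall>s\<in>R. (\<Sum>j\<in>I - {i}. b s j * x j) = 0" by blast
    define y where "y = x(i := - (\<Sum>j\<in>I - {i}. a r j * x j) / a r i)"
    have y: "(\<Sum>j\<in>I. a s j * y j) = a s i * y i + (\<Sum>j\<in>I - {i}. a s j * x j)" for s
    proof -
      have "(\<Sum>j\<in>I - {i}. a s j * y j) = (\<Sum>j\<in>I - {i}. a s j * x j)"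
        by (intro sum.cong) (auto simp: y_def)
      then show ?thesis using i insert.prems by (simp add: sum.remove)
    qed
    have "(\<Sum>j\<in>I. a s j * y j) = (\<Sum>j\<in>I - {i}. b s j * x j)" for s
      using i(2) unfolding y b_def
      by (simp add: y_def sum_subtractf left_diff_distrib sum_distrib_left sum_divide_distrib mult.assoc mult.left_commute)
    moreover have "(\<Sum>j\<in>I. a r j * y j) = 0" unfolding y using i(2) by (simp add: y_def)
    ultimately show ?thesis using x by (intro exI[of _ y]) (auto simp: y_def)
  qed
qed

section \<open>Laurent monomials\<close>

definition lmon :: "(nat \<Rightarrow>\<^sub>0 int) \<Rightarrow> ratfun" where
  "lmon a = (\<Prod>i\<in>keys a. rat_var i powi lookup a i)"

lemma lmon_superset:
  assumes "finite A" "keys a \<subseteq> A"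
  shows "lmon a = (\<Prod>i\<in>A. rat_var i powi lookup a i)"
  unfolding lmon_def using assms by (intro prod.mono_neutral_left) (auto simp: in_keys_iff)

lemma lmon_0 [simp]: "lmon 0 = 1"
  by (simp add: lmon_def)

lemma lmon_add: "lmon (a + b) = lmon a * lmon b"
proof -
  let ?A = "keys a \<union> keys b"
  have "keys (a + b) \<subseteq> ?A" by (rule Poly_Mapping.keys_add)
  then show ?thesis
    by (simp add: lmon_superset[of ?A] lookup_add power_int_add prod.distrib)
qed

lemma lmon_single [simp]: "lmon (single i n) = rat_var i powi n"
  by (cases "n = 0") (simp_all add: lmon_def)

lemma lmon_nonzero [simp]: "lmon a \<noteq> 0"
  by (simp add: lmon_def)

definition pexp :: "(nat \<Rightarrow> nat) \<Rightarrow> (nat \<Rightarrow>\<^sub>0 int) \<Rightarrow> (nat \<Rightarrow>\<^sub>0 int)" where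
  "pexp w a = Poly_Mapping.map_key (inv_into UNIV w) a"

lemma lookup_pexp: "bij w \<Longrightarrow> lookup (pexp w a) i = lookup a (inv_into UNIV w i)"
  by (simp add: pexp_def lookup_map_key bij_is_inj bij_imp_bij_inv)

lemma lookup_pexp_apply: "bij w \<Longrightarrow> lookup (pexp w a) (w i) = lookup a i"
  by (simp add: lookup_pexp bij_is_inj)

lemma keys_pexp: "bij w \<Longrightarrow> keys (pexp w a) = w ` keys a"
proof -
  assume w: "bij w"
  { fix x assume "x \<in> keys (pexp w a)"
    then have "inv_into UNIV w x \<in> keys a" using w by (simp add: in_keys_iff lookup_pexp)
    then have "x \<in> w ` keys a" using w by (metis bij_inv_eq_iff imageI) }
  moreover { fix x assume "x \<in> w ` keys a"
    then have "x \<in> keys (pexp w a)" using w by (auto simp: in_keys_iff lookup_pexp_apply) }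
  ultimately show ?thesis by blast
qed

lemma rat_perm_powi: "bij w \<Longrightarrow> rat_perm w (f powi n) = rat_perm w f powi n"
  by (cases n rule: int_cases2) (simp_all add: power_int_minus rat_perm_power rat_perm_inverse)

lemma rat_perm_lmon: "bij w \<Longrightarrow> rat_perm w (lmon a) = lmon (pexp w a)"
proof -
  assume w: "bij w"
  have "lmon (pexp w a) = (\<Prod>i\<in>w ` keys a. rat_var i powi lookup (pexp w a) i)"
    using w by (simp add: lmon_def keys_pexp)
  also have "\<dots> = (\<Prod>i\<in>keys a. rat_var (w i) powi lookup a i)"
    using w by (subst prod.reindex) (auto simp: lookup_pexp_apply intro: inj_on_subset[OF bij_is_inj])
  finally show ?thesis using w by (simp add: lmon_def rat_perm_prod rat_perm_powi)
qed

lemma euler_mult: "rat_var c * rat_deriv c (f * g) = (rat_var c * rat_deriv c f) * g + f * (rat_var c * rat_deriv c g)"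
  by (simp add: rat_deriv_mult algebra_simps)

lemma euler_powi: "rat_var c * rat_deriv c (rat_var i powi n) = rat_const (if i = c then of_int n else 0) * rat_var i powi n"
proof -
  have pow: "rat_var c * rat_deriv c (rat_var i ^ m) = rat_const (if i = c then of_nat m else 0) * rat_var i ^ m" for m
    by (induction m) (auto simp: rat_deriv_mult rat_deriv_var rat_const_add rat_const_of_nat algebra_simps)
  show ?thesis
  proof (cases n rule: int_cases2)
    case (nonneg m)
    then show ?thesis using pow by simp
  next
    case (nonpos m)
    let ?f = "rat_var i ^ m"
    have "rat_var c * rat_deriv c (inverse ?f) = - (rat_var c * rat_deriv c ?f) / ?f ^ 2"
      by (simp add: rat_deriv_inverse)
    also have "\<dots> = rat_const (if i = c then of_int n else 0) * inverse ?f"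
      unfolding pow using nonpos by (auto simp: power2_eq_square rat_const_minus divide_inverse)
    finally show ?thesis using nonpos by (simp add: power_int_minus)
  qed
qed

lemma euler_lmon: "rat_var c * rat_deriv c (lmon a) = rat_const (of_int (lookup a c)) * lmon a"
proof -
  have "rat_var c * rat_deriv c (\<Prod>i\<in>A. rat_var i powi f i)
      = rat_const (\<Sum>i\<in>A. if i = c then of_int (f i) else 0) * (\<Prod>i\<in>A. rat_var i powi f i)" if "finite A" for A f
    using that by (induction A) (auto simp: euler_mult euler_powi rat_const_add algebra_simps)
  then show ?thesis by (simp add: lmon_def in_keys_iff)
qed

text \<open>Monomials are joint eigenvectors of the Euler operators X_i d/dX_i, and distinct
  exponents are separated by some eigenvalue.\<close>

lemma lmon_independent:
  assumes "finite A" "(\<Sum>a\<in>A. rat_const (c a) * lmon a) = 0" "a \<in> A"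
  shows "c a = 0"
  using assms
proof (induction A arbitrary: c a)
  case (insert b A)
  have *: "c a = 0" if "a \<in> A" for a
  proof -
    have "a \<noteq> b" using that insert.hyps by auto
    then obtain i where i: "lookup a i \<noteq> lookup b i" by (metis poly_mapping_eqI)
    have "rat_var i * rat_deriv i (\<Sum>a\<in>insert b A. rat_const (c a) * lmon a)
        - rat_const (of_int (lookup b i)) * (\<Sum>a\<in>insert b A. rat_const (c a) * lmon a) = 0"
      unfolding insert.prems by simp
    then have "(\<Sum>a\<in>insert b A. rat_const (c a) * (rat_var i * rat_deriv i (lmon a))
        - rat_const (of_int (lookup b i)) * (rat_const (c a) * lmon a)) = 0"
      by (simp only: rat_deriv_sum rat_deriv_scale sum_distrib_left sum_subtractf mult.left_commute)
    then have "(\<Sum>a\<in>A. rat_const (c a * (of_int (lookup a i) - of_int (lookup b i))) * lmon a) = 0"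
      unfolding euler_lmon using insert.hyps by (simp add: rat_const_mult rat_const_diff algebra_simps)
    from insert.IH[OF this that] show ?thesis using i by simp
  qed
  have "rat_const (c b) * lmon b = 0" using insert.prems insert.hyps * by simp
  then show ?case using * insert.prems by auto
qed simp

definition lp :: "((nat \<Rightarrow>\<^sub>0 int) \<Rightarrow>\<^sub>0 complex) \<Rightarrow> ratfun" where
  "lp q = (\<Sum>a\<in>keys q. rat_const (lookup q a) * lmon a)"

lemma lp_add: "lp (q + r) = lp q + lp r"
  unfolding lp_def by (rule setsum_keys_plus_distrib) (simp_all add: rat_const_add distrib_right)

lemma lp_single: "lp (single a c) = rat_const c * lmon a"
  by (cases "c = 0") (simp_all add: lp_def)

lemma lp_0 [simp]: "lp 0 = 0"
  by (simp add: lp_def)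

lemma lp_minus: "lp (- q) = - lp q"
  using lp_add[of "- q" q] by (simp add: eq_neg_iff_add_eq_0)

lemma lp_mult: "lp (q * r) = lp q * lp r"
proof (induction q rule: poly_mapping_additive_induct)
  case (2 a c)
  show ?case
    by (induction r rule: poly_mapping_additive_induct)
      (simp_all add: lp_add lp_single mult_single rat_const_mult lmon_add distrib_left distrib_right mult_ac)
qed (simp_all add: lp_add distrib_right)

lemma lp_eq_0: "lp q = 0 \<Longrightarrow> q = 0"
  unfolding lp_def using lmon_independent[of "keys q" "lookup q"]
  by (metis finite_keys in_keys_iff lookup_zero poly_mapping_eqI)

lemma lp_inject: "lp q = lp r \<Longrightarrow> q = r"
  using lp_eq_0[of "q + - r"] lp_add[of q "- r"] lp_minus[of r] by (metis add.right_inverse add_diff_cancel_left' diff_conv_add_uminus eq_iff_diff_eq_0)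

lemma polynomials_lp:
  assumes "f \<in> polynomials N"
  shows "\<exists>q. f = lp q \<and> (\<forall>a\<in>keys q. keys a \<subseteq> {1..N} \<and> (\<forall>c. lookup a c \<ge> 0))"
  using assms
proof (induction rule: polynomials_induct)
  case (const c)
  have "rat_const c = lp (single 0 c)" by (simp add: lp_single)
  then show ?case by (intro exI[of _ "single 0 c"]) simp
next
  case (var i)
  have "rat_var i = lp (single (single i 1) 1)" by (simp add: lp_single)
  then show ?case using var
    by (intro exI[of _ "single (single i 1) 1"]) (auto simp: lookup_single when_def)
next
  case (add f g)
  then obtain q r where "f = lp q" "g = lp r"
    "\<forall>a\<in>keys q. keys a \<subseteq> {1..N} \<and> (\<forall>c. lookup a c \<ge> 0)"
    "\<forall>a\<in>keys r. keys a \<subseteq> {1..N} \<and> (\<forall>c. lookup a c \<ge> 0)" by blast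
  then show ?case using Poly_Mapping.keys_add[of q r] by (intro exI[of _ "q + r"]) (auto simp: lp_add)
next
  case (mult f g)
  then obtain q r where qr: "f = lp q" "g = lp r"
    "\<forall>a\<in>keys q. keys a \<subseteq> {1..N} \<and> (\<forall>c. lookup a c \<ge> 0)"
    "\<forall>a\<in>keys r. keys a \<subseteq> {1..N} \<and> (\<forall>c. lookup a c \<ge> 0)" by blast
  have "keys a \<subseteq> {1..N} \<and> (\<forall>c. lookup a c \<ge> 0)" if "a \<in> keys (q * r)" for a
  proof -
    obtain b c where "a = b + c" "b \<in> keys q" "c \<in> keys r" using keys_mult[of q r] \<open>a \<in> _\<close> by blast
    then show ?thesis using qr(3,4) Poly_Mapping.keys_add[of b c] by (fastforce simp: lookup_add)
  qed
  then show ?case using qr by (intro exI[of _ "q * r"]) (simp add: lp_mult)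
qed

lemma LP_lp:
  assumes "f \<in> LP N"
  shows "\<exists>q. f = lp q \<and> (\<forall>a\<in>keys q. keys a \<subseteq> {1..N})"
proof -
  obtain n where n: "f * Xall N ^ n \<in> polynomials N"
    using assms by (auto simp: laurent_eq_localized localized_def)
  obtain q where q: "f * Xall N ^ n = lp q" "\<forall>a\<in>keys q. keys a \<subseteq> {1..N}"
    using polynomials_lp[OF n] by blast
  define b where "b = (\<Sum>i\<in>{1..N}. single i (- int n))"
  have lb: "lmon (\<Sum>i\<in>A. single i m) = (\<Prod>i\<in>A. rat_var i powi m)" if "finite A" for A m
    using that by (induction A) (auto simp: lmon_add)
  have "keys b \<subseteq> {1..N}" unfolding b_def by (auto simp: in_keys_iff lookup_sum lookup_single when_def split: if_splits)
  moreover have "lmon b = inverse (Xall N ^ n)"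
    unfolding b_def Xall_def by (simp add: lb power_int_minus prod_inversef[unfolded comp_def] prod_power_distrib)
  then have "f = lp (q * single b 1)"
    using q(1) by (simp add: lp_mult lp_single divide_inverse[symmetric] eq_divide_eq)
  moreover have "keys a \<subseteq> {1..N}" if "a \<in> keys (q * single b 1)" for a
  proof -
    obtain c d where "a = c + d" "c \<in> keys q" "d \<in> keys (single b (1::complex))"
      using keys_mult[of q "single b 1"] \<open>a \<in> _\<close> by blast
    then show ?thesis using q(2) Poly_Mapping.keys_add[of c d] \<open>keys b \<subseteq> {1..N}\<close> by fastforce
  qed
  ultimately show ?thesis by blast
qed

text \<open>Independence of the monomials makes the chosen expansion unique; outside the range of
  \<open>lp\<close> the value is arbitrary.\<close>

definition coef :: "(nat \<Rightarrow>\<^sub>0 int) \<Rightarrow> ratfun \<Rightarrow> complex" where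
  "coef e f = lookup (SOME q. lp q = f) e"

lemma coef_lp [simp]: "coef e (lp q) = lookup q e"
proof -
  have "lp (SOME r. lp r = lp q) = lp q" by (rule someI) simp
  then show ?thesis unfolding coef_def using lp_inject by metis
qed

lemma coef_lmon [simp]: "coef e (rat_const c * lmon a) = (if a = e then c else 0)"
  using coef_lp[of e "single a c"] by (simp add: lp_single lookup_single when_def)

lemma coef_add: "f \<in> LP N \<Longrightarrow> g \<in> LP N \<Longrightarrow> coef e (f + g) = coef e f + coef e g"
  using LP_lp[of f N] LP_lp[of g N] by (metis coef_lp lookup_add lp_add)

lemma coef_0 [simp]: "coef e 0 = 0"
  using coef_lp[of e 0] by simp

lemma coef_scale: "f \<in> LP N \<Longrightarrow> coef e (rat_const c * f) = c * coef e f"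
proof -
  assume "f \<in> LP N"
  then obtain q where q: "f = lp q" using LP_lp by blast
  have "lookup (single 0 c * q) e = c * lookup q e"
    by (induction q rule: poly_mapping_additive_induct)
      (auto simp: mult_single lookup_add lookup_single when_def distrib_left)
  then show ?thesis using coef_lp[of e "single 0 c * q"] by (simp add: q lp_mult lp_single)
qed

lemma coef_sum: "(\<And>x. x \<in> A \<Longrightarrow> f x \<in> LP N) \<Longrightarrow> coef e (sum f A) = (\<Sum>x\<in>A. coef e (f x))"
proof (induction A rule: infinite_finite_induct)
  case (insert x A)
  then show ?case using coef_add[of "f x" N "sum f A" e] LP_intros(6)[of A f N] by simp
qed simp_all

lemma powi_LP: "i \<in> {1..N} \<Longrightarrow> rat_var i powi n \<in> LP N"
proof (cases n rule: int_cases2)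
  case (nonpos m)
  assume i: "i \<in> {1..N}"
  then show ?thesis using LP_ring(7)[OF LP_inverse_var[OF i], of m] nonpos by (simp add: power_int_minus power_inverse)
qed (simp add: LP_var LP_ring)

lemma lmon_LP: "keys a \<subseteq> {1..N} \<Longrightarrow> lmon a \<in> LP N"
  unfolding lmon_def by (intro LP_ring powi_LP) auto

lemma lmon_poly:
  assumes "keys a \<subseteq> {1..N}" "\<And>c. lookup a c \<ge> 0" shows "lmon a \<in> polynomials N"
  unfolding lmon_def
proof (rule polynomials_prod)
  fix i assume "i \<in> keys a"
  then have "rat_var i \<in> polynomials N" using assms(1) by (intro polynomials_var) auto
  moreover have "rat_var i powi lookup a i = rat_var i ^ nat (lookup a i)"
    using assms(2)[of i] by (simp add: power_int_def)
  ultimately show "rat_var i powi lookup a i \<in> polynomials N" using polynomials_power by simp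
qed

text \<open>This turns preservation of polynomials into linear equations, one for each exponent with
  a negative entry.\<close>

lemma coef_polynomial: "f \<in> polynomials N \<Longrightarrow> lookup e c < 0 \<Longrightarrow> coef e f = 0"
proof -
  assume f: "f \<in> polynomials N" and e: "lookup e c < 0"
  obtain q where q: "f = lp q" "\<forall>a\<in>keys q. \<forall>c. lookup a c \<ge> 0"
    using polynomials_lp[OF f] by blast
  then have "e \<notin> keys q" using e by (meson not_le)
  then show ?thesis using q(1) by (simp add: in_keys_iff)
qed

section \<open>Filtered families of elements\<close>

definition adeg :: "(nat \<Rightarrow>\<^sub>0 int) \<Rightarrow> nat" where
  "adeg a = (\<Sum>i\<in>keys a. nat \<bar>lookup a i\<bar>)"

lemma adeg_superset: "finite A \<Longrightarrow> keys a \<subseteq> A \<Longrightarrow> adeg a = (\<Sum>i\<in>A. nat \<bar>lookup a i\<bar>)"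
  unfolding adeg_def by (intro sum.mono_neutral_left) (auto simp: in_keys_iff)

lemma adeg_add: "adeg (a + b) \<le> adeg a + adeg b"
proof -
  let ?A = "keys a \<union> keys b"
  have "keys (a + b) \<subseteq> ?A" by (rule Poly_Mapping.keys_add)
  then show ?thesis
    by (simp add: adeg_superset[of ?A] lookup_add flip: sum.distrib) (intro sum_mono, simp)
qed

lemma adeg_single [simp]: "adeg (single i n) = nat \<bar>n\<bar>"
  by (cases "n = 0") (simp_all add: adeg_def)

lemma adeg_0 [simp]: "adeg 0 = 0"
  by (simp add: adeg_def)

lemma adeg_pexp: "bij w \<Longrightarrow> adeg (pexp w a) = adeg a"
  unfolding adeg_def
  by (subst keys_pexp, assumption, subst sum.reindex) (auto simp: lookup_pexp_apply intro: inj_on_subset[OF bij_is_inj])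

type_synonym idx = "(nat \<Rightarrow>\<^sub>0 int) \<times> (nat \<Rightarrow> nat) \<times> (nat \<Rightarrow>\<^sub>0 nat)"

text \<open>Standard monomials X^a w y^b, filtered so that each X_i, each inverse of X_i and each
  y_i has degree one; every level is finite.\<close>

definition Idx :: "nat \<Rightarrow> nat \<Rightarrow> idx set" where
  "Idx N n = {(a, w, b). keys a \<subseteq> {1..N} \<and> w permutes {1..N} \<and> keys b \<subseteq> {1..N} \<and> adeg a + tdeg b \<le> n}"

lemma finite_poly_mapping_box:
  fixes B :: "'b::zero set"
  assumes "finite A" "finite B" shows "finite {a. keys a \<subseteq> A \<and> (\<forall>i\<in>A. lookup a i \<in> B)}"
proof (rule inj_on_finite[where f = "\<lambda>a. restrict (lookup a) A"])
  show "inj_on (\<lambda>a. restrict (lookup a) A) {a. keys a \<subseteq> A \<and> (\<forall>i\<in>A. lookup a i \<in> B)}"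
  proof (rule inj_onI, rule poly_mapping_eqI)
    fix a b i assume *: "a \<in> {a. keys a \<subseteq> A \<and> (\<forall>i\<in>A. lookup a i \<in> B)}"
      "b \<in> {a. keys a \<subseteq> A \<and> (\<forall>i\<in>A. lookup a i \<in> B)}"
      "restrict (lookup a) A = restrict (lookup b) A"
    show "lookup a i = lookup b i"
    proof (cases "i \<in> A")
      case True
      then show ?thesis using fun_cong[OF *(3), of i] by simp
    next
      case False
      then have "i \<notin> keys a" "i \<notin> keys b" using *(1,2) by auto
      then show ?thesis by (simp add: in_keys_iff)
    qed
  qed
  show "(\<lambda>a. restrict (lookup a) A) ` {a. keys a \<subseteq> A \<and> (\<forall>i\<in>A. lookup a i \<in> B)} \<subseteq> PiE A (\<lambda>_. B)"
    by auto
qed (use assms in \<open>auto intro: finite_PiE\<close>)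

lemma abs_lookup_le_adeg: "nat \<bar>lookup a i\<bar> \<le> adeg a"
  by (cases "i \<in> keys a") (auto simp: adeg_def in_keys_iff intro: member_le_sum[of i _ "\<lambda>i. nat \<bar>lookup a i\<bar>"])

lemma lookup_le_tdeg: "lookup m i \<le> tdeg m"
  by (cases "i \<in> keys m") (auto simp: tdeg_def in_keys_iff intro: member_le_sum[of i _ "lookup m"])

lemma finite_Idx: "finite (Idx N n)"
proof (rule finite_subset)
  let ?A = "{a. keys a \<subseteq> {1..N} \<and> (\<forall>i\<in>{1..N}. lookup a i \<in> {- int n..int n})}"
  let ?B = "{b. keys b \<subseteq> {1..N} \<and> (\<forall>i\<in>{1..N}. lookup b i \<in> {0..n})}"
  show "Idx N n \<subseteq> ?A \<times> {w. w permutes {1..N}} \<times> ?B"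
  proof
    fix t assume "t \<in> Idx N n"
    then obtain a w b where t: "t = (a, w, b)" "keys a \<subseteq> {1..N}" "w permutes {1..N}"
      "keys b \<subseteq> {1..N}" "adeg a + tdeg b \<le> n" by (auto simp: Idx_def)
    have "lookup a i \<in> {- int n..int n}" "lookup b i \<in> {0..n}" for i
      using abs_lookup_le_adeg[of a i] lookup_le_tdeg[of b i] t(5) by auto
    then show "t \<in> ?A \<times> {w. w permutes {1..N}} \<times> ?B" using t by blast
  qed
  show "finite (?A \<times> {w. w permutes {1..N}} \<times> ?B)"
    by (intro finite_cartesian_product finite_poly_mapping_box finite_permutations) auto
qed

definition Yw :: "nat \<Rightarrow> complex \<Rightarrow> nat list \<Rightarrow> cra" where
  "Yw N k xs = prod_list (map (cY N k) xs)"

definition El :: "nat \<Rightarrow> complex \<Rightarrow> idx \<Rightarrow> cra" where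
  "El N k = (\<lambda>(a, w, b). cM (lmon a) * cP w * Yw N k (word b))"

text \<open>One family of polynomial coefficients must serve all k simultaneously; this makes the
  later linear systems polynomial in k.\<close>

definition Rep :: "nat \<Rightarrow> nat \<Rightarrow> (complex \<Rightarrow> cra) \<Rightarrow> bool" where
  "Rep N n \<phi> \<longleftrightarrow> (\<exists>c :: idx \<Rightarrow> complex poly. \<forall>k. \<phi> k = (\<Sum>t\<in>Idx N n. cC (poly (c t) k) * El N k t))"

lemma Rep_0: "Rep N n (\<lambda>k. 0)"
  unfolding Rep_def by (rule exI[of _ "\<lambda>_. 0"]) simp

lemma Rep_add: "Rep N n \<phi> \<Longrightarrow> Rep N n \<psi> \<Longrightarrow> Rep N n (\<lambda>k. \<phi> k + \<psi> k)"
  unfolding Rep_def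
proof (elim exE)
  fix c d :: "idx \<Rightarrow> complex poly"
  assume "\<forall>k. \<phi> k = (\<Sum>t\<in>Idx N n. cC (poly (c t) k) * El N k t)" "\<forall>k. \<psi> k = (\<Sum>t\<in>Idx N n. cC (poly (d t) k) * El N k t)"
  then show "\<exists>c. \<forall>k. \<phi> k + \<psi> k = (\<Sum>t\<in>Idx N n. cC (poly (c t) k) * El N k t)"
    by (intro exI[of _ "\<lambda>t. c t + d t"]) (simp add: rat_const_add cM_add distrib_right sum.distrib)
qed

lemma Rep_scale: "Rep N n \<phi> \<Longrightarrow> Rep N n (\<lambda>k. cC (poly q k) * \<phi> k)"
  unfolding Rep_def
proof (elim exE)
  fix c :: "idx \<Rightarrow> complex poly"
  assume "\<forall>k. \<phi> k = (\<Sum>t\<in>Idx N n. cC (poly (c t) k) * El N k t)"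
  then show "\<exists>c. \<forall>k. cC (poly q k) * \<phi> k = (\<Sum>t\<in>Idx N n. cC (poly (c t) k) * El N k t)"
    by (intro exI[of _ "\<lambda>t. q * c t"]) (simp add: rat_const_mult cM_mult sum_distrib_left mult.assoc)
qed

lemma Rep_const: "Rep N n \<phi> \<Longrightarrow> Rep N n (\<lambda>k. cC c * \<phi> k)"
  using Rep_scale[of N n \<phi> "[:c:]"] by simp

lemma Rep_k: "Rep N n \<phi> \<Longrightarrow> Rep N n (\<lambda>k. cC k * \<phi> k)"
  using Rep_scale[of N n \<phi> "[:0, 1:]"] by simp

lemma Rep_uminus: "Rep N n \<phi> \<Longrightarrow> Rep N n (\<lambda>k. - \<phi> k)"
  using Rep_const[of N n \<phi> "-1"] by (simp add: rat_const_minus cM_minus)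

lemma Rep_diff: "Rep N n \<phi> \<Longrightarrow> Rep N n \<psi> \<Longrightarrow> Rep N n (\<lambda>k. \<phi> k - \<psi> k)"
  using Rep_add[OF _ Rep_uminus, of N n \<phi> \<psi>] by simp

lemma Rep_sum: "(\<And>x. x \<in> A \<Longrightarrow> Rep N n (\<phi> x)) \<Longrightarrow> Rep N n (\<lambda>k. \<Sum>x\<in>A. \<phi> x k)"
  by (induction A rule: infinite_finite_induct) (auto intro: Rep_0 Rep_add)

lemma Rep_El: "t \<in> Idx N n \<Longrightarrow> Rep N n (\<lambda>k. El N k t)"
proof -
  assume t: "t \<in> Idx N n"
  have "El N k t = (\<Sum>s\<in>Idx N n. cC (poly (if s = t then 1 else 0) k) * El N k s)" for k
  proof -
    have "(\<Sum>s\<in>Idx N n. cC (poly (if s = t then 1 else 0) k) * El N k s) = (\<Sum>s\<in>Idx N n. if s = t then El N k s else 0)"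
      by (intro sum.cong) auto
    then show ?thesis using t finite_Idx by simp
  qed
  then show ?thesis unfolding Rep_def by (intro exI[of _ "\<lambda>s. if s = t then 1 else 0"]) blast
qed

lemma Rep_linear:
  assumes "Rep N n \<phi>" "\<And>t. t \<in> Idx N n \<Longrightarrow> Rep N m (\<lambda>k. L k * El N k t)"
  shows "Rep N m (\<lambda>k. L k * \<phi> k)"
proof -
  obtain c :: "idx \<Rightarrow> complex poly" where c: "\<And>k. \<phi> k = (\<Sum>t\<in>Idx N n. cC (poly (c t) k) * El N k t)"
    using assms(1) by (auto simp: Rep_def)
  have "Rep N m (\<lambda>k. \<Sum>t\<in>Idx N n. cC (poly (c t) k) * (L k * El N k t))"
    using assms(2) by (intro Rep_sum Rep_scale)
  moreover have "(\<lambda>k. \<Sum>t\<in>Idx N n. cC (poly (c t) k) * (L k * El N k t)) = (\<lambda>k. L k * \<phi> k)"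
    by (simp add: c sum_distrib_left cC_left_commute[of "L _"] fun_eq_iff)
  ultimately show ?thesis by simp
qed

lemma Idx_mono: "n \<le> m \<Longrightarrow> Idx N n \<subseteq> Idx N m"
  by (auto simp: Idx_def)

lemma Rep_mono: "Rep N n \<phi> \<Longrightarrow> n \<le> m \<Longrightarrow> Rep N m \<phi>"
  using Rep_linear[of N n \<phi> m "\<lambda>_. 1"] Rep_El[of _ N m] Idx_mono by fastforce

lemma Yw_Cons: "Yw N k (x # xs) = cY N k x * Yw N k xs" and Yw_Nil [simp]: "Yw N k [] = 1"
  by (simp_all add: Yw_def)

lemma Yw_mset_cong:
  assumes "set xs \<subseteq> {1..N}" "mset xs = mset ys" shows "Yw N k xs = Yw N k ys"
proof -
  have "Yw N k xs = foldr (\<lambda>i. (*) (cY N k i)) xs 1" for xs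
    by (induction xs) (simp_all add: Yw_def)
  moreover have "foldr (\<lambda>i. (*) (cY N k i)) xs = foldr (\<lambda>i. (*) (cY N k i)) ys"
  proof (rule foldr_mset_cong)
    fix i j assume "i \<in> set xs" "j \<in> set xs"
    then have "cY N k i * cY N k j = cY N k j * cY N k i" using assms(1) by (intro cY_commute) auto
    then show "(*) (cY N k i) \<circ> (*) (cY N k j) = (*) (cY N k j) \<circ> (*) (cY N k i)"
      by (simp add: fun_eq_iff flip: mult.assoc)
  qed (use assms in auto)
  ultimately show ?thesis by simp
qed

section \<open>Straightening of products into standard monomials\<close>

lemma Rep_lmon_mult:
  assumes "keys a \<subseteq> {1..N}" "Rep N n \<phi>" shows "Rep N (n + adeg a) (\<lambda>k. cM (lmon a) * \<phi> k)"
proof (rule Rep_linear[OF assms(2)])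
  fix t assume "t \<in> Idx N n"
  then obtain a' w b where t: "t = (a', w, b)" "(a', w, b) \<in> Idx N n" by (cases t) auto
  have "cM (lmon a) * El N k t = El N k (a + a', w, b)" for k
    by (simp add: El_def t lmon_add cM_mult mult.assoc)
  moreover have "(a + a', w, b) \<in> Idx N (n + adeg a)"
    using t(2) assms(1) Poly_Mapping.keys_add[of a a'] adeg_add[of a a'] by (auto simp: Idx_def)
  ultimately show "Rep N (n + adeg a) (\<lambda>k. cM (lmon a) * El N k t)" using Rep_El by simp
qed

lemma Rep_cP_mult:
  assumes v: "v permutes {1..N}" "Rep N n \<phi>" shows "Rep N n (\<lambda>k. cP v * \<phi> k)"
proof (rule Rep_linear[OF assms(2)])
  fix t assume "t \<in> Idx N n"
  then obtain a w b where t: "t = (a, w, b)" "(a, w, b) \<in> Idx N n" by (cases t) auto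
  have w: "w permutes {1..N}" using t(2) by (simp add: Idx_def)
  have "cP v * El N k t = El N k (pexp v a, v \<circ> w, b)" for k
  proof -
    have "cP v * El N k t = (cP v * cM (lmon a)) * cP w * Yw N k (word b)" by (simp add: El_def t mult.assoc)
    also have "\<dots> = cM (lmon (pexp v a)) * (cP v * cP w) * Yw N k (word b)"
      using permutes_bij[OF v(1)] by (simp add: cP_cM rat_perm_lmon mult.assoc)
    finally show ?thesis using permutes_bij[OF v(1)] permutes_bij[OF w] by (simp add: El_def cP_comp)
  qed
  moreover have "(pexp v a, v \<circ> w, b) \<in> Idx N n"
    using t(2) v(1) permutes_bij[OF v(1)] permutes_in_image[OF v(1)] permutes_compose[OF w v(1)]
    by (auto simp: Idx_def adeg_pexp keys_pexp subset_iff)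
  ultimately show "Rep N n (\<lambda>k. cP v * El N k t)" using Rep_El by simp
qed

lemma adeg_exchange:
  assumes "c \<noteq> j" "\<bar>x\<bar> + \<bar>y\<bar> \<le> \<bar>lookup a c\<bar> + \<bar>lookup a j\<bar>"
  shows "adeg (a + single c (x - lookup a c) + single j (y - lookup a j)) \<le> adeg a"
proof -
  let ?b = "a + single c (x - lookup a c) + single j (y - lookup a j)"
  let ?A = "keys a \<union> {c, j}"
  have l: "lookup ?b i = (if i = c then x else if i = j then y else lookup a i)" for i
    using assms(1) by (simp add: lookup_add lookup_single when_def)
  have S: "(\<Sum>i\<in>?A. g i) = g c + g j + (\<Sum>i\<in>?A - {c} - {j}. g i)" for g :: "nat \<Rightarrow> nat"
    using assms(1) sum.remove[of ?A c g] sum.remove[of "?A - {c}" j g] by simp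
  have "keys ?b \<subseteq> ?A" by (auto simp: in_keys_iff l split: if_splits)
  then have "adeg ?b = (\<Sum>i\<in>?A. nat \<bar>lookup ?b i\<bar>)" by (intro adeg_superset) auto
  also have "\<dots> = nat \<bar>x\<bar> + nat \<bar>y\<bar> + (\<Sum>i\<in>?A - {c} - {j}. nat \<bar>lookup a i\<bar>)"
    proof -
    have "(\<Sum>i\<in>?A - {c} - {j}. nat \<bar>lookup ?b i\<bar>) = (\<Sum>i\<in>?A - {c} - {j}. nat \<bar>lookup a i\<bar>)"
      by (intro sum.cong refl) (simp add: l)
    then show ?thesis unfolding S using assms(1) by (simp add: l)
  qed
  also have "\<dots> \<le> nat \<bar>lookup a c\<bar> + nat \<bar>lookup a j\<bar> + (\<Sum>i\<in>?A - {c} - {j}. nat \<bar>lookup a i\<bar>)"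
    using nat_mono[OF assms(2)] by (simp add: nat_add_distrib)
  also have "\<dots> = (\<Sum>i\<in>?A. nat \<bar>lookup a i\<bar>)"
    by (rule S[symmetric])
  also have "\<dots> = adeg a" by (rule adeg_superset[symmetric]) auto
  finally show ?thesis .
qed

text \<open>The factor X_c matters: with it, the divided difference is, up to sign, a sum of
  monomials whose exponents at c and j keep their sum and lie between the two original ones, so the
  absolute degree does not grow.\<close>

lemma ddiff_lmon:
  assumes "c \<noteq> j" "c \<in> {1..N}" "j \<in> {1..N}" "keys a \<subseteq> {1..N}"
  shows "\<exists>f (d::nat) s. rat_var c * ddiff c j (lmon a) = rat_const s * (\<Sum>r<d. lmon (f r))
     \<and> (\<forall>r<d. adeg (f r) \<le> adeg a \<and> keys (f r) \<subseteq> {1..N})"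
proof -
  let ?m = "lookup a c" and ?n = "lookup a j"
  let ?X = "rat_var c" and ?Y = "rat_var j"
  define ex where "ex x y = a + single c (x - ?m) + single j (y - ?n)" for x y
  have ex: "lmon (ex x y) = lmon a * ?X powi (x - ?m) * ?Y powi (y - ?n)" for x y
    by (simp add: ex_def lmon_add)
  have exk: "keys (ex x y) \<subseteq> {1..N}" for x y
    using assms(2-4) by (auto simp: in_keys_iff ex_def lookup_add lookup_single when_def split: if_splits)
  have "pexp (transpose c j) a = ex ?n ?m"
    by (rule poly_mapping_eqI) (use assms(1) in \<open>auto simp: lookup_pexp ex_def lookup_add lookup_single when_def transpose_def inv_swap_id\<close>)
  then have s: "rat_perm (transpose c j) (lmon a) = lmon a * ?X powi (?n - ?m) * ?Y powi (?m - ?n)"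
    by (simp add: rat_perm_lmon ex)
  have XY: "?X - ?Y \<noteq> 0" using assms(1) by simp
  show ?thesis
  proof (cases "?m \<ge> ?n")
    case True
    define d where "d = nat (?m - ?n)"
    have d: "?m - ?n = int d" "?n - ?m = - int d" using True by (auto simp: d_def)
    have "?X * ddiff c j (lmon a) = lmon a * (?X * (1 - ?X powi (- int d) * ?Y ^ d)) / (?X - ?Y)"
      unfolding ddiff_def s d by (simp add: algebra_simps)
    also have "?X * (1 - ?X powi (- int d) * ?Y ^ d) = ?X powi (1 - int d) * (?X ^ d - ?Y ^ d)"
      by (simp add: power_int_diff power_int_minus field_simps)
    also have "?X ^ d - ?Y ^ d = (?X - ?Y) * (\<Sum>r<d. ?Y ^ (d - Suc r) * ?X ^ r)" by (rule power_diff_sumr2)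
    also have "lmon a * (?X powi (1 - int d) * ((?X - ?Y) * (\<Sum>r<d. ?Y ^ (d - Suc r) * ?X ^ r))) / (?X - ?Y)
        = lmon a * (?X powi (1 - int d) * (\<Sum>r<d. ?Y ^ (d - Suc r) * ?X ^ r))"
      using XY by simp
    also have "\<dots> = (\<Sum>r<d. lmon a * (?X powi (1 - int d) * ?X ^ r) * ?Y ^ (d - Suc r))"
      by (simp add: sum_distrib_left mult_ac)
    also have "\<dots> = (\<Sum>r<d. lmon (ex (?n + 1 + int r) (?m - 1 - int r)))"
    proof (rule sum.cong)
      fix r assume "r \<in> {..<d}"
      then have y: "?m - 1 - int r - ?n = int (d - Suc r)" using d by auto
      have x: "?n + 1 + int r - ?m = (1 - int d) + int r" using d by simp
      show "lmon a * (?X powi (1 - int d) * ?X ^ r) * ?Y ^ (d - Suc r) = lmon (ex (?n + 1 + int r) (?m - 1 - int r))"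
        unfolding ex x y by (simp add: power_int_add del: of_nat_diff of_nat_Suc)
    qed simp
    finally have "?X * ddiff c j (lmon a) = rat_const 1 * (\<Sum>r<d. lmon (ex (?n + 1 + int r) (?m - 1 - int r)))" by simp
    moreover have "adeg (ex (?n + 1 + int r) (?m - 1 - int r)) \<le> adeg a" if "r < d" for r
      unfolding ex_def using that d by (intro adeg_exchange assms(1)) auto
    ultimately show ?thesis using exk
      by (intro exI[of _ "\<lambda>r. ex (?n + 1 + int r) (?m - 1 - int r)"] exI[of _ d] exI[of _ 1]) simp
  next
    case False
    define d where "d = nat (?n - ?m)"
    have d: "?n - ?m = int d" "?m - ?n = - int d" using False by (auto simp: d_def)
    have "?X * ddiff c j (lmon a) = lmon a * (?X * (1 - ?X ^ d * ?Y powi (- int d))) / (?X - ?Y)"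
      unfolding ddiff_def s d by (simp add: algebra_simps)
    also have "?X * (1 - ?X ^ d * ?Y powi (- int d)) = - (?X * ?Y powi (- int d) * (?X ^ d - ?Y ^ d))"
      by (simp add: power_int_minus field_simps)
    also have "?X ^ d - ?Y ^ d = (?X - ?Y) * (\<Sum>r<d. ?Y ^ (d - Suc r) * ?X ^ r)" by (rule power_diff_sumr2)
    also have "lmon a * - (?X * ?Y powi (- int d) * ((?X - ?Y) * (\<Sum>r<d. ?Y ^ (d - Suc r) * ?X ^ r))) / (?X - ?Y)
        = - (lmon a * (?X * ?Y powi (- int d) * (\<Sum>r<d. ?Y ^ (d - Suc r) * ?X ^ r)))"
      using XY by simp
    also have "lmon a * (?X * ?Y powi (- int d) * (\<Sum>r<d. ?Y ^ (d - Suc r) * ?X ^ r))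
        = (\<Sum>r<d. lmon a * (?X * ?X ^ r) * (?Y powi (- int d) * ?Y ^ (d - Suc r)))"
      by (simp add: sum_distrib_left mult_ac)
    also have "(\<Sum>r<d. lmon a * (?X * ?X ^ r) * (?Y powi (- int d) * ?Y ^ (d - Suc r)))
        = (\<Sum>r<d. lmon (ex (?m + 1 + int r) (?n - 1 - int r)))"
    proof (rule sum.cong)
      fix r assume "r \<in> {..<d}"
      then have y: "?n - 1 - int r - ?n = (- int d) + int (d - Suc r)" by auto
      have x: "?m + 1 + int r - ?m = 1 + int r" by simp
      have "?Y powi (- int d) * ?Y ^ (d - Suc r) = ?Y powi ((- int d) + int (d - Suc r))"
        by (subst power_int_add) simp_all
      then show "lmon a * (?X * ?X ^ r) * (?Y powi (- int d) * ?Y ^ (d - Suc r)) = lmon (ex (?m + 1 + int r) (?n - 1 - int r))"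
        unfolding ex x y by (simp add: power_int_add del: of_nat_diff of_nat_Suc)
    qed simp
    finally have "?X * ddiff c j (lmon a) = rat_const (- 1) * (\<Sum>r<d. lmon (ex (?m + 1 + int r) (?n - 1 - int r)))"
      by (simp add: rat_const_minus)
    moreover have "adeg (ex (?m + 1 + int r) (?n - 1 - int r)) \<le> adeg a" if "r < d" for r
      unfolding ex_def using that d by (intro adeg_exchange assms(1)) auto
    ultimately show ?thesis using exk
      by (intro exI[of _ "\<lambda>r. ex (?m + 1 + int r) (?n - 1 - int r)"] exI[of _ d] exI[of _ "- 1"]) simp
  qed
qed

lemma Rep_cY_mult:
  assumes c: "c \<in> {1..N}" and "Rep N n \<phi>" shows "Rep N (Suc n) (\<lambda>k. cY N k c * \<phi> k)"
proof (rule Rep_linear[OF assms(2)])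
  fix t assume "t \<in> Idx N n"
  then obtain a w b where t: "t = (a, w, b)" "(a, w, b) \<in> Idx N n" by (cases t) auto
  have a: "keys a \<subseteq> {1..N}" and w: "w permutes {1..N}" and b: "keys b \<subseteq> {1..N}"
    and deg: "adeg a + tdeg b \<le> n" using t(2) by (auto simp: Idx_def)
  define Z where "Z k = cP w * Yw N k (word b)" for k
  have El: "El N k t = cM (lmon a) * Z k" for k by (simp add: El_def t Z_def mult.assoc)
  have Zrep: "Rep N (tdeg b) Z"
    using Rep_El[of "(0, w, b)" N "tdeg b"] w b by (simp add: Idx_def El_def Z_def[abs_def])
  have pZ: "Rep N (tdeg b) (\<lambda>k. cP (transpose c j) * Z k)" if "j \<in> {1..N}" for j
    using permutes_transpose[OF c that] Zrep by (rule Rep_cP_mult)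
  have mono: "Rep N (Suc n) (\<lambda>k. cM (lmon a') * \<psi> k)"
    if "keys a' \<subseteq> {1..N}" "adeg a' \<le> adeg a" "Rep N (tdeg b) \<psi>" for a' \<psi>
    using Rep_lmon_mult[OF that(1,3)] by (rule Rep_mono) (use that deg in simp)
  have YZ: "Rep N (Suc (tdeg b)) (\<lambda>k. cY N k c * Z k)"
  proof -
    \<comment> \<open>With w c' = c, the element y_c passes w as y_(c'), up to k times
      permutations.\<close>
    define c' where "c' = inv_into UNIV w c"
    have wc: "w c' = c" unfolding c'_def using permutes_inverses(1)[OF w] by simp
    have c': "c' \<in> {1..N}" using wc c permutes_in_image[OF w, of c'] by simp
    have 1: "cP w * cY N k c' * Yw N k (word b) = El N k (0, w, b + single c' 1)" for k
    proof -
      have "Yw N k (c' # word b) = Yw N k (word (b + single c' 1))"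
        using c' b by (intro Yw_mset_cong) (auto simp: mset_word_add)
      then show ?thesis by (simp add: El_def Yw_Cons mult.assoc)
    qed
    have "cY N k c * Z k = El N k (0, w, b + single c' 1)
        - cC k * ((\<Sum>j\<in>{1..<c}. cP (transpose c j) * Z k) - (\<Sum>j\<in>{1..<c'}. cP (transpose c (w j)) * Z k))" for k
    proof -
      have "cY N k c * cP w = cP w * cY N k c'
          - cC k * ((\<Sum>j\<in>{1..<c}. cP (transpose c j)) - (\<Sum>j\<in>{1..<c'}. cP (transpose c (w j)))) * cP w"
        using cP_cY[OF w c', of k] by (simp add: wc)
      then have "cY N k c * Z k = cP w * cY N k c' * Yw N k (word b)
          - cC k * ((\<Sum>j\<in>{1..<c}. cP (transpose c j)) - (\<Sum>j\<in>{1..<c'}. cP (transpose c (w j)))) * Z k"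
        unfolding Z_def by (simp add: left_diff_distrib flip: mult.assoc)
      then show ?thesis unfolding 1 by (simp add: mult.assoc left_diff_distrib sum_distrib_right)
    qed
    moreover have "Rep N (Suc (tdeg b)) (\<lambda>k. El N k (0, w, b + single c' 1))"
      using w b c' Poly_Mapping.keys_add[of b "single c' 1"] by (intro Rep_El) (auto simp: Idx_def)
    moreover have "Rep N (Suc (tdeg b)) (\<lambda>k. cC k * ((\<Sum>j\<in>{1..<c}. cP (transpose c j) * Z k) - (\<Sum>j\<in>{1..<c'}. cP (transpose c (w j)) * Z k)))"
      using c c' permutes_in_image[OF w]
      by (intro Rep_k Rep_diff Rep_sum Rep_mono[OF pZ]) auto
    ultimately show ?thesis using Rep_diff by simp
  qed
  have A: "Rep N (Suc n) (\<lambda>k. cM (lmon a) * (cY N k c * Z k))"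
    using Rep_lmon_mult[OF a YZ] by (rule Rep_mono) (use deg in simp)
  have D: "Rep N (Suc n) (\<lambda>k. cM (rat_var c * ddiff c j (lmon a)) * (cP (transpose c j) * Z k))"
    if j: "j \<in> {1..N} - {c}" for j
  proof -
    obtain f d s where f: "rat_var c * ddiff c j (lmon a) = rat_const s * (\<Sum>r<d::nat. lmon (f r))"
      "\<And>r. r < d \<Longrightarrow> adeg (f r) \<le> adeg a \<and> keys (f r) \<subseteq> {1..N}"
      using ddiff_lmon[of c j N a] c j a by auto
    have "Rep N (Suc n) (\<lambda>k. cC s * (\<Sum>r<d. cM (lmon (f r)) * (cP (transpose c j) * Z k)))"
      using f(2) j by (intro Rep_const Rep_sum mono pZ) auto
    then show ?thesis unfolding f(1) by (simp add: cM_mult cM_sum sum_distrib_right mult.assoc)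
  qed
  have S: "Rep N (Suc n) (\<lambda>k. cM (lmon a - rat_perm (transpose c j) (lmon a)) * (cP (transpose c j) * Z k))"
    if j: "j \<in> {1..<c}" for j
  proof -
    have jN: "j \<in> {1..N}" using j c by auto
    have "keys (pexp (transpose c j) a) \<subseteq> {1..N}"
      using a permutes_in_image[OF permutes_transpose[OF c jN]] by (auto simp: keys_pexp subset_iff)
    then have "Rep N (Suc n) (\<lambda>k. cM (lmon a) * (cP (transpose c j) * Z k)
        - cM (lmon (pexp (transpose c j) a)) * (cP (transpose c j) * Z k))"
      using a jN by (intro Rep_diff mono pZ) (auto simp: adeg_pexp)
    then show ?thesis by (simp add: rat_perm_lmon cM_diff left_diff_distrib)
  qed
  have "cY N k c * El N k t = cM (lmon a) * (cY N k c * Z k) + cC (of_int (lookup a c)) * (cM (lmon a) * Z k)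
    - cC k * (\<Sum>j\<in>{1..N} - {c}. cM (rat_var c * ddiff c j (lmon a)) * (cP (transpose c j) * Z k))
    + cC k * (\<Sum>j\<in>{1..<c}. cM (lmon a - rat_perm (transpose c j) (lmon a)) * (cP (transpose c j) * Z k))" for k
  proof -
    have "cY N k c * El N k t = (cY N k c * cM (lmon a)) * Z k" by (simp add: El mult.assoc)
    then show ?thesis unfolding cY_cM euler_lmon
      by (simp add: cM_mult distrib_right left_diff_distrib sum_distrib_right mult.assoc)
  qed
  moreover have "Rep N (Suc n) (\<lambda>k. cM (lmon a) * (cY N k c * Z k) + cC (of_int (lookup a c)) * (cM (lmon a) * Z k)
    - cC k * (\<Sum>j\<in>{1..N} - {c}. cM (rat_var c * ddiff c j (lmon a)) * (cP (transpose c j) * Z k))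
    + cC k * (\<Sum>j\<in>{1..<c}. cM (lmon a - rat_perm (transpose c j) (lmon a)) * (cP (transpose c j) * Z k)))"
    by (intro Rep_add Rep_diff Rep_const Rep_k Rep_sum A D S mono[OF a order_refl Zrep])
  ultimately show "Rep N (Suc n) (\<lambda>k. cY N k c * El N k t)" by simp
qed

lemma Rep_Yw_mult: "set xs \<subseteq> {1..N} \<Longrightarrow> Rep N n \<phi> \<Longrightarrow> Rep N (n + length xs) (\<lambda>k. Yw N k xs * \<phi> k)"
  by (induction xs) (auto simp: Yw_Cons mult.assoc intro: Rep_cY_mult)

lemma Rep_1: "Rep N 0 (\<lambda>k. 1)"
  using Rep_El[of "(0, id, 0)" N 0] by (simp add: Idx_def permutes_id El_def)

lemma Rep_mult:
  assumes "Rep N m \<phi>" "Rep N n \<psi>" shows "Rep N (m + n) (\<lambda>k. \<phi> k * \<psi> k)"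
proof -
  obtain c :: "idx \<Rightarrow> complex poly" where c: "\<And>k. \<phi> k = (\<Sum>t\<in>Idx N m. cC (poly (c t) k) * El N k t)"
    using assms(1) by (auto simp: Rep_def)
  have "Rep N (m + n) (\<lambda>k. El N k t * \<psi> k)" if "t \<in> Idx N m" for t
  proof -
    obtain a w b where t: "t = (a, w, b)" "(a, w, b) \<in> Idx N m" using \<open>t \<in> Idx N m\<close> by (cases t) auto
    then have "Rep N (n + tdeg b + adeg a) (\<lambda>k. cM (lmon a) * (cP w * (Yw N k (word b) * \<psi> k)))"
      using assms(2) Rep_Yw_mult[of "word b" N n \<psi>] by (intro Rep_lmon_mult Rep_cP_mult) (auto simp: Idx_def)
    then show ?thesis using t Rep_mono[of N "n + tdeg b + adeg a" _ "m + n"] by (simp add: El_def mult.assoc Idx_def)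
  qed
  then have "Rep N (m + n) (\<lambda>k. \<Sum>t\<in>Idx N m. cC (poly (c t) k) * (El N k t * \<psi> k))" by (intro Rep_sum Rep_scale)
  then show ?thesis by (simp add: c sum_distrib_right mult.assoc)
qed

lemma Rep_cP: "w permutes {1..N} \<Longrightarrow> Rep N 0 (\<lambda>k. cP w)"
  using Rep_cP_mult[OF _ Rep_1] by simp

lemma Rep_cY: "c \<in> {1..N} \<Longrightarrow> Rep N 1 (\<lambda>k. cY N k c)"
  using Rep_cY_mult[OF _ Rep_1] by (simp add: One_nat_def)

lemma Rep_lmon: "keys a \<subseteq> {1..N} \<Longrightarrow> Rep N (adeg a) (\<lambda>k. cM (lmon a))"
  using Rep_lmon_mult[OF _ Rep_1, of a N] by simp

lemma Rep_cC: "Rep N 0 (\<lambda>k. cC c)"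
  using Rep_const[OF Rep_1, of N c] by simp

text \<open>The spanning half of a PBW theorem. The element is first extended to a family over all
  k, because straightening is done for families.\<close>

lemma H_Rep:
  assumes "L \<in> H N k" shows "\<exists>n x. L = (\<Sum>t\<in>Idx N n. cC (x t) * El N k t)"
proof -
  have "\<exists>n \<phi>. Rep N n \<phi> \<and> \<phi> k = L"
    using assms
  proof (induction rule: H_induct)
    case (const c)
    then show ?case using Rep_cC by blast
  next
    case (letter g)
    show ?case
    proof (cases g)
      case (Perm w)
      then show ?thesis using Rep_cP letter by (metis letter_cra.simps(1) letter_ok.simps(1))
    next
      case (VarX i)
      then show ?thesis using Rep_lmon[of "single i 1" N] letter by force
    next
      case (InvX i)
      then have "Rep N (adeg (single i (- 1))) (\<lambda>k. cM (1 / rat_var i))"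
        using Rep_lmon[of "single i (- 1)" N] letter by (simp add: power_int_minus divide_inverse)
      then show ?thesis using InvX by force
    next
      case (VarY i)
      then show ?thesis using Rep_cY[of i N] letter by (auto intro!: exI[of _ "\<lambda>k. cY N k i"])
    qed
  next
    case (add L M)
    then obtain m \<phi> n \<psi> where "Rep N m \<phi>" "\<phi> k = L" "Rep N n \<psi>" "\<psi> k = M" by blast
    then show ?case using Rep_add[OF Rep_mono[of N m \<phi> "m + n"] Rep_mono[of N n \<psi> "m + n"]]
      by (intro exI[of _ "m + n"] exI[of _ "\<lambda>k. \<phi> k + \<psi> k"]) simp
  next
    case (mult L M)
    then obtain m \<phi> n \<psi> where "Rep N m \<phi>" "\<phi> k = L" "Rep N n \<psi>" "\<psi> k = M" by blast
    then show ?case using Rep_mult by (intro exI[of _ "m + n"] exI[of _ "\<lambda>k. \<phi> k * \<psi> k"]) simp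
  qed
  then obtain n \<phi> and c :: "idx \<Rightarrow> complex poly"
    where "\<forall>k. \<phi> k = (\<Sum>t\<in>Idx N n. cC (poly (c t) k) * El N k t)" "\<phi> k = L" by (auto simp: Rep_def)
  then show ?thesis by (intro exI[of _ n] exI[of _ "\<lambda>t. poly (c t) k"]) auto
qed

section \<open>The action on monomials and its specialization at \<open>k = 0\<close>\<close>

lemma phi_mult: "L \<in> CA N \<Longrightarrow> M \<in> CA N \<Longrightarrow> phi.tw u (L * M) g = phi.tw u L (phi.tw u M g)"
  by (rule phi.tw_mult[OF CA_adm CA_adm])

lemma phi_scale: "L \<in> CA N \<Longrightarrow> phi.tw u L (rat_const c * g) = rat_const c * phi.tw u L g"
  using phi_mult[of L N "cC c" u g] cC_commute[of L c] by (simp add: phi.tw_cM phi.tw_cM_mult)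

text \<open>The coefficient of -k in the twisted action of y_i; it involves neither k nor u.\<close>

definition Bop :: "nat \<Rightarrow> nat \<Rightarrow> ratfun \<Rightarrow> ratfun" where
  "Bop N i g = (\<Sum>j\<in>{1..N} - {i}. rat_var i * ddiff i j g) + (\<Sum>j\<in>{1..<i}. rat_perm (transpose i j) g)"

lemma phi_cY:
  assumes i: "i \<in> {1..N}"
  shows "phi.tw u (cY N k i) g = rat_var i * rat_deriv i g + rat_const u * g - rat_const k * Bop N i g"
proof -
  have "phi.tw u (cP (transpose i j)) g = rat_perm (transpose i j) g" if "j \<in> {1..<i}" for j
    using phi.tw_cP[OF permutes_transpose[of i "{1..N}" j], of u g] that i by simp
  then have "phi.tw u (cY N k i) g = rat_var i * phi.tw u (cDk N k i) g - rat_const k * (\<Sum>j\<in>{1..<i}. rat_perm (transpose i j) g)"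
    unfolding cY_def phi.tw_diff phi.tw_cM_mult phi.tw_sum by simp
  also have "rat_var i * phi.tw u (cDk N k i) g
      = rat_var i * rat_deriv i g + rat_const u * g - rat_const k * (\<Sum>j\<in>{1..N} - {i}. rat_var i * ddiff i j g)"
    unfolding phi_tw_cDk[OF i] dk_def by (simp add: distrib_left right_diff_distrib sum_distrib_left mult.left_commute)
  finally show ?thesis by (simp add: Bop_def algebra_simps)
qed

text \<open>Laurent polynomials depending polynomially on \<open>k\<close>.\<close>

inductive pfam :: "nat \<Rightarrow> (complex \<Rightarrow> ratfun) \<Rightarrow> bool" for N where
  const: "f \<in> LP N \<Longrightarrow> pfam N (\<lambda>k. f)"
| add: "pfam N v \<Longrightarrow> pfam N w \<Longrightarrow> pfam N (\<lambda>k. v k + w k)"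
| scale: "pfam N v \<Longrightarrow> pfam N (\<lambda>k. rat_const k * v k)"

lemma pfam_LP: "pfam N v \<Longrightarrow> v k \<in> LP N"
  by (induction rule: pfam.induct) (auto intro: LP_ring)

lemma pfam_coef: "pfam N v \<Longrightarrow> \<exists>q. \<forall>k. coef e (v k) = poly q k"
proof (induction rule: pfam.induct)
  case (const f)
  show ?case by (rule exI[of _ "[:coef e f:]"]) simp
next
  case (add v w)
  then obtain q r where "\<forall>k. coef e (v k) = poly q k" "\<forall>k. coef e (w k) = poly r k" by blast
  then show ?case using coef_add[OF pfam_LP[OF add.hyps(1)] pfam_LP[OF add.hyps(2)]]
    by (intro exI[of _ "q + r"]) simp
next
  case (scale v)
  then obtain q where "\<forall>k. coef e (v k) = poly q k" by blast
  then show ?case using coef_scale[OF pfam_LP[OF scale.hyps]] by (intro exI[of _ "[:0, 1:] * q"]) simp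
qed

lemma pfam_map:
  assumes "pfam N v" "\<And>f. f \<in> LP N \<Longrightarrow> T f \<in> LP N" "\<And>f g. T (f + g) = T f + T g"
    "\<And>c f. T (rat_const c * f) = rat_const c * T f"
  shows "pfam N (\<lambda>k. T (v k))"
  using assms(1) by (induction rule: pfam.induct) (auto simp: assms(3,4) intro: pfam.intros assms(2))

lemma pfam_phi_cY:
  assumes i: "i \<in> {1..N}" and v: "pfam N v"
  shows "pfam N (\<lambda>k. phi.tw u (cY N k i) (v k))"
proof -
  have A: "pfam N (\<lambda>k. rat_var i * rat_deriv i (v k) + rat_const u * v k)"
  proof (rule pfam_map[OF v, of "\<lambda>f. rat_var i * rat_deriv i f + rat_const u * f"])
    fix f assume "f \<in> LP N"
    moreover have "rat_deriv i f \<in> LP N" using LP_dk[of i N f 0] i \<open>f \<in> LP N\<close> by (simp add: dk_def)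
    ultimately show "rat_var i * rat_deriv i f + rat_const u * f \<in> LP N" using i by (intro LP_ring LP_var LP_const)
  qed (simp_all add: rat_deriv_scale distrib_left mult.left_commute)
  have "pfam N (\<lambda>k. - Bop N i (v k))"
  proof (rule pfam_map[OF v, of "\<lambda>f. - Bop N i f"])
    fix f assume f: "f \<in> LP N"
    have "transpose i j permutes {1..N}" if "j \<in> {1..<i}" for j using i that by (intro permutes_transpose) auto
    then show "- Bop N i f \<in> LP N" unfolding Bop_def using i f
      by (intro LP_ring LP_var LP_ddiff LP_perm) auto
  qed (simp_all add: Bop_def ddiff_add ddiff_scale sum.distrib sum_distrib_left distrib_left right_diff_distrib mult.left_commute)
  then have "pfam N (\<lambda>k. (rat_var i * rat_deriv i (v k) + rat_const u * v k) + rat_const k * - Bop N i (v k))"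
    using pfam.add[OF A pfam.scale] by blast
  then show ?thesis by (simp add: phi_cY[OF i])
qed

lemma pfam_phi_word:
  "set xs \<subseteq> {1..N} \<Longrightarrow> pfam N v \<Longrightarrow> pfam N (\<lambda>k. foldr (\<lambda>i. phi.tw u (cY N k i)) xs (v k))"
  by (induction xs) (auto intro: pfam_phi_cY)

lemma CA_Yw: "set xs \<subseteq> {1..N} \<Longrightarrow> Yw N k xs \<in> CA N"
  unfolding Yw_def by (rule CA_prod_list) (auto intro: CA_cY)

lemma phi_Yw: "set xs \<subseteq> {1..N} \<Longrightarrow> phi.tw u (Yw N k xs) g = foldr (\<lambda>i. phi.tw u (cY N k i)) xs g"
proof (induction xs)
  case (Cons x xs)
  then show ?case using phi_mult[OF CA_cY CA_Yw, of x N xs u k k g] by (simp add: Yw_Cons)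
qed (simp add: phi.tw_1)

lemma Idx_iff: "(a, w, b) \<in> Idx N n \<longleftrightarrow>
    keys a \<subseteq> {1..N} \<and> w permutes {1..N} \<and> keys b \<subseteq> {1..N} \<and> adeg a + tdeg b \<le> n"
  by (simp add: Idx_def)

lemma phi_El:
  assumes "(a, w, b) \<in> Idx N n"
  shows "phi.tw u (El N k (a, w, b)) g = lmon a * rat_perm w (foldr (\<lambda>i. phi.tw u (cY N k i)) (word b) g)"
  using assms phi_mult[OF CA_cP CA_Yw, of w N "word b" u k g] phi.tw_cP[of w N u]
  by (simp add: Idx_iff El_def mult.assoc phi.tw_cM_mult phi_Yw)

lemma pfam_phi_El:
  assumes "t \<in> Idx N n" "f \<in> LP N" shows "pfam N (\<lambda>k. phi.tw u (El N k t) f)"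
proof -
  obtain a w b where t: "t = (a, w, b)" "(a, w, b) \<in> Idx N n" using assms(1) by (cases t) auto
  have "pfam N (\<lambda>k. lmon a * rat_perm w (foldr (\<lambda>i. phi.tw u (cY N k i)) (word b) f))"
  proof (rule pfam_map[of N _ "\<lambda>f. lmon a * rat_perm w f"])
    show "pfam N (\<lambda>k. foldr (\<lambda>i. phi.tw u (cY N k i)) (word b) f)"
      using t(2) assms(2) by (intro pfam_phi_word pfam.const) (auto simp: Idx_iff)
  qed (use t(2) in \<open>auto simp: Idx_iff permutes_bij distrib_left mult.left_commute intro: LP_ring LP_perm lmon_LP\<close>)
  then show ?thesis unfolding t(1) phi_El[OF t(2)] .
qed

lemma phi_cY_0:
  "i \<in> {1..N} \<Longrightarrow> phi.tw u (cY N 0 i) (rat_const c * lmon m) = rat_const ((of_int (lookup m i) + u) * c) * lmon m"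
  by (simp add: phi_cY rat_deriv_scale mult.left_commute[of "rat_var i"] euler_lmon rat_const_add rat_const_mult algebra_simps)

lemma phi_word_0:
  "set xs \<subseteq> {1..N} \<Longrightarrow> foldr (\<lambda>i. phi.tw u (cY N 0 i)) xs (lmon m)
    = rat_const (prod_list (map (\<lambda>i. of_int (lookup m i) + u) xs)) * lmon m"
  by (induction xs) (simp_all add: phi_cY_0)

lemma phi_El_0:
  assumes "(a, w, b) \<in> Idx N n"
  shows "phi.tw u (El N 0 (a, w, b)) (lmon m)
    = rat_const (mono_val (\<lambda>i. of_int (lookup m i) + u) b) * lmon (a + pexp w m)"
proof -
  have "set (word b) \<subseteq> {1..N}" "bij w" using assms by (auto simp: Idx_iff permutes_bij)
  then show ?thesis unfolding phi_El[OF assms] by (simp add: phi_word_0 mono_val_word rat_perm_lmon lmon_add)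
qed

section \<open>Exponents with well separated entries\<close>

text \<open>For these exponents \<open>m\<close>, the exponent \<open>a + w m\<close> with \<open>|a| \<le> n\<close> determines \<open>a\<close> and \<open>w\<close>.\<close>

definition gexp :: "nat \<Rightarrow> nat \<Rightarrow> (nat \<Rightarrow>\<^sub>0 int) \<Rightarrow> bool" where
  "gexp N n m \<longleftrightarrow> keys m \<subseteq> {1..N} \<and> (\<forall>i. lookup m i \<ge> 0) \<and>
    (\<forall>i\<in>{1..N}. \<forall>j\<in>{1..N}. i \<noteq> j \<longrightarrow> \<bar>lookup m i - lookup m j\<bar> > 2 * int n)"

text \<open>At a position where w and v pull back different entries of m, these differ by more than
  2n, which the entries of a and a', bounded by n, cannot compensate.\<close>

lemma gexp_separates:
  assumes m: "gexp N n m" and w: "w permutes {1..N}" "v permutes {1..N}" and "adeg a \<le> n" "adeg a' \<le> n"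
    and eq: "a + pexp w m = a' + pexp v m"
  shows "w = v \<and> a = a'"
proof -
  have *: "inv_into UNIV w x = inv_into UNIV v x" if x: "x \<in> {1..N}" for x
  proof (rule ccontr)
    assume ne: "inv_into UNIV w x \<noteq> inv_into UNIV v x"
    have "inv_into UNIV w x \<in> {1..N}" "inv_into UNIV v x \<in> {1..N}"
      using permutes_in_image[OF permutes_inv[OF w(1)]] permutes_in_image[OF permutes_inv[OF w(2)]] x by auto
    then have "\<bar>lookup m (inv_into UNIV w x) - lookup m (inv_into UNIV v x)\<bar> > 2 * int n"
      using m ne unfolding gexp_def by blast
    moreover have "lookup a x + lookup m (inv_into UNIV w x)
        = lookup a' x + lookup m (inv_into UNIV v x)"
      using arg_cong[OF eq, of "\<lambda>e. lookup e x"] w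
      by (simp add: lookup_add lookup_pexp permutes_bij)
    moreover have "\<bar>lookup a x\<bar> \<le> int n" "\<bar>lookup a' x\<bar> \<le> int n"
      using abs_lookup_le_adeg[of a x] abs_lookup_le_adeg[of a' x] assms(4,5) by linarith+
    ultimately show False by linarith
  qed
  have "w y = v y" for y
  proof (cases "y \<in> {1..N}")
    case True
    then have "w y \<in> {1..N}" using permutes_in_image[OF w(1)] by blast
    then have "inv_into UNIV v (w y) = y" using *[of "w y"] permutes_inverses(2)[OF w(1)] by simp
    then show ?thesis using permutes_inverses(1)[OF w(2), of "w y"] by simp
  next
    case False
    then show ?thesis using w by (simp add: permutes_not_in)
  qed
  then have "w = v" by blast
  then show ?thesis using eq by simp
qed

lemma gexp_select:
  fixes s :: "idx \<Rightarrow> complex"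
  assumes m: "gexp N n m" and T: "T \<subseteq> Idx N n" and w0: "w0 permutes {1..N}" and a0: "adeg a0 \<le> n"
  shows "(\<Sum>t\<in>T. if fst t + pexp (fst (snd t)) m = a0 + pexp w0 m then s t else 0) = (\<Sum>b | (a0, w0, b) \<in> T. s (a0, w0, b))"
proof -
  have fin: "finite T" using T finite_Idx finite_subset by blast
  have "(\<Sum>t\<in>T. if fst t + pexp (fst (snd t)) m = a0 + pexp w0 m then s t else 0)
      = (\<Sum>t\<in>(\<lambda>b. (a0, w0, b)) ` {b. (a0, w0, b) \<in> T}. s t)"
  proof (rule sum.mono_neutral_cong_right[OF fin])
    show "\<forall>t\<in>T - (\<lambda>b. (a0, w0, b)) ` {b. (a0, w0, b) \<in> T}.
        (if fst t + pexp (fst (snd t)) m = a0 + pexp w0 m then s t else 0) = 0"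
    proof
      fix t assume t: "t \<in> T - (\<lambda>b. (a0, w0, b)) ` {b. (a0, w0, b) \<in> T}"
      obtain a w b where t': "t = (a, w, b)" by (cases t)
      then have "(a, w, b) \<in> Idx N n" using t T by auto
      then have "a + pexp w m = a0 + pexp w0 m \<Longrightarrow> w = w0 \<and> a = a0"
        using gexp_separates[OF m _ w0 _ a0, of w a] by (auto simp: Idx_iff)
      then show "(if fst t + pexp (fst (snd t)) m = a0 + pexp w0 m then s t else 0) = 0" using t t' by auto
    qed
  qed auto
  also have "\<dots> = (\<Sum>b | (a0, w0, b) \<in> T. s (a0, w0, b))" by (subst sum.reindex) (auto simp: inj_on_def)
  finally show ?thesis .
qed

lemma ev_of_nat [simp]: "ev x (of_nat n) = of_nat n"
  by (induction n) (simp_all add: ev_simps)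

lemma ev_of_int [simp]: "ev x (of_int n) = of_int n"
  by (cases n) (simp_all add: ev_simps)

text \<open>Separated exponents are Zariski dense in the hyperplane x_c = t + u: after substitution,
  p times the nonzero product \<open>W\<close> of forbidden differences vanishes at all positive
  natural points. For c outside {1..N} no exponent is constrained, and this is density in the whole
  space.\<close>

lemma gexp_vanish:
  assumes p: "vars_in {1..N} p"
    and H: "\<And>m. gexp N n m \<Longrightarrow> (c \<in> {1..N} \<Longrightarrow> lookup m c = int t) \<Longrightarrow> ev (\<lambda>i. of_int (lookup m i) + u) p = 0"
    and x: "x c = of_nat t + u"
  shows "ev x p = 0"
proof -
  define \<sigma> where "\<sigma> j = (if j = c then mconst (of_nat t) else mvar j)" for j
  define \<tau> where "\<tau> j = \<sigma> j + mconst u" for j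
  define W where "W = (\<Prod>(i, j)\<in>{(i, j). i \<in> {1..N} \<and> j \<in> {1..N} \<and> i \<noteq> j}. \<Prod>d\<in>{- 2 * int n..2 * int n}. \<sigma> i - \<sigma> j - mconst (of_int d))"
  have ev\<sigma>: "ev y (\<sigma> j) = (if j = c then of_nat t else y j)" for y j
    by (simp add: \<sigma>_def ev_simps)
  have fin: "finite {(i, j). i \<in> {1..N} \<and> j \<in> {1..N} \<and> i \<noteq> j}"
    by (rule finite_subset[of _ "{1..N} \<times> {1..N}"]) auto
  have "\<sigma> i - \<sigma> j - mconst (of_int d) \<noteq> 0" if "i \<noteq> j" for i j d
  proof
    assume z: "\<sigma> i - \<sigma> j - mconst (of_int d) = 0"
    have "ev y (\<sigma> i - \<sigma> j - mconst (of_int d)) = 0" for y unfolding z by (simp add: ev_simps)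
    then have *: "ev y (\<sigma> i) - ev y (\<sigma> j) - of_int d = 0" for y by (simp add: ev_simps)
    \<comment> \<open>One of the two forms may be the constant t, so there are two test points: the
      first refutes the identity if i differs from c, the second if i = c.\<close>
    show False
      using *[of "\<lambda>x. if x = i then of_int d + 1 + of_nat t else of_nat t"]
        *[of "\<lambda>x. if x = j then of_nat t - of_int d - 1 else 0"] that
      by (auto simp: ev\<sigma> split: if_splits)
  qed
  then have W0: "W \<noteq> 0" unfolding W_def using fin by (auto simp: prod_zero_iff)
  have "msubst \<tau> p * W = 0"
  proof (rule mpoly_zeroI)
    fix y :: "nat \<Rightarrow> nat"
    let ?y = "\<lambda>i. of_nat (y i) :: complex"
    define m where "m = (\<Sum>i\<in>{1..N}. single i (int ((y(c := t)) i)))"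
    have m: "lookup m i = (if i \<in> {1..N} then int ((y(c := t)) i) else 0)" for i
      unfolding m_def by (simp add: lookup_sum lookup_single when_def)
    have \<tau>m: "ev ?y (\<tau> i) = of_int (lookup m i) + u" and \<sigma>m: "ev ?y (\<sigma> i) = of_int (lookup m i)"
      if "i \<in> {1..N}" for i using that by (simp_all add: \<tau>_def ev_simps ev\<sigma> m)
    show "ev ?y (msubst \<tau> p * W) = 0"
    proof (cases "ev ?y W = 0")
      case False
      have "gexp N n m" unfolding gexp_def
      proof (intro conjI ballI impI allI)
        fix i j assume ij: "i \<in> {1..N}" "j \<in> {1..N}" "i \<noteq> j"
        show "2 * int n < \<bar>lookup m i - lookup m j\<bar>"
        proof (rule ccontr)
          define d where "d = lookup m i - lookup m j"
          assume "\<not> 2 * int n < \<bar>lookup m i - lookup m j\<bar>"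
          then have d: "d \<in> {- 2 * int n..2 * int n}" by (auto simp: d_def)
          have "ev ?y (\<sigma> i - \<sigma> j - mconst (of_int d)) = 0"
            using ij by (simp add: ev_simps \<sigma>m d_def)
          then have "(\<Prod>d\<in>{- 2 * int n..2 * int n}. ev ?y (\<sigma> i - \<sigma> j - mconst (of_int d))) = 0"
            using d by (intro prod_zero) auto
          then have "(\<Prod>(i, j)\<in>{(i, j). i \<in> {1..N} \<and> j \<in> {1..N} \<and> i \<noteq> j}.
              \<Prod>d\<in>{- 2 * int n..2 * int n}. ev ?y (\<sigma> i - \<sigma> j - mconst (of_int d))) = 0"
            using ij by (intro prod_zero[OF fin] bexI[of _ "(i, j)"]) auto
          moreover have "ev ?y W = (\<Prod>(i, j)\<in>{(i, j). i \<in> {1..N} \<and> j \<in> {1..N} \<and> i \<noteq> j}.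
              \<Prod>d\<in>{- 2 * int n..2 * int n}. ev ?y (\<sigma> i - \<sigma> j - mconst (of_int d)))"
            unfolding W_def pev_prod[OF coeff_hom_id] by (intro prod.cong refl) (auto simp: pev_prod[OF coeff_hom_id])
          ultimately show False using False by simp
        qed
      qed (auto simp: m in_keys_iff split: if_splits)
      then have "ev (\<lambda>i. of_int (lookup m i) + u) p = 0" by (rule H) (simp add: m)
      moreover have "ev ?y (msubst \<tau> p) = ev (\<lambda>i. of_int (lookup m i) + u) p"
        unfolding ev_msubst by (rule ev_cong_vars[OF p]) (rule \<tau>m)
      ultimately show ?thesis by (simp add: ev_simps)
    qed (simp add: ev_simps)
  qed
  then have "msubst \<tau> p = 0" using W0 by simp
  then have "ev (\<lambda>i. x i - u) (msubst \<tau> p) = 0" by (simp add: ev_simps)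
  moreover have "(\<lambda>i. ev (\<lambda>i. x i - u) (\<tau> i)) = x" using x by (auto simp: \<tau>_def ev_simps ev\<sigma> fun_eq_iff)
  ultimately show ?thesis unfolding ev_msubst by simp
qed

lemma lookup_mvar_mult:
  "lookup (mvar c * q) b = (if lookup b c = 0 then 0 else lookup q (b - single c 1))"
proof (induction q rule: poly_mapping_additive_induct)
  case (2 m d)
  have "single c 1 + m = b \<longleftrightarrow> lookup b c \<noteq> 0 \<and> m = b - single c 1"
  proof
    assume "single c 1 + m = b"
    then show "lookup b c \<noteq> 0 \<and> m = b - single c 1" by (auto simp: lookup_add)
  next
    assume *: "lookup b c \<noteq> 0 \<and> m = b - single c 1"
    show "single c 1 + m = b"
      by (rule poly_mapping_eqI) (use * in \<open>auto simp: lookup_add lookup_minus lookup_single when_def\<close>)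
  qed
  then show ?case by (auto simp: mult_single lookup_single when_def)
qed (auto simp: distrib_left lookup_add)

text \<open>If p = (x_c - \<zeta>) q, the top-degree monomials of p are x_c times those of q, as
  \<zeta> q has smaller degree. The other hyperplanes are distinct from this one, so q still
  vanishes on them.\<close>

lemma topdeg_exponent_bound:
  assumes "finite Z" "\<And>\<zeta> x. \<zeta> \<in> Z \<Longrightarrow> x c = \<zeta> \<Longrightarrow> ev x p = 0" "b \<in> keys p"
    "\<And>b'. b' \<in> keys p \<Longrightarrow> tdeg b' \<le> tdeg b"
  shows "card Z \<le> lookup b c"
  using assms
proof (induction Z arbitrary: p b)
  case (insert \<zeta> Z)
  let ?e = "single c (1::nat)"
  have "(mvar c - mconst \<zeta>) dvd p" using insert.prems(1) by (intro hyperplane_dvd) auto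
  then obtain q where q: "p = (mvar c - mconst \<zeta>) * q" by (elim dvdE)
  have lk: "lookup p b = (if lookup b c = 0 then 0 else lookup q (b - ?e)) - \<zeta> * lookup q b" for b
    unfolding q left_diff_distrib lookup_minus lookup_mvar_mult lookup_mult_const ..
  have "q \<noteq> 0" using insert.prems(2) q by auto
  then have ne: "keys q \<noteq> {}" by simp
  have q_deg: "Suc (tdeg b') \<le> tdeg b" if "b' \<in> keys q" for b'
  proof -
    let ?M = "Max (tdeg ` keys q)"
    have "?M \<in> tdeg ` keys q" using ne by (intro Max_in) auto
    then obtain d where d: "d \<in> keys q" "tdeg d = ?M" by auto
    have M: "tdeg b' \<le> tdeg d" if "b' \<in> keys q" for b' using that by (simp add: d(2))
    have "d + ?e \<notin> keys q" using M[of "d + ?e"] by auto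
    then have "lookup p (d + ?e) = lookup q d"
      by (simp add: lk lookup_add in_keys_iff)
    then have "d + ?e \<in> keys p" using d(1) by (simp add: in_keys_iff)
    then show ?thesis using insert.prems(3)[of "d + ?e"] M[OF that] by simp
  qed
  then have "lookup q b = 0" using not_in_keys_iff_lookup_eq_zero by fastforce
  then have b: "lookup b c \<noteq> 0" "b - ?e \<in> keys q"
    using lk[of b] insert.prems(2) by (auto simp: in_keys_iff split: if_splits)
  have "b = (b - ?e) + ?e"
    by (rule poly_mapping_eqI) (use b(1) in \<open>auto simp: lookup_add lookup_minus lookup_single when_def\<close>)
  then have tb: "tdeg b = Suc (tdeg (b - ?e))" by (metis tdeg_add tdeg_single Suc_eq_plus1)
  have "card Z \<le> lookup (b - ?e) c"
  proof (rule insert.IH[of q])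
    fix \<xi> x assume "\<xi> \<in> Z" "x c = \<xi>"
    then have "ev x p = 0" "\<xi> \<noteq> \<zeta>" using insert.prems(1)[of \<xi> x] insert.hyps by auto
    then show "ev x q = 0" using \<open>x c = \<xi>\<close> by (simp add: q ev_simps)
  next
    fix b' assume "b' \<in> keys q"
    then show "tdeg b' \<le> tdeg (b - ?e)" using q_deg[of b'] tb by simp
  qed (rule b(2))
  then show ?case using insert.hyps b(1) by (simp add: lookup_minus)
qed simp

text \<open>A polynomial vanishing on \<open>r\<close> distinct hyperplanes \<open>x\<^sub>c = \<zeta>\<close> has top-degree monomials divisible by
  \<open>x\<^sub>c\<^sup>r\<close>. Hence an element preserving the lattices at \<open>k = 0\<close> is determined by its coefficients at the
  following indices.\<close>

definition piv :: "nat \<Rightarrow> nat \<Rightarrow> nat \<Rightarrow> idx set" where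
  "piv N n l = {(a, w, b). (a, w, b) \<in> Idx N n \<and> (\<forall>x\<in>{1..N}. l * nat (- lookup a (w x)) \<le> lookup b x)}"

lemma piv_subset: "piv N n l \<subseteq> Idx N n"
  by (auto simp: piv_def)

lemma piv_Idx: "(a, w, b) \<in> piv N n l \<Longrightarrow> (a, w, b) \<in> Idx N n"
  by (simp add: piv_def)

lemma lookup_sum_single:
  fixes g :: "'a \<Rightarrow> 'b" and c :: "'a \<Rightarrow> 'c::comm_monoid_add"
  assumes "finite B" "inj_on g B" "b \<in> B"
  shows "lookup (\<Sum>b\<in>B. single (g b) (c b)) (g b) = c b"
proof -
  have "lookup (\<Sum>b\<in>B. single (g b) (c b)) (g b) = (\<Sum>b'\<in>B. if b' = b then c b' else 0)"
    unfolding lookup_sum using assms by (intro sum.cong) (auto simp: lookup_single when_def inj_on_def)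
  then show ?thesis using assms by simp
qed

lemma ev_sum_single: "ev x (\<Sum>b\<in>B. single (g b) (c b)) = (\<Sum>b\<in>B. c b * mono_val x (g b))"
  by (simp add: ev_simps pev_single[OF coeff_hom_id])

lemma vars_in_sum_single:
  assumes "\<And>b. b \<in> B \<Longrightarrow> keys (g b) \<subseteq> V"
  shows "vars_in V (\<Sum>b\<in>B. single (g b) (c b :: complex))"
  unfolding vars_in_def
proof
  fix m assume "m \<in> keys (\<Sum>b\<in>B. single (g b) (c b))"
  then have "(\<Sum>b\<in>B. lookup (single (g b) (c b)) m) \<noteq> 0" by (simp add: in_keys_iff lookup_sum)
  then obtain b where "b \<in> B" "lookup (single (g b) (c b)) m \<noteq> 0" by (rule sum.not_neutral_contains_not_neutral)
  then show "keys m \<subseteq> V" using assms by (auto simp: lookup_single when_def split: if_splits)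
qed

lemma finite_fibre: "T \<subseteq> Idx N n \<Longrightarrow> finite {b. (a, w, b) \<in> T}"
  by (rule finite_subset[of _ "(snd \<circ> snd) ` T"]) (force, use finite_Idx finite_subset in blast)

text \<open>At a separated exponent only terms with the given permutation and X-part reach this
  monomial, so its coefficient is a polynomial in y evaluated at the point m + u.\<close>

lemma coef_El_0_sum:
  assumes m: "gexp N n m" and "w0 permutes {1..N}" "adeg a0 \<le> n"
  shows "(\<Sum>t\<in>Idx N n. c t * coef (a0 + pexp w0 m) (phi.tw u (El N 0 t) (lmon m)))
    = (\<Sum>b | (a0, w0, b) \<in> Idx N n. c (a0, w0, b) * mono_val (\<lambda>i. of_int (lookup m i) + u) b)"
proof -
  have "(\<Sum>t\<in>Idx N n. c t * coef (a0 + pexp w0 m) (phi.tw u (El N 0 t) (lmon m)))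
     = (\<Sum>t\<in>Idx N n. if fst t + pexp (fst (snd t)) m = a0 + pexp w0 m
         then c t * mono_val (\<lambda>i. of_int (lookup m i) + u) (snd (snd t)) else 0)"
  proof (rule sum.cong[OF refl])
    fix t assume t: "t \<in> Idx N n"
    obtain a w b where t': "t = (a, w, b)" by (cases t)
    show "c t * coef (a0 + pexp w0 m) (phi.tw u (El N 0 t) (lmon m)) = (if fst t + pexp (fst (snd t)) m = a0 + pexp w0 m
         then c t * mono_val (\<lambda>i. of_int (lookup m i) + u) (snd (snd t)) else 0)"
      using t unfolding t' phi_El_0[OF t[unfolded t']] coef_lmon by simp
  qed
  then show ?thesis by (simp only: gexp_select[OF m order_refl assms(2,3)] fst_conv snd_conv)
qed

text \<open>For fixed a and w the coefficients form a polynomial p in y. Where X^a w would create a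
  negative exponent, p has to vanish, which gives l times \<open>A\<close> hyperplanes; the
  hypothesis on z makes them distinct. A top-degree monomial of p is therefore indexed by a pivot,
  where the coefficients are zero.\<close>

lemma kernel_at_0:
  assumes z: "\<And>i j. i \<in> {1..l} \<Longrightarrow> j \<in> {1..l} \<Longrightarrow> i \<noteq> j \<Longrightarrow> z i - z j \<notin> \<int>"
    and H: "\<And>i m e x. i \<in> {1..l} \<Longrightarrow> keys m \<subseteq> {1..N} \<Longrightarrow> (\<And>y. lookup m y \<ge> 0) \<Longrightarrow>
      lookup e x < 0 \<Longrightarrow> (\<Sum>t\<in>Idx N n. c t * coef e (phi.tw (z i) (El N 0 t) (lmon m))) = 0"
    and P: "\<And>t. t \<in> piv N n l \<Longrightarrow> c t = 0" and t: "t \<in> Idx N n"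
  shows "c t = 0"
proof (rule ccontr)
  assume ct: "c t \<noteq> 0"
  obtain a w b0 where t': "t = (a, w, b0)" by (cases t)
  define B where "B = {b. (a, w, b) \<in> Idx N n}"
  have w: "w permutes {1..N}" and a: "adeg a \<le> n" using t by (auto simp: t' Idx_iff)
  have B: "finite B" "b0 \<in> B" using finite_fibre[of "Idx N n" N n a w] t by (auto simp: B_def t')
  define p where "p = (\<Sum>b\<in>B. single b (c (a, w, b)))"
  have lp: "lookup p b = c (a, w, b)" if "b \<in> B" for b
    using lookup_sum_single[OF B(1), of "\<lambda>b. b" b "\<lambda>b. c (a, w, b)"] that by (simp add: p_def)
  have pvars: "vars_in {1..N} p" unfolding p_def by (rule vars_in_sum_single) (auto simp: B_def Idx_iff)
  have "b0 \<in> keys p" using lp[OF B(2)] ct by (simp add: in_keys_iff t')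
  then have ne: "tdeg ` keys p \<noteq> {}" by blast
  then have "Max (tdeg ` keys p) \<in> tdeg ` keys p" by (intro Max_in) auto
  then obtain b where b: "b \<in> keys p" "tdeg b = Max (tdeg ` keys p)" by auto
  have bmax: "tdeg b' \<le> tdeg b" if "b' \<in> keys p" for b' using that by (simp add: b(2))
  have "b \<in> B"
  proof (rule ccontr)
    assume "b \<notin> B"
    then have "lookup p b = 0" unfolding p_def lookup_sum by (intro sum.neutral) (auto simp: lookup_single when_def)
    then show False using b(1) by (simp add: in_keys_iff)
  qed
  have "l * nat (- lookup a (w x)) \<le> lookup b x" if x: "x \<in> {1..N}" for x
  proof -
    define A where "A = nat (- lookup a (w x))"
    \<comment> \<open>For m_x = s < A the exponent of X^a w X^m at w x is negative, and under the
      twist by z_i the value of y_x on X^m is z_i + s.\<close>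
    define f where "f = (\<lambda>(i, s). z i + of_nat s)"
    define Z where "Z = f ` ({1..l} \<times> {..<A})"
    have "inj_on f ({1..l} \<times> {..<A})"
    proof (rule inj_onI, clarify)
      fix i s j s' assume ij: "i \<in> {1..l}" "j \<in> {1..l}" "f (i, s) = f (j, s')"
      then have d: "z i - z j = of_int (int s' - int s)" by (simp add: f_def algebra_simps)
      then have "z i - z j \<in> \<int>" by (metis Ints_of_int)
      then have "i = j" using z ij by blast
      then show "i = j \<and> s = s'" using ij by (simp add: f_def)
    qed
    then have "card Z = l * A" unfolding Z_def by (simp add: card_image card_cartesian_product)
    moreover have "card Z \<le> lookup b x"
    proof (rule topdeg_exponent_bound[OF _ _ b(1) bmax])
      show "finite Z" unfolding Z_def by auto
      fix \<zeta> q assume "\<zeta> \<in> Z" and q: "q x = \<zeta>"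
      then obtain i s where i: "i \<in> {1..l}" "s < A" "\<zeta> = of_nat s + z i" by (auto simp: Z_def f_def)
      show "ev q p = 0"
      proof (rule gexp_vanish[OF pvars, of n x s "z i"])
        fix m assume m: "gexp N n m" and "x \<in> {1..N} \<Longrightarrow> lookup m x = int s"
        then have "lookup (a + pexp w m) (w x) < 0"
          using i(2) x permutes_bij[OF w] by (auto simp: lookup_add lookup_pexp_apply A_def)
        then have "(\<Sum>t\<in>Idx N n. c t * coef (a + pexp w m) (phi.tw (z i) (El N 0 t) (lmon m))) = 0"
          using m i(1) by (intro H) (auto simp: gexp_def)
        then show "ev (\<lambda>i'. of_int (lookup m i') + z i) p = 0"
          unfolding coef_El_0_sum[OF m w a] p_def ev_sum_single B_def .
      qed (use q i in auto)
    qed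
    ultimately show ?thesis by (simp add: A_def)
  qed
  then have "(a, w, b) \<in> piv N n l" using \<open>b \<in> B\<close> by (simp add: piv_def B_def)
  then have "lookup p b = 0" using P lp \<open>b \<in> B\<close> by simp
  then show False using b(1) by (simp add: in_keys_iff)
qed

section \<open>Elements of the cyclotomic subalgebra with prescribed leading terms\<close>

text \<open>The middle factor is a permutation times pi_-, so this conjugate stays in the cyclotomic
  subalgebra.\<close>

definition xm :: "nat \<Rightarrow> nat \<Rightarrow> (nat \<Rightarrow> complex) \<Rightarrow> complex \<Rightarrow> nat \<Rightarrow> cra" where
  "xm N l z k c = cP (transpose 1 c) *
    (cM (1 / rat_var 1) * prod_list (map (\<lambda>i. cY N k 1 - cC (z i)) [1..<l+1])) * cP (transpose 1 c)"

definition beta :: "nat \<Rightarrow> nat \<Rightarrow> (nat \<Rightarrow>\<^sub>0 int) \<Rightarrow> (nat \<Rightarrow> nat) \<Rightarrow> (nat \<Rightarrow>\<^sub>0 nat)" where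
  "beta N l a w = (\<Sum>x\<in>{1..N}. single x (l * nat (- lookup a (w x))))"

lemma lookup_beta: "lookup (beta N l a w) x = (if x \<in> {1..N} then l * nat (- lookup a (w x)) else 0)"
  by (simp add: beta_def lookup_sum lookup_single when_def)

definition xpart :: "nat \<Rightarrow> nat \<Rightarrow> (nat \<Rightarrow> complex) \<Rightarrow> complex \<Rightarrow> (nat \<Rightarrow>\<^sub>0 int) \<Rightarrow> cra" where
  "xpart N l z k a = prod_list (map (\<lambda>c. cM (rat_var c) ^ nat (lookup a c)) [1..<N+1])
     * prod_list (map (\<lambda>c. xm N l z k c ^ nat (- lookup a c)) [1..<N+1])"

text \<open>The factors \<open>xm\<close> have leading term \<open>X\<^sub>c\<^sup>-\<^sup>1 y\<^sub>c\<^sup>l\<close>; \<open>beta\<close> collects the resulting powers of \<open>y\<close>,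
  transported through \<open>w\<close>.\<close>

definition Om :: "nat \<Rightarrow> nat \<Rightarrow> (nat \<Rightarrow> complex) \<Rightarrow> complex \<Rightarrow> idx \<Rightarrow> cra" where
  "Om N l z k = (\<lambda>(a, w, b). xpart N l z k a * (cP w * Yw N k (word (b - beta N l a w))))"

lemma sum_list_range: "sum_list (map f [1..<N+1]) = (\<Sum>c\<in>{1..N}. f c)"
  by (auto simp: sum_list_distinct_conv_sum_set intro!: sum.cong)

lemma piv_split:
  assumes "(a, w, b) \<in> piv N n l" shows "b = (b - beta N l a w) + beta N l a w"
proof (rule poly_mapping_eqI)
  fix x
  show "lookup b x = lookup (b - beta N l a w + beta N l a w) x"
    using assms by (auto simp: piv_def lookup_add lookup_minus lookup_beta)
qed

lemma keys_diff_nat: "keys (b - d) \<subseteq> keys (b :: nat \<Rightarrow>\<^sub>0 nat)"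
  by (auto simp: in_keys_iff lookup_minus)

lemma Rep_prod_list:
  "(\<And>x. x \<in> set xs \<Longrightarrow> Rep N (d x) (\<phi> x)) \<Longrightarrow> Rep N (sum_list (map d xs)) (\<lambda>k. prod_list (map (\<lambda>x. \<phi> x k) xs))"
  by (induction xs) (auto intro: Rep_1 Rep_mult)

lemma Rep_power: "Rep N d \<phi> \<Longrightarrow> Rep N (m * d) (\<lambda>k. \<phi> k ^ m)"
  by (induction m) (auto intro: Rep_1 Rep_mult)

lemma Rep_xm:
  assumes c: "c \<in> {1..N}" shows "Rep N (1 + l) (\<lambda>k. xm N l z k c)"
proof -
  have N: "1 \<in> {1..N}" using c by auto
  have p: "Rep N 0 (\<lambda>k. cP (transpose 1 c))" using permutes_transpose[OF N c] by (rule Rep_cP)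
  have x: "Rep N 1 (\<lambda>k. cM (1 / rat_var 1))"
    using Rep_lmon[of "single 1 (- 1)" N] N by (simp add: power_int_minus divide_inverse One_nat_def)
  have "Rep N 1 (\<lambda>k. cY N k 1 - cC (z i))" for i
    using Rep_diff[OF Rep_cY[OF N] Rep_mono[OF Rep_cC, of 1]] by simp
  then have "Rep N (sum_list (map (\<lambda>_. 1) [1..<l+1])) (\<lambda>k. prod_list (map (\<lambda>i. cY N k 1 - cC (z i)) [1..<l+1]))"
    by (intro Rep_prod_list)
  then have y: "Rep N l (\<lambda>k. prod_list (map (\<lambda>i. cY N k 1 - cC (z i)) [1..<l+1]))"
    by (simp add: sum_list_range del: upt_Suc)
  show ?thesis using Rep_mult[OF Rep_mult[OF p Rep_mult[OF x y]] p] by (simp add: xm_def)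
qed

text \<open>The degrees match exactly: a factor \<open>xm\<close> counts 1 for the inverse variable
  and l for the powers of y, and these powers together with b - beta make up the degree of
  b.\<close>

lemma Rep_Om:
  assumes t: "t \<in> piv N n l" shows "Rep N n (\<lambda>k. Om N l z k t)"
proof -
  obtain a w b where t': "t = (a, w, b)" "(a, w, b) \<in> piv N n l" using t by (cases t) auto
  then have I: "keys a \<subseteq> {1..N}" "w permutes {1..N}" "keys b \<subseteq> {1..N}" "adeg a + tdeg b \<le> n"
    using piv_Idx[OF t'(2)] by (simp_all add: Idx_iff)
  let ?b = "b - beta N l a w"
  let ?neg = "\<Sum>c\<in>{1..N}. nat (- lookup a c)"
  have X: "Rep N (\<Sum>c\<in>{1..N}. nat (lookup a c)) (\<lambda>k. prod_list (map (\<lambda>c. cM (rat_var c) ^ nat (lookup a c)) [1..<N+1]))"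
    unfolding sum_list_range[symmetric]
  proof (rule Rep_prod_list)
    fix c assume "c \<in> set [1..<N+1]"
    then have "c \<in> {1..N}" by auto
    then have "Rep N 1 (\<lambda>k. cM (rat_var c))" using Rep_lmon[of "single c 1" N] by (simp add: One_nat_def)
    from Rep_power[OF this] show "Rep N (nat (lookup a c)) (\<lambda>k. cM (rat_var c) ^ nat (lookup a c))" by simp
  qed
  have M: "Rep N (\<Sum>c\<in>{1..N}. nat (- lookup a c) * (1 + l)) (\<lambda>k. prod_list (map (\<lambda>c. xm N l z k c ^ nat (- lookup a c)) [1..<N+1]))"
    unfolding sum_list_range[symmetric] by (intro Rep_prod_list Rep_power Rep_xm) auto
  have "set (word ?b) \<subseteq> {1..N}" using I(3) keys_diff_nat[of b] by auto
  then have Y: "Rep N (tdeg ?b) (\<lambda>k. Yw N k (word ?b))" using Rep_Yw_mult[OF _ Rep_1] by fastforce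
  have "Rep N ((\<Sum>c\<in>{1..N}. nat (lookup a c)) + (\<Sum>c\<in>{1..N}. nat (- lookup a c) * (1 + l)) + (0 + tdeg ?b)) (\<lambda>k. Om N l z k t)"
    unfolding t' Om_def prod.case xpart_def by (intro Rep_mult X M Y Rep_cP I(2))
  moreover have "adeg a = (\<Sum>c\<in>{1..N}. nat (lookup a c)) + ?neg"
    using adeg_superset[of "{1..N}" a] I(1) by (auto simp: sum.distrib[symmetric] intro!: sum.cong)
  moreover have "(\<Sum>c\<in>{1..N}. nat (- lookup a c) * (1 + l)) = ?neg + l * ?neg"
    by (simp add: sum.distrib algebra_simps flip: sum_distrib_left)
  moreover have "tdeg b = tdeg ?b + l * ?neg"
  proof -
    have "tdeg (beta N l a w) = (\<Sum>x\<in>{1..N}. lookup (beta N l a w) x)"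
      by (rule tdeg_superset) (auto simp: in_keys_iff lookup_beta split: if_splits)
    also have "\<dots> = l * (\<Sum>x\<in>{1..N}. nat (- lookup a (w x)))" by (simp add: lookup_beta sum_distrib_left)
    also have "(\<Sum>x\<in>{1..N}. nat (- lookup a (w x))) = ?neg"
      using sum.permute[OF I(2), of "\<lambda>x. nat (- lookup a x)"] by (simp add: comp_def)
    finally show ?thesis using piv_split[OF t'(2)] by (metis tdeg_add)
  qed
  ultimately show ?thesis using I(4) Rep_mono by simp
qed

section \<open>The words belong to the cyclotomic subalgebra\<close>

lemma Cyc_1 [simp]: "1 \<in> Cyc N l z k"
  using Cyc_cC[of 1 N l z k] by (simp del: Cyc_cC)

lemma Cyc_prod_list: "(\<And>x. x \<in> set xs \<Longrightarrow> x \<in> Cyc N l z k) \<Longrightarrow> prod_list xs \<in> Cyc N l z k"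
  by (induction xs) (auto intro: Cyc_mult)

lemma Cyc_power: "L \<in> Cyc N l z k \<Longrightarrow> L ^ n \<in> Cyc N l z k"
  by (induction n) (auto intro: Cyc_mult)

lemma Cyc_0 [simp]: "0 \<in> Cyc N l z k"
  using Cyc_cC[of 0 N l z k] by (simp del: Cyc_cC)

lemma Cyc_sum: "(\<And>x. x \<in> A \<Longrightarrow> f x \<in> Cyc N l z k) \<Longrightarrow> sum f A \<in> Cyc N l z k"
  by (induction A rule: infinite_finite_induct) (auto intro: Cyc_add)

lemma Cyc_cP:
  assumes "w permutes {1..N}" shows "cP w \<in> Cyc N l z k"
proof -
  have up: "1 \<le> i \<Longrightarrow> i + d + 1 \<le> N \<Longrightarrow> cP (transpose i (i + d + 1)) \<in> Cyc N l z k" for i d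
  proof (induction d)
    case 0
    then show ?case using Cyc_simple[of i N l z k] by simp
  next
    case (Suc d)
    let ?j = "i + d + 1"
    have "transpose i (?j + 1) = transpose ?j (?j + 1) \<circ> transpose i ?j \<circ> transpose ?j (?j + 1)"
      by (auto simp: fun_eq_iff transpose_def)
    then have "cP (transpose i (?j + 1)) = cP (transpose ?j (?j + 1)) * cP (transpose i ?j) * cP (transpose ?j (?j + 1))"
      by (simp add: cP_comp bij_comp)
    moreover have "cP (transpose ?j (?j + 1)) \<in> Cyc N l z k" using Suc.prems by (intro Cyc_simple) auto
    ultimately have "cP (transpose i (?j + 1)) \<in> Cyc N l z k" using Suc by (simp add: Cyc_mult)
    moreover have "i + Suc d + 1 = ?j + 1" by simp
    ultimately show ?case by (simp only:)
  qed
  have tr: "cP (transpose i j) \<in> Cyc N l z k" if "i \<in> {1..N}" "j \<in> {1..N}" "i < j" for i j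
    using up[of i "j - i - 1"] that by simp
  have tr': "cP (transpose i j) \<in> Cyc N l z k" if "i \<in> {1..N}" "j \<in> {1..N}" "i \<noteq> j" for i j
    using tr[of i j] tr[of j i] that by (cases "i < j") (auto simp: transpose_commute)
  show ?thesis using assms finite_atLeastAtMost
  proof (induction rule: permutes_induct)
    case (swap a b p)
    have "cP (transpose a b \<circ> p) = cP (transpose a b) * cP p" using permutes_bij[OF \<open>p permutes {1..N}\<close>] by (simp add: cP_comp)
    moreover have "cP (transpose a b) * cP p \<in> Cyc N l z k" using swap tr'[of a b] by (intro Cyc_mult) auto
    ultimately show ?case by (simp only: comp_def)
  next
    case id
    have "cP id \<in> Cyc N l z k" unfolding cP_id by (rule Cyc_1)
    then show ?case unfolding id_def .
  qed
qed

lemma Cyc_rat_var: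
  assumes c: "c \<in> {1..N}" shows "cM (rat_var c) \<in> Cyc N l z k"
proof -
  have N: "1 \<in> {1..N}" "N \<ge> 1" using c by auto
  let ?r = "prod_list (map (\<lambda>i. cP (transpose i (i+1))) (rev [1..<N]))"
  have "?r \<in> Cyc N l z k" by (rule Cyc_prod_list) (auto intro!: Cyc_cP transpose_permutes)
  moreover have "cM (rat_var 1) = cpi N * ?r"
    unfolding cpi_def mult.assoc using prod_list_transpose_inverse[of "[1..<N]" 1] by simp
  ultimately have "cM (rat_var 1) \<in> Cyc N l z k" using Cyc_cpi[OF N(2)] Cyc_mult by simp
  moreover have "cM (rat_var c) = cP (transpose 1 c) * cM (rat_var 1) * cP (transpose 1 c)"
    by (simp add: cP_cM mult.assoc cP_comp)
  ultimately show ?thesis using Cyc_cP[OF permutes_transpose[OF N(1) c]] Cyc_mult by simp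
qed

lemma Cyc_xm:
  assumes c: "c \<in> {1..N}" shows "xm N l z k c \<in> Cyc N l z k"
proof -
  have N: "1 \<in> {1..N}" "N \<ge> 1" using c by auto
  let ?r = "prod_list (map (\<lambda>i. cP (transpose i (i+1))) [1..<N])"
  have "?r \<in> Cyc N l z k" by (rule Cyc_prod_list) (auto intro!: Cyc_cP transpose_permutes)
  moreover have "cM (1 / rat_var 1) * prod_list (map (\<lambda>i. cY N k 1 - cC (z i)) [1..<l+1]) = ?r * cpi_minus N l z k"
    unfolding cpi_minus_def cpi_inv_def mult.assoc prod_list_transpose_inverse ..
  ultimately have "cM (1 / rat_var 1) * prod_list (map (\<lambda>i. cY N k 1 - cC (z i)) [1..<l+1]) \<in> Cyc N l z k"
    using Cyc_cpi_minus[OF N(2)] Cyc_mult by simp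
  then show ?thesis unfolding xm_def using Cyc_cP[OF permutes_transpose[OF N(1) c]] Cyc_mult by simp
qed

lemma Cyc_Om:
  assumes t: "t \<in> piv N n l" shows "Om N l z k t \<in> Cyc N l z k"
proof -
  obtain a w b where t': "t = (a, w, b)" by (cases t)
  then have "w permutes {1..N}" "keys b \<subseteq> {1..N}"
    using piv_Idx[of a w b N n l] t by (simp_all add: Idx_iff)
  then show ?thesis using keys_diff_nat[of b "beta N l a w"]
    unfolding t' Om_def prod.case xpart_def Yw_def
    by (intro Cyc_mult Cyc_prod_list Cyc_cP) (auto intro!: Cyc_power Cyc_rat_var Cyc_xm Cyc_cY)
qed

text \<open>Weighted shifts of monomials with nowhere vanishing weights; unlike injectivity on a
  finite set, this is stable under products.\<close>

definition shifts :: "nat \<Rightarrow> complex \<Rightarrow> cra \<Rightarrow> (nat \<Rightarrow>\<^sub>0 int) \<Rightarrow> bool" where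
  "shifts N u L e \<longleftrightarrow> L \<in> CA N \<and> (\<forall>m. \<exists>\<theta>. \<theta> \<noteq> 0 \<and> phi.tw u L (lmon m) = rat_const \<theta> * lmon (m + e))"

lemma shifts_1: "shifts N u 1 0"
  unfolding shifts_def by (auto simp: phi.tw_1 intro!: exI[of _ 1])

lemma shifts_mult:
  assumes "shifts N u L e" "shifts N u M f" shows "shifts N u (L * M) (e + f)"
  unfolding shifts_def
proof (intro conjI allI)
  fix m
  obtain \<theta> where \<theta>: "\<theta> \<noteq> 0" "phi.tw u M (lmon m) = rat_const \<theta> * lmon (m + f)"
    using assms(2) by (auto simp: shifts_def)
  obtain \<theta>' where \<theta>': "\<theta>' \<noteq> 0" "phi.tw u L (lmon (m + f)) = rat_const \<theta>' * lmon (m + f + e)"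
    using assms(1) by (auto simp: shifts_def)
  have CA: "L \<in> CA N" "M \<in> CA N" using assms by (simp_all add: shifts_def)
  have "phi.tw u (L * M) (lmon m) = rat_const (\<theta> * \<theta>') * lmon (m + (e + f))"
    unfolding phi_mult[OF CA] \<theta>(2) phi_scale[OF CA(1)] \<theta>'(2) by (simp add: rat_const_mult add_ac)
  then show "\<exists>\<theta>. \<theta> \<noteq> 0 \<and> phi.tw u (L * M) (lmon m) = rat_const \<theta> * lmon (m + (e + f))"
    using \<theta>(1) \<theta>'(1) by (intro exI[of _ "\<theta> * \<theta>'"]) simp
qed (use assms in \<open>auto simp: shifts_def intro: CA_mult\<close>)

lemma shifts_power:
  assumes "shifts N u L (single c s)"
  shows "shifts N u (L ^ j) (single c (int j * s))"
proof (induction j)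
  case (Suc j)
  have "single c s + single c (int j * s) = single c (int (Suc j) * s)"
    by (simp add: algebra_simps flip: single_add)
  then show ?case using shifts_mult[OF assms Suc] by simp
qed (simp add: shifts_1)

lemma shifts_prod_list:
  "(\<And>x. x \<in> set xs \<Longrightarrow> shifts N u (L x) (e x)) \<Longrightarrow> shifts N u (prod_list (map L xs)) (sum_list (map e xs))"
  by (induction xs) (auto intro: shifts_1 shifts_mult)

lemma shifts_rat_var: "c \<in> {1..N} \<Longrightarrow> shifts N u (cM (rat_var c)) (single c 1)"
  unfolding shifts_def
  by (auto simp: phi.tw_cM lmon_add mult.commute intro!: CA_cM RF_poly exI[of _ 1])

lemma CA_inverse_var: "i \<in> {1..N} \<Longrightarrow> cM (1 / rat_var i) \<in> CA N"
  using LP_inverse_var[of i N] LP_subset_RF[of N] by (auto simp: divide_inverse intro!: CA_cM)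

text \<open>The weights are products of numbers r + u - z_i with r an integer, nonzero by the
  assumption on u.\<close>

lemma shifts_xm:
  assumes c: "c \<in> {1..N}" and u: "\<And>i. i \<in> {1..l} \<Longrightarrow> u - z i \<notin> \<int>"
  shows "shifts N u (xm N l z 0 c) (single c (- 1))"
proof -
  have N: "1 \<in> {1..N}" using c by auto
  have perm: "transpose 1 c permutes {1..N}" using permutes_transpose[OF N c] .
  have Y: "shifts N u (cY N 0 1 - cC (z i)) 0" if i: "i \<in> {1..l}" for i
    unfolding shifts_def
  proof (intro conjI allI)
    fix m :: "nat \<Rightarrow>\<^sub>0 int"
    have "of_int (lookup m 1) + u - z i \<noteq> 0"
    proof
      assume "of_int (lookup m 1) + u - z i = 0"
      then have "u - z i = of_int (- lookup m 1)" by (simp add: algebra_simps eq_neg_iff_add_eq_0)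
      then show False using u[OF i] by simp
    qed
    moreover have "phi.tw u (cY N 0 1 - cC (z i)) (lmon m) = rat_const (of_int (lookup m 1) + u - z i) * lmon (m + 0)"
      using phi_cY_0[OF N, of u 1 m] by (simp add: phi.tw_diff phi.tw_cM rat_const_diff left_diff_distrib)
    ultimately show "\<exists>\<theta>. \<theta> \<noteq> 0 \<and> phi.tw u (cY N 0 1 - cC (z i)) (lmon m) = rat_const \<theta> * lmon (m + 0)" by blast
  qed (intro CA_diff CA_cY CA_cC N)
  have "shifts N u (prod_list (map (\<lambda>i. cY N 0 1 - cC (z i)) [1..<l+1])) (sum_list (map (\<lambda>_. 0) [1..<l+1]))"
    by (intro shifts_prod_list Y) auto
  then have Y: "shifts N u (prod_list (map (\<lambda>i. cY N 0 1 - cC (z i)) [1..<l+1])) 0"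
    by (simp add: sum_list_range del: upt_Suc)
  have "shifts N u (cM (1 / rat_var 1)) (single 1 (- 1))"
    unfolding shifts_def phi.tw_cM
    by (auto simp: lmon_add power_int_minus divide_inverse intro!: exI[of _ 1] CA_inverse_var[OF N, unfolded divide_inverse mult_1])
  from shifts_mult[OF this Y] have Z: "shifts N u (cM (1 / rat_var 1) * prod_list (map (\<lambda>i. cY N 0 1 - cC (z i)) [1..<l+1])) (single 1 (- 1))" (is "shifts N u ?Z _")
    by simp
  have CA: "cP (transpose 1 c) \<in> CA N" "?Z \<in> CA N" using Z CA_cP[OF perm] by (simp_all add: shifts_def)
  show ?thesis unfolding shifts_def
  proof (intro conjI allI)
    show "xm N l z 0 c \<in> CA N" unfolding xm_def by (intro CA_mult CA)
    fix m
    let ?t = "transpose 1 c"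
    obtain \<theta> where \<theta>: "\<theta> \<noteq> 0" "phi.tw u ?Z (lmon (pexp ?t m)) = rat_const \<theta> * lmon (pexp ?t m + single 1 (- 1))"
      using Z by (auto simp: shifts_def)
    have pe: "pexp ?t (pexp ?t m + single 1 (- 1)) = m + single c (- 1)"
      by (rule poly_mapping_eqI) (auto simp: lookup_pexp lookup_add lookup_single when_def transpose_def inv_swap_id)
    have P: "phi.tw u (cP ?t) g = rat_perm ?t g" for g using phi.tw_cP[OF perm, of u g] by simp
    have "phi.tw u (xm N l z 0 c) (lmon m) = rat_perm ?t (phi.tw u ?Z (rat_perm ?t (lmon m)))"
      unfolding xm_def by (simp only: phi_mult[OF CA_mult[OF CA] CA(1)] phi_mult[OF CA] P)
    also have "\<dots> = rat_const \<theta> * lmon (m + single c (- 1))"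
      by (simp add: rat_perm_lmon \<theta>(2) pe del: lmon_single)
    finally show "\<exists>\<theta>. \<theta> \<noteq> 0 \<and> phi.tw u (xm N l z 0 c) (lmon m) = rat_const \<theta> * lmon (m + single c (- 1))"
      using \<theta>(1) by blast
  qed
qed

lemma shifts_xpart:
  assumes u: "\<And>i. i \<in> {1..l} \<Longrightarrow> u - z i \<notin> \<int>" and a: "keys a \<subseteq> {1..N}"
  shows "shifts N u (xpart N l z 0 a) a"
proof -
  have "shifts N u (xpart N l z 0 a) (sum_list (map (\<lambda>c. single c (int (nat (lookup a c)) * 1)) [1..<N+1])
      + sum_list (map (\<lambda>c. single c (int (nat (- lookup a c)) * (- 1))) [1..<N+1]))"
    unfolding xpart_def by (intro shifts_mult shifts_prod_list shifts_power shifts_rat_var shifts_xm u) auto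
  moreover have "sum_list (map (\<lambda>c. single c (int (nat (lookup a c)) * 1)) [1..<N+1])
      + sum_list (map (\<lambda>c. single c (int (nat (- lookup a c)) * (- 1))) [1..<N+1]) = a" (is "?l = a")
  proof (rule poly_mapping_eqI)
    fix x
    have "lookup ?l x = (if x \<in> {1..N} then int (nat (lookup a x)) - int (nat (- lookup a x)) else 0)"
      unfolding sum_list_range by (simp add: lookup_add lookup_sum lookup_single when_def)
    also have "\<dots> = lookup a x" using a by (auto simp: in_keys_iff)
    finally show "lookup ?l x = lookup a x" .
  qed
  ultimately show ?thesis by simp
qed

lemma phi_Om_0:
  assumes u: "\<And>i. i \<in> {1..l} \<Longrightarrow> u - z i \<notin> \<int>" and a: "keys a \<subseteq> {1..N}" and w: "w permutes {1..N}"
  shows "\<exists>\<theta>. \<theta> \<noteq> 0 \<and> (\<forall>b. keys b \<subseteq> {1..N} \<longrightarrow> phi.tw u (Om N l z 0 (a, w, b)) (lmon m)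
    = rat_const (\<theta> * mono_val (\<lambda>i. of_int (lookup m i) + u) (b - beta N l a w)) * lmon (a + pexp w m))"
proof -
  have X: "shifts N u (xpart N l z 0 a) a" using shifts_xpart u a by blast
  then obtain \<theta> where \<theta>: "\<theta> \<noteq> 0" "phi.tw u (xpart N l z 0 a) (lmon (pexp w m)) = rat_const \<theta> * lmon (pexp w m + a)"
    by (auto simp: shifts_def)
  have XA: "xpart N l z 0 a \<in> CA N" using X by (simp add: shifts_def)
  have "phi.tw u (Om N l z 0 (a, w, b)) (lmon m)
    = rat_const (\<theta> * mono_val (\<lambda>i. of_int (lookup m i) + u) (b - beta N l a w)) * lmon (a + pexp w m)"
    if b: "keys b \<subseteq> {1..N}" for b
  proof -
    let ?b = "b - beta N l a w"
    have wb: "set (word ?b) \<subseteq> {1..N}" using b keys_diff_nat[of b] by auto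
    have "phi.tw u (Om N l z 0 (a, w, b)) (lmon m) = phi.tw u (xpart N l z 0 a) (rat_perm w (phi.tw u (Yw N 0 (word ?b)) (lmon m)))"
      using phi.tw_cP[OF w, of u] unfolding Om_def prod.case
      by (simp add: phi_mult[OF XA CA_mult[OF CA_cP[OF w] CA_Yw[OF wb]]] phi_mult[OF CA_cP[OF w] CA_Yw[OF wb]])
    also have "rat_perm w (phi.tw u (Yw N 0 (word ?b)) (lmon m))
        = rat_const (mono_val (\<lambda>i. of_int (lookup m i) + u) ?b) * lmon (pexp w m)"
      using permutes_bij[OF w] by (simp add: phi_Yw[OF wb] phi_word_0[OF wb] mono_val_word rat_perm_lmon)
    finally show ?thesis unfolding phi_scale[OF XA] \<theta>(2) by (simp add: rat_const_mult add.commute[of a] mult_ac)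
  qed
  then show ?thesis using \<theta>(1) by blast
qed

text \<open>The words are tested on a lattice with generic u, where none of their factors kills a
  monomial. Separated exponents isolate a pair a, w, and what remains is a polynomial in y vanishing
  on a dense set.\<close>

lemma words_independent_at_0:
  assumes L: "(\<Sum>t\<in>piv N n l. cC (x t) * Om N l z 0 t) = 0" and t: "t \<in> piv N n l"
  shows "x t = 0"
proof -
  \<comment> \<open>The imaginary part exceeds that of every z_i, so u - z_i is not even
    real.\<close>
  define u where "u = Complex 0 (1 + (\<Sum>i\<in>{1..l}. \<bar>Im (z i)\<bar>))"
  have u: "u - z i \<notin> \<int>" if i: "i \<in> {1..l}" for i
  proof
    assume "u - z i \<in> \<int>"
    then obtain j where j: "u - z i = of_int j" by (elim Ints_cases)
    have "Im u - Im (z i) = 0" using arg_cong[OF j, of Im] by simp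
    moreover have "\<bar>Im (z i)\<bar> \<le> (\<Sum>i\<in>{1..l}. \<bar>Im (z i)\<bar>)" using i by (intro member_le_sum) auto
    ultimately show False by (simp add: u_def)
  qed
  obtain a w b0 where t': "t = (a, w, b0)" by (cases t)
  have aw: "keys a \<subseteq> {1..N}" "w permutes {1..N}" "adeg a \<le> n" using piv_Idx[of a w b0 N n l] t by (auto simp: t' Idx_iff)
  define B where "B = {b. (a, w, b) \<in> piv N n l}"
  let ?\<beta> = "beta N l a w"
  have B: "finite B" "b0 \<in> B" using finite_fibre[OF piv_subset] t by (auto simp: B_def t')
  have inj: "inj_on (\<lambda>b. b - ?\<beta>) B"
    by (rule inj_on_inverseI[of _ "\<lambda>b. b + ?\<beta>"]) (use piv_split in \<open>auto simp: B_def\<close>)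
  define p where "p = (\<Sum>b\<in>B. single (b - ?\<beta>) (x (a, w, b)))"
  have pvars: "vars_in {1..N} p" unfolding p_def
    using keys_diff_nat[of _ ?\<beta>] piv_Idx by (intro vars_in_sum_single) (fastforce simp: B_def Idx_iff)
  have *: "ev (\<lambda>i. of_int (lookup m i) + u) p = 0" if m: "gexp N n m" for m
  proof -
    let ?mv = "\<lambda>(a, w, b). mono_val (\<lambda>i. of_int (lookup m i) + u) (b - beta N l a w)"
    \<comment> \<open>The weight depends on a and w but not on b, so it factors out of the sum over
      b.\<close>
    define \<theta> where "\<theta> a w = (SOME \<theta>. \<theta> \<noteq> 0 \<and> (\<forall>b. keys b \<subseteq> {1..N} \<longrightarrow>
        phi.tw u (Om N l z 0 (a, w, b)) (lmon m) = rat_const (\<theta> * ?mv (a, w, b)) * lmon (a + pexp w m)))" for a w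
    have \<theta>: "\<theta> a w \<noteq> 0 \<and> (\<forall>b. keys b \<subseteq> {1..N} \<longrightarrow>
        phi.tw u (Om N l z 0 (a, w, b)) (lmon m) = rat_const (\<theta> a w * ?mv (a, w, b)) * lmon (a + pexp w m))"
      if "keys a \<subseteq> {1..N}" "w permutes {1..N}" for a w
      unfolding \<theta>_def prod.case by (rule someI_ex[OF phi_Om_0[OF u that]])
    define s where "s t = x t * (\<theta> (fst t) (fst (snd t)) * ?mv t)" for t
    have act: "phi.tw u (cC (x t) * Om N l z 0 t) (lmon m) = rat_const (s t) * lmon (fst t + pexp (fst (snd t)) m)"
      and act_LP: "rat_const (s t) * lmon (fst t + pexp (fst (snd t)) m) \<in> LP N" if t: "t \<in> piv N n l" for t
    proof -
      obtain a w b where t': "t = (a, w, b)" by (cases t)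
      then have I: "keys a \<subseteq> {1..N}" "w permutes {1..N}" "keys b \<subseteq> {1..N}"
        using piv_Idx[of a w b N n l] t by (simp_all add: Idx_iff)
      have "phi.tw u (Om N l z 0 (a, w, b)) (lmon m) = rat_const (\<theta> a w * ?mv (a, w, b)) * lmon (a + pexp w m)"
        using \<theta>[OF I(1,2)] I(3) by blast
      then show "phi.tw u (cC (x t) * Om N l z 0 t) (lmon m) = rat_const (s t) * lmon (fst t + pexp (fst (snd t)) m)"
        unfolding t' phi.tw_cM_mult by (simp add: s_def rat_const_mult)
      have "keys (pexp w m) \<subseteq> {1..N}"
        using m keys_pexp[OF permutes_bij[OF I(2)]] permutes_in_image[OF I(2)] by (auto simp: gexp_def)
      then have "keys (a + pexp w m) \<subseteq> {1..N}" using I(1) Poly_Mapping.keys_add[of a "pexp w m"] by blast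
      then show "rat_const (s t) * lmon (fst t + pexp (fst (snd t)) m) \<in> LP N" by (simp add: t' LP_ring lmon_LP)
    qed
    let ?e = "a + pexp w m"
    have "0 = coef ?e (phi.tw u (\<Sum>t\<in>piv N n l. cC (x t) * Om N l z 0 t) (lmon m))" unfolding L phi.tw_0 by simp
    also have "\<dots> = coef ?e (\<Sum>t\<in>piv N n l. rat_const (s t) * lmon (fst t + pexp (fst (snd t)) m))"
      unfolding phi.tw_sum by (simp add: act)
    also have "\<dots> = (\<Sum>t\<in>piv N n l. if fst t + pexp (fst (snd t)) m = ?e then s t else 0)"
      by (simp add: coef_sum[OF act_LP])
    also have "\<dots> = (\<Sum>b\<in>B. s (a, w, b))" unfolding B_def by (rule gexp_select[OF m piv_subset aw(2,3)])
    also have "\<dots> = \<theta> a w * ev (\<lambda>i. of_int (lookup m i) + u) p"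
      unfolding p_def ev_sum_single sum_distrib_left by (intro sum.cong) (simp_all add: s_def)
    finally show ?thesis using \<theta>[OF aw(1,2)] by simp
  qed
  have "p = 0"
  proof (rule mpoly_zeroI)
    fix y :: "nat \<Rightarrow> nat"
    let ?y = "\<lambda>i. if i = 0 then of_nat 0 + u else of_nat (y i)"
    have "ev ?y p = 0"
    \<comment> \<open>The index 0 lies outside {1..N}, so the hyperplane condition concerns a dummy
      coordinate only.\<close>
    proof (rule gexp_vanish[OF pvars, where c = 0 and t = 0 and n = n and u = u])
      fix m assume "gexp N n m"
      then show "ev (\<lambda>i. of_int (lookup m i) + u) p = 0" by (rule *)
    qed simp
    moreover have "ev (\<lambda>i. of_nat (y i)) p = ev ?y p" by (rule ev_cong_vars[OF pvars]) auto
    ultimately show "ev (\<lambda>i. of_nat (y i)) p = 0" by simp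
  qed
  moreover have "lookup p (b0 - ?\<beta>) = x (a, w, b0)"
    unfolding p_def by (rule lookup_sum_single[OF B(1) inj B(2)])
  ultimately show ?thesis by (simp add: t')
qed

section \<open>The cyclotomic subalgebra preserves the lattices\<close>

text \<open>\<open>CA\<close> is built in so that multiplicativity of the twisted action applies and
  the set is closed under products.\<close>

definition poly_pres :: "nat \<Rightarrow> complex \<Rightarrow> cra set" where
  "poly_pres N u = {L \<in> CA N. \<forall>f\<in>polynomials N. phi.tw u L f \<in> polynomials N}"

lemma poly_pres_add: "L \<in> poly_pres N u \<Longrightarrow> M \<in> poly_pres N u \<Longrightarrow> L + M \<in> poly_pres N u"
  by (auto simp: poly_pres_def phi.tw_add intro: CA_add)

lemma poly_pres_mult: "L \<in> poly_pres N u \<Longrightarrow> M \<in> poly_pres N u \<Longrightarrow> L * M \<in> poly_pres N u"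
  by (auto simp: poly_pres_def phi_mult[of L N M] intro: CA_mult)

lemma poly_pres_cM: "f \<in> polynomials N \<Longrightarrow> cM f \<in> poly_pres N u"
  by (auto simp: poly_pres_def phi.tw_cM intro: CA_cM RF_poly)

lemma poly_pres_prod_list: "(\<And>x. x \<in> set xs \<Longrightarrow> x \<in> poly_pres N u) \<Longrightarrow> prod_list xs \<in> poly_pres N u"
  using poly_pres_cM[of 1 N u] by (induction xs) (auto intro: poly_pres_mult)

lemma poly_pres_cP: "w permutes {1..N} \<Longrightarrow> cP w \<in> poly_pres N u"
  by (auto simp: poly_pres_def phi.tw_cP intro: CA_cP polynomials_perm)

lemma poly_pres_cY: assumes i: "i \<in> {1..N}" shows "cY N k i \<in> poly_pres N u"
proof -
  have "rat_perm (transpose i j) f \<in> polynomials N" if "f \<in> polynomials N" "j \<in> {1..<i}" for f j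
    using i that by (intro polynomials_perm permutes_transpose) auto
  then show ?thesis using i unfolding poly_pres_def
    by (auto simp: phi_cY Bop_def intro!: CA_cY polynomials_diff polynomials_add polynomials_mult polynomials_sum polynomials_ddiff polynomials_deriv)
qed

lemma prod_list_move:
  fixes F :: "'i \<Rightarrow> 'a::monoid_mult"
  assumes "x \<in> set xs" "\<And>x y. F x * F y = F y * F x"
  shows "prod_list (map F xs) = F x * prod_list (map F (remove1 x xs))"
  using assms(1)
proof (induction xs)
  case (Cons y xs)
  then show ?case using assms(2)[of y x] by (auto simp flip: mult.assoc)
qed simp

text \<open>The factor \<open>y\<^sub>1 - z\<^sub>i\<close> can be moved to the left, where it acts on the \<open>i\<close>-th lattice as
  \<open>X\<^sub>1 D\<^sub>1\<close>; this absorbs the pole of \<open>\<pi>\<^sup>-\<^sup>1\<close>.\<close>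

lemma poly_pres_cpi_minus:
  assumes N: "N \<ge> 1" and i: "i \<in> {1..l}" shows "cpi_minus N l z k \<in> poly_pres N (z i)"
proof -
  have 1: "1 \<in> {1..N}" using N by auto
  let ?F = "\<lambda>i. cY N k 1 - cC (z i)"
  let ?R = "prod_list (map ?F (remove1 i [1..<l+1]))"
  have comm: "?F x * ?F y = ?F y * ?F x" for x y
    using cC_commute[of "cY N k 1"] cC_commute[of "cC (z x)" "z y"] by (simp add: algebra_simps)
  have "prod_list (map ?F [1..<l+1]) = ?F i * ?R" by (rule prod_list_move[OF _ comm]) (use i in auto)
  then have eq: "cpi_minus N l z k = prod_list (map (\<lambda>i. cP (transpose i (i+1))) (rev [1..<N])) * (cM (1 / rat_var 1) * ?F i * ?R)"
    unfolding cpi_minus_def cpi_inv_def by (simp only: mult.assoc)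
  have F: "?F j \<in> poly_pres N u" for j u
    using poly_pres_add[OF poly_pres_cY[OF 1, of k u] poly_pres_cM[OF polynomials_const[of "- z j" N], of u]] by (simp add: rat_const_minus cM_minus)
  have R: "?R \<in> poly_pres N (z i)" by (rule poly_pres_prod_list) (use F in auto)
  have B: "cM (1 / rat_var 1) * ?F i \<in> poly_pres N (z i)"
  proof -
    have "phi.tw (z i) (?F i) f = rat_var 1 * dk N k 1 f" for f
      using 1 by (simp add: phi.tw_diff phi.tw_cM phi_cY Bop_def dk_def right_diff_distrib sum_distrib_left mult.left_commute)
    then have "phi.tw (z i) (cM (1 / rat_var 1) * ?F i) f = dk N k 1 f" for f
      unfolding phi.tw_cM_mult by simp
    then show ?thesis using polynomials_dk[OF 1] CA_mult[OF CA_inverse_var[OF 1]] F[of i "z i"] by (auto simp: poly_pres_def)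
  qed
  have "prod_list (map (\<lambda>i. cP (transpose i (i+1))) (rev [1..<N])) \<in> poly_pres N (z i)"
    by (rule poly_pres_prod_list) (auto intro!: poly_pres_cP transpose_permutes)
  then show ?thesis unfolding eq by (rule poly_pres_mult[OF _ poly_pres_mult[OF B R]])
qed

lemma Cyc_poly_pres:
  assumes "L \<in> Cyc N l z k" "N \<ge> 1" "i \<in> {1..l}" shows "L \<in> poly_pres N (z i)"
  using assms(1,2)
proof (induction rule: Cyc_induct)
  case pi
  have "rat_var 1 \<in> polynomials N" using assms(2) by (intro polynomials_var) auto
  then show ?case unfolding cpi_def
    by (intro poly_pres_mult poly_pres_prod_list poly_pres_cM) (auto intro!: poly_pres_cP transpose_permutes)
next
  case (simple j)
  then show ?case by (intro poly_pres_cP transpose_permutes) auto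
next
  case pi_minus
  show ?case using poly_pres_cpi_minus assms by blast
qed (auto intro: poly_pres_cM poly_pres_cP transpose_permutes poly_pres_cY poly_pres_add poly_pres_mult)

section \<open>Generic values of \<open>k\<close>\<close>

lemma phi_sum_coef:
  assumes "T \<subseteq> Idx N n" "f \<in> LP N"
  shows "coef e (phi.tw u (\<Sum>s\<in>T. cC (c s) * El N k s) f) = (\<Sum>s\<in>T. c s * coef e (phi.tw u (El N k s) f))"
proof -
  have LP: "phi.tw u (El N k s) f \<in> LP N" if "s \<in> T" for s
    using pfam_LP[OF pfam_phi_El[of s N n f u]] that assms by blast
  have "coef e (phi.tw u (\<Sum>s\<in>T. cC (c s) * El N k s) f) = (\<Sum>s\<in>T. coef e (rat_const (c s) * phi.tw u (El N k s) f))"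
    unfolding phi.tw_sum phi.tw_cM_mult by (rule coef_sum[where N = N]) (intro LP_ring LP_const LP)
  also have "\<dots> = (\<Sum>s\<in>T. c s * coef e (phi.tw u (El N k s) f))"
    by (intro sum.cong refl coef_scale[OF LP])
  finally show ?thesis .
qed

lemma poly_pres_functional:
  assumes "(\<Sum>s\<in>Idx N n. cC (c s) * El N k s) \<in> poly_pres N u"
    and "keys m \<subseteq> {1..N}" "\<And>y. lookup m y \<ge> 0" "lookup e x < 0"
  shows "(\<Sum>s\<in>Idx N n. c s * coef e (phi.tw u (El N k s) (lmon m))) = 0"
proof -
  have m: "lmon m \<in> polynomials N" using assms(2,3) by (rule lmon_poly)
  then have "phi.tw u (\<Sum>s\<in>Idx N n. cC (c s) * El N k s) (lmon m) \<in> polynomials N"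
    using assms(1) by (simp add: poly_pres_def)
  then show ?thesis
    using coef_polynomial[OF _ assms(4)] phi_sum_coef[OF subset_refl LP_poly[OF m], of e u c k n] by simp
qed

lemma combine_expansions:
  "(\<Sum>s\<in>I. cC (\<Sum>t\<in>T. y t * f t s) * El N k s) = (\<Sum>t\<in>T. cC (y t) * (\<Sum>s\<in>I. cC (f t s) * El N k s))"
proof -
  have "(\<Sum>s\<in>I. cC (\<Sum>t\<in>T. y t * f t s) * El N k s) = (\<Sum>s\<in>I. \<Sum>t\<in>T. cC (y t) * (cC (f t s) * El N k s))"
    by (simp add: rat_const_sum cM_sum sum_distrib_right rat_const_mult cM_mult mult.assoc)
  also have "\<dots> = (\<Sum>t\<in>T. cC (y t) * (\<Sum>s\<in>I. cC (f t s) * El N k s))"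
    by (subst sum.swap) (simp add: sum_distrib_left)
  finally show ?thesis .
qed

text \<open>For k outside a finite set a solution is determined by its pivot coordinates, and the
  words have independent vectors of pivot coordinates. A nontrivial relation among the pivot
  coordinates of a given solution and of all words then expresses the solution through
  words.\<close>

lemma generic_level:
  assumes N: "N \<ge> 1" and z: "\<And>i j. i \<in> {1..l} \<Longrightarrow> j \<in> {1..l} \<Longrightarrow> i \<noteq> j \<Longrightarrow> z i - z j \<notin> \<int>"
  shows "\<exists>F. finite F \<and> (\<forall>k. k \<notin> F \<longrightarrow> (\<forall>x. (\<forall>i\<in>{1..l}. (\<Sum>t\<in>Idx N n. cC (x t) * El N k t) \<in> poly_pres N (z i)) \<longrightarrow>
      (\<Sum>t\<in>Idx N n. cC (x t) * El N k t) \<in> Cyc N l z k))"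
proof -
  let ?I = "Idx N n"
  let ?T = "piv N n l"
  have finT: "finite ?T" by (rule finite_subset[OF piv_subset finite_Idx])
  \<comment> \<open>Rows of two kinds: the functionals that vanish on preservers, and the pivot
    coordinates; together they are injective at k = 0.\<close>
  define R :: "(nat \<times> (nat \<Rightarrow>\<^sub>0 int) \<times> (nat \<Rightarrow>\<^sub>0 int) + idx) set" where
    "R = Inl ` {(i, m, e). i \<in> {1..l} \<and> keys m \<subseteq> {1..N} \<and> (\<forall>y. lookup m y \<ge> 0) \<and> (\<exists>x. lookup e x < 0)} \<union> Inr ` ?T"
  define Q where "Q i m e s = (SOME q. \<forall>k. coef e (phi.tw (z i) (El N k s) (lmon m)) = poly q k)" for i m e s
  have Q: "poly (Q i m e s) k = coef e (phi.tw (z i) (El N k s) (lmon m))" if "s \<in> ?I" "keys m \<subseteq> {1..N}" for i m e s k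
    unfolding Q_def by (rule someI_ex[OF pfam_coef[OF pfam_phi_El[OF that(1) lmon_LP[OF that(2)]]], THEN spec, symmetric])
  define A where "A r s = (case r of Inl (i, m, e) \<Rightarrow> Q i m e s | Inr t \<Rightarrow> if s = t then 1 else 0)" for r s
  have row_pivot: "(\<Sum>s\<in>?I. poly (A (Inr t) s) k * c s) = c t" if "t \<in> ?T" for t k c
  proof -
    have "(\<Sum>s\<in>?I. poly (A (Inr t) s) k * c s) = (\<Sum>s\<in>?I. if s = t then c s else 0)"
      by (intro sum.cong) (auto simp: A_def)
    then show ?thesis using that piv_subset finite_Idx by auto
  qed
  have row_functional: "(\<Sum>s\<in>?I. poly (A (Inl (i, m, e)) s) k * c s) = (\<Sum>s\<in>?I. c s * coef e (phi.tw (z i) (El N k s) (lmon m)))"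
    if "keys m \<subseteq> {1..N}" for i m e k c
    by (intro sum.cong refl) (simp add: A_def Q[OF _ that])
  have "\<exists>F. finite F \<and> (\<forall>k. k \<notin> F \<longrightarrow> (\<forall>c. (\<forall>r\<in>R. (\<Sum>s\<in>?I. poly (A r s) k * c s) = 0) \<longrightarrow> (\<forall>s\<in>?I. c s = 0)))"
  proof (rule poly_system_injective[OF finite_Idx], rule ballI)
    fix c s assume c: "\<And>r. r \<in> R \<Longrightarrow> (\<Sum>s\<in>?I. poly (A r s) 0 * c s) = 0" and s: "s \<in> ?I"
    show "c s = 0"
    proof (rule kernel_at_0[where l = l and z = z and N = N and n = n and c = c, OF z _ _ s])
      fix i x and m e :: "nat \<Rightarrow>\<^sub>0 int" assume *: "i \<in> {1..l}" "keys m \<subseteq> {1..N}" "\<And>y. 0 \<le> lookup m y" "lookup e x < (0::int)"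
      then have "Inl (i, m, e) \<in> R" unfolding R_def by blast
      from c[OF this] show "(\<Sum>t\<in>?I. c t * coef e (phi.tw (z i) (El N 0 t) (lmon m))) = 0"
        unfolding row_functional[OF *(2)] .
    next
      fix t assume t: "t \<in> ?T"
      then have "Inr t \<in> R" by (simp add: R_def)
      from c[OF this] show "c t = 0" unfolding row_pivot[OF t] .
    qed
  qed
  then obtain F1 where F1: "finite F1" and F1_inj: "\<forall>k. k \<notin> F1 \<longrightarrow> (\<forall>c. (\<forall>r\<in>R. (\<Sum>s\<in>?I. poly (A r s) k * c s) = 0) \<longrightarrow> (\<forall>s\<in>?I. c s = 0))"
    by (elim exE conjE)
  have inj: "c s = 0" if k: "k \<notin> F1" and pres: "\<forall>i\<in>{1..l}. (\<Sum>s\<in>?I. cC (c s) * El N k s) \<in> poly_pres N (z i)"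
    and piv: "\<And>t. t \<in> ?T \<Longrightarrow> c t = 0" and s: "s \<in> ?I" for k c s
  proof -
    have "\<forall>r\<in>R. (\<Sum>s\<in>?I. poly (A r s) k * c s) = 0"
    proof
      fix r assume "r \<in> R"
      then consider (f) i m e x where "r = Inl (i, m, e)" "i \<in> {1..l}" "keys m \<subseteq> {1..N}"
          "\<And>y. lookup m y \<ge> 0" "lookup e x < 0"
        | (p) t where "r = Inr t" "t \<in> ?T" unfolding R_def by blast
      then show "(\<Sum>s\<in>?I. poly (A r s) k * c s) = 0"
      proof cases
        case f
        then show ?thesis using row_functional[OF f(3), of i e k c] poly_pres_functional[OF bspec[OF pres f(2)] f(3,4,5)] by simp
      next
        case p
        then show ?thesis using row_pivot piv by simp
      qed
    qed
    then show ?thesis using F1_inj k s by blast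
  qed
  have "\<exists>c :: idx \<Rightarrow> complex poly. \<forall>k. Om N l z k t = (\<Sum>s\<in>?I. cC (poly (c s) k) * El N k s)" if "t \<in> ?T" for t
    using Rep_Om[OF that] unfolding Rep_def .
  then have "\<forall>t\<in>?T. \<exists>c :: idx \<Rightarrow> complex poly. \<forall>k. Om N l z k t = (\<Sum>s\<in>?I. cC (poly (c s) k) * El N k s)" by (rule ballI)
  from bchoice[OF this] obtain co :: "idx \<Rightarrow> idx \<Rightarrow> complex poly" where
    co: "\<forall>t\<in>?T. \<forall>k. Om N l z k t = (\<Sum>s\<in>?I. cC (poly (co t s) k) * El N k s)" by (elim exE)
  have Om_comb: "(\<Sum>s\<in>?I. cC (\<Sum>t\<in>?T. y t * poly (co t s) k) * El N k s) = (\<Sum>t\<in>?T. cC (y t) * Om N l z k t)" for y k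
    unfolding combine_expansions using co by (intro sum.cong) auto
  have Om_Cyc: "(\<Sum>t\<in>?T. cC (y t) * Om N l z k t) \<in> Cyc N l z k" for y k
    by (intro Cyc_sum Cyc_mult Cyc_cC Cyc_Om)
  \<comment> \<open>The square matrix of pivot coordinates of the words. At k = 0 a combination with
    zero pivot coordinates is a preserver, so it vanishes by \<open>kernel_at_0\<close>, and the
    words are independent.\<close>
  have "\<exists>F. finite F \<and> (\<forall>k. k \<notin> F \<longrightarrow> (\<forall>y. (\<forall>s\<in>?T. (\<Sum>t\<in>?T. poly (co t s) k * y t) = 0) \<longrightarrow> (\<forall>t\<in>?T. y t = 0)))"
  proof (rule poly_system_injective[OF finT, of ?T "\<lambda>s t. co t s"], rule ballI)
    fix y t assume y: "\<And>s. s \<in> ?T \<Longrightarrow> (\<Sum>t\<in>?T. poly (co t s) 0 * y t) = 0" and t: "t \<in> ?T"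
    define c where "c s = (\<Sum>t\<in>?T. y t * poly (co t s) 0)" for s
    have eq: "(\<Sum>s\<in>?I. cC (c s) * El N 0 s) = (\<Sum>t\<in>?T. cC (y t) * Om N l z 0 t)" unfolding c_def by (rule Om_comb)
    have pres: "(\<Sum>s\<in>?I. cC (c s) * El N 0 s) \<in> poly_pres N (z i)" if "i \<in> {1..l}" for i
      unfolding eq using Cyc_poly_pres[OF Om_Cyc N that] .
    have "c s = 0" if s: "s \<in> ?I" for s
    proof (rule kernel_at_0[where l = l and z = z and N = N and n = n and c = c, OF z _ _ s])
      fix i x and m e :: "nat \<Rightarrow>\<^sub>0 int" assume *: "i \<in> {1..l}" "keys m \<subseteq> {1..N}" "\<And>y. 0 \<le> lookup m y" "lookup e x < (0::int)"
      show "(\<Sum>t\<in>?I. c t * coef e (phi.tw (z i) (El N 0 t) (lmon m))) = 0"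
        by (rule poly_pres_functional[OF pres[OF *(1)] *(2,3,4)])
    next
      fix t assume "t \<in> ?T"
      then show "c t = 0" using y[of t] by (simp add: c_def mult.commute)
    qed
    then have "(\<Sum>t\<in>?T. cC (y t) * Om N l z 0 t) = 0" unfolding eq[symmetric] by (intro sum.neutral) simp
    then show "y t = 0" using t by (rule words_independent_at_0)
  qed
  then obtain F2 where F2: "finite F2" and F2_inj: "\<forall>k. k \<notin> F2 \<longrightarrow> (\<forall>y. (\<forall>s\<in>?T. (\<Sum>t\<in>?T. poly (co t s) k * y t) = 0) \<longrightarrow> (\<forall>t\<in>?T. y t = 0))"
    by (elim exE conjE)
  have "(\<Sum>t\<in>?I. cC (x t) * El N k t) \<in> Cyc N l z k" (is "?L \<in> _")
    if k: "k \<notin> F1 \<union> F2" and x: "\<forall>i\<in>{1..l}. (\<Sum>t\<in>?I. cC (x t) * El N k t) \<in> poly_pres N (z i)" for k x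
  proof -
    \<comment> \<open>\<open>None\<close> stands for the given element and \<open>Some t\<close> for
      the words: one unknown more than there are pivot equations.\<close>
    define a where "a s v = (case v of None \<Rightarrow> x s | Some t \<Rightarrow> poly (co t s) k)" for s v
    have "card ?T < card (insert None (Some ` ?T))" using finT by (simp add: card_image)
    from homogeneous_system_solution[OF finT _ this, of a] finT obtain y
      where y0: "\<exists>v\<in>insert None (Some ` ?T). y v \<noteq> 0" and y: "\<forall>s\<in>?T. (\<Sum>v\<in>insert None (Some ` ?T). a s v * y v) = 0" by auto
    have row: "(\<Sum>v\<in>insert None (Some ` ?T). a s v * y v) = x s * y None + (\<Sum>t\<in>?T. poly (co t s) k * y (Some t))" for s
      using finT by (subst sum.insert) (auto simp: a_def sum.reindex)
    define d where "d s = y None * x s + (\<Sum>t\<in>?T. y (Some t) * poly (co t s) k)" for s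
    let ?W = "\<Sum>t\<in>?T. cC (y (Some t)) * Om N l z k t"
    have "(\<Sum>s\<in>?I. cC (d s) * El N k s) = cC (y None) * ?L + (\<Sum>s\<in>?I. cC (\<Sum>t\<in>?T. y (Some t) * poly (co t s) k) * El N k s)"
      unfolding d_def by (simp add: rat_const_add cM_add distrib_right sum.distrib sum_distrib_left rat_const_mult cM_mult mult.assoc)
    then have eq: "(\<Sum>s\<in>?I. cC (d s) * El N k s) = cC (y None) * ?L + ?W" unfolding Om_comb .
    have "\<forall>i\<in>{1..l}. (\<Sum>s\<in>?I. cC (d s) * El N k s) \<in> poly_pres N (z i)"
      unfolding eq
    proof
      fix i assume i: "i \<in> {1..l}"
      show "cC (y None) * ?L + ?W \<in> poly_pres N (z i)"
        by (rule poly_pres_add[OF poly_pres_mult[OF poly_pres_cM[OF polynomials_const] bspec[OF x i]] Cyc_poly_pres[OF Om_Cyc N i]])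
    qed
    moreover have "d t = 0" if "t \<in> ?T" for t
      using bspec[OF y that] unfolding row by (simp add: d_def mult.commute)
    ultimately have "d s = 0" if "s \<in> ?I" for s using inj[of k d s] k that by blast
    then have "(\<Sum>s\<in>?I. cC (d s) * El N k s) = 0" by (intro sum.neutral) simp
    then have L: "cC (y None) * ?L = cC (- 1) * ?W" unfolding eq by (simp add: rat_const_minus cM_minus eq_neg_iff_add_eq_0)
    \<comment> \<open>Otherwise the relation would be among words alone, against the independence of
      their pivot coordinates.\<close>
    have "y None \<noteq> 0"
    proof
      assume "y None = 0"
      then have "\<forall>s\<in>?T. (\<Sum>t\<in>?T. poly (co t s) k * y (Some t)) = 0" using y unfolding row by simp
      then have "\<forall>t\<in>?T. y (Some t) = 0" using F2_inj[THEN spec, THEN mp, THEN spec, THEN mp, of k "\<lambda>t. y (Some t)"] k by simp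
      then show False using y0 \<open>y None = 0\<close> by auto
    qed
    then have "?L = cC (inverse (y None)) * (cC (y None) * ?L)"
      by (simp flip: mult.assoc cM_mult rat_const_mult)
    also have "\<dots> \<in> Cyc N l z k" unfolding L by (intro Cyc_mult Cyc_cC Om_Cyc)
    finally show ?thesis .
  qed
  then show ?thesis using F1 F2 by (intro exI[of _ "F1 \<union> F2"]) simp
qed

lemma cyclotomic_generic:
  assumes N: "N \<ge> 1" and z: "\<And>i j. i \<in> {1..l} \<Longrightarrow> j \<in> {1..l} \<Longrightarrow> i \<noteq> j \<Longrightarrow> z i - z j \<notin> \<int>"
  shows "\<exists>C. countable C \<and> (\<forall>k. k \<notin> C \<longrightarrow> k - 1 / 2 \<notin> \<int> \<and> Cyc N l z k = {L \<in> H N k. \<forall>i\<in>{1..l}. L \<in> poly_pres N (z i)})"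
proof -
  have "\<forall>n. \<exists>F. finite F \<and> (\<forall>k. k \<notin> F \<longrightarrow> (\<forall>x. (\<forall>i\<in>{1..l}. (\<Sum>t\<in>Idx N n. cC (x t) * El N k t) \<in> poly_pres N (z i)) \<longrightarrow>
      (\<Sum>t\<in>Idx N n. cC (x t) * El N k t) \<in> Cyc N l z k))"
    using generic_level[of N l z, OF N z] by blast
  from choice[OF this] obtain F where F: "\<forall>n. finite (F n) \<and> (\<forall>k. k \<notin> F n \<longrightarrow> (\<forall>x. (\<forall>i\<in>{1..l}. (\<Sum>t\<in>Idx N n. cC (x t) * El N k t) \<in> poly_pres N (z i)) \<longrightarrow>
      (\<Sum>t\<in>Idx N n. cC (x t) * El N k t) \<in> Cyc N l z k))" by (elim exE)
  \<comment> \<open>Half-integers are added so that (i) is available at every remaining k.\<close>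
  define C where "C = (\<Union>n. F n) \<union> Set.range (\<lambda>j. of_int j + 1 / 2)"
  have "countable C" unfolding C_def using F by (intro countable_Un countable_UN) (auto intro: countable_finite)
  moreover have "k - 1 / 2 \<notin> \<int> \<and> Cyc N l z k = {L \<in> H N k. \<forall>i\<in>{1..l}. L \<in> poly_pres N (z i)}" if k: "k \<notin> C" for k
  proof (intro conjI equalityI subsetI)
    show "k - 1 / 2 \<notin> \<int>"
    proof
      assume "k - 1 / 2 \<in> \<int>"
      then obtain j where "k - 1 / 2 = of_int j" by (elim Ints_cases)
      then have "k = of_int j + 1 / 2" by (simp add: algebra_simps)
      then show False using k by (auto simp: C_def)
    qed
  next
    fix L assume "L \<in> Cyc N l z k"
    then show "L \<in> {L \<in> H N k. \<forall>i\<in>{1..l}. L \<in> poly_pres N (z i)}"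
      using Cyc_poly_pres[OF _ N] by (auto simp: Cyc_def H_def)
  next
    fix L assume L: "L \<in> {L \<in> H N k. \<forall>i\<in>{1..l}. L \<in> poly_pres N (z i)}"
    then obtain n x where "L = (\<Sum>t\<in>Idx N n. cC (x t) * El N k t)" using H_Rep by blast
    moreover have "k \<notin> F n" using k by (auto simp: C_def)
    ultimately show "L \<in> Cyc N l z k" using F L by blast
  qed
  ultimately show ?thesis by blast
qed

section \<open>Translation back to the crossed algebra and conclusion\<close>

lemma crossed_algebra_eq_CA: "crossed_algebra N = rep_cra ` CA N"
proof
  show "crossed_algebra N \<subseteq> rep_cra ` CA N"
  proof
    fix L assume L: "L \<in> crossed_algebra N"
    then have "adm {1..N} L" by (simp add: crossed_algebra_iff)
    then have "rep_cra (abs_cra L) = L" by (intro abs_cra_inverse) (auto simp: adm_def permutes_subset)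
    then show "L \<in> rep_cra ` CA N" using L by (intro image_eqI[of _ _ "abs_cra L"]) (auto simp: CA_def)
  qed
qed (auto simp: CA_def)

lemma preserves_P_iff: "preserves_P N (rep_cra L) \<longleftrightarrow> (\<forall>f\<in>LP N. op L f \<in> LP N)"
  by (simp add: preserves_P_def preserves_def op.rep_eq)

lemma preserves_Delta_sign_P_iff: "preserves_Delta_sign_P N \<kappa> (rep_cra L) \<longleftrightarrow> (\<forall>f\<in>LP N. psi.tw N \<kappa> L f \<in> LP N)"
  by (simp add: preserves_Delta_sign_P_def preserves_def act_psi)

lemma preserves_power_P_plus_iff:
  "L \<in> CA N \<Longrightarrow> preserves_power_P_plus N u (rep_cra L) \<longleftrightarrow> L \<in> poly_pres N u"
  by (simp add: preserves_power_P_plus_def preserves_def act_phi poly_pres_def)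

lemma daha_in_crossed_preservers:
  assumes "k - 1 / 2 \<notin> \<int>"
  shows "daha_in_crossed N k = {L \<in> crossed_algebra N. preserves_P N L \<and> preserves_Delta_sign_P N (2 * k) L}"
  unfolding daha_in_crossed_eq crossed_algebra_eq_CA H_eq_lattice_preservers[OF assms]
  by (auto simp: preserves_P_iff preserves_Delta_sign_P_iff)

theorem theorem2p10:
  fixes N l :: nat and z :: "nat \<Rightarrow> complex"
  assumes "N \<ge> 1"
  shows
    "(\<forall>k::complex. k - 1/2 \<notin> \<int> \<longrightarrow>
        daha_in_crossed N k =
          {L \<in> crossed_algebra N. preserves_P N L \<and> preserves_Delta_sign_P N (2 * k) L}) \<and>
     ((\<forall>i\<in>{1..l}. \<forall>j\<in>{1..l}. i \<noteq> j \<longrightarrow> z i - z j \<notin> \<int>) \<longrightarrow>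
        (\<exists>C::complex set. countable C \<and> (\<forall>k. k \<notin> C \<longrightarrow>
          cyclotomic_in_crossed N l z k =
            {L \<in> daha_in_crossed N k. \<forall>i\<in>{1..l}. preserves_power_P_plus N (z i) L} \<and>
          cyclotomic_in_crossed N l z k =
            {L \<in> crossed_algebra N. preserves_P N L \<and> preserves_Delta_sign_P N (2 * k) L \<and>
               (\<forall>i\<in>{1..l}. preserves_power_P_plus N (z i) L)})))"
proof (intro conjI allI impI)
  fix k :: complex assume "k - 1/2 \<notin> \<int>"
  then show "daha_in_crossed N k = {L \<in> crossed_algebra N. preserves_P N L \<and> preserves_Delta_sign_P N (2 * k) L}"
    by (rule daha_in_crossed_preservers)
next
  assume "\<forall>i\<in>{1..l}. \<forall>j\<in>{1..l}. i \<noteq> j \<longrightarrow> z i - z j \<notin> \<int>"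
  then obtain C where C: "countable C"
    "\<And>k. k \<notin> C \<Longrightarrow> k - 1 / 2 \<notin> \<int> \<and> Cyc N l z k = {L \<in> H N k. \<forall>i\<in>{1..l}. L \<in> poly_pres N (z i)}"
    using cyclotomic_generic[OF assms, of l z] by blast
  have "cyclotomic_in_crossed N l z k =
        {L \<in> daha_in_crossed N k. \<forall>i\<in>{1..l}. preserves_power_P_plus N (z i) L} \<and>
      cyclotomic_in_crossed N l z k =
        {L \<in> crossed_algebra N. preserves_P N L \<and> preserves_Delta_sign_P N (2 * k) L \<and>
           (\<forall>i\<in>{1..l}. preserves_power_P_plus N (z i) L)}" if k: "k \<notin> C" for k
  proof -
    have eq: "cyclotomic_in_crossed N l z k =
        {L \<in> daha_in_crossed N k. \<forall>i\<in>{1..l}. preserves_power_P_plus N (z i) L}"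
      unfolding cyclotomic_in_crossed_eq[OF assms] daha_in_crossed_eq conjunct2[OF C(2)[OF k]]
      by (auto simp: preserves_power_P_plus_iff H_subset_CA)
    then show ?thesis using daha_in_crossed_preservers[OF conjunct1[OF C(2)[OF k]], of N] by auto
  qed
  with C(1) show "\<exists>C. countable C \<and> (\<forall>k. k \<notin> C \<longrightarrow>
      cyclotomic_in_crossed N l z k =
        {L \<in> daha_in_crossed N k. \<forall>i\<in>{1..l}. preserves_power_P_plus N (z i) L} \<and>
      cyclotomic_in_crossed N l z k =
        {L \<in> crossed_algebra N. preserves_P N L \<and> preserves_Delta_sign_P N (2 * k) L \<and>
           (\<forall>i\<in>{1..l}. preserves_power_P_plus N (z i) L)})" by blast
qed

end
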